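(* Let $X_G=T/G$ be a finite quotient of a complex torus $T$, where $G$ is a finite group of (holomorphic) automorphisms of $T$ acting freely on $T$. If the complex manifold $X_G$ is deformation rigid, then $X_G$ is a quotient of an abelian variety; in particular, $X_G$ is projective.
   Context: A complex manifold is deformation rigid if it does not admit any non-trivial continuous deformation of its complex structure, where a continuous deformation is trivial if all its members are biholomorphic to the original manifold. Here, writing $T=(\mathbb{R}^{2k}/\Lambda,J_0)$ and letting $\mu(g)\in\mathrm{GL}(2k,\mathbb{R})$ denote the linear part of the affine action of $g\in G$, continuous deformations of the complex structure of $X_G$ are given by continuous paths $t\mapsto J_t$, $t\in[0,1]$, starting at $J_0$, in $\mathfrak{D}(G)=\{J\in\mathrm{End}(\mathbb{R}^{2k}): J^2=-\mathrm{id},\ \mu(g)J=J\mu(g)\ \forall g\in G\}$: the member at time $t$ is the quotient of the complex torus $(\mathbb{R}^{2k}/\Lambda,J_t)$ by the same affine action of $G$. An abelian variety is a complex torus which embeds holomorphically as a subvariety of a complex projective space; a compact complex manifold is projective if it has such an embedding. *)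

theory Defs
  imports "HOL-Analysis.Analysis" "HOL-Algebra.Bij"
begin

section \<open>Holomorphic functions on open subsets of \<open>\<complex>\<^sup>d\<close>\<close>

text \<open>
  The dimension of a projective space is existentially quantified below, so \<open>\<complex>\<^sup>d\<close> cannot be
  indexed by a type: its vectors are the sequences that vanish from index \<open>d\<close> on, with the
  topology inherited from the product topology on \<^typ>\<open>nat \<Rightarrow> complex\<close>.
\<close>

definition Cn :: "nat \<Rightarrow> (nat \<Rightarrow> complex) set" where
  "Cn d = {z. \<forall>i\<ge>d. z i = 0}"

text \<open>
  \<open>f\<close> is complex (Frechet) differentiable at \<open>z\<close> with partial derivatives \<open>c 0, \<dots>, c (d - 1)\<close>.
\<close>

definition has_cgradient ::
  "nat \<Rightarrow> (nat \<Rightarrow> complex) set \<Rightarrow> ((nat \<Rightarrow> complex) \<Rightarrow> complex) \<Rightarrow> (nat \<Rightarrow> complex) \<Rightarrow> (nat \<Rightarrow> complex) \<Rightarrow> bool"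
  where
  "has_cgradient d S f c z \<longleftrightarrow>
     ((\<lambda>w. (f w - f z - (\<Sum>i<d. c i * (w i - z i)))
            / complex_of_real (L2_set (\<lambda>i. cmod (w i - z i)) {..<d})) \<longlongrightarrow> 0) (at z within S)"

definition holo_fun :: "nat \<Rightarrow> (nat \<Rightarrow> complex) set \<Rightarrow> ((nat \<Rightarrow> complex) \<Rightarrow> complex) \<Rightarrow> bool" where
  "holo_fun d S f \<longleftrightarrow> (\<forall>z\<in>S. \<exists>c. has_cgradient d S f c z)"

definition holo_map ::
  "nat \<Rightarrow> nat \<Rightarrow> (nat \<Rightarrow> complex) set \<Rightarrow> ((nat \<Rightarrow> complex) \<Rightarrow> nat \<Rightarrow> complex) \<Rightarrow> bool" where
  "holo_map d e S F \<longleftrightarrow> F ` S \<subseteq> Cn e \<and> (\<forall>j<e. holo_fun d S (\<lambda>z. F z j))"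


section \<open>Complex manifolds\<close>

record 'a cmfd =
  cdim :: nat
  ctop :: "'a topology"
  catlas :: "('a set \<times> ('a \<Rightarrow> nat \<Rightarrow> complex)) set"

abbreviation points :: "'a cmfd \<Rightarrow> 'a set" where
  "points M \<equiv> topspace (ctop M)"

definition complex_manifold :: "'a cmfd \<Rightarrow> bool" where
  "complex_manifold M \<longleftrightarrow>
     Hausdorff_space (ctop M) \<and> second_countable (ctop M) \<and>
     (\<Union>(U, \<phi>)\<in>catlas M. U) = points M \<and>
     (\<forall>(U, \<phi>)\<in>catlas M.
        openin (ctop M) U \<and>
        openin (top_of_set (Cn (cdim M))) (\<phi> ` U) \<and>
        homeomorphic_map (subtopology (ctop M) U) (top_of_set (\<phi> ` U)) \<phi>) \<and>
     (\<forall>(U, \<phi>)\<in>catlas M. \<forall>(V, \<psi>)\<in>catlas M.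
        holo_map (cdim M) (cdim M) (\<phi> ` (U \<inter> V)) (\<psi> \<circ> inv_into U \<phi>))"

definition holomorphic_map :: "'a cmfd \<Rightarrow> 'b cmfd \<Rightarrow> ('a \<Rightarrow> 'b) \<Rightarrow> bool" where
  "holomorphic_map M N f \<longleftrightarrow>
     continuous_map (ctop M) (ctop N) f \<and>
     (\<forall>(U, \<phi>)\<in>catlas M. \<forall>(V, \<psi>)\<in>catlas N.
        holo_map (cdim M) (cdim N) (\<phi> ` (U \<inter> f -` V)) (\<psi> \<circ> f \<circ> inv_into U \<phi>))"

definition biholomorphism :: "'a cmfd \<Rightarrow> 'b cmfd \<Rightarrow> ('a \<Rightarrow> 'b) \<Rightarrow> bool" where
  "biholomorphism M N f \<longleftrightarrow>
     (\<exists>g. homeomorphic_maps (ctop M) (ctop N) f g \<and> holomorphic_map M N f \<and> holomorphic_map N M g)"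

definition biholomorphic :: "'a cmfd \<Rightarrow> 'b cmfd \<Rightarrow> bool" where
  "biholomorphic M N \<longleftrightarrow> (\<exists>f. biholomorphism M N f)"

text \<open>Injectivity of the differential, with \<open>c j i\<close> the entries of the Jacobian matrix in charts.\<close>

definition immersion :: "'a cmfd \<Rightarrow> 'b cmfd \<Rightarrow> ('a \<Rightarrow> 'b) \<Rightarrow> bool" where
  "immersion M N f \<longleftrightarrow>
     (\<forall>(U, \<phi>)\<in>catlas M. \<forall>(V, \<psi>)\<in>catlas N. \<forall>x\<in>U \<inter> f -` V. \<exists>c.
        (\<forall>j<cdim N. has_cgradient (cdim M) (\<phi> ` (U \<inter> f -` V))
                      (\<lambda>z. (\<psi> \<circ> f \<circ> inv_into U \<phi>) z j) (c j) (\<phi> x)) \<and>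
        (\<forall>v. (\<forall>j<cdim N. (\<Sum>i<cdim M. c j i * v i) = 0) \<longrightarrow> (\<forall>i<cdim M. v i = 0)))"

definition holomorphic_embedding :: "'a cmfd \<Rightarrow> 'b cmfd \<Rightarrow> ('a \<Rightarrow> 'b) \<Rightarrow> bool" where
  "holomorphic_embedding M N f \<longleftrightarrow>
     holomorphic_map M N f \<and> immersion M N f \<and> embedding_map (ctop M) (ctop N) f"

definition holomorphic_function_on :: "'a cmfd \<Rightarrow> 'a set \<Rightarrow> ('a \<Rightarrow> complex) \<Rightarrow> bool" where
  "holomorphic_function_on M W h \<longleftrightarrow>
     (\<forall>(U, \<phi>)\<in>catlas M. holo_fun (cdim M) (\<phi> ` (U \<inter> W)) (h \<circ> inv_into U \<phi>))"

definition analytic_subvariety :: "'a cmfd \<Rightarrow> 'a set \<Rightarrow> bool" where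
  "analytic_subvariety M A \<longleftrightarrow>
     A \<subseteq> points M \<and>
     (\<forall>x\<in>points M. \<exists>W F. openin (ctop M) W \<and> x \<in> W \<and> finite F \<and>
        (\<forall>h\<in>F. holomorphic_function_on M W h) \<and> A \<inter> W = {y \<in> W. \<forall>h\<in>F. h y = 0})"


section \<open>Quotients by groups of automorphisms\<close>

definition orb :: "('a \<Rightarrow> 'a) set \<Rightarrow> 'a \<Rightarrow> 'a set" where
  "orb G x = (\<lambda>g. g x) ` G"

definition quot_topology :: "'a topology \<Rightarrow> ('a \<Rightarrow> 'b) \<Rightarrow> 'b topology" where
  "quot_topology X q =
     topology (\<lambda>V. V \<subseteq> q ` topspace X \<and> openin X {x \<in> topspace X. q x \<in> V})"

lemma openin_quot_topology:
  "openin (quot_topology X q) V \<longleftrightarrow> V \<subseteq> q ` topspace X \<and> openin X {x \<in> topspace X. q x \<in> V}"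
proof -
  have "istopology (\<lambda>V. V \<subseteq> q ` topspace X \<and> openin X {x \<in> topspace X. q x \<in> V})"
    unfolding istopology_def
  proof (intro conjI allI impI)
    fix S T
    assume S: "S \<subseteq> q ` topspace X \<and> openin X {x \<in> topspace X. q x \<in> S}"
      and T: "T \<subseteq> q ` topspace X \<and> openin X {x \<in> topspace X. q x \<in> T}"
    have "openin X ({x \<in> topspace X. q x \<in> S} \<inter> {x \<in> topspace X. q x \<in> T})"
      using S T by (intro openin_Int) simp_all
    moreover have "{x \<in> topspace X. q x \<in> S} \<inter> {x \<in> topspace X. q x \<in> T}
        = {x \<in> topspace X. q x \<in> S \<inter> T}"
      by (simp add: set_eq_iff) blast
    ultimately show "openin X {x \<in> topspace X. q x \<in> S \<inter> T}" by (simp only:)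
    show "S \<inter> T \<subseteq> q ` topspace X" using S by blast
  next
    fix K
    assume K: "\<forall>V\<in>K. V \<subseteq> q ` topspace X \<and> openin X {x \<in> topspace X. q x \<in> V}"
    have "{x \<in> topspace X. q x \<in> \<Union>K} = (\<Union>V\<in>K. {x \<in> topspace X. q x \<in> V})"
      by blast
    moreover have "openin X (\<Union>V\<in>K. {x \<in> topspace X. q x \<in> V})"
      using K by (intro openin_Union) blast
    ultimately show "openin X {x \<in> topspace X. q x \<in> \<Union>K}" by (rule ssubst)
    show "\<Union>K \<subseteq> q ` topspace X" using K by blast
  qed
  then show ?thesis by (simp add: quot_topology_def)
qed

lemma topspace_quot_topology: "topspace (quot_topology X q) = q ` topspace X"
proof
  show "topspace (quot_topology X q) \<subseteq> q ` topspace X"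
    using openin_topspace[of "quot_topology X q"] unfolding openin_quot_topology by (rule conjunct1)
  have "{x \<in> topspace X. q x \<in> q ` topspace X} = topspace X" by blast
  then have "openin (quot_topology X q) (q ` topspace X)"
    by (simp add: openin_quot_topology)
  then show "q ` topspace X \<subseteq> topspace (quot_topology X q)" by (rule openin_subset)
qed

lemma quotient_map_quot_topology: "quotient_map X (quot_topology X q) q"
  unfolding quotient_map_def topspace_quot_topology openin_quot_topology by blast

text \<open>
  For a free, properly discontinuous group \<open>G\<close> of automorphisms of \<open>M\<close> the charts are the
  compositions of charts of \<open>M\<close> with local inverses of the projection \<open>orb G\<close>.
\<close>

definition quot_manifold :: "'a cmfd \<Rightarrow> ('a \<Rightarrow> 'a) set \<Rightarrow> 'a set cmfd" where
  "quot_manifold M G =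
     \<lparr>cdim = cdim M,
      ctop = quot_topology (ctop M) (orb G),
      catlas = {(orb G ` W, \<phi> \<circ> inv_into W (orb G)) | U \<phi> W.
                  (U, \<phi>) \<in> catlas M \<and> W \<subseteq> U \<and> openin (ctop M) W \<and> inj_on (orb G) W}\<rparr>"

definition finite_free_aut_group :: "'a cmfd \<Rightarrow> ('a \<Rightarrow> 'a) set \<Rightarrow> bool" where
  "finite_free_aut_group M G \<longleftrightarrow>
     finite G \<and> subgroup G (BijGroup (points M)) \<and> (\<forall>g\<in>G. biholomorphism M M g) \<and>
     (\<forall>g\<in>G. \<forall>x\<in>points M. g x = x \<longrightarrow> g = \<one>\<^bsub>BijGroup (points M)\<^esub>)"


section \<open>Projective manifolds\<close>

definition scalings :: "((nat \<Rightarrow> complex) \<Rightarrow> nat \<Rightarrow> complex) set" where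
  "scalings = {\<lambda>z i. c * z i | c. c \<noteq> 0}"

text \<open>
  The points of \<open>\<pp>\<^sup>N\<close> are the \<open>\<complex>\<^sup>*\<close>-orbits in \<open>\<complex>\<^bsup>N+1\<^esup> - {0}\<close>, and the \<open>j\<close>-th affine chart omits the
  \<open>j\<close>-th entry of \<open>(z\<^sub>i / z\<^sub>j)\<^sub>i\<close>. The choice of a representative \<open>z\<close> is immaterial.
\<close>

definition affine_chart :: "nat \<Rightarrow> nat \<Rightarrow> (nat \<Rightarrow> complex) set \<Rightarrow> nat \<Rightarrow> complex" where
  "affine_chart N j p =
     (let z = (SOME z. z \<in> p)
      in (\<lambda>i. if i < j then z i / z j else if i < N then z (Suc i) / z j else 0))"

definition proj_space :: "nat \<Rightarrow> (nat \<Rightarrow> complex) set cmfd" where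
  "proj_space N =
     \<lparr>cdim = N,
      ctop = quot_topology (top_of_set (Cn (Suc N) - {\<lambda>_. 0})) (orb scalings),
      catlas = {(orb scalings ` {z \<in> Cn (Suc N). z j \<noteq> 0}, affine_chart N j) | j. j \<le> N}\<rparr>"

text \<open>
  By Chow's theorem the analytic subvarieties of \<open>\<pp>\<^sup>N\<close> are exactly the algebraic ones.
\<close>

definition projective :: "'a cmfd \<Rightarrow> bool" where
  "projective M \<longleftrightarrow>
     complex_manifold M \<and> compact_space (ctop M) \<and>
     (\<exists>N f. holomorphic_embedding M (proj_space N) f \<and>
            analytic_subvariety (proj_space N) (f ` points M))"


section \<open>Complex tori and deformations of their quotients\<close>

definition complex_structure :: "real^'n^'n \<Rightarrow> bool" where
  "complex_structure J \<longleftrightarrow> J ** J = - mat 1"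

text \<open>
  The complex vector space \<open>(\<real>\<^bsup>2k\<^esup>, J)\<close> as a manifold; its charts are all complex linear
  isomorphisms onto \<open>\<complex>\<^sup>k\<close>. A complex structure exists only if \<open>CARD('n)\<close> is even.
\<close>

definition linear_manifold :: "real^'n^'n \<Rightarrow> (real^'n) cmfd" where
  "linear_manifold J =
     \<lparr>cdim = CARD('n) div 2,
      ctop = euclidean,
      catlas = {(UNIV, \<phi>) | \<phi>. bij_betw \<phi> UNIV (Cn (CARD('n) div 2)) \<and>
                  (\<forall>i. linear (\<lambda>v. \<phi> v i)) \<and> (\<forall>v i. \<phi> (J *v v) i = \<i> * \<phi> v i)}\<rparr>"

definition full_lattice :: "(real^'n) set \<Rightarrow> bool" where
  "full_lattice \<Lambda> \<longleftrightarrow>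
     (\<exists>B. independent B \<and> span B = UNIV \<and>
          \<Lambda> = {\<Sum>b\<in>B. of_int (m b) *\<^sub>R b | m. True})"

definition lattice_shifts :: "(real^'n) set \<Rightarrow> (real^'n \<Rightarrow> real^'n) set" where
  "lattice_shifts \<Lambda> = (\<lambda>l x. x + l) ` \<Lambda>"

text \<open>
  The points of \<open>\<real>\<^bsup>2k\<^esup>/\<Lambda>\<close> are the cosets of \<open>\<Lambda>\<close>. As a topological space the torus does not
  depend on \<open>J\<close>, so that a map of the torus for one \<open>J\<close> is a map of the torus for any other.
\<close>

definition torus :: "(real^'n) set \<Rightarrow> real^'n^'n \<Rightarrow> (real^'n) set cmfd" where
  "torus \<Lambda> J = quot_manifold (linear_manifold J) (lattice_shifts \<Lambda>)"

abbreviation coset :: "(real^'n) set \<Rightarrow> real^'n \<Rightarrow> (real^'n) set" where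
  "coset \<Lambda> x \<equiv> orb (lattice_shifts \<Lambda>) x"

text \<open>
  Holomorphic maps between complex tori are affine, and the linear part is unique since \<open>\<Lambda>\<close> is
  discrete, so the description is proper for every automorphism \<open>g\<close> of a complex torus.
\<close>

definition linear_part :: "(real^'n) set \<Rightarrow> ((real^'n) set \<Rightarrow> (real^'n) set) \<Rightarrow> real^'n^'n" where
  "linear_part \<Lambda> g = (THE A. \<exists>b. \<forall>x. g (coset \<Lambda> x) = coset \<Lambda> (A *v x + b))"

definition invariant_complex_structures ::
  "(real^'n) set \<Rightarrow> ((real^'n) set \<Rightarrow> (real^'n) set) set \<Rightarrow> (real^'n^'n) set" where
  "invariant_complex_structures \<Lambda> G =
     {J. complex_structure J \<and> (\<forall>g\<in>G. linear_part \<Lambda> g ** J = J ** linear_part \<Lambda> g)}"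

definition deformation_rigid ::
  "(real^'n) set \<Rightarrow> real^'n^'n \<Rightarrow> ((real^'n) set \<Rightarrow> (real^'n) set) set \<Rightarrow> bool" where
  "deformation_rigid \<Lambda> J\<^sub>0 G \<longleftrightarrow>
     (\<forall>J :: real \<Rightarrow> real^'n^'n.
        continuous_on {0..1} J \<and> J ` {0..1} \<subseteq> invariant_complex_structures \<Lambda> G \<and> J 0 = J\<^sub>0 \<longrightarrow>
        (\<forall>t\<in>{0..1}. biholomorphic (quot_manifold (torus \<Lambda> (J t)) G)
                                  (quot_manifold (torus \<Lambda> J\<^sub>0) G)))"

definition complex_torus :: "(real^'n) set \<Rightarrow> real^'n^'n \<Rightarrow> bool" where
  "complex_torus \<Lambda> J \<longleftrightarrow> full_lattice \<Lambda> \<and> complex_structure J"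

definition abelian_variety :: "(real^'n) set \<Rightarrow> real^'n^'n \<Rightarrow> bool" where
  "abelian_variety \<Lambda> J \<longleftrightarrow> complex_torus \<Lambda> J \<and> projective (torus \<Lambda> J)"

text \<open>
  A finite free quotient has the dimension of the torus it comes from, so there is no loss in
  letting the abelian variety be a quotient of the same real vector space.
\<close>

definition quotient_of_abelian_variety :: "(real^'n) set set cmfd \<Rightarrow> bool" where
  "quotient_of_abelian_variety X \<longleftrightarrow>
     (\<exists>(\<Lambda> :: (real^'n) set) J H.
        abelian_variety \<Lambda> J \<and> finite_free_aut_group (torus \<Lambda> J) H \<and>
        biholomorphic X (quot_manifold (torus \<Lambda> J) H))"

end

theory Submission
  imports Defs "HOL-Complex_Analysis.Complex_Analysis"
begin

text \<open>
  Let \<open>W = P\<^sub>0 J\<^sub>0\<close> be the imaginary part of a \<open>G\<close>-invariant Hermitian metric of \<open>T\<close>. As \<open>G\<close> acts on \<open>\<Lambda>\<close>,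
  averaging shows that \<open>W\<close> is a limit of \<open>G\<close>-invariant forms that are rational on \<open>\<Lambda>\<close>. If \<open>V\<close> is such a form
  near \<open>W\<close>, the polar part \<open>J\<close> of \<open>P\<^sub>0\<^sup>-\<^sup>1 V\<close> is a \<open>G\<close>-invariant complex structure for which \<open>V\<close> is a
  polarization, and \<open>J\<close> is conjugate to \<open>J\<^sub>0\<close> along a path of invariant complex structures. By rigidity \<open>X\<^sub>G\<close> is
  biholomorphic to the quotient for \<open>J\<close>, so both the torus and the quotient have to be shown projective for a
  polarized \<open>J\<close>. Both are quotients of \<open>\<complex>\<^sup>k\<close> by a crystallographic group \<open>\<Gamma>\<close> of unitary affine maps. Instead
  of theta functions and the Kodaira theorem, the embedding uses Poincare series over \<open>\<Gamma>\<close> of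
  Gaussian sections peaked at the points of a fine net: in a high power of the line bundle defined by \<open>V\<close> each series is
  dominated by its central term, which makes them separate points and tangent vectors.
\<close>

section \<open>Gradients on \<open>\<complex>\<^sup>d\<close>\<close>

text \<open>Two obstacles shape the proof. Rigidity only compares structures joined to
  \<open>J\<^sub>0\<close> by a path, so the polarizable structure has to come with such a path; it
  is therefore built as a small perturbation of \<open>J\<^sub>0\<close>. Secondly, the factor
  exp(m(H(Az,b) + |b|^2/2)) attached to the map z -> Az + b is multiplicative only up to exp of i m
  times a symplectic pairing of translation parts. The usual remedy is a semicharacter of the
  lattice, which would have to be extended to the affine group. Instead the origin is moved to a
  point where all translation parts are rational with one denominator, and the form is multiplied by
  2 pi and enough integers; the defect is then 1. Freeness of the action enters as a uniform lower
  bound \<rho> for the displacement of nontrivial elements of the affine group. All scales are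
  fractions of it: a net of mesh \<rho>/32, local coordinates on balls of radius \<rho>/8, dominance
  of the central term within \<rho>/4. The Gaussian sums have a bound that depends only on \<rho>
  and the dimension, so that one high power m serves all points at once.\<close>

text \<open>The denominator of \<open>has_cgradient\<close>. On \<open>Cn d\<close> it induces the
  topology inherited from the product, which allows epsilon-delta arguments.\<close>

definition cdist :: "nat \<Rightarrow> (nat \<Rightarrow> complex) \<Rightarrow> (nat \<Rightarrow> complex) \<Rightarrow> real" where
  "cdist d w z = L2_set (\<lambda>i. cmod (w i - z i)) {..<d}"

lemma cdist_nonneg [simp]: "0 \<le> cdist d w z"
  by (simp add: cdist_def L2_set_nonneg)

lemma cdist_self [simp]: "cdist d z z = 0"
  by (simp add: cdist_def L2_set_def)

lemma cdist_pos: "w \<in> Cn d \<Longrightarrow> z \<in> Cn d \<Longrightarrow> w \<noteq> z \<Longrightarrow> 0 < cdist d w z"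
proof -
  assume a: "w \<in> Cn d" "z \<in> Cn d" "w \<noteq> z"
  then obtain i where i: "w i \<noteq> z i" by auto
  then have "i < d" using a by (metis (mono_tags, lifting) Cn_def mem_Collect_eq not_le)
  then have "cmod (w i - z i) \<le> cdist d w z"
    unfolding cdist_def by (intro member_le_L2_set) auto
  then show ?thesis using i by (smt (verit) right_minus_eq zero_less_norm_iff)
qed

lemma cmod_le_cdist: "i < d \<Longrightarrow> cmod (w i - z i) \<le> cdist d w z"
  unfolding cdist_def by (intro member_le_L2_set) auto

lemma cdist_le_sum: "cdist d w z \<le> (\<Sum>i<d. cmod (w i - z i))"
  unfolding cdist_def by (rule L2_set_le_sum) auto

lemma continuous_on_cdist: "continuous_on A (\<lambda>w. cdist d w z)"
  unfolding cdist_def L2_set_def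
  by (intro continuous_intros continuous_on_product_then_coordinatewise continuous_on_id)

text \<open>A basic neighbourhood is a box, and the coordinates from \<open>d\<close> on cannot
  leave it because they vanish at both points. Only \<open>d\<close> radii matter, so a positive
  minimum exists; the extra 1 covers \<open>d = 0\<close>.\<close>

lemma open_contains_cdist_ball:
  assumes "open T" "z \<in> T" "z \<in> Cn d"
  obtains \<delta> where "0 < \<delta>" "\<And>w. w \<in> Cn d \<Longrightarrow> cdist d w z < \<delta> \<Longrightarrow> w \<in> T"
proof -
  have "openin (product_topology (\<lambda>i. euclidean) UNIV) T"
    using assms(1) by (simp add: open_fun_def)
  from product_topology_open_contains_basis[OF this assms(2)]
  obtain X where X: "z \<in> (\<Pi>\<^sub>E i\<in>UNIV. X i)" "\<And>i. openin euclidean (X i)"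
    "(\<Pi>\<^sub>E i\<in>UNIV. X i) \<subseteq> T" by blast
  have "\<exists>e>0. ball (z i) e \<subseteq> X i" for i
    using X(1) X(2)[of i] by (auto simp: PiE_iff open_contains_ball)
  then obtain e where e: "\<And>i. e i > 0" "\<And>i. ball (z i) (e i) \<subseteq> X i" by metis
  define \<delta> where "\<delta> = Min (insert 1 (e ` {..<d}))"
  have "\<delta> > 0" unfolding \<delta>_def using e by (subst Min_gr_iff) auto
  moreover have "w \<in> T" if w: "w \<in> Cn d" "cdist d w z < \<delta>" for w
  proof -
    have "w i \<in> X i" for i
    proof (cases "i < d")
      case True
      then have "\<delta> \<le> e i" unfolding \<delta>_def by (intro Min_le) auto
      then have "w i \<in> ball (z i) (e i)"
        using cmod_le_cdist[OF True, of w z] w by (auto simp: dist_norm norm_minus_commute)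
      then show ?thesis using e by blast
    next
      case False
      then have "w i = z i" using w assms(3) by (auto simp: Cn_def)
      then show ?thesis using e[of i] by (metis centre_in_ball in_mono)
    qed
    then show ?thesis using X(3) by (auto simp: PiE_iff)
  qed
  ultimately show ?thesis using that by blast
qed

lemma open_cdist_ball: "open {w. cdist d w z < \<delta>}"
  using continuous_on_cdist[of UNIV d z] by (intro open_Collect_less continuous_on_const)

lemma openin_Cn_contains_cdist_ball:
  assumes "openin (top_of_set (Cn d)) T" "z \<in> T"
  obtains \<delta> where "0 < \<delta>" "\<And>w. w \<in> Cn d \<Longrightarrow> cdist d w z < \<delta> \<Longrightarrow> w \<in> T"
proof -
  obtain T' where "open T'" "T = Cn d \<inter> T'" using assms(1) by (auto simp: openin_open)
  then show ?thesis using open_contains_cdist_ball[of T' z d] assms(2) that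
    by (metis IntD1 IntD2 IntI)
qed

lemma eventually_at_within_Cn:
  assumes "S \<subseteq> Cn d" "z \<in> Cn d"
  shows "eventually P (at z within S) \<longleftrightarrow> (\<exists>\<delta>>0. \<forall>w\<in>S. w \<noteq> z \<and> cdist d w z < \<delta> \<longrightarrow> P w)"
proof
  assume "eventually P (at z within S)"
  then obtain T where T: "open T" "z \<in> T" "\<forall>w\<in>T. w \<noteq> z \<longrightarrow> w \<in> S \<longrightarrow> P w"
    by (auto simp: eventually_at_topological)
  then show "\<exists>\<delta>>0. \<forall>w\<in>S. w \<noteq> z \<and> cdist d w z < \<delta> \<longrightarrow> P w"
    using open_contains_cdist_ball[OF T(1,2) assms(2)] assms(1) by (metis subsetD)
next
  assume "\<exists>\<delta>>0. \<forall>w\<in>S. w \<noteq> z \<and> cdist d w z < \<delta> \<longrightarrow> P w"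
  then obtain \<delta> where "\<delta> > 0" "\<forall>w\<in>S. w \<noteq> z \<and> cdist d w z < \<delta> \<longrightarrow> P w" by blast
  then show "eventually P (at z within S)"
    unfolding eventually_at_topological
    by (intro exI[of _ "{w. cdist d w z < \<delta>}"]) (auto simp: open_cdist_ball)
qed

text \<open>Multiplied out, the inequality holds trivially at \<open>w = z\<close>, so the punctured
  neighbourhood of the limit disappears.\<close>

lemma has_cgradient_iff:
  assumes "S \<subseteq> Cn d" "z \<in> Cn d"
  shows "has_cgradient d S f c z \<longleftrightarrow>
    (\<forall>\<epsilon>>0. \<exists>\<delta>>0. \<forall>w\<in>S. cdist d w z < \<delta> \<longrightarrow>
       cmod (f w - f z - (\<Sum>i<d. c i * (w i - z i))) \<le> \<epsilon> * cdist d w z)" (is "_ = ?R")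
proof -
  have *: "has_cgradient d S f c z \<longleftrightarrow> (\<forall>\<epsilon>>0. \<exists>\<delta>>0. \<forall>w\<in>S. w \<noteq> z \<and> cdist d w z < \<delta> \<longrightarrow>
       cmod (f w - f z - (\<Sum>i<d. c i * (w i - z i))) / cdist d w z < \<epsilon>)"
    unfolding has_cgradient_def tendsto_iff eventually_at_within_Cn[OF assms] cdist_def[symmetric]
    by (simp add: norm_divide)
  show ?thesis
  proof
    assume L: "has_cgradient d S f c z"
    show ?R
    proof (intro allI impI)
      fix \<epsilon> :: real assume "\<epsilon> > 0"
      then obtain \<delta> where d: "\<delta> > 0" "\<And>w. w\<in>S \<Longrightarrow> w \<noteq> z \<Longrightarrow> cdist d w z < \<delta> \<Longrightarrow>
       cmod (f w - f z - (\<Sum>i<d. c i * (w i - z i))) / cdist d w z < \<epsilon>"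
        using L unfolding * by blast
      have "cmod (f w - f z - (\<Sum>i<d. c i * (w i - z i))) \<le> \<epsilon> * cdist d w z"
        if w: "w \<in> S" "cdist d w z < \<delta>" for w
      proof (cases "w = z")
        case False
        then have "cdist d w z > 0" using cdist_pos w assms by blast
        then show ?thesis using d(2)[OF w(1) False w(2)] by (simp add: divide_simps)
      qed simp
      then show "\<exists>\<delta>>0. \<forall>w\<in>S. cdist d w z < \<delta> \<longrightarrow>
       cmod (f w - f z - (\<Sum>i<d. c i * (w i - z i))) \<le> \<epsilon> * cdist d w z" using d(1) by blast
    qed
  next
    assume R: ?R
    show "has_cgradient d S f c z"
      unfolding *
    proof (intro allI impI)
      fix \<epsilon> :: real assume "\<epsilon> > 0"
      then obtain \<delta> where d: "\<delta> > 0" "\<And>w. w\<in>S \<Longrightarrow> cdist d w z < \<delta> \<Longrightarrow>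
       cmod (f w - f z - (\<Sum>i<d. c i * (w i - z i))) \<le> \<epsilon>/2 * cdist d w z"
        using R[rule_format, of "\<epsilon>/2"] by auto
      have "cmod (f w - f z - (\<Sum>i<d. c i * (w i - z i))) / cdist d w z < \<epsilon>"
        if w: "w \<in> S" "w \<noteq> z" "cdist d w z < \<delta>" for w
      proof -
        have p: "cdist d w z > 0" using cdist_pos w assms by blast
        have "\<epsilon>/2 * cdist d w z < \<epsilon> * cdist d w z" using p \<open>\<epsilon> > 0\<close> by simp
        then show ?thesis using d(2)[OF w(1,3)] p by (simp add: divide_simps)
      qed
      then show "\<exists>\<delta>>0. \<forall>w\<in>S. w \<noteq> z \<and> cdist d w z < \<delta> \<longrightarrow>
       cmod (f w - f z - (\<Sum>i<d. c i * (w i - z i))) / cdist d w z < \<epsilon>" using d(1) by blast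
    qed
  qed
qed

text \<open>Locality: function and domain are replaced together, because expressions with
  \<open>inv_into\<close> agree with their intended formulas only near the point.\<close>

lemma has_cgradient_transfer:
  assumes g: "has_cgradient d S f c z" and S: "S \<subseteq> Cn d" "S' \<subseteq> Cn d" "z \<in> Cn d" and "\<delta> > 0"
    and eq: "\<And>w. w \<in> S' \<Longrightarrow> cdist d w z < \<delta> \<Longrightarrow> w \<in> S \<and> g w = f w" "g z = f z"
  shows "has_cgradient d S' g c z"
  unfolding has_cgradient_iff[OF S(2,3)]
proof (intro allI impI)
  fix \<epsilon> :: real assume "\<epsilon> > 0"
  then obtain \<eta> where "\<eta> > 0" "\<forall>w\<in>S. cdist d w z < \<eta> \<longrightarrow>
       cmod (f w - f z - (\<Sum>i<d. c i * (w i - z i))) \<le> \<epsilon> * cdist d w z"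
    using g unfolding has_cgradient_iff[OF S(1,3)] by blast
  then show "\<exists>\<delta>>0. \<forall>w\<in>S'. cdist d w z < \<delta> \<longrightarrow>
       cmod (g w - g z - (\<Sum>i<d. c i * (w i - z i))) \<le> \<epsilon> * cdist d w z"
    using \<open>\<delta> > 0\<close> eq by (intro exI[of _ "min \<delta> \<eta>"]) auto
qed

lemma has_cgradient_lipschitz:
  assumes S: "S \<subseteq> Cn d" "z \<in> Cn d" and "has_cgradient d S f c z"
  obtains \<delta> K where "0 < \<delta>" "0 < K" "\<And>w. w \<in> S \<Longrightarrow> cdist d w z < \<delta> \<Longrightarrow> cmod (f w - f z) \<le> K * cdist d w z"
proof -
  obtain \<delta> where d: "\<delta> > 0" "\<forall>w\<in>S. cdist d w z < \<delta> \<longrightarrow>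
       cmod (f w - f z - (\<Sum>i<d. c i * (w i - z i))) \<le> 1 * cdist d w z"
    using assms(3)[unfolded has_cgradient_iff[OF S], rule_format, of 1] by auto
  have "cmod (f w - f z) \<le> (1 + (\<Sum>i<d. cmod (c i))) * cdist d w z"
    if "w \<in> S" "cdist d w z < \<delta>" for w
  proof -
    have "cmod (\<Sum>i<d. c i * (w i - z i)) \<le> (\<Sum>i<d. cmod (c i) * cdist d w z)"
      by (intro sum_norm_le) (auto simp: norm_mult cmod_le_cdist mult_left_mono)
    then have "cmod (\<Sum>i<d. c i * (w i - z i)) \<le> (\<Sum>i<d. cmod (c i)) * cdist d w z"
      by (simp add: sum_distrib_right)
    moreover have "cmod (f w - f z - (\<Sum>i<d. c i * (w i - z i))) \<le> cdist d w z" using d that by auto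
    ultimately show ?thesis
      using norm_triangle_sub[of "f w - f z" "\<Sum>i<d. c i * (w i - z i)"] by (simp add: algebra_simps)
  qed
  moreover have "0 < 1 + (\<Sum>i<d. cmod (c i))" by (smt (verit) norm_ge_zero sum_nonneg)
  ultimately show ?thesis using that d(1) by blast
qed

lemma has_cgradient_compose:
  assumes S: "S \<subseteq> Cn d" "z \<in> Cn d" and T: "T \<subseteq> Cn e" "F ` S \<subseteq> T" "F z \<in> Cn e"
    and F: "\<And>j. j < e \<Longrightarrow> has_cgradient d S (\<lambda>w. F w j) (A j) z"
    and f: "has_cgradient e T f c (F z)"
  shows "has_cgradient d S (\<lambda>w. f (F w)) (\<lambda>i. \<Sum>j<e. c j * A j i) z"
  unfolding has_cgradient_iff[OF S]
proof (intro allI impI)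
  fix \<epsilon> :: real assume e: "\<epsilon> > 0"
  have "\<exists>\<delta> K. 0 < \<delta> \<and> 0 < K \<and> (\<forall>w\<in>S. cdist d w z < \<delta> \<longrightarrow> cmod (F w j - F z j) \<le> K * cdist d w z)"
    if "j < e" for j
    using has_cgradient_lipschitz[OF S F[OF that]] by metis
  then obtain \<delta>1 K where K: "\<And>j. j < e \<Longrightarrow> 0 < \<delta>1 j \<and> 0 < K j \<and>
      (\<forall>w\<in>S. cdist d w z < \<delta>1 j \<longrightarrow> cmod (F w j - F z j) \<le> K j * cdist d w z)" by metis
  \<comment> \<open>\<open>L\<close> is a Lipschitz bound for \<open>F\<close> at \<open>z\<close>.
    Half of epsilon pays for the remainder of \<open>f\<close>, scaled by \<open>L\<close>; the
    other half for the remainders of the components of \<open>F\<close>, scaled by the size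
    \<open>C\<close> of the gradient of \<open>f\<close>.\<close>
  define L where "L = 1 + (\<Sum>j<e. K j)"
  have L: "L > 0" unfolding L_def using K by (smt (verit) lessThan_iff sum_nonneg)
  define \<delta>2 where "\<delta>2 = Min (insert 1 (\<delta>1 ` {..<e}))"
  have d2: "\<delta>2 > 0" unfolding \<delta>2_def using K by (subst Min_gr_iff) auto
  have d2': "j < e \<Longrightarrow> \<delta>2 \<le> \<delta>1 j" for j unfolding \<delta>2_def by (intro Min_le) auto
  have lip: "cdist e (F w) (F z) \<le> L * cdist d w z" if "w \<in> S" "cdist d w z < \<delta>2" for w
  proof -
    have "cdist e (F w) (F z) \<le> (\<Sum>j<e. cmod (F w j - F z j))" by (rule cdist_le_sum)
    also have "\<dots> \<le> (\<Sum>j<e. K j * cdist d w z)"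
      using K d2' that by (intro sum_mono) (metis lessThan_iff order_less_le_trans)
    also have "\<dots> \<le> L * cdist d w z" by (simp add: L_def sum_distrib_right algebra_simps)
    finally show ?thesis .
  qed
  obtain \<delta>3 where d3: "\<delta>3 > 0" "\<And>u. u \<in> T \<Longrightarrow> cdist e u (F z) < \<delta>3 \<Longrightarrow>
       cmod (f u - f (F z) - (\<Sum>j<e. c j * (u j - F z j))) \<le> \<epsilon> / (2 * L) * cdist e u (F z)"
    using f[unfolded has_cgradient_iff[OF T(1,3)], rule_format, of "\<epsilon> / (2 * L)"] e L by auto
  define C where "C = 1 + (\<Sum>j<e. cmod (c j))"
  have C: "C > 0" unfolding C_def by (smt (verit) norm_ge_zero sum_nonneg)
  have "\<exists>\<delta>>0. \<forall>w\<in>S. cdist d w z < \<delta> \<longrightarrow>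
     cmod (F w j - F z j - (\<Sum>i<d. A j i * (w i - z i))) \<le> \<epsilon> / (2 * C) * cdist d w z" if "j < e" for j
    using F[OF that, unfolded has_cgradient_iff[OF S], rule_format, of "\<epsilon> / (2 * C)"] e C by auto
  then obtain \<delta>4 where d4: "\<And>j. j < e \<Longrightarrow> \<delta>4 j > 0 \<and> (\<forall>w\<in>S. cdist d w z < \<delta>4 j \<longrightarrow>
     cmod (F w j - F z j - (\<Sum>i<d. A j i * (w i - z i))) \<le> \<epsilon> / (2 * C) * cdist d w z)" by metis
  define \<delta>5 where "\<delta>5 = Min (insert 1 (\<delta>4 ` {..<e}))"
  have d5: "\<delta>5 > 0" unfolding \<delta>5_def using d4 by (subst Min_gr_iff) auto
  have d5': "j < e \<Longrightarrow> \<delta>5 \<le> \<delta>4 j" for j unfolding \<delta>5_def by (intro Min_le) auto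
  define \<delta> where "\<delta> = min (min \<delta>2 \<delta>5) (\<delta>3 / L)"
  have "\<delta> > 0" using d2 d3 d5 L by (simp add: \<delta>_def)
  moreover have "cmod (f (F w) - f (F z) - (\<Sum>i<d. (\<Sum>j<e. c j * A j i) * (w i - z i))) \<le> \<epsilon> * cdist d w z"
    if w: "w \<in> S" "cdist d w z < \<delta>" for w
  proof -
    have l: "cdist e (F w) (F z) \<le> L * cdist d w z" using lip w by (simp add: \<delta>_def)
    have "cdist d w z < \<delta>3 / L" using w by (simp add: \<delta>_def)
    then have "cdist e (F w) (F z) < \<delta>3" using l L by (simp add: pos_less_divide_eq mult.commute)
    then have 1: "cmod (f (F w) - f (F z) - (\<Sum>j<e. c j * (F w j - F z j))) \<le> \<epsilon> / (2 * L) * cdist e (F w) (F z)"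
      using d3(2) w(1) T(2) by blast
    have "\<epsilon> / (2 * L) * cdist e (F w) (F z) \<le> \<epsilon> / (2 * L) * (L * cdist d w z)"
      using l e L by (intro mult_left_mono) auto
    then have 3: "cmod (f (F w) - f (F z) - (\<Sum>j<e. c j * (F w j - F z j))) \<le> \<epsilon> / 2 * cdist d w z"
      using 1 L by simp
    have "(\<Sum>i<d. (\<Sum>j<e. c j * A j i) * (w i - z i)) = (\<Sum>j<e. c j * (\<Sum>i<d. A j i * (w i - z i)))"
      by (simp add: sum_distrib_left sum_distrib_right mult.assoc) (rule sum.swap)
    then have eq: "(\<Sum>j<e. c j * (F w j - F z j)) - (\<Sum>i<d. (\<Sum>j<e. c j * A j i) * (w i - z i))
        = (\<Sum>j<e. c j * (F w j - F z j - (\<Sum>i<d. A j i * (w i - z i))))"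
      by (simp add: sum_subtractf right_diff_distrib)
    have "cmod (\<Sum>j<e. c j * (F w j - F z j - (\<Sum>i<d. A j i * (w i - z i))))
        \<le> (\<Sum>j<e. cmod (c j) * (\<epsilon> / (2 * C) * cdist d w z))"
    proof (intro sum_norm_le)
      fix j assume "j \<in> {..<e}"
      then have "j < e" by simp
      then have "cmod (F w j - F z j - (\<Sum>i<d. A j i * (w i - z i))) \<le> \<epsilon> / (2 * C) * cdist d w z"
        using d4[of j] d5'[of j] w by (simp add: \<delta>_def)
      then show "cmod (c j * (F w j - F z j - (\<Sum>i<d. A j i * (w i - z i)))) \<le> cmod (c j) * (\<epsilon> / (2 * C) * cdist d w z)"
        by (simp only: norm_mult) (rule mult_left_mono, auto)
    qed
    also have "\<dots> = (\<Sum>j<e. cmod (c j)) * (\<epsilon> / (2 * C) * cdist d w z)" by (simp only: sum_distrib_right)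
    also have "\<dots> = (C - 1) * (\<epsilon> / (2 * C) * cdist d w z)" by (simp add: C_def)
    also have "\<dots> \<le> C * (\<epsilon> / (2 * C) * cdist d w z)"
      using e C by (intro mult_right_mono) auto
    also have "\<dots> = \<epsilon> / 2 * cdist d w z" using C by (simp add: field_simps)
    finally have 2: "cmod ((\<Sum>j<e. c j * (F w j - F z j)) - (\<Sum>i<d. (\<Sum>j<e. c j * A j i) * (w i - z i))) \<le> \<epsilon> / 2 * cdist d w z"
      unfolding eq .
    show ?thesis using norm_diff_triangle_le[OF 3 2] by simp
  qed
  ultimately show "\<exists>\<delta>>0. \<forall>w\<in>S. cdist d w z < \<delta> \<longrightarrow>
       cmod (f (F w) - f (F z) - (\<Sum>i<d. (\<Sum>j<e. c j * A j i) * (w i - z i))) \<le> \<epsilon> * cdist d w z" by blast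
qed

lemma has_cgradient_coordinate: 
  assumes "S \<subseteq> Cn d" "z \<in> Cn d" "j < d"
  shows "has_cgradient d S (\<lambda>w. w j) (\<lambda>i. if i = j then 1 else 0) z"
proof -
  have "(\<Sum>i<d. (if i = j then 1 else 0) * (w i - z i)) = w j - z j" for w :: "nat \<Rightarrow> complex"
    using assms(3) by (simp add: if_distrib[of "\<lambda>x. x * _"] cong: if_cong)
  then show ?thesis unfolding has_cgradient_iff[OF assms(1,2)] by (auto intro!: exI[of _ 1])
qed

lemma has_cgradient_unique:
  assumes S: "openin (top_of_set (Cn d)) S" "z \<in> S" 
    and "has_cgradient d S f c z" "has_cgradient d S f c' z" "i < d"
  shows "c i = c' i"
proof (rule ccontr)
  assume ne: "c i \<noteq> c' i"
  have SC: "S \<subseteq> Cn d" "z \<in> Cn d" using S openin_subset by force+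
  \<comment> \<open>Along a step of length t in direction i the two linear parts differ by 4 epsilon
    t, while the two remainders leave room for 2 epsilon t only.\<close>
  define \<epsilon> where "\<epsilon> = cmod (c i - c' i) / 4"
  have e: "\<epsilon> > 0" using ne by (simp add: \<epsilon>_def)
  obtain \<delta> where d: "0 < \<delta>" "\<And>w. w \<in> Cn d \<Longrightarrow> cdist d w z < \<delta> \<Longrightarrow> w \<in> S"
    using openin_Cn_contains_cdist_ball[OF S] by blast
  obtain \<delta>1 where d1: "\<delta>1 > 0" "\<And>w. w\<in>S \<Longrightarrow> cdist d w z < \<delta>1 \<Longrightarrow>
       cmod (f w - f z - (\<Sum>i<d. c i * (w i - z i))) \<le> \<epsilon> * cdist d w z"
    using assms(3) e unfolding has_cgradient_iff[OF SC] by blast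
  obtain \<delta>2 where d2: "\<delta>2 > 0" "\<And>w. w\<in>S \<Longrightarrow> cdist d w z < \<delta>2 \<Longrightarrow>
       cmod (f w - f z - (\<Sum>i<d. c' i * (w i - z i))) \<le> \<epsilon> * cdist d w z"
    using assms(4) e unfolding has_cgradient_iff[OF SC] by blast
  define t where "t = min \<delta> (min \<delta>1 \<delta>2) / 2"
  have t: "t > 0" "t < \<delta>" "t < \<delta>1" "t < \<delta>2" using d(1) d1(1) d2(1) by (auto simp: t_def)
  define w where "w = (\<lambda>j. if j = i then z i + of_real t else z j)"
  have wC: "w \<in> Cn d" using SC assms(5) by (auto simp: w_def Cn_def)
  have "cdist d w z \<le> (\<Sum>j<d. cmod (w j - z j))" by (rule cdist_le_sum)
  also have "\<dots> = (\<Sum>j<d. if j = i then t else 0)" by (intro sum.cong) (use t in \<open>auto simp: w_def\<close>)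
  also have "\<dots> = t" using assms(5) by simp
  finally have dt: "cdist d w z \<le> t" .
  have wS: "w \<in> S" using d(2)[OF wC] dt t by simp
  have s: "(\<Sum>j<d. b j * (w j - z j)) = b i * of_real t" for b :: "nat \<Rightarrow> complex"
  proof -
    have "(\<Sum>j<d. b j * (w j - z j)) = (\<Sum>j<d. if j = i then b i * of_real t else 0)"
      by (intro sum.cong) (auto simp: w_def)
    then show ?thesis using assms(5) by simp
  qed
  have 1: "cmod (f w - f z - c i * of_real t) \<le> \<epsilon> * t"
    using d1(2)[OF wS] dt t e by (simp add: s) (meson dual_order.trans mult_left_mono less_imp_le)
  have 2: "cmod (f w - f z - c' i * of_real t) \<le> \<epsilon> * t"
    using d2(2)[OF wS] dt t e by (simp add: s) (meson dual_order.trans mult_left_mono less_imp_le)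
  have "cmod ((c i - c' i) * of_real t) \<le> \<epsilon> * t + \<epsilon> * t"
    using 1 2 norm_triangle_ineq4[of "f w - f z - c' i * of_real t" "f w - f z - c i * of_real t"]
    by (simp add: algebra_simps)
  then have "cmod (c i - c' i) * t \<le> (2 * \<epsilon>) * t" using t(1) by (simp add: norm_mult)
  then have "cmod (c i - c' i) \<le> 2 * \<epsilon>" using t(1) by (rule mult_right_le_imp_le)
  then show False using e by (simp add: \<epsilon>_def)
qed


section \<open>Biholomorphic invariance of projectivity\<close>

lemma complex_manifoldD:
  assumes "complex_manifold M"
  shows "Hausdorff_space (ctop M)" "second_countable (ctop M)" "(\<Union>(U, \<phi>)\<in>catlas M. U) = points M"
    and "(U, \<phi>) \<in> catlas M \<Longrightarrow> openin (ctop M) U"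
    and "(U, \<phi>) \<in> catlas M \<Longrightarrow> openin (top_of_set (Cn (cdim M))) (\<phi> ` U)"
    and "(U, \<phi>) \<in> catlas M \<Longrightarrow> homeomorphic_map (subtopology (ctop M) U) (top_of_set (\<phi> ` U)) \<phi>"
    and "(U, \<phi>) \<in> catlas M \<Longrightarrow> (V, \<psi>) \<in> catlas M \<Longrightarrow>
      holo_map (cdim M) (cdim M) (\<phi> ` (U \<inter> V)) (\<psi> \<circ> inv_into U \<phi>)"
  using assms unfolding complex_manifold_def by fast+

lemma chart_inj_on:
  assumes "complex_manifold M" "(U, \<phi>) \<in> catlas M"
  shows "inj_on \<phi> U"
  using homeomorphic_imp_injective_map[OF complex_manifoldD(6)[OF assms]]
    openin_subset[OF complex_manifoldD(4)[OF assms]]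
  by (simp add: Int_absorb1)

lemma openin_chart_image:
  assumes M: "complex_manifold M" "(U, \<phi>) \<in> catlas M" and "openin (ctop M) W"
  shows "openin (top_of_set (Cn (cdim M))) (\<phi> ` (U \<inter> W))"
proof -
  have "openin (subtopology (ctop M) U) (U \<inter> W)"
    using assms(3) openin_subtopology_Int2 by blast
  then have "openin (top_of_set (\<phi> ` U)) (\<phi> ` (U \<inter> W))"
    using homeomorphic_imp_open_map[OF complex_manifoldD(6)[OF M]] unfolding open_map_def by blast
  then show ?thesis using complex_manifoldD(5)[OF M] openin_trans by blast
qed

lemma chart_image_subset_Cn:
  assumes "complex_manifold M" "(U, \<phi>) \<in> catlas M"
  shows "\<phi> ` U \<subseteq> Cn (cdim M)"
  using openin_subset[OF complex_manifoldD(5)[OF assms]] by simp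

lemma openin_continuous_vimage:
  assumes "continuous_map X Y f" "openin X U" "openin Y V"
  shows "openin X (U \<inter> f -` V)"
proof -
  have "openin X (U \<inter> {x \<in> topspace X. f x \<in> V})"
    using assms by (intro openin_Int openin_continuous_map_preimage)
  moreover have "U \<inter> {x \<in> topspace X. f x \<in> V} = U \<inter> f -` V" using openin_subset[OF assms(2)] by blast
  ultimately show ?thesis by simp
qed

text \<open>The chain rule does not apply on the whole chart domain, since \<open>F\<close> maps
  only a part of \<open>U\<close> into \<open>U'\<close>. That part is open, so the gradient
  transfers.\<close>

lemma has_cgradient_in_charts_compose:
  assumes M: "complex_manifold M" "complex_manifold N" and F: "holomorphic_map M N F"
    and U: "(U, \<phi>) \<in> catlas M" "(U', \<phi>') \<in> catlas N" and x: "x \<in> U" "F x \<in> U'"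
    and A: "\<And>i. i < cdim N \<Longrightarrow>
      has_cgradient (cdim M) (\<phi> ` (U \<inter> F -` U')) (\<lambda>w. (\<phi>' \<circ> F \<circ> inv_into U \<phi>) w i) (A i) (\<phi> x)"
    and c: "has_cgradient (cdim N) (\<phi>' ` (U' \<inter> f -` V)) (\<lambda>z. (\<psi> \<circ> f \<circ> inv_into U' \<phi>') z j) c (\<phi>' (F x))"
  shows "has_cgradient (cdim M) (\<phi> ` (U \<inter> (f \<circ> F) -` V)) (\<lambda>w. (\<psi> \<circ> (f \<circ> F) \<circ> inv_into U \<phi>) w j)
           (\<lambda>i. \<Sum>l<cdim N. c l * A l i) (\<phi> x)"
proof -
  have inj: "inj_on \<phi> U" "inj_on \<phi>' U'" using chart_inj_on M U by blast+
  have sub: "\<phi> ` U \<subseteq> Cn (cdim M)" "\<phi>' ` U' \<subseteq> Cn (cdim N)" using chart_image_subset_Cn M U by blast+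
  define S where "S = \<phi> ` (U \<inter> F -` U' \<inter> (f \<circ> F) -` V)"
  define T where "T = \<phi>' ` (U' \<inter> f -` V)"
  define \<Phi> where "\<Phi> = \<phi>' \<circ> F \<circ> inv_into U \<phi>"
  have SC: "S \<subseteq> Cn (cdim M)" "\<phi> x \<in> Cn (cdim M)" "T \<subseteq> Cn (cdim N)" 
    using sub x by (auto simp: S_def T_def)
  have \<Phi>x: "\<Phi> (\<phi> x) = \<phi>' (F x)" using inj x by (simp add: \<Phi>_def)
  have ST: "\<Phi> ` S \<subseteq> T" using inj by (auto simp: S_def T_def \<Phi>_def)
  have "has_cgradient (cdim M) S (\<lambda>w. \<Phi> w i) (A i) (\<phi> x)" if "i < cdim N" for i
    by (rule has_cgradient_transfer[OF A[OF that], of _ 1]) (use sub x in \<open>auto simp: S_def \<Phi>_def\<close>)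
  then have *: "has_cgradient (cdim M) S (\<lambda>w. ((\<lambda>z. (\<psi> \<circ> f \<circ> inv_into U' \<phi>') z j) (\<Phi> w)))
           (\<lambda>i. \<Sum>l<cdim N. c l * A l i) (\<phi> x)"
    by (intro has_cgradient_compose[OF SC(1,2,3) ST]) (use c x sub in \<open>auto simp: \<Phi>x T_def\<close>)
  have "openin (ctop M) (U \<inter> F -` U')"
    using F complex_manifoldD(4)[OF M(1) U(1)] complex_manifoldD(4)[OF M(2) U(2)]
    by (intro openin_continuous_vimage) (auto simp: holomorphic_map_def)
  then have "openin (top_of_set (Cn (cdim M))) (\<phi> ` (U \<inter> F -` U'))"
    using openin_chart_image[OF M(1) U(1)] by (metis inf_left_idem)
  then obtain \<delta> where \<delta>: "0 < \<delta>" "\<And>w. w \<in> Cn (cdim M) \<Longrightarrow> cdist (cdim M) w (\<phi> x) < \<delta> \<Longrightarrow> w \<in> \<phi> ` (U \<inter> F -` U')"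
    using openin_Cn_contains_cdist_ball[of _ _ "\<phi> x"] x by (metis IntI imageI vimageI2)
  show ?thesis
  proof (rule has_cgradient_transfer[OF * SC(1) _ SC(2) \<delta>(1)])
    show "\<phi> ` (U \<inter> (f \<circ> F) -` V) \<subseteq> Cn (cdim M)" using sub by auto
    show "(\<psi> \<circ> (f \<circ> F) \<circ> inv_into U \<phi>) (\<phi> x) j = (\<psi> \<circ> f \<circ> inv_into U' \<phi>') (\<Phi> (\<phi> x)) j"
      using inj x by (simp add: \<Phi>x)
    fix w assume w: "w \<in> \<phi> ` (U \<inter> (f \<circ> F) -` V)" "cdist (cdim M) w (\<phi> x) < \<delta>"
    then obtain u where u: "u \<in> U" "f (F u) \<in> V" "w = \<phi> u" by auto
    have "w \<in> \<phi> ` (U \<inter> F -` U')" using \<delta>(2) w u sub by blast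
    then have "F u \<in> U'" using u inj(1) by (auto simp: inj_on_def)
    then show "w \<in> S \<and> (\<psi> \<circ> (f \<circ> F) \<circ> inv_into U \<phi>) w j = (\<psi> \<circ> f \<circ> inv_into U' \<phi>') (\<Phi> w) j"
      using u inj by (auto simp: S_def \<Phi>_def)
  qed
qed

lemma holomorphic_map_gradients:
  assumes "holomorphic_map M N F" "(U, \<phi>) \<in> catlas M" "(V, \<psi>) \<in> catlas N" "x \<in> U" "F x \<in> V"
  obtains A where "\<forall>i<cdim N.
      has_cgradient (cdim M) (\<phi> ` (U \<inter> F -` V)) (\<lambda>w. (\<psi> \<circ> F \<circ> inv_into U \<phi>) w i) (A i) (\<phi> x)"
proof -
  have "\<phi> x \<in> \<phi> ` (U \<inter> F -` V)" using assms by auto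
  moreover have "holo_map (cdim M) (cdim N) (\<phi> ` (U \<inter> F -` V)) (\<psi> \<circ> F \<circ> inv_into U \<phi>)"
    using assms unfolding holomorphic_map_def by auto
  ultimately have "\<forall>i<cdim N. \<exists>c. has_cgradient (cdim M) (\<phi> ` (U \<inter> F -` V)) (\<lambda>w. (\<psi> \<circ> F \<circ> inv_into U \<phi>) w i) c (\<phi> x)"
    unfolding holo_map_def holo_fun_def by blast
  then obtain A where "\<forall>i<cdim N. has_cgradient (cdim M) (\<phi> ` (U \<inter> F -` V)) (\<lambda>w. (\<psi> \<circ> F \<circ> inv_into U \<phi>) w i) (A i) (\<phi> x)"
    by metis
  then show ?thesis using that by blast
qed

lemma ex_chart:
  assumes "complex_manifold M" "x \<in> points M"
  obtains U \<phi> where "(U, \<phi>) \<in> catlas M" "x \<in> U"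
proof -
  have "x \<in> (\<Union>(U, \<phi>)\<in>catlas M. U)" using assms complex_manifoldD(3)[OF assms(1)] by simp
  then obtain p where "p \<in> catlas M" "x \<in> fst p" by (auto simp: case_prod_beta)
  then show ?thesis using that[of "fst p" "snd p"] by simp
qed

text \<open>Precomposing the embedding of \<open>N\<close> with the biholomorphism does not change
  the image, so its analyticity is inherited. The work lies in the injectivity of the
  differential.\<close>

lemma projective_biholomorphic:
  assumes "biholomorphic M N" "complex_manifold M" "projective N"
  shows "projective M"
proof -
  have N: "complex_manifold N" "compact_space (ctop N)" using assms by (auto simp: projective_def)
  obtain K f where f: "holomorphic_map N (proj_space K) f" "immersion N (proj_space K) f"
      "embedding_map (ctop N) (ctop (proj_space K)) f" 
    and an: "analytic_subvariety (proj_space K) (f ` points N)"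
    using assms(3) unfolding projective_def holomorphic_embedding_def by blast
  obtain F G where hom: "homeomorphic_maps (ctop M) (ctop N) F G" 
    and F: "holomorphic_map M N F" and G: "holomorphic_map N M G"
    using assms(1) unfolding biholomorphic_def biholomorphism_def by blast
  have hF: "homeomorphic_map (ctop M) (ctop N) F" using hom homeomorphic_maps_map by blast
  have FN: "F x \<in> points N" if "x \<in> points M" for x
    using hF that homeomorphic_imp_surjective_map by fastforce
  have GF: "G (F x) = x" if "x \<in> points M" for x using hom that by (simp add: homeomorphic_maps_def)
  have chart: "\<exists>A. (\<forall>i<cdim N. has_cgradient (cdim M) (\<phi> ` (U \<inter> F -` U')) (\<lambda>w. (\<phi>' \<circ> F \<circ> inv_into U \<phi>) w i) (A i) (\<phi> x))
     \<and> (\<forall>v. (\<forall>j<cdim N. (\<Sum>i<cdim M. A j i * v i) = 0) \<longrightarrow> (\<forall>i<cdim M. v i = 0))"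
    if U: "(U, \<phi>) \<in> catlas M" "(U', \<phi>') \<in> catlas N" "x \<in> U" "F x \<in> U'" for U \<phi> U' \<phi>' x
  proof -
    have UM: "U \<subseteq> points M" using complex_manifoldD(4)[OF assms(2) U(1)] openin_subset by blast
    obtain A where A: "\<And>i. i < cdim N \<Longrightarrow>
      has_cgradient (cdim M) (\<phi> ` (U \<inter> F -` U')) (\<lambda>w. (\<phi>' \<circ> F \<circ> inv_into U \<phi>) w i) (A i) (\<phi> x)"
      using holomorphic_map_gradients[OF F U] by blast
    have GFx: "G (F x) \<in> U" using GF U UM by auto
    obtain B where B: "\<And>i. i < cdim M \<Longrightarrow>
      has_cgradient (cdim N) (\<phi>' ` (U' \<inter> G -` U)) (\<lambda>w. (\<phi> \<circ> G \<circ> inv_into U' \<phi>') w i) (B i) (\<phi>' (F x))"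
      using holomorphic_map_gradients[OF G U(2,1,4) GFx] by blast
    have inj: "inj_on \<phi> U" by (rule chart_inj_on[OF assms(2) U(1)])
    \<comment> \<open>The product of both Jacobians is a gradient of the identity on an open set,
      hence the unit matrix by uniqueness; so \<open>A\<close> has a left inverse.\<close>
    have BA: "(\<Sum>l<cdim N. B j l * A l i) = (if i = j then 1 else 0)" if ij: "i < cdim M" "j < cdim M" for i j
    proof (rule has_cgradient_unique[where S = "\<phi> ` U" and z = "\<phi> x", OF _ _ _ _ ij(1)])
      show "openin (top_of_set (Cn (cdim M))) (\<phi> ` U)" by (rule complex_manifoldD(5)[OF assms(2) U(1)])
      show "\<phi> x \<in> \<phi> ` U" using U by simp
      have "U \<inter> (G \<circ> F) -` U = U" using GF UM by auto
      then have *: "has_cgradient (cdim M) (\<phi> ` U) (\<lambda>w. (\<phi> \<circ> (G \<circ> F) \<circ> inv_into U \<phi>) w j) (\<lambda>i. \<Sum>l<cdim N. B j l * A l i) (\<phi> x)"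
        using has_cgradient_in_charts_compose[OF assms(2) N(1) F U A B[OF ij(2)]] by simp
      show "has_cgradient (cdim M) (\<phi> ` U) (\<lambda>w. w j) (\<lambda>i. \<Sum>l<cdim N. B j l * A l i) (\<phi> x)"
        by (rule has_cgradient_transfer[OF *, of _ 1]) 
           (use chart_image_subset_Cn[OF assms(2) U(1)] U inj GF UM in auto)
      show "has_cgradient (cdim M) (\<phi> ` U) (\<lambda>w. w j) (\<lambda>i. if i = j then 1 else 0) (\<phi> x)"
        by (rule has_cgradient_coordinate) (use chart_image_subset_Cn[OF assms(2) U(1)] U ij in auto)
    qed
    have "v i = 0" if v: "\<forall>j<cdim N. (\<Sum>i<cdim M. A j i * v i) = 0" and i: "i < cdim M" for v i
    proof -
      have "0 = (\<Sum>l<cdim N. B i l * (\<Sum>m<cdim M. A l m * v m))" using v by simp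
      also have "\<dots> = (\<Sum>m<cdim M. (\<Sum>l<cdim N. B i l * A l m) * v m)"
        by (simp add: sum_distrib_left sum_distrib_right mult.assoc) (rule sum.swap)
      also have "\<dots> = (\<Sum>m<cdim M. (if m = i then 1 else 0) * v m)"
        by (intro sum.cong refl) (use BA i in auto)
      also have "\<dots> = v i" using i by (simp add: if_distrib[of "\<lambda>x. x * _"] cong: if_cong)
      finally show ?thesis by simp
    qed
    then show ?thesis using A by blast
  qed
  have "holomorphic_map M (proj_space K) (f \<circ> F)"
    unfolding holomorphic_map_def
  proof (intro conjI)
    show "continuous_map (ctop M) (ctop (proj_space K)) (f \<circ> F)"
      using F f unfolding holomorphic_map_def by (meson continuous_map_compose)
  next
    show "\<forall>(U, \<phi>)\<in>catlas M. \<forall>(V, \<psi>)\<in>catlas (proj_space K).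
        holo_map (cdim M) (cdim (proj_space K)) (\<phi> ` (U \<inter> (f \<circ> F) -` V)) (\<psi> \<circ> (f \<circ> F) \<circ> inv_into U \<phi>)"
    proof clarify
    fix U \<phi> V \<psi> assume U: "(U, \<phi>) \<in> catlas M" "(V, \<psi>) \<in> catlas (proj_space K)"
    have UM: "U \<subseteq> points M" using complex_manifoldD(4)[OF assms(2) U(1)] openin_subset by blast
    have main: "\<exists>c. has_cgradient (cdim M) (\<phi> ` (U \<inter> (f \<circ> F) -` V)) (\<lambda>w. (\<psi> \<circ> (f \<circ> F) \<circ> inv_into U \<phi>) w j) c (\<phi> x)"
      if x: "x \<in> U" "f (F x) \<in> V" and j: "j < cdim (proj_space K)" for x j
    proof -
      obtain U' \<phi>' where U': "(U', \<phi>') \<in> catlas N" "F x \<in> U'" using ex_chart[OF N(1)] FN x UM by blast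
      obtain A where A: "\<And>i. i < cdim N \<Longrightarrow> has_cgradient (cdim M) (\<phi> ` (U \<inter> F -` U')) (\<lambda>w. (\<phi>' \<circ> F \<circ> inv_into U \<phi>) w i) (A i) (\<phi> x)"
        using chart[OF U(1) U'(1) x(1) U'(2)] by blast
      obtain C where C: "\<And>i. i < cdim (proj_space K) \<Longrightarrow>
        has_cgradient (cdim N) (\<phi>' ` (U' \<inter> f -` V)) (\<lambda>w. (\<psi> \<circ> f \<circ> inv_into U' \<phi>') w i) (C i) (\<phi>' (F x))"
        using holomorphic_map_gradients[OF f(1) U'(1) U(2) U'(2) x(2)] by blast
      show ?thesis
        using has_cgradient_in_charts_compose[OF assms(2) N(1) F U(1) U'(1) x(1) U'(2) A C[rule_format, OF j]] by blast
    qed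
    have "\<psi> y \<in> Cn K" if "y \<in> V" for y
    proof -
      obtain j where j: "j \<le> K" "\<psi> = affine_chart K j" using U(2) by (auto simp: proj_space_def)
      show ?thesis using j by (auto simp: affine_chart_def Let_def Cn_def)
    qed
    then have "(\<psi> \<circ> (f \<circ> F) \<circ> inv_into U \<phi>) ` (\<phi> ` (U \<inter> (f \<circ> F) -` V)) \<subseteq> Cn (cdim (proj_space K))"
      using chart_inj_on[OF assms(2) U(1)] by (auto simp: proj_space_def)
    moreover have "\<exists>c. has_cgradient (cdim M) (\<phi> ` (U \<inter> (f \<circ> F) -` V)) (\<lambda>w. (\<psi> \<circ> (f \<circ> F) \<circ> inv_into U \<phi>) w j) c z"
      if z: "z \<in> \<phi> ` (U \<inter> (f \<circ> F) -` V)" and j: "j < cdim (proj_space K)" for z j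
    proof -
      obtain x where "x \<in> U" "f (F x) \<in> V" "z = \<phi> x" using z by auto
      then show ?thesis using main[of x j] j by simp
    qed
    ultimately show "holo_map (cdim M) (cdim (proj_space K)) (\<phi> ` (U \<inter> (f \<circ> F) -` V)) (\<psi> \<circ> (f \<circ> F) \<circ> inv_into U \<phi>)"
      unfolding holo_map_def holo_fun_def by blast
    qed
  qed
  moreover have "immersion M (proj_space K) (f \<circ> F)"
    unfolding immersion_def
  proof (clarify, goal_cases)
    case (1 U \<phi> V \<psi> x)
    then have U: "(U, \<phi>) \<in> catlas M" "(V, \<psi>) \<in> catlas (proj_space K)" and x: "x \<in> U" "f (F x) \<in> V" by auto
    have UM: "U \<subseteq> points M" using complex_manifoldD(4)[OF assms(2) U(1)] openin_subset by blast
    obtain U' \<phi>' where U': "(U', \<phi>') \<in> catlas N" "F x \<in> U'" using ex_chart[OF N(1)] FN x UM by blast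
    obtain A where A: "\<And>i. i < cdim N \<Longrightarrow> has_cgradient (cdim M) (\<phi> ` (U \<inter> F -` U')) (\<lambda>w. (\<phi>' \<circ> F \<circ> inv_into U \<phi>) w i) (A i) (\<phi> x)"
      and Ai: "\<And>v. (\<forall>j<cdim N. (\<Sum>i<cdim M. A j i * v i) = 0) \<Longrightarrow> (\<forall>i<cdim M. v i = 0)"
      using chart[OF U(1) U'(1) x(1) U'(2)] by blast
    obtain C where C: "\<And>i. i < cdim (proj_space K) \<Longrightarrow>
        has_cgradient (cdim N) (\<phi>' ` (U' \<inter> f -` V)) (\<lambda>w. (\<psi> \<circ> f \<circ> inv_into U' \<phi>') w i) (C i) (\<phi>' (F x))"
      and Ci: "\<And>v. (\<forall>j<cdim (proj_space K). (\<Sum>i<cdim N. C j i * v i) = 0) \<Longrightarrow> (\<forall>i<cdim N. v i = 0)"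
      using f(2) U'(1) U(2) U'(2) x(2) unfolding immersion_def by fast
    show ?case
    proof (rule exI[of _ "\<lambda>j i. \<Sum>l<cdim N. C j l * A l i"], intro conjI allI impI)
      fix j assume "j < cdim (proj_space K)"
      then show "has_cgradient (cdim M) (\<phi> ` (U \<inter> (f \<circ> F) -` V)) (\<lambda>z. (\<psi> \<circ> (f \<circ> F) \<circ> inv_into U \<phi>) z j) (\<lambda>i. \<Sum>l<cdim N. C j l * A l i) (\<phi> x)"
        using has_cgradient_in_charts_compose[OF assms(2) N(1) F U(1) U'(1) x(1) U'(2) A C] by blast
    next
      fix v i assume v: "\<forall>j<cdim (proj_space K). (\<Sum>i<cdim M. (\<Sum>l<cdim N. C j l * A l i) * v i) = 0" and i: "i < cdim M"
      have "(\<Sum>i<cdim M. (\<Sum>l<cdim N. C j l * A l i) * v i) = (\<Sum>l<cdim N. C j l * (\<Sum>i<cdim M. A l i * v i))" for j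
        by (simp add: sum_distrib_left sum_distrib_right mult.assoc) (rule sum.swap)
      then have "\<forall>j<cdim (proj_space K). (\<Sum>l<cdim N. C j l * (\<Sum>i<cdim M. A l i * v i)) = 0" using v by simp
      then show "v i = 0" using Ai[of v] Ci[of "\<lambda>l. \<Sum>i<cdim M. A l i * v i"] i by blast
    qed
  qed
  moreover have "embedding_map (ctop M) (ctop (proj_space K)) (f \<circ> F)"
    using hF f(3) embedding_map_compose surjective_embedding_map by blast
  moreover have "(f \<circ> F) ` points M = f ` points N"
    using homeomorphic_imp_surjective_map[OF hF] by (metis image_comp)
  moreover have "compact_space (ctop M)"
    using N(2) hF homeomorphic_compact_space homeomorphic_map_imp_homeomorphic_space by blast
  ultimately show ?thesis
    using assms(2) an unfolding projective_def holomorphic_embedding_def by metis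
qed

lemma biholomorphic_sym: "biholomorphic M N \<Longrightarrow> biholomorphic N M"
  unfolding biholomorphic_def biholomorphism_def by (metis homeomorphic_maps_sym)

section \<open>Quotient topologies of transformation groups\<close>

text \<open>The group laws are asked on \<open>topspace X\<close> only: members of a
  \<open>BijGroup\<close> are \<open>undefined\<close> off the carrier, whereas lattice shifts and
  scalings are total functions. One notion has to cover all three.\<close>

definition transformation_group :: "'a topology \<Rightarrow> ('a \<Rightarrow> 'a) set \<Rightarrow> bool" where
  "transformation_group X G \<longleftrightarrow>
     (\<forall>g\<in>G. homeomorphic_map X X g) \<and>
     (\<exists>e\<in>G. \<forall>x\<in>topspace X. e x = x) \<and>
     (\<forall>g\<in>G. \<forall>h\<in>G. \<exists>k\<in>G. \<forall>x\<in>topspace X. k x = g (h x)) \<and>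
     (\<forall>g\<in>G. \<exists>h\<in>G. \<forall>x\<in>topspace X. h (g x) = x)"

lemma transformation_group_closed:
  assumes "transformation_group X G" "g \<in> G" "x \<in> topspace X"
  shows "g x \<in> topspace X"
  using assms homeomorphic_imp_surjective_map unfolding transformation_group_def by blast

lemma orb_eq_iff:
  assumes G: "transformation_group X G" and x: "x \<in> topspace X"
  shows "orb G x = orb G y \<and> y \<in> topspace X \<longleftrightarrow> (\<exists>g\<in>G. y = g x)"
proof
  assume "orb G x = orb G y \<and> y \<in> topspace X"
  moreover obtain e where "e \<in> G" "\<forall>x\<in>topspace X. e x = x" 
    using G by (auto simp: transformation_group_def)
  ultimately have "y \<in> orb G x" unfolding orb_def by (metis image_eqI)
  then show "\<exists>g\<in>G. y = g x" by (auto simp: orb_def)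
next
  assume "\<exists>g\<in>G. y = g x"
  then obtain g where g: "g \<in> G" "y = g x" by blast
  have y: "y \<in> topspace X" using transformation_group_closed[OF G g(1) x] g by simp
  obtain h where h: "h \<in> G" "\<forall>x\<in>topspace X. h (g x) = x"
    using G g by (auto simp: transformation_group_def)
  have mult: "\<exists>k\<in>G. \<forall>x\<in>topspace X. k x = a (b x)" if "a \<in> G" "b \<in> G" for a b
    using G that by (auto simp: transformation_group_def)
  have "k x \<in> orb G y" if k: "k \<in> G" for k
  proof -
    obtain l where l: "l \<in> G" "\<forall>x\<in>topspace X. l x = k (h x)" using mult[OF k h(1)] by blast
    have "l y = k x" using l(2) y h(2) x g(2) by auto
    then show ?thesis using l(1) unfolding orb_def by (metis image_eqI)
  qed
  moreover have "k y \<in> orb G x" if k: "k \<in> G" for k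
  proof -
    obtain l where l: "l \<in> G" "\<forall>x\<in>topspace X. l x = k (g x)" using mult[OF k g(1)] by blast
    then have "l x = k y" using x g(2) by auto
    then show ?thesis using l(1) unfolding orb_def by (metis image_eqI)
  qed
  ultimately show "orb G x = orb G y \<and> y \<in> topspace X" using y by (auto simp: orb_def)
qed

text \<open>The saturation of an open set is the union of its translates.\<close>

lemma open_map_orb:
  assumes G: "transformation_group X G"
  shows "open_map X (quot_topology X (orb G)) (orb G)"
  unfolding open_map_def
proof (intro allI impI)
  fix W assume W: "openin X W"
  have WX: "W \<subseteq> topspace X" by (rule openin_subset[OF W])
  have "{x \<in> topspace X. orb G x \<in> orb G ` W} = (\<Union>g\<in>G. g ` W)"
  proof (intro equalityI subsetI)
    fix x assume "x \<in> {x \<in> topspace X. orb G x \<in> orb G ` W}"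
    then obtain w where "w \<in> W" "x \<in> topspace X" "orb G w = orb G x" by auto
    then have "\<exists>g\<in>G. x = g w" using orb_eq_iff[OF G] WX by blast
    then show "x \<in> (\<Union>g\<in>G. g ` W)" using \<open>w \<in> W\<close> by blast
  next
    fix x assume "x \<in> (\<Union>g\<in>G. g ` W)"
    then obtain g w where "g \<in> G" "w \<in> W" "x = g w" by blast
    then have "orb G w = orb G x \<and> x \<in> topspace X" using orb_eq_iff[OF G] WX by blast
    then show "x \<in> {x \<in> topspace X. orb G x \<in> orb G ` W}" using \<open>w \<in> W\<close> by auto
  qed
  moreover have "openin X (\<Union>g\<in>G. g ` W)"
    using G W homeomorphic_imp_open_map unfolding transformation_group_def open_map_def
    by (auto intro!: openin_Union)
  ultimately show "openin (quot_topology X (orb G)) (orb G ` W)"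
    using WX by (auto simp: openin_quot_topology)
qed

lemma continuous_map_quot: "continuous_map X (quot_topology X q) q"
  by (rule quotient_imp_continuous_map[OF quotient_map_quot_topology])

lemma Hausdorff_space_open_image:
  assumes "open_map X Y q" "q ` topspace X = topspace Y"
    and "\<And>x y. x \<in> topspace X \<Longrightarrow> y \<in> topspace X \<Longrightarrow> q x \<noteq> q y \<Longrightarrow>
      \<exists>U V. openin X U \<and> openin X V \<and> x \<in> U \<and> y \<in> V \<and> q ` U \<inter> q ` V = {}"
  shows "Hausdorff_space Y"
  unfolding Hausdorff_space_def
proof (intro allI impI)
  fix a b assume ab: "a \<in> topspace Y \<and> b \<in> topspace Y \<and> a \<noteq> b"
  then obtain x y where "x \<in> topspace X" "y \<in> topspace X" "a = q x" "b = q y" 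
    using assms(2) by (metis imageE)
  then obtain U V where "openin X U" "openin X V" "x \<in> U" "y \<in> V" "q ` U \<inter> q ` V = {}"
    using assms(3)[of x y] ab by auto
  then show "\<exists>U V. openin Y U \<and> openin Y V \<and> a \<in> U \<and> b \<in> V \<and> disjnt U V"
    using assms(1) \<open>a = q x\<close> \<open>b = q y\<close> unfolding open_map_def disjnt_def
    by (metis imageI)
qed

text \<open>Each \<open>g x\<close> is separated from \<open>y\<close>. Pulling back along
  \<open>g\<close> and intersecting over the finite group gives neighbourhoods of \<open>x\<close>
  and \<open>y\<close> such that no orbit meets both.\<close>

lemma Hausdorff_quot_finite:
  assumes G: "transformation_group X G" and fin: "finite G" and X: "Hausdorff_space X"
  shows "Hausdorff_space (quot_topology X (orb G))"
proof (rule Hausdorff_space_open_image[OF open_map_orb[OF G]])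
  show "orb G ` topspace X = topspace (quot_topology X (orb G))" by (simp add: topspace_quot_topology)
  fix x y assume xy: "x \<in> topspace X" "y \<in> topspace X" "orb G x \<noteq> orb G y"
  have hom: "homeomorphic_map X X g" if "g \<in> G" for g using G that by (auto simp: transformation_group_def)
  have "\<exists>U V. openin X U \<and> openin X V \<and> g x \<in> U \<and> y \<in> V \<and> U \<inter> V = {}" if g: "g \<in> G" for g
  proof -
    have "g x \<noteq> y" using orb_eq_iff[OF G xy(1), of y] xy g by blast
    then show ?thesis using X xy transformation_group_closed[OF G g xy(1)]
      unfolding Hausdorff_space_def disjnt_def by blast
  qed
  then obtain U V where UV: "\<And>g. g \<in> G \<Longrightarrow> openin X (U g) \<and> openin X (V g) \<and> g x \<in> U g \<and> y \<in> V g \<and> U g \<inter> V g = {}"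
    by metis
  define A where "A = topspace X \<inter> (\<Inter>g\<in>G. {u \<in> topspace X. g u \<in> U g})"
  define B where "B = topspace X \<inter> (\<Inter>g\<in>G. V g)"
  have "openin X A"
    unfolding A_def using UV hom fin
    by (intro openin_Int_Inter openin_continuous_map_preimage[of X X])
       (auto intro!: openin_continuous_map_preimage homeomorphic_imp_continuous_map)
  moreover have "openin X B"
    unfolding B_def using UV fin by (intro openin_Int_Inter) auto
  moreover have "x \<in> A" "y \<in> B" using UV xy by (auto simp: A_def B_def)
  moreover have "orb G ` A \<inter> orb G ` B = {}"
  proof (rule ccontr)
    assume "orb G ` A \<inter> orb G ` B \<noteq> {}"
    then obtain a b where ab: "a \<in> A" "b \<in> B" "orb G a = orb G b" by auto
    then obtain g where "g \<in> G" "b = g a" using orb_eq_iff[OF G, of a b] by (auto simp: A_def B_def)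
    then have "b \<in> U g" "b \<in> V g" using ab by (auto simp: A_def B_def)
    then show False using UV \<open>g \<in> G\<close> by blast
  qed
  ultimately show "\<exists>U V. openin X U \<and> openin X V \<and> x \<in> U \<and> y \<in> V \<and> orb G ` U \<inter> orb G ` V = {}" by blast
qed

text \<open>The finitely many elements that move \<open>x\<close> carry a small neighbourhood off
  itself. The others fix \<open>x\<close>, hence by \<open>free\<close> every point, and identify
  nothing.\<close>

lemma locally_inj_orb_finite:
  assumes G: "transformation_group X G" and fin: "finite G" and X: "Hausdorff_space X"
    and free: "\<And>g x y. g \<in> G \<Longrightarrow> x \<in> topspace X \<Longrightarrow> y \<in> topspace X \<Longrightarrow> g x = x \<Longrightarrow> g y = y"
    and x: "x \<in> topspace X"
  shows "\<exists>W. openin X W \<and> x \<in> W \<and> inj_on (orb G) W"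
proof -
  have hom: "homeomorphic_map X X g" if "g \<in> G" for g using G that by (auto simp: transformation_group_def)
  define H where "H = {g \<in> G. g x \<noteq> x}"
  have "\<exists>U V. openin X U \<and> openin X V \<and> g x \<in> U \<and> x \<in> V \<and> U \<inter> V = {}" if g: "g \<in> H" for g
    using g X x transformation_group_closed[OF G _ x]
      unfolding Hausdorff_space_def disjnt_def H_def by blast
  then obtain U V where UV: "\<And>g. g \<in> H \<Longrightarrow> openin X (U g) \<and> openin X (V g) \<and> g x \<in> U g \<and> x \<in> V g \<and> U g \<inter> V g = {}"
    by metis
  define W where "W = topspace X \<inter> (\<Inter>g\<in>H. {u \<in> topspace X. g u \<in> U g} \<inter> V g)"
  have "openin X W"
    unfolding W_def using UV hom fin
    by (intro openin_Int_Inter)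
       (auto simp: H_def intro!: openin_Int openin_continuous_map_preimage homeomorphic_imp_continuous_map)
  moreover have "x \<in> W" using UV x by (auto simp: W_def)
  moreover have "inj_on (orb G) W"
  proof (rule inj_onI)
    fix a b assume ab: "a \<in> W" "b \<in> W" "orb G a = orb G b"
    then obtain g where g: "g \<in> G" "b = g a" using orb_eq_iff[OF G, of a b] by (auto simp: W_def)
    show "a = b"
    proof (cases "g x = x")
      case True
      then show ?thesis using free[OF g(1) x, of a] g(2) ab by (auto simp: W_def)
    next
      case False
      then have "g \<in> H" using g by (simp add: H_def)
      then have "b \<in> U g" "b \<in> V g" using ab g by (auto simp: W_def)
      then show ?thesis using UV \<open>g \<in> H\<close> by blast
    qed
  qed
  ultimately show ?thesis by blast
qed

lemma finite_free_aut_groupD: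
  assumes "finite_free_aut_group M G"
  shows "finite G" "transformation_group (ctop M) G"
    and "\<And>g x y. g \<in> G \<Longrightarrow> x \<in> points M \<Longrightarrow> y \<in> points M \<Longrightarrow> g x = x \<Longrightarrow> g y = y"
proof -
  have sub: "subgroup G (BijGroup (points M))" and fin: "finite G"
    and bih: "\<And>g. g \<in> G \<Longrightarrow> biholomorphism M M g"
    and free: "\<And>g x. g \<in> G \<Longrightarrow> x \<in> points M \<Longrightarrow> g x = x \<Longrightarrow> g = \<one>\<^bsub>BijGroup (points M)\<^esub>"
    using assms by (auto simp: finite_free_aut_group_def)
  interpret B: group "BijGroup (points M)" by (rule group_BijGroup)
  show "finite G" by (rule fin)
  show "g y = y" if "g \<in> G" "x \<in> points M" "y \<in> points M" "g x = x" for g x y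
    using free[OF that(1,2,4)] that by (simp add: BijGroup_def)
  show "transformation_group (ctop M) G"
    unfolding transformation_group_def
  proof (intro conjI ballI)
    fix g assume "g \<in> G"
    then show "homeomorphic_map (ctop M) (ctop M) g"
      using bih homeomorphic_maps_map unfolding biholomorphism_def by blast
  next
    show "\<exists>e\<in>G. \<forall>x\<in>points M. e x = x"
      using subgroup.one_closed[OF sub] by (intro bexI[of _ "\<lambda>x\<in>points M. x"]) (auto simp: BijGroup_def)
  next
    fix g h assume gh: "g \<in> G" "h \<in> G"
    have "g \<in> Bij (points M)" "h \<in> Bij (points M)" 
      using subgroup.subset[OF sub] gh by (auto simp: BijGroup_def)
    moreover have "g \<otimes>\<^bsub>BijGroup (points M)\<^esub> h \<in> G" using subgroup.m_closed[OF sub gh] .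
    ultimately have "compose (points M) g h \<in> G" by (simp add: BijGroup_def)
    then show "\<exists>k\<in>G. \<forall>x\<in>points M. k x = g (h x)"
      by (rule bexI[rotated]) (simp add: compose_def)
  next
    fix g assume g: "g \<in> G"
    have gB: "g \<in> Bij (points M)" using subgroup.subset[OF sub] g by (auto simp: BijGroup_def)
    have "inv\<^bsub>BijGroup (points M)\<^esub> g \<in> G" using subgroup.m_inv_closed[OF sub g] .
    moreover have "inv\<^bsub>BijGroup (points M)\<^esub> g = (\<lambda>x\<in>points M. inv_into (points M) g x)"
      by (rule inv_BijGroup[OF gB])
    moreover have "(\<lambda>x\<in>points M. inv_into (points M) g x) (g x) = x" if "x \<in> points M" for x
      using gB that by (auto simp: Bij_def bij_betw_def)
    ultimately show "\<exists>h\<in>G. \<forall>x\<in>points M. h (g x) = x" by metis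
  qed
qed


section \<open>Complex linear coordinates\<close>

definition linear_chart :: "real^'n^'n \<Rightarrow> (real^'n \<Rightarrow> nat \<Rightarrow> complex) \<Rightarrow> bool" where
  "linear_chart J \<phi> \<longleftrightarrow> bij_betw \<phi> UNIV (Cn (CARD('n) div 2)) \<and>
     (\<forall>i. linear (\<lambda>v. \<phi> v i)) \<and> (\<forall>v i. \<phi> (J *v v) i = \<i> * \<phi> v i)"

lemma complex_structure_twice: "complex_structure J \<Longrightarrow> J *v (J *v v) = - v"
  unfolding complex_structure_def
  by (metis matrix_vector_mul_assoc matrix_vector_mul_lid scaleR_minus1_left scaleR_matrix_vector_assoc)

text \<open>A set B is chosen maximal such that B and J B are disjoint and jointly independent.
  Maximality makes them span, so the real dimension is twice the size of B.\<close>

lemma ex_complex_basis: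
  fixes J :: "real^'n^'n"
  assumes J: "complex_structure J"
  obtains e :: "nat \<Rightarrow> real^'n" where
    "\<And>x y. (\<Sum>i<CARD('n) div 2. x i *\<^sub>R e i + y i *\<^sub>R (J *v e i)) = 0 \<Longrightarrow>
       (\<forall>i<CARD('n) div 2. x i = 0 \<and> y i = (0::real))"
    "\<And>v. \<exists>x y. v = (\<Sum>i<CARD('n) div 2. x i *\<^sub>R e i + y i *\<^sub>R (J *v e i))"
proof -
  let ?j = "\<lambda>v. J *v v"
  have JJ: "J *v (J *v v) = - v" for v by (rule complex_structure_twice[OF J])
  have inj: "inj ?j" by (rule inj_on_inverseI[of _ "\<lambda>v. - (J *v v)"]) (simp add: JJ)
  have lin: "linear ?j" by simp
  define Q where "Q B \<longleftrightarrow> finite B \<and> B \<inter> ?j ` B = {} \<and> independent (B \<union> ?j ` B)" for B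
  have bound: "card B < Suc CARD('n)" if "Q B" for B
  proof -
    have "card B \<le> card (B \<union> ?j ` B)" using that by (intro card_mono) (auto simp: Q_def)
    also have "\<dots> \<le> CARD('n)" using that independent_bound[of "B \<union> ?j ` B"] by (simp add: Q_def)
    finally show ?thesis by simp
  qed
  have "Q {}" by (simp add: Q_def independent_empty)
  then obtain B where B: "Q B" and max: "\<And>C. Q C \<Longrightarrow> card C \<le> card B"
    using ex_has_greatest_nat[of Q "{}" card "Suc CARD('n)"] bound by blast
  let ?S = "B \<union> ?j ` B"
  have fin: "finite B" and dis: "B \<inter> ?j ` B = {}" and ind: "independent ?S" using B by (auto simp: Q_def)
  have Jspan: "J *v s \<in> span ?S" if "s \<in> span ?S" for s
    using that
  proof (induction rule: span_induct_alt)
    case base then show ?case by (simp add: span_zero)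
  next
    case (step c x y)
    have "J *v x \<in> span ?S"
      using step(1)
    proof
      assume "x \<in> B" then show ?thesis by (intro span_base) simp
    next
      assume "x \<in> ?j ` B"
      then obtain b where "b \<in> B" "x = J *v b" by blast
      then show ?thesis by (simp add: JJ span_base span_neg)
    qed
    then show ?case using step by (simp add: matrix_vector_right_distrib matrix_vector_mult_scaleR span_add span_scale)
  qed
  have span: "span ?S = UNIV"
  proof (rule ccontr)
    assume "span ?S \<noteq> UNIV"
    then obtain v where v: "v \<notin> span ?S" by blast
    have Jv: "J *v v \<notin> span (insert v ?S)"
    proof
      assume "J *v v \<in> span (insert v ?S)"
      then obtain a where a: "J *v v - a *\<^sub>R v \<in> span ?S" by (auto simp: span_breakdown_eq)
      \<comment> \<open>Modulo the J-stable span, J v = a v would give -v = a^2 v. The combination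
        exhibits the nonzero factor 1 + a^2.\<close>
      have "J *v (J *v v - a *\<^sub>R v) + a *\<^sub>R (J *v v - a *\<^sub>R v) \<in> span ?S"
        by (intro span_add span_scale Jspan a)
      moreover have "J *v (J *v v - a *\<^sub>R v) + a *\<^sub>R (J *v v - a *\<^sub>R v) = - (1 + a * a) *\<^sub>R v"
        by (simp add: matrix_vector_mult_diff_distrib matrix_vector_mult_scaleR JJ algebra_simps)
      ultimately have "(- 1 / (1 + a * a)) *\<^sub>R (- (1 + a * a) *\<^sub>R v) \<in> span ?S" by (simp only: span_scale)
      moreover have "(- 1 / (1 + a * a)) * (- (1 + a * a)) = 1"
      proof -
        have "- 1 / q * - q = 1" if "q \<noteq> 0" for q :: real using that by simp
        moreover have "1 + a * a \<noteq> 0" using zero_le_square[of a] by linarith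
        ultimately show ?thesis by blast
      qed
      ultimately have "v \<in> span ?S" by (metis scaleR_one scaleR_scaleR)
      then show False using v by blast
    qed
    have vB: "v \<notin> ?S" using v span_base[of v ?S] by blast
    have Jvn: "J *v v \<notin> insert v ?S" using Jv span_base[of "J *v v" "insert v ?S"] by blast
    have "Q (insert v B)"
      unfolding Q_def
    proof (intro conjI)
      show "finite (insert v B)" using fin by simp
      have "v \<noteq> J *v b" if "b \<in> B" for b using vB that by blast
      moreover have "J *v v \<noteq> b" if "b \<in> B" for b using Jvn that by blast
      ultimately show "insert v B \<inter> ?j ` insert v B = {}" using dis Jvn by auto
      have "independent (insert (J *v v) (insert v ?S))"
        using ind v Jv by (simp add: independent_insert)
      moreover have "insert v B \<union> ?j ` insert v B = insert (J *v v) (insert v ?S)" by auto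
      ultimately show "independent (insert v B \<union> ?j ` insert v B)" by metis
    qed
    then have "card (insert v B) \<le> card B" by (rule max)
    then show False using fin vB by simp
  qed
  have cj: "card (?j ` B) = card B" using inj by (intro card_image) (auto simp: inj_on_def)
  have "card ?S = CARD('n)"
    using ind span by (metis dim_UNIV dim_span dim_eq_card DIM_cart DIM_real mult.right_neutral)
  then have k: "CARD('n) div 2 = card B"
    using card_Un_disjoint[OF fin _ dis] fin cj by simp
  let ?k = "CARD('n) div 2"
  obtain e where e: "bij_betw e {..<?k} B" 
    using fin k by (metis ex_bij_betw_nat_finite atLeast0LessThan)
  have sumB: "(\<Sum>i<?k. f (e i)) = (\<Sum>b\<in>B. f b)" for f :: "real^'n \<Rightarrow> real^'n"
    using sum.reindex_bij_betw[OF e] .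
  let ?ei = "inv_into {..<?k} e"
  have eB: "e ` {..<?k} = B" "inj_on e {..<?k}" using e by (auto simp: bij_betw_def)
  have ei1: "i < ?k \<Longrightarrow> ?ei (e i) = i" for i using eB(2) by simp
  have eiB: "i < ?k \<Longrightarrow> e i \<in> B" for i using eB(1) by blast
  have split: "(\<Sum>v\<in>?S. u v *\<^sub>R v) = (\<Sum>b\<in>B. u b *\<^sub>R b + u (J *v b) *\<^sub>R (J *v b))" for u :: "real^'n \<Rightarrow> real"
  proof -
    have "(\<Sum>v\<in>?j ` B. u v *\<^sub>R v) = (\<Sum>b\<in>B. u (J *v b) *\<^sub>R (J *v b))"
      using inj by (subst sum.reindex) (auto simp: inj_on_def)
    then show ?thesis using fin dis by (simp add: sum.union_disjoint sum.distrib)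
  qed
  show ?thesis
  proof (rule that[of e])
    fix x y :: "nat \<Rightarrow> real"
    assume 0: "(\<Sum>i<?k. x i *\<^sub>R e i + y i *\<^sub>R (J *v e i)) = 0"
    define u where "u v = (if v \<in> B then x (?ei v) else y (?ei (- (J *v v))))" for v
    have uJ: "u (J *v b) = y (?ei b)" if "b \<in> B" for b
      using dis that by (auto simp: u_def JJ)
    have "(\<Sum>v\<in>?S. u v *\<^sub>R v) = (\<Sum>b\<in>B. x (?ei b) *\<^sub>R b + y (?ei b) *\<^sub>R (J *v b))"
      unfolding split by (intro sum.cong refl) (simp add: uJ, simp add: u_def)
    also have "\<dots> = (\<Sum>i<?k. x (?ei (e i)) *\<^sub>R e i + y (?ei (e i)) *\<^sub>R (J *v e i))"
      by (rule sumB[symmetric])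
    also have "\<dots> = 0" using 0 by (simp add: ei1)
    finally have "\<forall>v\<in>?S. u v = 0"
      using ind fin independentD[of ?S ?S u] by blast
    then have z: "u (e i) = 0" "u (J *v e i) = 0" if "i < ?k" for i
      using eiB[OF that] by blast+
    show "\<forall>i<?k. x i = 0 \<and> y i = 0"
    proof (intro allI impI)
      fix i assume i: "i < ?k"
      show "x i = 0 \<and> y i = 0"
        using z[OF i] uJ[OF eiB[OF i]] eiB[OF i] by (simp add: u_def ei1[OF i])
    qed
  next
    fix v :: "real^'n"
    have "v \<in> span ?S" using span by simp
    then obtain u where "v = (\<Sum>v\<in>?S. u v *\<^sub>R v)"
      using fin by (auto simp: span_finite)
    then have "v = (\<Sum>i<?k. u (e i) *\<^sub>R e i + u (J *v e i) *\<^sub>R (J *v e i))"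
      using sumB[of "\<lambda>b. u b *\<^sub>R b + u (J *v b) *\<^sub>R (J *v b)"] split by simp
    then show "\<exists>x y. v = (\<Sum>i<?k. x i *\<^sub>R e i + y i *\<^sub>R (J *v e i))"
      by (intro exI[of _ "\<lambda>i. u (e i)"] exI[of _ "\<lambda>i. u (J *v e i)"])
  qed
qed

lemma ex_linear_chart:
  fixes J :: "real^'n^'n"
  assumes J: "complex_structure J"
  shows "\<exists>\<phi>. linear_chart J \<phi>"
proof -
  let ?k = "CARD('n) div 2"
  obtain e :: "nat \<Rightarrow> real^'n" where e: "\<And>x y. (\<Sum>i<?k. x i *\<^sub>R e i + y i *\<^sub>R (J *v e i)) = 0 \<Longrightarrow>
       (\<forall>i<?k. x i = 0 \<and> y i = (0::real))"
    and sp: "\<And>v. \<exists>x y. v = (\<Sum>i<?k. x i *\<^sub>R e i + y i *\<^sub>R (J *v e i))"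
    using ex_complex_basis[OF J] by blast
  define \<sigma> :: "(nat \<Rightarrow> complex) \<Rightarrow> real^'n" where
    "\<sigma> w = (\<Sum>i<?k. Re (w i) *\<^sub>R e i + Im (w i) *\<^sub>R (J *v e i))" for w
  have add: "\<sigma> (\<lambda>i. u i + w i) = \<sigma> u + \<sigma> w" for u w
    by (simp add: \<sigma>_def scaleR_add_left sum.distrib algebra_simps)
  have scale: "\<sigma> (\<lambda>i. of_real c * w i) = c *\<^sub>R \<sigma> w" for c w
    by (simp add: \<sigma>_def scaleR_sum_right scaleR_add_right)
  have im: "\<sigma> (\<lambda>i. \<i> * w i) = J *v \<sigma> w" for w
    unfolding \<sigma>_def linear_sum[OF matrix_vector_mul_linear]
    by (intro sum.cong refl) (simp add: matrix_vector_right_distrib matrix_vector_mult_scaleR 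
          complex_structure_twice[OF J])
  have bij: "bij_betw \<sigma> (Cn ?k) UNIV"
    unfolding bij_betw_def
  proof
    show "inj_on \<sigma> (Cn ?k)"
    proof (rule inj_onI)
      fix u w assume uw: "u \<in> Cn ?k" "w \<in> Cn ?k" "\<sigma> u = \<sigma> w"
      then have s0: "(\<Sum>i<?k. (Re (u i) - Re (w i)) *\<^sub>R e i + (Im (u i) - Im (w i)) *\<^sub>R (J *v e i)) = 0"
        by (simp add: \<sigma>_def scaleR_diff_left sum.distrib sum_subtractf algebra_simps)
      have "\<forall>i<?k. Re (u i) - Re (w i) = 0 \<and> Im (u i) - Im (w i) = 0" by (rule e[OF s0])
      then have "\<forall>i<?k. u i = w i" by (simp add: complex_eq_iff)
      then show "u = w" using uw by (auto simp: Cn_def fun_eq_iff) (metis not_le)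
    qed
    show "\<sigma> ` Cn ?k = UNIV"
    proof (intro equalityI subsetI)
      fix v :: "real^'n"
      obtain x y where v: "v = (\<Sum>i<?k. x i *\<^sub>R e i + y i *\<^sub>R (J *v e i))" using sp by blast
      let ?w = "\<lambda>i. if i < ?k then Complex (x i) (y i) else 0"
      have "v = \<sigma> ?w" unfolding v \<sigma>_def by (intro sum.cong) auto
      moreover have "?w \<in> Cn ?k" by (simp add: Cn_def)
      ultimately show "v \<in> \<sigma> ` Cn ?k" by blast
    qed auto
  qed
  define \<phi> where "\<phi> = inv_into (Cn ?k) \<sigma>"
  have b: "bij_betw \<phi> UNIV (Cn ?k)" unfolding \<phi>_def by (rule bij_betw_inv_into[OF bij])
  have C: "\<phi> v \<in> Cn ?k" for v using b by (auto simp: bij_betw_def)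
  have \<sigma>\<phi>: "\<sigma> (\<phi> v) = v" for v unfolding \<phi>_def using bij by (simp add: bij_betw_def f_inv_into_f)
  have \<phi>\<sigma>: "\<phi> v = w" if "w \<in> Cn ?k" "\<sigma> w = v" for v w
    unfolding \<phi>_def that(2)[symmetric] using bij that(1) by (simp add: bij_betw_def)
  have "linear_chart J \<phi>"
    unfolding linear_chart_def
  proof (intro conjI allI b)
    fix i
    show "linear (\<lambda>v. \<phi> v i)"
    proof (rule linearI)
      fix u v
      have "\<phi> (u + v) = (\<lambda>i. \<phi> u i + \<phi> v i)"
        by (rule \<phi>\<sigma>) (use C[of u] C[of v] in \<open>auto simp: Cn_def add \<sigma>\<phi>\<close>)
      then show "\<phi> (u + v) i = \<phi> u i + \<phi> v i" by simp
    next
      fix c v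
      have "\<phi> (c *\<^sub>R v) = (\<lambda>i. of_real c * \<phi> v i)"
        by (rule \<phi>\<sigma>) (use C[of v] in \<open>auto simp: Cn_def scale \<sigma>\<phi>\<close>)
      then show "\<phi> (c *\<^sub>R v) i = c *\<^sub>R \<phi> v i" by (simp add: scaleR_conv_of_real)
    qed
    fix v
    have "\<phi> (J *v v) = (\<lambda>i. \<i> * \<phi> v i)"
      by (rule \<phi>\<sigma>) (use C[of v] in \<open>auto simp: Cn_def im \<sigma>\<phi>\<close>)
    then show "\<phi> (J *v v) i = \<i> * \<phi> v i" by simp
  qed
  then show ?thesis by blast
qed

section \<open>Inverses and bounds of linear charts\<close>

abbreviation linv :: "('a \<Rightarrow> 'b) \<Rightarrow> 'b \<Rightarrow> 'a" where
  "linv \<phi> \<equiv> inv_into UNIV \<phi>"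

definition cunit :: "nat \<Rightarrow> nat \<Rightarrow> complex" where
  "cunit i = (\<lambda>j. if j = i then 1 else 0)"

lemma linear_chartD:
  fixes J :: "real^'n^'n"
  assumes "linear_chart J \<phi>"
  shows "linv \<phi> (\<phi> v) = v" "\<phi> v \<in> Cn (CARD('n) div 2)" "linear (\<lambda>v. \<phi> v i)"
    and "\<phi> (J *v v) i = \<i> * \<phi> v i"
    and "w \<in> Cn (CARD('n) div 2) \<Longrightarrow> \<phi> (linv \<phi> w) = w"
proof -
  have b: "bij_betw \<phi> UNIV (Cn (CARD('n) div 2))" using assms by (simp add: linear_chart_def)
  show "linv \<phi> (\<phi> v) = v" using b by (simp add: bij_betw_def)
  show "\<phi> v \<in> Cn (CARD('n) div 2)" using b by (auto simp: bij_betw_def)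
  show "w \<in> Cn (CARD('n) div 2) \<Longrightarrow> \<phi> (linv \<phi> w) = w" using b by (metis bij_betw_imp_surj_on f_inv_into_f)
  show "linear (\<lambda>v. \<phi> v i)" "\<phi> (J *v v) i = \<i> * \<phi> v i" using assms by (auto simp: linear_chart_def)
qed

lemma linear_chart_inv_sum:
  fixes J :: "real^'n^'n"
  assumes \<phi>: "linear_chart J \<phi>" and w: "w \<in> Cn (CARD('n) div 2)"
  shows "linv \<phi> w = (\<Sum>i<CARD('n) div 2. Re (w i) *\<^sub>R linv \<phi> (cunit i) + Im (w i) *\<^sub>R (J *v linv \<phi> (cunit i)))"
proof -
  let ?k = "CARD('n) div 2"
  let ?R = "\<Sum>i<?k. Re (w i) *\<^sub>R linv \<phi> (cunit i) + Im (w i) *\<^sub>R (J *v linv \<phi> (cunit i))"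
  have "\<phi> ?R j = w j" for j
  proof -
    interpret l: linear "\<lambda>v. \<phi> v j" by (rule linear_chartD(3)[OF \<phi>])
    have "\<phi> ?R j = (\<Sum>i<?k. Re (w i) *\<^sub>R \<phi> (linv \<phi> (cunit i)) j + Im (w i) *\<^sub>R \<phi> (J *v linv \<phi> (cunit i)) j)"
      by (simp only: l.sum l.add l.scale)
    also have "\<dots> = (\<Sum>i<?k. w i * cunit i j)"
    proof (intro sum.cong refl)
      fix i assume "i \<in> {..<?k}"
      then have "cunit i \<in> Cn ?k" by (auto simp: cunit_def Cn_def)
      then have *: "\<phi> (linv \<phi> (cunit i)) = cunit i" by (rule linear_chartD(5)[OF \<phi>])
      show "Re (w i) *\<^sub>R \<phi> (linv \<phi> (cunit i)) j + Im (w i) *\<^sub>R \<phi> (J *v linv \<phi> (cunit i)) j = w i * cunit i j"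
        by (subst (3) complex_eq) (simp add: linear_chartD(4)[OF \<phi>] * scaleR_conv_of_real algebra_simps)
    qed
    also have "\<dots> = w j"
      using w by (auto simp: cunit_def Cn_def if_distrib[of "\<lambda>x. _ * x"] cong: if_cong)
    finally show ?thesis .
  qed
  then have "\<phi> ?R = w" by blast
  then show ?thesis using linear_chartD(1)[OF \<phi>, of ?R] by simp
qed

lemma linear_chart_inv_diff:
  fixes J :: "real^'n^'n"
  assumes \<phi>: "linear_chart J \<phi>" and "w \<in> Cn (CARD('n) div 2)" "z \<in> Cn (CARD('n) div 2)"
  shows "linv \<phi> (\<lambda>i. w i - z i) = linv \<phi> w - linv \<phi> z"
proof -
  have "(\<lambda>i. w i - z i) \<in> Cn (CARD('n) div 2)" using assms by (auto simp: Cn_def)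
  then show ?thesis using assms
    by (simp add: linear_chart_inv_sum[OF \<phi>] sum_subtractf[symmetric] algebra_simps)
qed

lemma linear_chart_inv_bound:
  fixes J :: "real^'n^'n"
  assumes \<phi>: "linear_chart J \<phi>"
  obtains K where "0 < K" "\<And>w z. w \<in> Cn (CARD('n) div 2) \<Longrightarrow> z \<in> Cn (CARD('n) div 2) \<Longrightarrow>
     norm (linv \<phi> w - linv \<phi> z) \<le> K * cdist (CARD('n) div 2) w z"
proof -
  let ?k = "CARD('n) div 2"
  let ?K = "1 + (\<Sum>i<?k. norm (linv \<phi> (cunit i)) + norm (J *v linv \<phi> (cunit i)))"
  have "norm (linv \<phi> w - linv \<phi> z) \<le> ?K * cdist ?k w z" if "w \<in> Cn ?k" "z \<in> Cn ?k" for w z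
  proof -
    have C: "(\<lambda>i. w i - z i) \<in> Cn ?k" using that by (auto simp: Cn_def)
    have "norm (linv \<phi> w - linv \<phi> z) = norm (linv \<phi> (\<lambda>i. w i - z i))"
      using linear_chart_inv_diff[OF \<phi> that] by simp
    also have "\<dots> \<le> (\<Sum>i<?k. (norm (linv \<phi> (cunit i)) + norm (J *v linv \<phi> (cunit i))) * cdist ?k w z)"
      unfolding linear_chart_inv_sum[OF \<phi> C]
    proof (intro sum_norm_le)
      fix i assume "i \<in> {..<?k}"
      then have "cmod (w i - z i) \<le> cdist ?k w z" by (auto intro: cmod_le_cdist)
      then have le: "\<bar>Re (w i - z i)\<bar> \<le> cdist ?k w z" "\<bar>Im (w i - z i)\<bar> \<le> cdist ?k w z"
        using abs_Re_le_cmod abs_Im_le_cmod order_trans by blast+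
      have "norm (Re (w i - z i) *\<^sub>R linv \<phi> (cunit i) + Im (w i - z i) *\<^sub>R (J *v linv \<phi> (cunit i)))
         \<le> \<bar>Re (w i - z i)\<bar> * norm (linv \<phi> (cunit i)) + \<bar>Im (w i - z i)\<bar> * norm (J *v linv \<phi> (cunit i))"
        by (metis norm_scaleR norm_triangle_ineq)
      also have "\<dots> \<le> cdist ?k w z * norm (linv \<phi> (cunit i)) + cdist ?k w z * norm (J *v linv \<phi> (cunit i))"
        using le by (intro add_mono mult_right_mono) auto
      finally show "norm (Re (w i - z i) *\<^sub>R linv \<phi> (cunit i) + Im (w i - z i) *\<^sub>R (J *v linv \<phi> (cunit i)))
        \<le> (norm (linv \<phi> (cunit i)) + norm (J *v linv \<phi> (cunit i))) * cdist ?k w z"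
        by (simp add: algebra_simps)
    qed
    also have "\<dots> \<le> ?K * cdist ?k w z" unfolding sum_distrib_right[symmetric] by (intro mult_right_mono) auto
    finally show ?thesis .
  qed
  moreover have "0 < ?K" by (intro add_pos_nonneg sum_nonneg) auto
  ultimately show ?thesis using that by blast
qed

lemma linear_chart_bound:
  fixes J :: "real^'n^'n"
  assumes \<phi>: "linear_chart J \<phi>"
  obtains K where "0 < K" "\<And>u v. cdist (CARD('n) div 2) (\<phi> u) (\<phi> v) \<le> K * norm (u - v)"
proof -
  let ?k = "CARD('n) div 2"
  have "\<exists>B>0. \<forall>v. norm (\<phi> v i) \<le> norm v * B" for i
    using linear_chartD(3)[OF \<phi>, of i] bounded_linear.pos_bounded linear_conv_bounded_linear by blast
  then obtain B where B: "\<And>i. B i > 0" "\<And>i v. norm (\<phi> v i) \<le> norm v * B i" by metis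
  have "cdist ?k (\<phi> u) (\<phi> v) \<le> (1 + (\<Sum>i<?k. B i)) * norm (u - v)" for u v
  proof -
    have "cdist ?k (\<phi> u) (\<phi> v) \<le> (\<Sum>i<?k. cmod (\<phi> u i - \<phi> v i))" by (rule cdist_le_sum)
    also have "\<dots> \<le> (\<Sum>i<?k. norm (u - v) * B i)"
      using B(2)[of "u - v"] linear_diff[OF linear_chartD(3)[OF \<phi>]] by (intro sum_mono) metis
    also have "\<dots> \<le> (1 + (\<Sum>i<?k. B i)) * norm (u - v)"
      unfolding sum_distrib_left[symmetric] by (subst mult.commute, intro mult_right_mono) auto
    finally show ?thesis .
  qed
  moreover have "0 < 1 + (\<Sum>i<?k. B i)" using B(1) by (intro add_pos_nonneg sum_nonneg) (auto simp: less_imp_le)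
  ultimately show ?thesis using that by blast
qed

text \<open>Holomorphy on the real space with structure \<open>J\<close>: a real derivative that is
  complex linear. It keeps the analysis on the covering space free of coordinates; the lemmas that
  follow convert to and from \<open>has_cgradient\<close>.\<close>

definition cderiv :: "real^'n^'n \<Rightarrow> (real^'n \<Rightarrow> complex) \<Rightarrow> (real^'n \<Rightarrow> complex) \<Rightarrow> real^'n \<Rightarrow> bool" where
  "cderiv J F D x \<longleftrightarrow> (F has_derivative D) (at x) \<and> (\<forall>v. D (J *v v) = \<i> * D v)"

lemma linear_chart_inv_complex_linear:
  fixes J :: "real^'n^'n"
  assumes \<phi>: "linear_chart J \<phi>" and D: "linear D" "\<And>v. D (J *v v) = \<i> * D v"
    and w: "w \<in> Cn (CARD('n) div 2)"
  shows "D (linv \<phi> w) = (\<Sum>i<CARD('n) div 2. D (linv \<phi> (cunit i)) * w i)"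
proof -
  interpret linear D by (rule D(1))
  have "Re (w i) *\<^sub>R a + Im (w i) *\<^sub>R (\<i> * a) = a * w i" for a i
    by (subst (3) complex_eq) (simp add: scaleR_conv_of_real algebra_simps)
  then show ?thesis
    by (subst linear_chart_inv_sum[OF \<phi> w]) (simp add: sum add scale D(2))
qed

text \<open>The shift by \<open>c\<close> is there because charts of quotients are linear only up to
  a constant. The partial derivatives are the values of \<open>D\<close> on the basis vectors
  belonging to the chart.\<close>

lemma has_cgradient_linear_chart:
  fixes J :: "real^'n^'n"
  assumes \<phi>: "linear_chart J \<phi>" and F: "cderiv J F D x" and c: "c \<in> Cn (CARD('n) div 2)"
    and S: "S \<subseteq> Cn (CARD('n) div 2)"
  shows "has_cgradient (CARD('n) div 2) S (\<lambda>w. F (linv \<phi> (\<lambda>i. w i - c i)))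
           (\<lambda>i. D (linv \<phi> (cunit i))) (\<lambda>i. \<phi> x i + c i)"
proof -
  let ?k = "CARD('n) div 2"
  let ?z = "\<lambda>i. \<phi> x i + c i"
  have z: "?z \<in> Cn ?k" using c linear_chartD(2)[OF \<phi>, of x] by (auto simp: Cn_def)
  obtain K where K: "0 < K" "\<And>w z. w \<in> Cn ?k \<Longrightarrow> z \<in> Cn ?k \<Longrightarrow>
     norm (linv \<phi> w - linv \<phi> z) \<le> K * cdist ?k w z" using linear_chart_inv_bound[OF \<phi>] by blast
  have zx: "linv \<phi> (\<lambda>i. ?z i - c i) = x" using linear_chartD(1)[OF \<phi>, of x] by simp
  have D: "linear D" "\<And>v. D (J *v v) = \<i> * D v"
    using F has_derivative_linear unfolding cderiv_def by blast+
  have der: "\<forall>e>0. \<exists>d>0. \<forall>y. norm (y - x) < d \<longrightarrow> norm (F y - F x - D (y - x)) \<le> e * norm (y - x)"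
    using F unfolding cderiv_def has_derivative_at_alt by blast
  show ?thesis
    unfolding has_cgradient_iff[OF S z]
  proof (intro allI impI)
    fix \<epsilon> :: real assume e: "\<epsilon> > 0"
    then obtain d where d: "d > 0" "\<And>y. norm (y - x) < d \<Longrightarrow> norm (F y - F x - D (y - x)) \<le> \<epsilon> / K * norm (y - x)"
      using der K(1) by (metis divide_pos_pos)
    have "cmod (F (linv \<phi> (\<lambda>i. w i - c i)) - F (linv \<phi> (\<lambda>i. ?z i - c i)) -
                 (\<Sum>i<?k. D (linv \<phi> (cunit i)) * (w i - ?z i))) \<le> \<epsilon> * cdist ?k w ?z"
      if w: "w \<in> S" "cdist ?k w ?z < d / K" for w
    proof -
      have wC: "w \<in> Cn ?k" using w S by blast
      let ?y = "linv \<phi> (\<lambda>i. w i - c i)"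
      have C: "(\<lambda>i. w i - c i) \<in> Cn ?k" "(\<lambda>i. ?z i - c i) \<in> Cn ?k" "(\<lambda>i. w i - ?z i) \<in> Cn ?k"
        using wC z c by (auto simp: Cn_def)
      have yx: "?y - x = linv \<phi> (\<lambda>i. w i - ?z i)"
        using linear_chart_inv_diff[OF \<phi> C(1,2)] zx by (simp add: algebra_simps)
      have "cdist ?k (\<lambda>i. w i - c i) (\<lambda>i. ?z i - c i) = cdist ?k w ?z" by (simp add: cdist_def algebra_simps)
      then have n: "norm (?y - x) \<le> K * cdist ?k w ?z" using K(2)[OF C(1,2)] zx by simp
      then have "norm (?y - x) < d" using w(2) K(1) by (simp add: pos_less_divide_eq mult.commute)
      then have "norm (F ?y - F x - D (?y - x)) \<le> \<epsilon> / K * norm (?y - x)" by (rule d(2))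
      also have "\<dots> \<le> \<epsilon> / K * (K * cdist ?k w ?z)" using n e K by (intro mult_left_mono) auto
      also have "\<dots> = \<epsilon> * cdist ?k w ?z" using K by simp
      finally show ?thesis
        unfolding zx yx linear_chart_inv_complex_linear[OF \<phi> D C(3)] .
    qed
    then show "\<exists>\<delta>>0. \<forall>w\<in>S. cdist ?k w ?z < \<delta> \<longrightarrow> cmod (F (linv \<phi> (\<lambda>i. w i - c i)) - F (linv \<phi> (\<lambda>i. ?z i - c i)) -
                 (\<Sum>i<?k. D (linv \<phi> (cunit i)) * (w i - ?z i))) \<le> \<epsilon> * cdist ?k w ?z"
      using d(1) K(1) by (intro exI[of _ "d / K"]) auto
  qed
qed

lemma cderiv_of_cgradient:
  fixes J :: "real^'n^'n"
  assumes \<phi>: "linear_chart J \<phi>" and c: "c \<in> Cn (CARD('n) div 2)" and S: "S \<subseteq> Cn (CARD('n) div 2)"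
    and f: "has_cgradient (CARD('n) div 2) S f a (\<lambda>i. \<phi> x i + c i)"
    and Y: "open Y" "x \<in> Y" "\<And>y. y \<in> Y \<Longrightarrow> (\<lambda>i. \<phi> y i + c i) \<in> S \<and> F y = f (\<lambda>i. \<phi> y i + c i)"
  shows "cderiv J F (\<lambda>v. \<Sum>i<CARD('n) div 2. a i * \<phi> v i) x"
proof -
  let ?k = "CARD('n) div 2"
  let ?D = "\<lambda>v. \<Sum>i<?k. a i * \<phi> v i"
  let ?h = "\<lambda>y i. \<phi> y i + c i"
  have C: "?h y \<in> Cn ?k" for y using c linear_chartD(2)[OF \<phi>, of y] by (auto simp: Cn_def)
  obtain K where K: "0 < K" "\<And>u v. cdist ?k (\<phi> u) (\<phi> v) \<le> K * norm (u - v)"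
    using linear_chart_bound[OF \<phi>] by blast
  obtain r where r: "r > 0" "ball x r \<subseteq> Y" using Y open_contains_ball by blast
  have "linear ?D"
  proof (rule linearI)
    show "?D (u + v) = ?D u + ?D v" for u v
      by (simp add: linear_add[OF linear_chartD(3)[OF \<phi>]] sum.distrib algebra_simps)
    show "?D (t *\<^sub>R v) = t *\<^sub>R ?D v" for t v
      by (simp add: linear_cmul[OF linear_chartD(3)[OF \<phi>]] scaleR_sum_right)
  qed
  then have bl: "bounded_linear ?D" by (simp add: linear_conv_bounded_linear)
  have "(F has_derivative ?D) (at x)"
    unfolding has_derivative_at_alt
  proof (intro conjI bl allI impI)
    fix e :: real assume e: "e > 0"
    then obtain d where d: "d > 0" "\<And>w. w\<in>S \<Longrightarrow> cdist ?k w (?h x) < d \<Longrightarrow>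
       cmod (f w - f (?h x) - (\<Sum>i<?k. a i * (w i - ?h x i))) \<le> e / K * cdist ?k w (?h x)"
      using f[unfolded has_cgradient_iff[OF S C], rule_format, of "e / K"] K(1) by auto
    have "norm (F y - F x - ?D (y - x)) \<le> e * norm (y - x)" if y: "norm (y - x) < min r (d / K)" for y
    proof -
      have yO: "y \<in> Y" using y r by (auto simp: dist_norm norm_minus_commute subset_iff)
      have cd: "cdist ?k (?h y) (?h x) = cdist ?k (\<phi> y) (\<phi> x)" by (simp add: cdist_def)
      have "cdist ?k (?h y) (?h x) < d"
        using K(2)[of y x] y K(1) unfolding cd by (simp add: pos_less_divide_eq mult.commute)
      then have "cmod (f (?h y) - f (?h x) - (\<Sum>i<?k. a i * (?h y i - ?h x i))) \<le> e / K * cdist ?k (?h y) (?h x)"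
        using d(2) Y(3)[OF yO] by blast
      also have "\<dots> \<le> e / K * (K * norm (y - x))"
        unfolding cd using K e by (intro mult_left_mono) auto
      also have "\<dots> = e * norm (y - x)" using K by simp
      finally show ?thesis
        using Y(3)[OF yO] Y(3)[OF Y(2)] by (simp add: linear_diff[OF linear_chartD(3)[OF \<phi>]])
    qed
    then show "\<exists>d>0. \<forall>y. norm (y - x) < d \<longrightarrow> norm (F y - F x - ?D (y - x)) \<le> e * norm (y - x)"
      using r(1) d(1) K(1) by (intro exI[of _ "min r (d / K)"]) auto
  qed
  moreover have "?D (J *v v) = \<i> * ?D v" for v
    by (simp add: linear_chartD(4)[OF \<phi>] sum_distrib_left mult.left_commute)
  ultimately show ?thesis by (simp add: cderiv_def)
qed


section \<open>Manifolds covered affinely by a complex vector space\<close>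

text \<open>Every chart of \<open>M\<close>, read through \<open>\<pi>\<close>, is locally a complex
  linear chart plus a constant. The chart \<open>\<kappa>\<close> may vary from point to point,
  since passing to another sheet composes it with the linear part of a group element. In this form
  the property survives quotients, so the vector space, its torus and \<open>X_G\<close> are treated
  alike.\<close>

definition affine_cover :: "real^'n^'n \<Rightarrow> 'a cmfd \<Rightarrow> (real^'n \<Rightarrow> 'a) \<Rightarrow> bool" where
  "affine_cover J M \<pi> \<longleftrightarrow>
     cdim M = CARD('n) div 2 \<and> continuous_map euclidean (ctop M) \<pi> \<and> open_map euclidean (ctop M) \<pi> \<and>
     range \<pi> = points M \<and> (\<Union>(U, \<phi>)\<in>catlas M. U) = points M \<and>
     (\<forall>(U, \<phi>)\<in>catlas M. openin (ctop M) U \<and> inj_on \<phi> U \<and>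
        (\<forall>x. \<pi> x \<in> U \<longrightarrow> (\<exists>\<kappa> c W. linear_chart J \<kappa> \<and> c \<in> Cn (CARD('n) div 2) \<and> open W \<and> x \<in> W \<and>
            (\<forall>y\<in>W. \<pi> y \<in> U \<and> \<phi> (\<pi> y) = (\<lambda>i. \<kappa> y i + c i)))))"

lemma affine_coverD:
  fixes J :: "real^'n^'n"
  assumes "affine_cover J M \<pi>"
  shows "cdim M = CARD('n) div 2" "continuous_map euclidean (ctop M) \<pi>" "open_map euclidean (ctop M) \<pi>"
    and "range \<pi> = points M" "(\<Union>(U, \<phi>)\<in>catlas M. U) = points M"
    and "(U, \<phi>) \<in> catlas M \<Longrightarrow> openin (ctop M) U" "(U, \<phi>) \<in> catlas M \<Longrightarrow> inj_on \<phi> U"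
    and "(U, \<phi>) \<in> catlas M \<Longrightarrow> \<pi> x \<in> U \<Longrightarrow> \<exists>\<kappa> c W. linear_chart J \<kappa> \<and> c \<in> Cn (CARD('n) div 2) \<and> open W \<and> x \<in> W \<and>
            (\<forall>y\<in>W. \<pi> y \<in> U \<and> \<phi> (\<pi> y) = (\<lambda>i. \<kappa> y i + c i))"
proof -
  note a = assms[unfolded affine_cover_def]
  show "cdim M = CARD('n) div 2" "continuous_map euclidean (ctop M) \<pi>" "open_map euclidean (ctop M) \<pi>"
    "range \<pi> = points M" "(\<Union>(U, \<phi>)\<in>catlas M. U) = points M"
    by (rule a[THEN conjunct1] a[THEN conjunct2, THEN conjunct1]
        a[THEN conjunct2, THEN conjunct2, THEN conjunct1]
        a[THEN conjunct2, THEN conjunct2, THEN conjunct2, THEN conjunct1]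
        a[THEN conjunct2, THEN conjunct2, THEN conjunct2, THEN conjunct2, THEN conjunct1])+
  have ball: "\<forall>(U, \<phi>)\<in>catlas M. openin (ctop M) U \<and> inj_on \<phi> U \<and>
        (\<forall>x. \<pi> x \<in> U \<longrightarrow> (\<exists>\<kappa> c W. linear_chart J \<kappa> \<and> c \<in> Cn (CARD('n) div 2) \<and> open W \<and> x \<in> W \<and>
            (\<forall>y\<in>W. \<pi> y \<in> U \<and> \<phi> (\<pi> y) = (\<lambda>i. \<kappa> y i + c i))))"
    by (rule a[THEN conjunct2, THEN conjunct2, THEN conjunct2, THEN conjunct2, THEN conjunct2])
  show "openin (ctop M) U" if "(U, \<phi>) \<in> catlas M" using bspec[OF ball that] unfolding split by (elim conjE)
  show "inj_on \<phi> U" if "(U, \<phi>) \<in> catlas M" using bspec[OF ball that] unfolding split by (elim conjE)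
  show "\<exists>\<kappa> c W. linear_chart J \<kappa> \<and> c \<in> Cn (CARD('n) div 2) \<and> open W \<and> x \<in> W \<and>
            (\<forall>y\<in>W. \<pi> y \<in> U \<and> \<phi> (\<pi> y) = (\<lambda>i. \<kappa> y i + c i))"
    if "(U, \<phi>) \<in> catlas M" "\<pi> x \<in> U"
    using bspec[OF ball that(1)] that(2) unfolding split by (elim conjE allE[of _ x] impE)
qed

lemma affine_cover_chart_inverse:
  fixes J :: "real^'n^'n"
  assumes lc: "linear_chart J \<kappa>" and c: "c \<in> Cn (CARD('n) div 2)" and W: "open W" "x \<in> W"
  obtains \<delta> where "0 < \<delta>" "\<And>w. w \<in> Cn (CARD('n) div 2) \<Longrightarrow> cdist (CARD('n) div 2) w (\<lambda>i. \<kappa> x i + c i) < \<delta> \<Longrightarrow>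
     linv \<kappa> (\<lambda>i. w i - c i) \<in> W \<and> w = (\<lambda>i. \<kappa> (linv \<kappa> (\<lambda>i. w i - c i)) i + c i)"
proof -
  let ?k = "CARD('n) div 2"
  obtain K where K: "0 < K" "\<And>w z. w \<in> Cn ?k \<Longrightarrow> z \<in> Cn ?k \<Longrightarrow>
     norm (linv \<kappa> w - linv \<kappa> z) \<le> K * cdist ?k w z" using linear_chart_inv_bound[OF lc] by blast
  obtain r where r: "r > 0" "ball x r \<subseteq> W" using W open_contains_ball by blast
  have "linv \<kappa> (\<lambda>i. w i - c i) \<in> W \<and> w = (\<lambda>i. \<kappa> (linv \<kappa> (\<lambda>i. w i - c i)) i + c i)"
    if w: "w \<in> Cn ?k" "cdist ?k w (\<lambda>i. \<kappa> x i + c i) < r / K" for w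
  proof -
    have C: "(\<lambda>i. w i - c i) \<in> Cn ?k" using w c by (auto simp: Cn_def)
    have "cdist ?k (\<lambda>i. w i - c i) (\<kappa> x) = cdist ?k w (\<lambda>i. \<kappa> x i + c i)" by (simp add: cdist_def algebra_simps)
    then have "norm (linv \<kappa> (\<lambda>i. w i - c i) - x) < r"
      using K(2)[OF C linear_chartD(2)[OF lc, of x]] w(2) K(1)
      by (simp add: linear_chartD(1)[OF lc] pos_less_divide_eq mult.commute)
    then have "linv \<kappa> (\<lambda>i. w i - c i) \<in> W" using r by (auto simp: dist_norm norm_minus_commute subset_iff)
    then show ?thesis using linear_chartD(5)[OF lc C] by simp
  qed
  then show ?thesis using that r(1) K(1) by (meson divide_pos_pos)
qed

text \<open>\<open>\<kappa>\<close> is chosen before \<open>F\<close>, \<open>D\<close> and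
  \<open>h\<close>, so that all components of a map have their gradients expressed in the same
  basis; the injectivity of a Jacobian needs this.\<close>

lemma affine_cover_gradient:
  fixes J :: "real^'n^'n"
  assumes cov: "affine_cover J M \<pi>" and U: "(U, \<phi>) \<in> catlas M" "\<pi> x \<in> U"
  shows "\<exists>\<kappa>. linear_chart J \<kappa> \<and> (\<forall>F D h Y S. cderiv J F D x \<longrightarrow> open Y \<longrightarrow> x \<in> Y \<longrightarrow> S \<subseteq> U \<longrightarrow> \<pi> x \<in> S \<longrightarrow>
      (\<forall>y\<in>Y. \<pi> y \<in> S \<longrightarrow> h (\<pi> y) = F y) \<longrightarrow>
      has_cgradient (CARD('n) div 2) (\<phi> ` S) (h \<circ> inv_into U \<phi>) (\<lambda>i. D (linv \<kappa> (cunit i))) (\<phi> (\<pi> x)))"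
proof -
  let ?k = "CARD('n) div 2"
  obtain \<kappa> c W where lc: "linear_chart J \<kappa>" and c: "c \<in> Cn ?k" and W: "open W" "x \<in> W"
      "\<And>y. y \<in> W \<Longrightarrow> \<pi> y \<in> U \<and> \<phi> (\<pi> y) = (\<lambda>i. \<kappa> y i + c i)"
    using affine_coverD(8)[OF cov U] by blast
  have inj: "inj_on \<phi> U" by (rule affine_coverD(7)[OF cov U(1)])
  have UC: "\<phi> ` U \<subseteq> Cn ?k"
  proof
    fix w assume "w \<in> \<phi> ` U"
    then obtain u where u: "u \<in> U" "w = \<phi> u" by blast
    then have "u \<in> points M" using affine_coverD(6)[OF cov U(1)] openin_subset by blast
    then obtain y where y: "u = \<pi> y" using affine_coverD(4)[OF cov] by blast
    then obtain \<kappa>' c' W' where "linear_chart J \<kappa>'" "c' \<in> Cn ?k" "y \<in> W'" 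
      "\<forall>y\<in>W'. \<pi> y \<in> U \<and> \<phi> (\<pi> y) = (\<lambda>i. \<kappa>' y i + c' i)"
      using affine_coverD(8)[OF cov U(1), of y] u by blast
    then show "w \<in> Cn ?k" using u y linear_chartD(2)[of J \<kappa>' y] by (auto simp: Cn_def)
  qed
  have "has_cgradient ?k (\<phi> ` S) (h \<circ> inv_into U \<phi>) (\<lambda>i. D (linv \<kappa> (cunit i))) (\<phi> (\<pi> x))"
    if F: "cderiv J F D x" and Y: "open Y" "x \<in> Y" and S: "S \<subseteq> U" "\<pi> x \<in> S"
      and h: "\<forall>y\<in>Y. \<pi> y \<in> S \<longrightarrow> h (\<pi> y) = F y" for F D h Y S
  proof -
    have px: "\<phi> (\<pi> x) = (\<lambda>i. \<kappa> x i + c i)" using W by blast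
    have g: "has_cgradient ?k (Cn ?k) (\<lambda>w. F (linv \<kappa> (\<lambda>i. w i - c i))) (\<lambda>i. D (linv \<kappa> (cunit i))) (\<phi> (\<pi> x))"
      unfolding px by (rule has_cgradient_linear_chart[OF lc F c]) simp
    obtain \<delta> where d: "0 < \<delta>" "\<And>w. w \<in> Cn ?k \<Longrightarrow> cdist ?k w (\<phi> (\<pi> x)) < \<delta> \<Longrightarrow>
        linv \<kappa> (\<lambda>i. w i - c i) \<in> W \<inter> Y \<and> w = (\<lambda>i. \<kappa> (linv \<kappa> (\<lambda>i. w i - c i)) i + c i)"
      unfolding px using affine_cover_chart_inverse[OF lc c, of "W \<inter> Y" x] W Y by blast
    show ?thesis
    proof (rule has_cgradient_transfer[OF g _ _ _ d(1)])
      show "\<phi> ` S \<subseteq> Cn ?k" "\<phi> (\<pi> x) \<in> Cn ?k" using UC S by blast+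
      show "(h \<circ> inv_into U \<phi>) (\<phi> (\<pi> x)) = F (linv \<kappa> (\<lambda>i. \<phi> (\<pi> x) i - c i))"
        using h Y S inj unfolding px[symmetric] by (simp add: px linear_chartD(1)[OF lc] subset_iff) (simp add: px[symmetric] subset_iff)
      fix w assume w: "w \<in> \<phi> ` S" "cdist ?k w (\<phi> (\<pi> x)) < \<delta>"
      then have wC: "w \<in> Cn ?k" using UC S by blast
      let ?y = "linv \<kappa> (\<lambda>i. w i - c i)"
      have y: "?y \<in> W" "?y \<in> Y" "w = (\<lambda>i. \<kappa> ?y i + c i)" using d(2)[OF wC w(2)] by blast+
      then have py: "\<pi> ?y \<in> U" "\<phi> (\<pi> ?y) = w" using W(3) by metis+
      obtain s where s: "s \<in> S" "w = \<phi> s" using w by blast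
      then have "\<pi> ?y = s" using py inj S by (auto simp: inj_on_def)
      then show "w \<in> Cn ?k \<and> (h \<circ> inv_into U \<phi>) w = F ?y"
        using wC h y(2) s S inj by (auto simp: subset_iff)
    qed (simp)
  qed
  then show ?thesis using lc by blast
qed

lemma affine_cover_chart_Cn:
  fixes J :: "real^'n^'n"
  assumes cov: "affine_cover J M \<pi>" and U: "(U, \<phi>) \<in> catlas M"
  shows "\<phi> ` U \<subseteq> Cn (CARD('n) div 2)"
proof
  fix w assume "w \<in> \<phi> ` U"
  then obtain u where u: "u \<in> U" "w = \<phi> u" by blast
  then have "u \<in> points M" using affine_coverD(6)[OF cov U(1)] openin_subset by blast
  then obtain y where y: "u = \<pi> y" using affine_coverD(4)[OF cov] by blast
  then obtain \<kappa>' c' W' where "linear_chart J \<kappa>'" "c' \<in> Cn (CARD('n) div 2)" "y \<in> W'" 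
    "\<forall>y\<in>W'. \<pi> y \<in> U \<and> \<phi> (\<pi> y) = (\<lambda>i. \<kappa>' y i + c' i)"
    using affine_coverD(8)[OF cov U(1), of y] u by blast
  then show "w \<in> Cn (CARD('n) div 2)" using u y linear_chartD(2)[of J \<kappa>' y] by (auto simp: Cn_def)
qed

lemma holomorphic_map_affine_cover:
  fixes J :: "real^'n^'n"
  assumes cov: "affine_cover J M \<pi>" and f: "continuous_map (ctop M) (ctop N) f"
    and N: "\<And>V \<psi>. (V, \<psi>) \<in> catlas N \<Longrightarrow> \<psi> ` V \<subseteq> Cn (cdim N)"
    and loc: "\<And>V \<psi> x j. (V, \<psi>) \<in> catlas N \<Longrightarrow> f (\<pi> x) \<in> V \<Longrightarrow> j < cdim N \<Longrightarrow>
       \<exists>Y F D. open Y \<and> x \<in> Y \<and> cderiv J F D x \<and> (\<forall>y\<in>Y. f (\<pi> y) \<in> V \<longrightarrow> \<psi> (f (\<pi> y)) j = F y)"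
  shows "holomorphic_map M N f"
  unfolding holomorphic_map_def
proof (intro conjI f)
  show "\<forall>(U, \<phi>)\<in>catlas M. \<forall>(V, \<psi>)\<in>catlas N.
        holo_map (cdim M) (cdim N) (\<phi> ` (U \<inter> f -` V)) (\<psi> \<circ> f \<circ> inv_into U \<phi>)"
  proof clarify
    fix U \<phi> V \<psi> assume U: "(U, \<phi>) \<in> catlas M" and V: "(V, \<psi>) \<in> catlas N"
    have inj: "inj_on \<phi> U" by (rule affine_coverD(7)[OF cov U])
    show "holo_map (cdim M) (cdim N) (\<phi> ` (U \<inter> f -` V)) (\<psi> \<circ> f \<circ> inv_into U \<phi>)"
      unfolding holo_map_def holo_fun_def
    proof (intro conjI allI impI ballI)
      show "(\<psi> \<circ> f \<circ> inv_into U \<phi>) ` \<phi> ` (U \<inter> f -` V) \<subseteq> Cn (cdim N)"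
        using N[OF V] inj by auto
      fix j z assume j: "j < cdim N" and z: "z \<in> \<phi> ` (U \<inter> f -` V)"
      then obtain u where u: "u \<in> U" "f u \<in> V" "z = \<phi> u" by blast
      then have "u \<in> points M" using affine_coverD(6)[OF cov U(1)] openin_subset by blast
      then obtain x where x: "u = \<pi> x" using affine_coverD(4)[OF cov] by blast
      obtain Y F D where Y: "open Y" "x \<in> Y" "cderiv J F D x" "\<forall>y\<in>Y. f (\<pi> y) \<in> V \<longrightarrow> \<psi> (f (\<pi> y)) j = F y"
        using loc[OF V _ j, of x] u x by blast
      obtain \<kappa> where "\<forall>F D h Y S. cderiv J F D x \<longrightarrow> open Y \<longrightarrow> x \<in> Y \<longrightarrow> S \<subseteq> U \<longrightarrow> \<pi> x \<in> S \<longrightarrow>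
        (\<forall>y\<in>Y. \<pi> y \<in> S \<longrightarrow> h (\<pi> y) = F y) \<longrightarrow>
        has_cgradient (CARD('n) div 2) (\<phi> ` S) (h \<circ> inv_into U \<phi>) (\<lambda>i. D (linv \<kappa> (cunit i))) (\<phi> (\<pi> x))"
        using affine_cover_gradient[OF cov U, of x] u x by blast
      from this[rule_format, OF Y(3,1,2), of "U \<inter> f -` V" "\<lambda>p. \<psi> (f p) j"] Y(4) u x
      show "\<exists>c. has_cgradient (cdim M) (\<phi> ` (U \<inter> f -` V)) (\<lambda>z. (\<psi> \<circ> f \<circ> inv_into U \<phi>) z j) c z"
        using affine_coverD(1)[OF cov] by (auto simp: comp_def)
    qed
  qed
qed

lemma cderiv_linear_chart:
  fixes J :: "real^'n^'n"
  assumes "linear_chart J \<kappa>" "A ** J = J ** A"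
  shows "cderiv J (\<lambda>y. \<kappa> (A *v y + b) j + c) (\<lambda>v. \<kappa> (A *v v) j) x"
proof -
  have l: "linear (\<lambda>v. \<kappa> v j)" by (rule linear_chartD(3)[OF assms(1)])
  have "linear (\<lambda>v. \<kappa> (A *v v) j)"
    using linear_compose[OF matrix_vector_mul_linear l, of A] by (simp add: comp_def)
  then have "((\<lambda>v. \<kappa> (A *v v) j) has_derivative (\<lambda>v. \<kappa> (A *v v) j)) (at x)"
    by (intro bounded_linear_imp_has_derivative) (simp add: linear_conv_bounded_linear)
  then have "((\<lambda>y. \<kappa> (A *v y) j + (\<kappa> b j + c)) has_derivative (\<lambda>v. \<kappa> (A *v v) j)) (at x)"
    by (rule has_derivative_add_const)
  moreover have "\<kappa> (A *v (J *v v)) j = \<i> * \<kappa> (A *v v) j" for v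
    using assms(2) linear_chartD(4)[OF assms(1)] by (simp add: matrix_vector_mul_assoc) (simp flip: matrix_vector_mul_assoc)
  ultimately show ?thesis by (simp add: cderiv_def linear_add[OF l] add.assoc)
qed

lemma holomorphic_map_affine:
  fixes J :: "real^'n^'n"
  assumes cov: "affine_cover J M \<pi>" "affine_cover J N \<rho>" and f: "continuous_map (ctop M) (ctop N) f"
    and A: "A ** J = J ** A" "\<And>x. f (\<pi> x) = \<rho> (A *v x + b)"
  shows "holomorphic_map M N f"
proof (rule holomorphic_map_affine_cover[OF cov(1) f])
  fix V \<psi> assume V: "(V, \<psi>) \<in> catlas N"
  show "\<psi> ` V \<subseteq> Cn (cdim N)" using affine_cover_chart_Cn[OF cov(2) V] affine_coverD(1)[OF cov(2)] by simp
  fix x j assume x: "f (\<pi> x) \<in> V" and j: "j < cdim N"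
  obtain \<kappa> c W where lc: "linear_chart J \<kappa>" and W: "open W" "A *v x + b \<in> W"
      "\<forall>y\<in>W. \<rho> y \<in> V \<and> \<psi> (\<rho> y) = (\<lambda>i. \<kappa> y i + c i)"
    using affine_coverD(8)[OF cov(2) V, of "A *v x + b"] x A(2) by auto
  have "open ((\<lambda>y. A *v y + b) -` W)"
    by (intro open_vimage W continuous_intros linear_continuous_on) (simp add: linear_conv_bounded_linear[symmetric])
  then show "\<exists>Y F D. open Y \<and> x \<in> Y \<and> cderiv J F D x \<and> (\<forall>y\<in>Y. f (\<pi> y) \<in> V \<longrightarrow> \<psi> (f (\<pi> y)) j = F y)"
    using W cderiv_linear_chart[OF lc A(1), of b j "c j" x] A(2)
    by (intro exI[of _ "(\<lambda>y. A *v y + b) -` W"] exI[of _ "\<lambda>y. \<kappa> (A *v y + b) j + c j"] exI[of _ "\<lambda>v. \<kappa> (A *v v) j"]) auto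
qed

lemma second_countable_euclidean_space:
  "second_countable (euclidean :: 'a::second_countable_topology topology)"
proof -
  obtain B :: "'a set set" where "countable B" "topological_basis B"
    using ex_countable_basis by blast
  then show ?thesis
    unfolding second_countable_def by (metis open_openin topological_basis_open topological_basisE)
qed

text \<open>All local properties come from the covering; only separation is global and has to be
  supplied.\<close>

lemma complex_manifold_affine_cover:
  fixes J :: "real^'n^'n"
  assumes cov: "affine_cover J M \<pi>" and H: "Hausdorff_space (ctop M)"
  shows "complex_manifold M"
proof -
  let ?k = "CARD('n) div 2"
  note D = affine_coverD[OF cov]
  have image: "openin (top_of_set (Cn ?k)) (\<phi> ` S)" if U: "(U, \<phi>) \<in> catlas M" and S: "openin (ctop M) S" "S \<subseteq> U" for U \<phi> S
  proof (subst openin_subopen, intro ballI)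
    fix w assume "w \<in> \<phi> ` S"
    then obtain u where u: "u \<in> S" "w = \<phi> u" by blast
    then have "u \<in> points M" using S openin_subset by blast
    then obtain x where x: "u = \<pi> x" using D(4) by blast
    obtain \<kappa> c W where lc: "linear_chart J \<kappa>" and c: "c \<in> Cn ?k" and W: "open W" "x \<in> W"
      "\<And>y. y \<in> W \<Longrightarrow> \<pi> y \<in> U \<and> \<phi> (\<pi> y) = (\<lambda>i. \<kappa> y i + c i)"
      using D(8)[OF U, of x] u S x by blast
    have "open (\<pi> -` S)" using openin_continuous_map_preimage[OF D(2) S(1)] by (simp add: vimage_def)
    then obtain \<delta> where d: "0 < \<delta>" "\<And>w. w \<in> Cn ?k \<Longrightarrow> cdist ?k w (\<lambda>i. \<kappa> x i + c i) < \<delta> \<Longrightarrow>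
        linv \<kappa> (\<lambda>i. w i - c i) \<in> W \<inter> \<pi> -` S \<and> w = (\<lambda>i. \<kappa> (linv \<kappa> (\<lambda>i. w i - c i)) i + c i)"
      using affine_cover_chart_inverse[OF lc c, of "W \<inter> \<pi> -` S" x] W u x by blast
    have wx: "w = (\<lambda>i. \<kappa> x i + c i)" using W u x by blast
    have wC: "w \<in> Cn ?k" using affine_cover_chart_Cn[OF cov U] u S by blast
    let ?T = "Cn ?k \<inter> {v. cdist ?k v w < \<delta>}"
    have "openin (top_of_set (Cn ?k)) ?T" by (intro openin_open_Int open_cdist_ball)
    moreover have "w \<in> ?T" using wC d by simp
    moreover have "?T \<subseteq> \<phi> ` S"
    proof
      fix v assume "v \<in> ?T"
      then have "linv \<kappa> (\<lambda>i. v i - c i) \<in> W \<inter> \<pi> -` S \<and> v = (\<lambda>i. \<kappa> (linv \<kappa> (\<lambda>i. v i - c i)) i + c i)"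
        using d(2) wx by blast
      then have "v = \<phi> (\<pi> (linv \<kappa> (\<lambda>i. v i - c i)))" "\<pi> (linv \<kappa> (\<lambda>i. v i - c i)) \<in> S"
        using W(3) by auto
      then show "v \<in> \<phi> ` S" by blast
    qed
    ultimately show "\<exists>T. openin (top_of_set (Cn ?k)) T \<and> w \<in> T \<and> T \<subseteq> \<phi> ` S" by blast
  qed
  have hom: "homeomorphic_map (subtopology (ctop M) U) (top_of_set (\<phi> ` U)) \<phi>" if U: "(U, \<phi>) \<in> catlas M" for U \<phi>
  proof (rule bijective_open_imp_homeomorphic_map)
    have UM: "U \<subseteq> points M" by (rule openin_subset[OF D(6)[OF U]])
    then have ts: "topspace (subtopology (ctop M) U) = U" by auto
    show "\<phi> ` topspace (subtopology (ctop M) U) = topspace (top_of_set (\<phi> ` U))" unfolding ts by simp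
    show "inj_on \<phi> (topspace (subtopology (ctop M) U))" unfolding ts by (rule D(7)[OF U])
    show "open_map (subtopology (ctop M) U) (top_of_set (\<phi> ` U)) \<phi>"
      unfolding open_map_def
    proof (intro allI impI)
      fix S assume "openin (subtopology (ctop M) U) S"
      then have S: "openin (ctop M) S" "S \<subseteq> U" using D(6)[OF U] openin_open_subtopology by blast+
      then have "openin (top_of_set (Cn ?k)) (\<phi> ` S)" using image[OF U] by blast
      then show "openin (top_of_set (\<phi> ` U)) (\<phi> ` S)"
        using S affine_cover_chart_Cn[OF cov U] by (meson image_mono openin_subset_trans)
    qed
    show "continuous_map (subtopology (ctop M) U) (top_of_set (\<phi> ` U)) \<phi>"
      unfolding continuous_map_def
    proof (intro conjI allI impI)
      show "\<phi> \<in> topspace (subtopology (ctop M) U) \<rightarrow> topspace (top_of_set (\<phi> ` U))" unfolding ts by auto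
      fix T assume "openin (top_of_set (\<phi> ` U)) T"
      then obtain T' where T': "open T'" "T = \<phi> ` U \<inter> T'" by (auto simp: openin_open)
      have "openin (ctop M) {u \<in> U. \<phi> u \<in> T}"
      proof (subst openin_subopen, intro ballI)
        fix u assume u: "u \<in> {u \<in> U. \<phi> u \<in> T}"
        then obtain x where x: "u = \<pi> x" using D(4) UM by blast
        obtain \<kappa> c W where lc: "linear_chart J \<kappa>" and c: "c \<in> Cn ?k" and W: "open W" "x \<in> W"
          "\<And>y. y \<in> W \<Longrightarrow> \<pi> y \<in> U \<and> \<phi> (\<pi> y) = (\<lambda>i. \<kappa> y i + c i)"
          using D(8)[OF U, of x] u x by blast
        have "continuous_on UNIV (\<lambda>y i. \<kappa> y i + c i)"
          using linear_chartD(3)[OF lc]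
          by (intro continuous_on_coordinatewise_then_product continuous_intros linear_continuous_on)
             (simp add: linear_conv_bounded_linear[symmetric])
        then have "open ((\<lambda>y i. \<kappa> y i + c i) -` T')" using T'(1) open_vimage by blast
        then have "openin (ctop M) (\<pi> ` (W \<inter> (\<lambda>y i. \<kappa> y i + c i) -` T'))"
          using D(3) W(1) unfolding open_map_def by (simp add: open_Int)
        moreover have "u \<in> \<pi> ` (W \<inter> (\<lambda>y i. \<kappa> y i + c i) -` T')"
        proof -
          have "(\<lambda>i. \<kappa> x i + c i) \<in> T'" using W(3)[OF W(2)] u x T'(2) by auto
          then show ?thesis using x W(2) by blast
        qed
        moreover have "\<pi> ` (W \<inter> (\<lambda>y i. \<kappa> y i + c i) -` T') \<subseteq> {u \<in> U. \<phi> u \<in> T}"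
          using W(3) T'(2) by auto
        ultimately show "\<exists>S. openin (ctop M) S \<and> u \<in> S \<and> S \<subseteq> {u \<in> U. \<phi> u \<in> T}" by blast
      qed
      then show "openin (subtopology (ctop M) U) {u \<in> topspace (subtopology (ctop M) U). \<phi> u \<in> T}"
        unfolding ts using D(6)[OF U] by (simp add: openin_open_subtopology subset_iff)
    qed
  qed
  have "second_countable (ctop M)"
    using second_countable_open_map_image[OF D(2,3)] D(4) second_countable_euclidean_space by simp
  moreover have "\<forall>(U, \<phi>)\<in>catlas M. \<forall>(V, \<psi>)\<in>catlas M. holo_map (cdim M) (cdim M) (\<phi> ` (U \<inter> V)) (\<psi> \<circ> inv_into U \<phi>)"
  proof -
    \<comment> \<open>Chart transitions are the chart expressions of the identity, which lifts to an
      affine map.\<close>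
    have "holomorphic_map M M id"
      using holomorphic_map_affine[OF cov cov continuous_map_id, of "mat 1" 0] by simp
    then show ?thesis unfolding holomorphic_map_def by simp
  qed
  ultimately show ?thesis
    unfolding complex_manifold_def using H D(5,6) image[OF _ D(6)] hom D(1) by fastforce
qed

lemma affine_cover_quot:
  fixes J :: "real^'n^'n"
  assumes cov: "affine_cover J M \<pi>" and G: "transformation_group (ctop M) G"
    and inj: "\<And>x. x \<in> points M \<Longrightarrow> \<exists>W. openin (ctop M) W \<and> x \<in> W \<and> inj_on (orb G) W"
    and lift: "\<And>g. g \<in> G \<Longrightarrow> \<exists>A b. A ** J = J ** A \<and> invertible A \<and> (\<forall>x. g (\<pi> x) = \<pi> (A *v x + b))"
  shows "affine_cover J (quot_manifold M G) (orb G \<circ> \<pi>)"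
proof -
  let ?k = "CARD('n) div 2"
  note D = affine_coverD[OF cov]
  let ?Q = "quot_manifold M G"
  have Q: "cdim ?Q = ?k" "ctop ?Q = quot_topology (ctop M) (orb G)"
    "catlas ?Q = {(orb G ` W, \<phi> \<circ> inv_into W (orb G)) | U \<phi> W.
                  (U, \<phi>) \<in> catlas M \<and> W \<subseteq> U \<and> openin (ctop M) W \<and> inj_on (orb G) W}"
    using D(1) by (auto simp: quot_manifold_def)
  have opn: "open_map (ctop M) (ctop ?Q) (orb G)" unfolding Q by (rule open_map_orb[OF G])
  have pts: "points ?Q = orb G ` points M" by (simp add: Q topspace_quot_topology)
  show ?thesis
    unfolding affine_cover_def
  proof (intro conjI)
    show "cdim ?Q = ?k" by (rule Q)
    show "continuous_map euclidean (ctop ?Q) (orb G \<circ> \<pi>)"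
      unfolding Q by (rule continuous_map_compose[OF D(2) continuous_map_quot])
    show "open_map euclidean (ctop ?Q) (orb G \<circ> \<pi>)" by (rule open_map_compose[OF D(3) opn])
    show "range (orb G \<circ> \<pi>) = points ?Q" unfolding pts D(4)[symmetric] by auto
    show "(\<Union>(U, \<phi>)\<in>catlas ?Q. U) = points ?Q"
    proof
      show "(\<Union>(U, \<phi>)\<in>catlas ?Q. U) \<subseteq> points ?Q"
        unfolding pts Q(3) using openin_subset by fastforce
      show "points ?Q \<subseteq> (\<Union>(U, \<phi>)\<in>catlas ?Q. U)"
      proof
        fix p assume "p \<in> points ?Q"
        then obtain x where x: "x \<in> points M" "p = orb G x" unfolding pts by blast
        obtain W where W: "openin (ctop M) W" "x \<in> W" "inj_on (orb G) W" using inj[OF x(1)] by blast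
        obtain U \<phi> where U: "(U, \<phi>) \<in> catlas M" "x \<in> U" using x(1) unfolding D(5)[symmetric] by auto
        have "(orb G ` (U \<inter> W), \<phi> \<circ> inv_into (U \<inter> W) (orb G)) \<in> catlas ?Q"
          unfolding Q(3) mem_Collect_eq
        proof (rule exI[of _ U], rule exI[of _ \<phi>], rule exI[of _ "U \<inter> W"], intro conjI U refl)
          show "openin (ctop M) (U \<inter> W)" using D(6)[OF U(1)] W(1) by (rule openin_Int)
          show "inj_on (orb G) (U \<inter> W)" using W(3) by (rule inj_on_subset) simp
        qed simp
        moreover have "p \<in> orb G ` (U \<inter> W)" using x U W by blast
        ultimately show "p \<in> (\<Union>(U, \<phi>)\<in>catlas ?Q. U)" by blast
      qed
    qed
    show "\<forall>(U, \<phi>)\<in>catlas ?Q. openin (ctop ?Q) U \<and> inj_on \<phi> U \<and>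
        (\<forall>x. (orb G \<circ> \<pi>) x \<in> U \<longrightarrow> (\<exists>\<kappa> c W. linear_chart J \<kappa> \<and> c \<in> Cn ?k \<and> open W \<and> x \<in> W \<and>
            (\<forall>y\<in>W. (orb G \<circ> \<pi>) y \<in> U \<and> \<phi> ((orb G \<circ> \<pi>) y) = (\<lambda>i. \<kappa> y i + c i))))"
    proof clarify
      fix U' \<phi>' assume "(U', \<phi>') \<in> catlas ?Q"
      then obtain U \<phi> W where U: "(U, \<phi>) \<in> catlas M" and W: "W \<subseteq> U" "openin (ctop M) W" "inj_on (orb G) W"
        and U': "U' = orb G ` W" "\<phi>' = \<phi> \<circ> inv_into W (orb G)" unfolding Q(3) by blast
      have 1: "openin (ctop ?Q) U'" using opn W unfolding U' open_map_def by blast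
      have 2: "inj_on \<phi>' U'"
        unfolding U' using comp_inj_on[OF inj_on_inv_into, of "orb G ` W" "orb G" W \<phi>] D(7)[OF U] W
        by (simp add: inv_into_image_cancel inj_on_subset)
      have 3: "\<exists>\<kappa> c W. linear_chart J \<kappa> \<and> c \<in> Cn ?k \<and> open W \<and> x \<in> W \<and>
            (\<forall>y\<in>W. (orb G \<circ> \<pi>) y \<in> U' \<and> \<phi>' ((orb G \<circ> \<pi>) y) = (\<lambda>i. \<kappa> y i + c i))"
        if x: "(orb G \<circ> \<pi>) x \<in> U'" for x
      proof -
        have pM: "\<pi> y \<in> points M" for y using D(4) by blast
        \<comment> \<open>The domain \<open>W\<close> may meet the orbit of \<open>\<pi> x\<close>
          only in a translate of \<open>\<pi> x\<close>. The affine lift of the group element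
          leading there turns the linear chart at the translate into \<open>\<kappa>\<close>
          composed with \<open>A\<close>, with the new constant
          \<open>\<kappa> b + c\<close>.\<close>
        obtain w where w: "w \<in> W" "orb G (\<pi> x) = orb G w" using x U' by auto
        have "w \<in> points M" using w W openin_subset by blast
        then obtain g where g: "g \<in> G" "w = g (\<pi> x)" using orb_eq_iff[OF G pM] w by blast
        obtain A b where A: "A ** J = J ** A" "invertible A" and Ab: "\<And>x. g (\<pi> x) = \<pi> (A *v x + b)"
          using lift[OF g(1)] by blast
        have orbA: "orb G (\<pi> (A *v y + b)) = orb G (\<pi> y)" for y
          using orb_eq_iff[OF G pM, of y "\<pi> (A *v y + b)"] g(1) Ab by metis
        have xW: "\<pi> (A *v x + b) \<in> W" using w g Ab by simp
        obtain \<kappa> c W0 where lc: "linear_chart J \<kappa>" and c: "c \<in> Cn ?k" and W0: "open W0" "A *v x + b \<in> W0"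
          "\<And>y. y \<in> W0 \<Longrightarrow> \<pi> y \<in> U \<and> \<phi> (\<pi> y) = (\<lambda>i. \<kappa> y i + c i)"
          using D(8)[OF U, of "A *v x + b"] xW W by blast
        have oW: "open (\<pi> -` W)" using openin_continuous_map_preimage[OF D(2) W(2)] by (simp add: vimage_def)
        have "open ((\<lambda>y. A *v y + b) -` (W0 \<inter> \<pi> -` W))"
          by (intro open_vimage open_Int W0 oW continuous_intros linear_continuous_on)
             (simp add: linear_conv_bounded_linear[symmetric])
        moreover have "linear_chart J (\<lambda>v. \<kappa> (A *v v))"
          unfolding linear_chart_def
        proof (intro conjI allI)
          have "bij ((*v) A)" using A(2) invertible_eq_bij by blast
          moreover have "bij_betw \<kappa> UNIV (Cn ?k)" using lc by (simp add: linear_chart_def)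
          ultimately show "bij_betw (\<lambda>v. \<kappa> (A *v v)) UNIV (Cn ?k)"
            using bij_betw_trans[of "(*v) A" UNIV UNIV \<kappa>] by (simp add: comp_def)
          show "linear (\<lambda>v. \<kappa> (A *v v) i)" for i
            using linear_compose[OF matrix_vector_mul_linear[of A] linear_chartD(3)[OF lc, of i]] by (simp add: comp_def)
          show "\<kappa> (A *v (J *v v)) i = \<i> * \<kappa> (A *v v) i" for v i
            using A(1) linear_chartD(4)[OF lc] by (simp add: matrix_vector_mul_assoc) (simp flip: matrix_vector_mul_assoc)
        qed
        moreover have "(\<lambda>i. \<kappa> b i + c i) \<in> Cn ?k" using c linear_chartD(2)[OF lc, of b] by (auto simp: Cn_def)
        moreover have "x \<in> (\<lambda>y. A *v y + b) -` (W0 \<inter> \<pi> -` W)" using W0 xW by simp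
        moreover have "(orb G \<circ> \<pi>) y \<in> U' \<and> \<phi>' ((orb G \<circ> \<pi>) y) = (\<lambda>i. \<kappa> (A *v y) i + (\<kappa> b i + c i))"
          if y: "y \<in> (\<lambda>y. A *v y + b) -` (W0 \<inter> \<pi> -` W)" for y
        proof -
          have "\<pi> (A *v y + b) \<in> W" using y by simp
          then have "orb G (\<pi> y) \<in> U'" "inv_into W (orb G) (orb G (\<pi> y)) = \<pi> (A *v y + b)"
            using orbA[of y] W(3) U' by (metis imageI, metis inv_into_f_f)
          moreover have "\<phi> (\<pi> (A *v y + b)) = (\<lambda>i. \<kappa> (A *v y + b) i + c i)" using W0(3) y by simp
          ultimately show ?thesis unfolding U' using linear_add[OF linear_chartD(3)[OF lc]] by (simp add: add.assoc)
        qed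
        ultimately show ?thesis by blast
      qed
      show "openin (ctop ?Q) U' \<and> inj_on \<phi>' U' \<and> (\<forall>x. (orb G \<circ> \<pi>) x \<in> U' \<longrightarrow> (\<exists>\<kappa> c W. linear_chart J \<kappa> \<and> c \<in> Cn ?k \<and> open W \<and> x \<in> W \<and>
            (\<forall>y\<in>W. (orb G \<circ> \<pi>) y \<in> U' \<and> \<phi>' ((orb G \<circ> \<pi>) y) = (\<lambda>i. \<kappa> y i + c i))))"
        using 1 2 3 by blast
    qed
  qed
qed

section \<open>Lattices and tori\<close>

lemma affine_cover_linear_manifold:
  fixes J :: "real^'n^'n"
  assumes "complex_structure J"
  shows "affine_cover J (linear_manifold J) id"
proof -
  have at: "catlas (linear_manifold J) = {(UNIV, \<phi>) | \<phi>. linear_chart J \<phi>}"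
    by (simp add: linear_manifold_def linear_chart_def)
  obtain \<phi>0 where "linear_chart J \<phi>0" using ex_linear_chart[OF assms] by blast
  then have "(\<Union>(U, \<phi>)\<in>catlas (linear_manifold J). U) = UNIV" unfolding at by auto
  moreover have "openin (ctop (linear_manifold J)) U \<and> inj_on \<phi> U \<and>
      (\<forall>x. id x \<in> U \<longrightarrow> (\<exists>\<kappa> c W. linear_chart J \<kappa> \<and> c \<in> Cn (CARD('n) div 2) \<and> open W \<and> x \<in> W \<and>
            (\<forall>y\<in>W. id y \<in> U \<and> \<phi> (id y) = (\<lambda>i. \<kappa> y i + c i))))"
    if "(U, \<phi>) \<in> catlas (linear_manifold J)" for U \<phi>
  proof -
    have U: "U = UNIV" and \<phi>: "linear_chart J \<phi>" using that unfolding at by auto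
    have "(\<lambda>_. 0) \<in> Cn (CARD('n) div 2)" by (simp add: Cn_def)
    then have "\<exists>\<kappa> c W. linear_chart J \<kappa> \<and> c \<in> Cn (CARD('n) div 2) \<and> open W \<and> x \<in> W \<and>
            (\<forall>y\<in>W. id y \<in> U \<and> \<phi> (id y) = (\<lambda>i. \<kappa> y i + c i))" for x
      using \<phi> U by (intro exI[of _ \<phi>] exI[of _ "\<lambda>_. 0"] exI[of _ UNIV]) auto
    moreover have "inj_on \<phi> U" using \<phi> U by (auto simp: linear_chart_def bij_betw_def)
    ultimately show ?thesis using U by (simp add: linear_manifold_def)
  qed
  ultimately show ?thesis
    unfolding affine_cover_def
    by (auto simp: linear_manifold_def open_map_def continuous_map_iff_continuous2)
qed

text \<open>The columns of \<open>M\<close> are a lattice basis and \<open>N\<close> gives lattice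
  coordinates. Closure, discreteness and cocompactness of the lattice thereby reduce to statements
  about integers.\<close>

lemma full_lattice_coordinates:
  fixes \<Lambda> :: "(real^'n) set"
  assumes "full_lattice \<Lambda>"
  obtains M N :: "real^'n^'n" where "M ** N = mat 1" "N ** M = mat 1" "\<Lambda> = {x. \<forall>i. (N *v x) $ i \<in> \<int>}"
proof -
  obtain B where ind: "independent B" and sp: "span B = UNIV" and
      L: "\<Lambda> = {\<Sum>b\<in>B. of_int (m b) *\<^sub>R b | m. True}"
    using assms by (auto simp: full_lattice_def)
  have fin: "finite B" using ind independent_imp_finite by blast
  have "card B = CARD('n)"
    using ind sp by (metis dim_UNIV dim_span dim_eq_card DIM_cart DIM_real mult.right_neutral)
  then obtain f :: "'n \<Rightarrow> real^'n" where f: "bij_betw f UNIV B"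
    using finite_same_card_bij[of "UNIV::'n set" B] fin by auto
  define M :: "real^'n^'n" where "M = (\<chi> i j. f j $ i)"
  have col: "column j M = f j" for j by (simp add: column_def M_def vec_eq_iff)
  have Mv: "M *v v = (\<Sum>j\<in>UNIV. (v $ j) *\<^sub>R f j)" for v
    by (simp add: matrix_mult_sum col scalar_mult_eq_scaleR)
  have "columns M = B" using f col by (auto simp: columns_def bij_betw_def)
  then obtain N where N: "M ** N = mat 1" using sp matrix_right_invertible_span_columns[of M] by (auto simp: span_vec_eq)
  then have N': "N ** M = mat 1" by (simp add: matrix_left_right_inverse)
  have sumB: "(\<Sum>b\<in>B. of_int (m b) *\<^sub>R b) = M *v (\<chi> j. of_int (m (f j)))" for m
    using sum.reindex_bij_betw[OF f, of "\<lambda>b. of_int (m b) *\<^sub>R b"] by (simp add: Mv)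
  have "\<Lambda> = {x. \<forall>i. (N *v x) $ i \<in> \<int>}"
  proof (intro equalityI subsetI)
    fix x assume "x \<in> \<Lambda>"
    then obtain m where "x = M *v (\<chi> j. of_int (m (f j)))" using L sumB by auto
    then have "N *v x = (\<chi> j. of_int (m (f j)))" by (simp add: matrix_vector_mul_assoc N')
    then show "x \<in> {x. \<forall>i. (N *v x) $ i \<in> \<int>}" by simp
  next
    fix x assume "x \<in> {x. \<forall>i. (N *v x) $ i \<in> \<int>}"
    then have "\<forall>i. \<exists>k::int. (N *v x) $ i = of_int k" by (auto elim: Ints_cases)
    then obtain k :: "'n \<Rightarrow> int" where k: "\<And>i. (N *v x) $ i = of_int (k i)" by metis
    have "x = M *v (N *v x)" by (simp add: matrix_vector_mul_assoc N)
    also have "N *v x = (\<chi> j. of_int ((k \<circ> inv_into UNIV f) (f j)))"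
      using f by (simp add: vec_eq_iff k bij_betw_def)
    finally show "x \<in> \<Lambda>" unfolding L sumB[symmetric] by blast
  qed
  then show ?thesis using that N N' by blast
qed

lemma full_lattice_closed_under:
  fixes \<Lambda> :: "(real^'n) set"
  assumes "full_lattice \<Lambda>"
  shows "0 \<in> \<Lambda>" "x \<in> \<Lambda> \<Longrightarrow> y \<in> \<Lambda> \<Longrightarrow> x + y \<in> \<Lambda>" "x \<in> \<Lambda> \<Longrightarrow> - x \<in> \<Lambda>"
    "x \<in> \<Lambda> \<Longrightarrow> y \<in> \<Lambda> \<Longrightarrow> x - y \<in> \<Lambda>"
proof -
  obtain N :: "real^'n^'n" where "\<Lambda> = {x. \<forall>i. (N *v x) $ i \<in> \<int>}" using full_lattice_coordinates[OF assms] by blast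
  then show "0 \<in> \<Lambda>" "x \<in> \<Lambda> \<Longrightarrow> y \<in> \<Lambda> \<Longrightarrow> x + y \<in> \<Lambda>" "x \<in> \<Lambda> \<Longrightarrow> - x \<in> \<Lambda>"
    "x \<in> \<Lambda> \<Longrightarrow> y \<in> \<Lambda> \<Longrightarrow> x - y \<in> \<Lambda>"
    by (auto simp: matrix_vector_right_distrib matrix_vector_mult_diff_distrib
        linear_neg[OF matrix_vector_mul_linear])
qed

lemma closed_full_lattice:
  fixes \<Lambda> :: "(real^'n) set"
  assumes "full_lattice \<Lambda>"
  shows "closed \<Lambda>"
proof -
  obtain N :: "real^'n^'n" where L: "\<Lambda> = {x. \<forall>i. (N *v x) $ i \<in> \<int>}" using full_lattice_coordinates[OF assms] by blast
  have "closed {x. (N *v x) $ i \<in> \<int>}" for i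
  proof -
    have "closed ((\<lambda>x. (N *v x) $ i) -` \<int>)"
      by (intro closed_vimage closed_Ints continuous_intros linear_continuous_on)
         (simp add: linear_conv_bounded_linear[symmetric])
    then show ?thesis by (simp add: vimage_def)
  qed
  then show ?thesis unfolding L by (intro closed_Collect_all) auto
qed

lemma full_lattice_min_norm:
  fixes \<Lambda> :: "(real^'n) set"
  assumes "full_lattice \<Lambda>"
  obtains r where "r > 0" "\<And>l. l \<in> \<Lambda> \<Longrightarrow> l \<noteq> 0 \<Longrightarrow> r \<le> norm l"
proof -
  obtain M N :: "real^'n^'n" where MN: "M ** N = mat 1" and L: "\<Lambda> = {x. \<forall>i. (N *v x) $ i \<in> \<int>}"
    using full_lattice_coordinates[OF assms] by blast
  have "bounded_linear ((*v) N)" by (simp add: linear_conv_bounded_linear[symmetric])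
  then obtain K where K: "K > 0" "\<And>x. norm (N *v x) \<le> norm x * K"
    using bounded_linear.pos_bounded by blast
  have "1 / K \<le> norm l" if l: "l \<in> \<Lambda>" "l \<noteq> 0" for l
  proof -
    have "M *v (N *v l) = l" by (simp add: matrix_vector_mul_assoc MN)
    then have "N *v l \<noteq> 0" using l by auto
    then obtain i where i: "(N *v l) $ i \<noteq> 0" by (auto simp: vec_eq_iff)
    moreover have "(N *v l) $ i \<in> \<int>" using l L by simp
    ultimately have "1 \<le> \<bar>(N *v l) $ i\<bar>" by (metis Ints_nonzero_abs_ge1)
    also have "\<dots> \<le> norm (N *v l)" by (rule component_le_norm_cart)
    also have "\<dots> \<le> norm l * K" by (rule K)
    finally show ?thesis using K by (simp add: divide_le_eq)
  qed
  then show ?thesis using that K(1) by (metis zero_less_divide_1_iff)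
qed

lemma full_lattice_cobounded:
  fixes \<Lambda> :: "(real^'n) set"
  assumes "full_lattice \<Lambda>"
  obtains R where "\<And>x. \<exists>l\<in>\<Lambda>. norm (x + l) \<le> R"
proof -
  obtain M N :: "real^'n^'n" where MN: "M ** N = mat 1" and NM: "N ** M = mat 1" and L: "\<Lambda> = {x. \<forall>i. (N *v x) $ i \<in> \<int>}"
    by (rule full_lattice_coordinates[OF assms])
  have "bounded_linear ((*v) M)" by (simp add: linear_conv_bounded_linear[symmetric])
  then obtain K where K: "K > 0" "\<And>x. norm (M *v x) \<le> norm x * K"
    using bounded_linear.pos_bounded by blast
  have "\<exists>l\<in>\<Lambda>. norm (x + l) \<le> real CARD('n) * K" for x
  proof
    let ?l = "- (M *v (\<chi> i. of_int \<lfloor>(N *v x) $ i\<rfloor>))"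
    have "x + ?l = M *v (N *v x - (\<chi> i. of_int \<lfloor>(N *v x) $ i\<rfloor>))"
      by (simp add: matrix_vector_mult_diff_distrib matrix_vector_mul_assoc MN)
    also have "norm \<dots> \<le> norm (N *v x - (\<chi> i. of_int \<lfloor>(N *v x) $ i\<rfloor>)) * K" by (rule K)
    also have "\<dots> \<le> real CARD('n) * K"
    proof (intro mult_right_mono)
      have "norm (N *v x - (\<chi> i. of_int \<lfloor>(N *v x) $ i\<rfloor>)) \<le> (\<Sum>i\<in>UNIV. \<bar>(N *v x - (\<chi> i. of_int \<lfloor>(N *v x) $ i\<rfloor>)) $ i\<bar>)"
        by (rule norm_le_l1_cart)
      also have "\<dots> \<le> (\<Sum>i\<in>(UNIV::'n set). 1)" by (intro sum_mono) (simp, linarith)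
      finally show "norm (N *v x - (\<chi> i. of_int \<lfloor>(N *v x) $ i\<rfloor>)) \<le> real CARD('n)" by simp
    qed (use K in simp)
    finally show "norm (x + ?l) \<le> real CARD('n) * K" .
    show "?l \<in> \<Lambda>"
      unfolding L by (simp add: linear_neg[OF matrix_vector_mul_linear] matrix_vector_mul_assoc NM)
  qed
  then show ?thesis using that by blast
qed

lemma coset_eq_iff:
  assumes "full_lattice \<Lambda>"
  shows "coset \<Lambda> x = coset \<Lambda> y \<longleftrightarrow> y - x \<in> \<Lambda>"
proof
  note cl = full_lattice_closed_under[OF assms]
  have mem: "z \<in> coset \<Lambda> x \<longleftrightarrow> z - x \<in> \<Lambda>" for z x
    by (auto simp: orb_def lattice_shifts_def image_iff algebra_simps intro!: bexI[of _ "z - x"])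
  {
    assume "coset \<Lambda> x = coset \<Lambda> y"
    then have "y \<in> coset \<Lambda> x" using mem[of y y] cl(1) by simp
    then show "y - x \<in> \<Lambda>" by (simp add: mem)
  next
    assume xy: "y - x \<in> \<Lambda>"
    have "z - x \<in> \<Lambda> \<longleftrightarrow> z - y \<in> \<Lambda>" for z
      using cl(2)[of "z - y" "y - x"] cl(4)[of "z - x" "y - x"] xy by auto
    then show "coset \<Lambda> x = coset \<Lambda> y" using mem by blast
  }
qed

lemma transformation_group_lattice_shifts:
  assumes "full_lattice \<Lambda>"
  shows "transformation_group euclidean (lattice_shifts \<Lambda>)"
  unfolding transformation_group_def
proof (intro conjI ballI)
  note cl = full_lattice_closed_under[OF assms]
  fix g assume "g \<in> lattice_shifts \<Lambda>"
  then obtain l where l: "l \<in> \<Lambda>" "g = (\<lambda>x. x + l)" by (auto simp: lattice_shifts_def)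
  have "homeomorphic_maps euclidean euclidean g (\<lambda>x. x - l)"
    unfolding homeomorphic_maps_def l(2) by (auto intro!: continuous_intros)
  then show "homeomorphic_map euclidean euclidean g" using homeomorphic_maps_map by blast
  have "(\<lambda>x. x + - l) \<in> lattice_shifts \<Lambda>" using cl(3)[OF l(1)] unfolding lattice_shifts_def by blast
  then show "\<exists>h\<in>lattice_shifts \<Lambda>. \<forall>x\<in>topspace euclidean. h (g x) = x"
    using l by (intro bexI[of _ "\<lambda>x. x + - l"]) auto
  fix h assume "h \<in> lattice_shifts \<Lambda>"
  then obtain m where m: "m \<in> \<Lambda>" "h = (\<lambda>x. x + m)" by (auto simp: lattice_shifts_def)
  have "(\<lambda>x. x + (m + l)) \<in> lattice_shifts \<Lambda>" using cl(2)[OF m(1) l(1)] unfolding lattice_shifts_def by blast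
  then show "\<exists>k\<in>lattice_shifts \<Lambda>. \<forall>x\<in>topspace euclidean. k x = g (h x)"
    using l m by (intro bexI[of _ "\<lambda>x. x + (m + l)"]) auto
next
  have "(\<lambda>x. x + 0) \<in> lattice_shifts \<Lambda>"
    using full_lattice_closed_under(1)[OF assms] unfolding lattice_shifts_def by blast
  then show "\<exists>e\<in>lattice_shifts \<Lambda>. \<forall>x\<in>topspace euclidean. e x = x"
    by (intro bexI[of _ "\<lambda>x. x + 0"]) auto
qed

lemma ctop_torus: "ctop (torus \<Lambda> J) = quot_topology euclidean (coset \<Lambda>)"
  by (simp add: torus_def quot_manifold_def linear_manifold_def)

lemma points_torus: "points (torus \<Lambda> J) = range (coset \<Lambda>)"
  by (simp add: ctop_torus topspace_quot_topology)

lemma affine_cover_torus: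
  fixes J :: "real^'n^'n"
  assumes "complex_torus \<Lambda> J"
  shows "affine_cover J (torus \<Lambda> J) (coset \<Lambda>)"
proof -
  have L: "full_lattice \<Lambda>" and J: "complex_structure J" using assms by (auto simp: complex_torus_def)
  have ct: "ctop (linear_manifold J) = euclidean" by (simp add: linear_manifold_def)
  obtain r where r: "r > 0" "\<And>l. l \<in> \<Lambda> \<Longrightarrow> l \<noteq> 0 \<Longrightarrow> r \<le> norm l"
    using full_lattice_min_norm[OF L] by blast
  have "affine_cover J (quot_manifold (linear_manifold J) (lattice_shifts \<Lambda>)) (orb (lattice_shifts \<Lambda>) \<circ> id)"
  proof (rule affine_cover_quot[OF affine_cover_linear_manifold[OF J]])
    show "transformation_group (ctop (linear_manifold J)) (lattice_shifts \<Lambda>)"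
      unfolding ct by (rule transformation_group_lattice_shifts[OF L])
    fix x :: "real^'n"
    have "inj_on (coset \<Lambda>) (ball x (r / 2))"
    proof (rule inj_onI)
      fix a b assume ab: "a \<in> ball x (r / 2)" "b \<in> ball x (r / 2)" "coset \<Lambda> a = coset \<Lambda> b"
      have "norm (b - a) < r"
        using ab dist_triangle_half_r[of x b r a] by (simp add: dist_norm norm_minus_commute)
      then show "a = b" using r(2)[of "b - a"] ab coset_eq_iff[OF L] by force
    qed
    then show "\<exists>W. openin (ctop (linear_manifold J)) W \<and> x \<in> W \<and> inj_on (coset \<Lambda>) W"
      unfolding ct using r(1) by (intro exI[of _ "ball x (r / 2)"]) auto
  next
    fix g assume "g \<in> lattice_shifts \<Lambda>"
    then obtain l where "g = (\<lambda>x. x + l)" by (auto simp: lattice_shifts_def)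
    then show "\<exists>A b. A ** J = J ** A \<and> invertible A \<and> (\<forall>x. g (id x) = id (A *v x + b))"
      by (intro exI[of _ "mat 1"] exI[of _ l]) (auto simp: invertible_def intro: exI[of _ "mat 1"])
  qed
  then show ?thesis by (simp add: torus_def)
qed

lemma Hausdorff_torus:
  assumes L: "full_lattice \<Lambda>"
  shows "Hausdorff_space (ctop (torus \<Lambda> J))"
  unfolding ctop_torus
proof (rule Hausdorff_space_open_image[OF open_map_orb[OF transformation_group_lattice_shifts[OF L]]])
  show "coset \<Lambda> ` topspace euclidean = topspace (quot_topology euclidean (coset \<Lambda>))"
    by (simp add: topspace_quot_topology)
  fix x y assume "coset \<Lambda> x \<noteq> coset \<Lambda> y"
  then have "y - x \<in> - \<Lambda>" using coset_eq_iff[OF L] by blast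
  then obtain e where e: "e > 0" "ball (y - x) e \<subseteq> - \<Lambda>"
    using closed_full_lattice[OF L] open_contains_ball[of "- \<Lambda>"] by blast
  have "coset \<Lambda> ` ball x (e / 2) \<inter> coset \<Lambda> ` ball y (e / 2) = {}"
  proof (rule ccontr)
    assume "coset \<Lambda> ` ball x (e / 2) \<inter> coset \<Lambda> ` ball y (e / 2) \<noteq> {}"
    then obtain a b where ab: "norm (x - a) < e / 2" "norm (y - b) < e / 2" "coset \<Lambda> a = coset \<Lambda> b"
      by (auto simp: dist_norm)
    then have "b - a \<in> \<Lambda>" using coset_eq_iff[OF L] by blast
    moreover have "norm ((y - x) - (b - a)) < e"
      using ab norm_triangle_ineq4[of "y - b" "x - a"] by (simp add: algebra_simps)
    ultimately show False using e(2) by (auto simp: dist_norm)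
  qed
  then show "\<exists>U V. openin euclidean U \<and> openin euclidean V \<and> x \<in> U \<and> y \<in> V \<and> coset \<Lambda> ` U \<inter> coset \<Lambda> ` V = {}"
    using e(1) by (intro exI[of _ "ball x (e / 2)"] exI[of _ "ball y (e / 2)"]) auto
qed

lemma compact_torus:
  assumes L: "full_lattice \<Lambda>"
  shows "compact_space (ctop (torus \<Lambda> J))"
proof -
  obtain R where R: "\<And>x. \<exists>l\<in>\<Lambda>. norm (x + l) \<le> R" using full_lattice_cobounded[OF L] by blast
  have "range (coset \<Lambda>) = coset \<Lambda> ` cball 0 R"
  proof
    show "range (coset \<Lambda>) \<subseteq> coset \<Lambda> ` cball 0 R"
    proof clarify
      fix x obtain l where l: "l \<in> \<Lambda>" "norm (x + l) \<le> R" using R by blast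
      then have "coset \<Lambda> x = coset \<Lambda> (x + l)" using coset_eq_iff[OF L, of x "x + l"] by simp
      then show "coset \<Lambda> x \<in> coset \<Lambda> ` cball 0 R" using l by auto
    qed
  qed auto
  moreover have "compactin (ctop (torus \<Lambda> J)) (coset \<Lambda> ` cball 0 R)"
    unfolding ctop_torus by (rule image_compactin[OF _ continuous_map_quot]) simp
  ultimately show ?thesis by (simp add: compact_space_def points_torus)
qed

lemma complex_manifold_torus:
  "complex_torus \<Lambda> J \<Longrightarrow> complex_manifold (torus \<Lambda> J)"
  using complex_manifold_affine_cover[OF affine_cover_torus Hausdorff_torus] by (auto simp: complex_torus_def)

lemma quotient_affine_cover:
  fixes M :: "'a cmfd" and J :: "real^'n^'n"
  assumes "affine_cover J M \<pi>" "Hausdorff_space (ctop M)" "finite_free_aut_group M G"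
    and "\<And>g. g \<in> G \<Longrightarrow> \<exists>A b. A ** J = J ** A \<and> invertible A \<and> (\<forall>x. g (\<pi> x) = \<pi> (A *v x + b))"
  shows "affine_cover J (quot_manifold M G) (orb G \<circ> \<pi>)"
    and "complex_manifold (quot_manifold M G)"
proof -
  note G = finite_free_aut_groupD[OF assms(3)]
  show c: "affine_cover J (quot_manifold M G) (orb G \<circ> \<pi>)"
    using affine_cover_quot[OF assms(1) G(2) locally_inj_orb_finite[OF G(2,1) assms(2)] assms(4)] G(3) by blast
  show "complex_manifold (quot_manifold M G)"
    using Hausdorff_quot_finite[OF G(2,1) assms(2)]
    by (intro complex_manifold_affine_cover[OF c]) (simp add: quot_manifold_def)
qed

lemma compact_quot_manifold:
  assumes "compact_space (ctop M)"
  shows "compact_space (ctop (quot_manifold M G))"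
proof -
  have "compactin (ctop (quot_manifold M G)) (orb G ` points M)"
    using image_compactin[OF _ continuous_map_quot] assms by (simp add: quot_manifold_def compact_space_def)
  then show ?thesis by (simp add: compact_space_def quot_manifold_def topspace_quot_topology)
qed

section \<open>Calculus of gradients\<close>

text \<open>A finite family of functions becomes a map into \<open>Cn e\<close> after padding with
  zeros.\<close>

lemma has_cgradient_compose_fields:
  assumes S: "S \<subseteq> Cn d" "z \<in> Cn d"
    and F: "\<And>j. j < e \<Longrightarrow> has_cgradient d S (F j) (A j) z"
    and h: "has_cgradient e (Cn e) h c (\<lambda>j. if j < e then F j z else 0)"
  shows "has_cgradient d S (\<lambda>w. h (\<lambda>j. if j < e then F j w else 0)) (\<lambda>i. \<Sum>j<e. c j * A j i) z"
proof (rule has_cgradient_compose[OF S, of "Cn e" e "\<lambda>w j. if j < e then F j w else 0"])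
  show "(\<lambda>w j. if j < e then F j w else 0) ` S \<subseteq> Cn e" by (auto simp: Cn_def)
qed (use F h in \<open>auto simp: Cn_def\<close>)

lemma has_cgradient_linear: 
  assumes "S \<subseteq> Cn d" "z \<in> Cn d"
  shows "has_cgradient d S (\<lambda>w. \<Sum>i<d. c i * w i) c z"
  unfolding has_cgradient_iff[OF assms]
  by (auto simp: sum_subtractf[symmetric] right_diff_distrib intro!: exI[of _ 1])

lemma has_cgradient_sum:
  fixes e :: nat
  assumes S: "S \<subseteq> Cn d" "z \<in> Cn d"
    and F: "\<And>j. j < e \<Longrightarrow> has_cgradient d S (F j) (A j) z"
  shows "has_cgradient d S (\<lambda>w. \<Sum>j<e. c j * F j w) (\<lambda>i. \<Sum>j<e. c j * A j i) z"
proof -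
  have "has_cgradient e (Cn e) (\<lambda>u. \<Sum>j<e. c j * u j) c (\<lambda>j. if j < e then F j z else 0)"
    by (rule has_cgradient_linear) (auto simp: Cn_def)
  from has_cgradient_compose_fields[OF S F this] show ?thesis by simp
qed

lemma has_cgradient_field:
  assumes S: "S \<subseteq> Cn d" "z \<in> Cn d" and f: "has_cgradient d S f c z" 
    and \<phi>: "(\<phi> has_field_derivative \<phi>') (at (f z))"
  shows "has_cgradient d S (\<lambda>w. \<phi> (f w)) (\<lambda>i. \<phi>' * c i) z"
proof -
  let ?z = "\<lambda>j. if j < (1::nat) then f z else 0"
  have C: "Cn 1 \<subseteq> Cn 1" "?z \<in> Cn 1" by (auto simp: Cn_def)
  have cd: "cdist 1 u ?z = cmod (u 0 - f z)" for u
    by (simp add: cdist_def L2_set_def)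
  have "has_cgradient 1 (Cn 1) (\<lambda>u. \<phi> (u 0)) (\<lambda>_. \<phi>') ?z"
    unfolding has_cgradient_iff[OF C]
  proof (intro allI impI)
    fix \<epsilon> :: real assume "\<epsilon> > 0"
    have "(\<phi> has_derivative (*) \<phi>') (at (f z))" using \<phi> by (simp add: has_field_derivative_def)
    then have "\<exists>d>0. \<forall>y. norm (y - f z) < d \<longrightarrow> norm (\<phi> y - \<phi> (f z) - \<phi>' * (y - f z)) \<le> \<epsilon> * norm (y - f z)"
      using \<open>\<epsilon> > 0\<close> unfolding has_derivative_at_alt by blast
    then obtain d where d: "d > 0" "\<And>y. norm (y - f z) < d \<Longrightarrow> norm (\<phi> y - \<phi> (f z) - \<phi>' * (y - f z)) \<le> \<epsilon> * norm (y - f z)"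
      by blast
    then show "\<exists>\<delta>>0. \<forall>w\<in>Cn 1. cdist 1 w ?z < \<delta> \<longrightarrow>
         cmod (\<phi> (w 0) - \<phi> (?z 0) - (\<Sum>i<1. \<phi>' * (w i - ?z i))) \<le> \<epsilon> * cdist 1 w ?z"
      unfolding cd by (intro exI[of _ d]) auto
  qed
  then have "has_cgradient d S (\<lambda>w. (\<lambda>u. \<phi> (u 0)) (\<lambda>j. if j < (1::nat) then f w else 0)) (\<lambda>i. \<Sum>j<(1::nat). \<phi>' * c i) z"
    by (intro has_cgradient_compose_fields[OF S, where F = "\<lambda>_. f" and A = "\<lambda>_. c" and c = "\<lambda>_. \<phi>'"] f)
  then show ?thesis by simp
qed

definition cdifferentiable :: "nat \<Rightarrow> (nat \<Rightarrow> complex) set \<Rightarrow> ((nat \<Rightarrow> complex) \<Rightarrow> complex) \<Rightarrow> (nat \<Rightarrow> complex) \<Rightarrow> bool" where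
  "cdifferentiable d S f z \<longleftrightarrow> S \<subseteq> Cn d \<and> z \<in> Cn d \<and> (\<exists>c. has_cgradient d S f c z)"

lemma cdifferentiable_const: "S \<subseteq> Cn d \<Longrightarrow> z \<in> Cn d \<Longrightarrow> cdifferentiable d S (\<lambda>_. a) z"
proof -
  assume "S \<subseteq> Cn d" "z \<in> Cn d"
  moreover have "has_cgradient d S (\<lambda>_. a) (\<lambda>_. 0) z" by (simp add: has_cgradient_def)
  ultimately show ?thesis unfolding cdifferentiable_def by blast
qed

lemma cdifferentiable_coordinate: 
  assumes "S \<subseteq> Cn d" "z \<in> Cn d"
  shows "cdifferentiable d S (\<lambda>w. w j) z"
proof (cases "j < d")
  case True
  then show ?thesis using has_cgradient_coordinate assms unfolding cdifferentiable_def by blast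
next
  case False
  have "has_cgradient d S (\<lambda>w. w j) (\<lambda>_. 0) z"
    by (rule has_cgradient_transfer[of d S "\<lambda>_. 0" "\<lambda>_. 0" z _ 1])
       (use assms False in \<open>auto simp: has_cgradient_def Cn_def\<close>)
  then show ?thesis using assms unfolding cdifferentiable_def by blast
qed

lemma cdifferentiable_sum:
  fixes e :: nat
  assumes "\<And>j. j < e \<Longrightarrow> cdifferentiable d S (F j) z" "S \<subseteq> Cn d" "z \<in> Cn d"
  shows "cdifferentiable d S (\<lambda>w. \<Sum>j<e. c j * F j w) z"
proof -
  have "\<exists>A. \<forall>j<e. has_cgradient d S (F j) (A j) z"
    using assms unfolding cdifferentiable_def by metis
  then show ?thesis using has_cgradient_sum[of S d z e F] assms unfolding cdifferentiable_def by blast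
qed

lemma cdifferentiable_field:
  assumes "cdifferentiable d S f z" "(\<phi> has_field_derivative \<phi>') (at (f z))"
  shows "cdifferentiable d S (\<lambda>w. \<phi> (f w)) z"
  using has_cgradient_field[of S d z f _ \<phi> \<phi>'] assms unfolding cdifferentiable_def by blast

lemma cdifferentiable_add:
  assumes "cdifferentiable d S f z" "cdifferentiable d S g z"
  shows "cdifferentiable d S (\<lambda>w. a * f w + b * g w) z"
  using cdifferentiable_sum[of 2 d S "\<lambda>j. if j = 0 then f else g" z "\<lambda>j. if j = 0 then a else b"] assms
  by (simp add: numeral_2_eq_2 lessThan_Suc cdifferentiable_def less_Suc_eq add.commute)

text \<open>Products reduce to squares by polarization, so that the chain rule suffices.\<close>

lemma cdifferentiable_mult:
  assumes "cdifferentiable d S f z" "cdifferentiable d S g z"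
  shows "cdifferentiable d S (\<lambda>w. f w * g w) z"
proof -
  have sq: "cdifferentiable d S (\<lambda>w. (h w)^2) z" if "cdifferentiable d S h z" for h
    by (rule cdifferentiable_field[OF that]) (rule derivative_eq_intros refl)+
  have "cdifferentiable d S (\<lambda>w. 1/4 * (1 * f w + 1 * g w)^2 + (- 1/4) * (1 * f w + (- 1) * g w)^2) z"
    by (intro cdifferentiable_add[of d S] sq assms)
  moreover have "1/4 * (1 * f w + 1 * g w)^2 + (- 1/4) * (1 * f w + (- 1) * g w)^2 = f w * g w" for w
    by (simp add: power2_eq_square field_simps)
  ultimately show ?thesis by (simp only:)
qed

lemma cdifferentiable_divide:
  assumes "cdifferentiable d S f z" "cdifferentiable d S g z" "g z \<noteq> 0"
  shows "cdifferentiable d S (\<lambda>w. f w / g w) z"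
proof -
  have "cdifferentiable d S (\<lambda>w. inverse (g w)) z"
    by (rule cdifferentiable_field[OF assms(2) DERIV_inverse[OF assms(3)]])
  then show ?thesis unfolding divide_inverse by (rule cdifferentiable_mult[OF assms(1)])
qed


section \<open>Projective space\<close>

lemma transformation_group_scalings:
  "transformation_group (top_of_set (Cn (Suc N) - {\<lambda>_. 0})) scalings"
  unfolding transformation_group_def
proof (intro conjI ballI)
  let ?X = "top_of_set (Cn (Suc N) - {\<lambda>_. 0})"
  have cont: "continuous_map ?X ?X (\<lambda>z i. c * z i)" if "c \<noteq> 0" for c :: complex
    unfolding continuous_map_iff_continuous2
  proof (simp, intro conjI)
    show "continuous_on (Cn (Suc N) - {\<lambda>_. 0}) (\<lambda>z i. c * z i)"
      by (intro continuous_on_coordinatewise_then_product continuous_intros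
          continuous_on_product_then_coordinatewise[OF continuous_on_id])
    show "(\<lambda>z i. c * z i) \<in> Cn (Suc N) - {\<lambda>_. 0} \<rightarrow> Cn (Suc N) - {\<lambda>_. 0}"
      using that by (auto simp: Cn_def fun_eq_iff)
  qed
  fix g assume "g \<in> scalings"
  then obtain c where c: "c \<noteq> 0" "g = (\<lambda>z i. c * z i)" by (auto simp: scalings_def)
  have "homeomorphic_maps ?X ?X g (\<lambda>z i. inverse c * z i)"
    unfolding homeomorphic_maps_def c(2) using cont[of c] cont[of "inverse c"] c(1)
    by (simp add: fun_eq_iff)
  then show "homeomorphic_map ?X ?X g" using homeomorphic_maps_map by blast
  have "(\<lambda>z i. inverse c * z i) \<in> scalings" using c(1) unfolding scalings_def by (intro CollectI exI[of _ "inverse c"]) simp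
  then show "\<exists>h\<in>scalings. \<forall>x\<in>topspace ?X. h (g x) = x"
    using c by (intro bexI[of _ "\<lambda>z i. inverse c * z i"]) (auto simp: fun_eq_iff)
  fix h assume "h \<in> scalings"
  then obtain b where b: "b \<noteq> 0" "h = (\<lambda>z i. b * z i)" by (auto simp: scalings_def)
  have "(\<lambda>z i. (c * b) * z i) \<in> scalings" using c(1) b(1) unfolding scalings_def by (intro CollectI exI[of _ "c * b"]) simp
  then show "\<exists>k\<in>scalings. \<forall>x\<in>topspace ?X. k x = g (h x)"
    using c b by (intro bexI[of _ "\<lambda>z i. (c * b) * z i"]) (auto simp: fun_eq_iff)
next
  have "(\<lambda>z i. 1 * z i) \<in> scalings" unfolding scalings_def by (intro CollectI exI[of _ 1]) simp
  then show "\<exists>e\<in>scalings. \<forall>x\<in>topspace (top_of_set (Cn (Suc N) - {\<lambda>_. 0})). e x = x"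
    by (intro bexI[of _ "\<lambda>z i. 1 * z i"]) auto
qed

lemma orb_scalings_eq_iff:
  assumes "z \<in> Cn (Suc N)" "z \<noteq> (\<lambda>_. 0)"
  shows "orb scalings z = orb scalings w \<and> w \<in> Cn (Suc N) - {\<lambda>_. 0} \<longleftrightarrow> (\<exists>c. c \<noteq> 0 \<and> w = (\<lambda>i. c * z i))"
proof -
  have "(\<exists>g\<in>scalings. w = g z) \<longleftrightarrow> (\<exists>c. c \<noteq> 0 \<and> w = (\<lambda>i. c * z i))"
    unfolding scalings_def by auto
  then show ?thesis using orb_eq_iff[OF transformation_group_scalings, of z N w] assms by simp
qed

lemma orb_scalings_someE:
  obtains c where "c \<noteq> 0" "(SOME w. w \<in> orb scalings z) = (\<lambda>i. c * z i)"
proof -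
  have "(\<lambda>i. 1 * z i) \<in> orb scalings z" unfolding orb_def scalings_def by (auto intro!: image_eqI[of _ _ "\<lambda>z i. 1 * z i"] exI[of _ 1])
  then have "(SOME w. w \<in> orb scalings z) \<in> orb scalings z" by (rule someI[of "\<lambda>w. w \<in> orb scalings z"])
  then show ?thesis using that unfolding orb_def scalings_def by auto
qed

lemma proj_space_simps:
  "cdim (proj_space N) = N"
  "ctop (proj_space N) = quot_topology (top_of_set (Cn (Suc N) - {\<lambda>_. 0})) (orb scalings)"
  "points (proj_space N) = orb scalings ` (Cn (Suc N) - {\<lambda>_. 0})"
  "catlas (proj_space N) = {(orb scalings ` {z \<in> Cn (Suc N). z j \<noteq> 0}, affine_chart N j) | j. j \<le> N}"
  by (simp_all add: proj_space_def topspace_quot_topology)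

lemma affine_chart_orb:
  "affine_chart N j (orb scalings z) = (\<lambda>i. if i < j then z i / z j else if i < N then z (Suc i) / z j else 0)"
proof -
  obtain c where c: "c \<noteq> 0" "(SOME w. w \<in> orb scalings z) = (\<lambda>i. c * z i)" by (rule orb_scalings_someE)
  show ?thesis unfolding affine_chart_def Let_def c(2) using c(1) by (simp add: fun_eq_iff)
qed

lemma orb_in_affine_domain:
  assumes "z \<in> Cn (Suc N)" "z \<noteq> (\<lambda>_. 0)"
  shows "orb scalings z \<in> orb scalings ` {z \<in> Cn (Suc N). z j \<noteq> 0} \<longleftrightarrow> z j \<noteq> 0"
proof
  assume "orb scalings z \<in> orb scalings ` {z \<in> Cn (Suc N). z j \<noteq> 0}"
  then obtain w where w: "w \<in> Cn (Suc N)" "w j \<noteq> 0" "orb scalings z = orb scalings w" by auto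
  then have "w \<noteq> (\<lambda>_. 0)" by auto
  then obtain c where "c \<noteq> 0" "w = (\<lambda>i. c * z i)" using orb_scalings_eq_iff[OF assms, of w] w by blast
  then show "z j \<noteq> 0" using w by auto
qed (use assms in auto)

text \<open>The scaling group is infinite, so the finite argument does not apply. Two points differ
  exactly if some minor \<open>x i * y j - x j * y i\<close> is nonzero, an open condition on pairs
  of representatives.\<close>

lemma Hausdorff_proj_space: "Hausdorff_space (ctop (proj_space N))"
  unfolding proj_space_simps
proof (rule Hausdorff_space_open_image[OF open_map_orb[OF transformation_group_scalings]])
  let ?X = "Cn (Suc N) - {\<lambda>_. 0}"
  show "orb scalings ` topspace (top_of_set ?X) = topspace (quot_topology (top_of_set ?X) (orb scalings))"
    by (simp add: topspace_quot_topology)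
  fix x y assume xy: "x \<in> topspace (top_of_set ?X)" "y \<in> topspace (top_of_set ?X)" "orb scalings x \<noteq> orb scalings y"
  have "\<exists>i j. x i * y j \<noteq> x j * y i"
  proof (rule ccontr)
    assume "\<nexists>i j. x i * y j \<noteq> x j * y i"
    then have eq: "x i * y j = x j * y i" for i j by blast
    obtain j where j: "x j \<noteq> 0" using xy by fastforce
    have y: "y = (\<lambda>i. y j / x j * x i)" using eq[of _ j] j by (auto simp: fun_eq_iff field_simps)
    have "y j \<noteq> 0"
    proof
      assume "y j = 0"
      then have "y i = 0" for i using eq[of i j] j by simp
      then have "y = (\<lambda>_. 0)" by (simp add: fun_eq_iff)
      then show False using xy by simp
    qed
    then have "\<exists>c. c \<noteq> 0 \<and> y = (\<lambda>i. c * x i)" using y j by (intro exI[of _ "y j / x j"]) auto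
    then show False using orb_scalings_eq_iff[of x N y] xy by auto
  qed
  then obtain i j where ij: "x i * y j \<noteq> x j * y i" by blast
  let ?f = "\<lambda>p::(nat \<Rightarrow> complex) \<times> (nat \<Rightarrow> complex). fst p i * snd p j - fst p j * snd p i"
  have "continuous_on UNIV ?f"
    by (intro continuous_intros continuous_on_product_then_coordinatewise[of UNIV fst]
        continuous_on_product_then_coordinatewise[of UNIV snd])
  then have "open (?f -` (- {0}))" by (intro open_vimage) auto
  moreover have "(x, y) \<in> ?f -` (- {0})" using ij by simp
  ultimately obtain A B where AB: "open A" "open B" "(x, y) \<in> A \<times> B" "A \<times> B \<subseteq> ?f -` (- {0})"
    by (rule open_prod_elim)
  have "orb scalings ` (?X \<inter> A) \<inter> orb scalings ` (?X \<inter> B) = {}"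
  proof (rule ccontr)
    assume "orb scalings ` (?X \<inter> A) \<inter> orb scalings ` (?X \<inter> B) \<noteq> {}"
    then obtain a b where ab: "a \<in> ?X" "a \<in> A" "b \<in> ?X" "b \<in> B" "orb scalings a = orb scalings b" by auto
    then obtain c where "b = (\<lambda>i. c * a i)" using orb_scalings_eq_iff[of a N b] by auto
    then have "?f (a, b) = 0" by simp
    moreover have "(a, b) \<in> ?f -` (- {0})" using ab AB by blast
    ultimately show False by simp
  qed
  then show "\<exists>U V. openin (top_of_set ?X) U \<and> openin (top_of_set ?X) V \<and> x \<in> U \<and> y \<in> V \<and>
         orb scalings ` U \<inter> orb scalings ` V = {}"
    using AB xy by (intro exI[of _ "?X \<inter> A"] exI[of _ "?X \<inter> B"]) (auto simp: openin_open_Int)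
qed

text \<open>The inverse of an affine chart at the level of homogeneous coordinates: the
  \<open>l\<close>-th coordinate is normalized to 1.\<close>

definition insert_one :: "nat \<Rightarrow> (nat \<Rightarrow> complex) \<Rightarrow> nat \<Rightarrow> complex" where
  "insert_one l w = (\<lambda>i. if i < l then w i else if i = l then 1 else w (i - 1))"

lemma insert_one_affine:
  assumes "z \<in> Cn (Suc N)" "l \<le> N" "z l \<noteq> 0"
  shows "insert_one l (\<lambda>i. if i < l then z i / z l else if i < N then z (Suc i) / z l else 0) = (\<lambda>i. 1 / z l * z i)"
proof
  fix i
  show "insert_one l (\<lambda>i. if i < l then z i / z l else if i < N then z (Suc i) / z l else 0) i = 1 / z l * z i"
  proof (cases "l < i")
    case True
    then obtain k where k: "i = Suc k" "l \<le> k" by (cases i) auto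
    show ?thesis
    proof (cases "k < N")
      case True
      then show ?thesis using k by (simp add: insert_one_def)
    next
      case False
      then have "z i = 0" using assms(1) k by (simp add: Cn_def)
      then show ?thesis using k False by (simp add: insert_one_def)
    qed
  next
    case False
    then show ?thesis using assms by (cases "i = l") (auto simp: insert_one_def)
  qed
qed

lemma cdifferentiable_insert_one:
  assumes "S \<subseteq> Cn d" "z \<in> Cn d"
  shows "cdifferentiable d S (\<lambda>w. insert_one l w i) z"
  unfolding insert_one_def using cdifferentiable_coordinate[OF assms] cdifferentiable_const[OF assms]
  by (cases "i < l"; cases "i = l") simp_all

text \<open>The inverse of the \<open>l\<close>-th chart sends \<open>u\<close> to the class of
  \<open>insert_one l u\<close>, so holomorphy in charts is differentiability of the homogeneous
  formula \<open>H\<close> along this section.\<close>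

lemma holomorphic_function_on_proj_space:
  assumes W: "W \<subseteq> points (proj_space N)"
    and h: "\<And>z. z \<in> Cn (Suc N) - {\<lambda>_. 0} \<Longrightarrow> orb scalings z \<in> W \<Longrightarrow> h (orb scalings z) = H z"
    and H: "\<And>l S w. l \<le> N \<Longrightarrow> S \<subseteq> Cn N \<Longrightarrow> w \<in> S \<Longrightarrow>
       (\<And>u. u \<in> S \<Longrightarrow> insert_one l u \<in> Cn (Suc N) - {\<lambda>_. 0} \<and> orb scalings (insert_one l u) \<in> W) \<Longrightarrow>
       cdifferentiable N S (\<lambda>u. H (insert_one l u)) w"
  shows "holomorphic_function_on (proj_space N) W h"
  unfolding holomorphic_function_on_def proj_space_simps
proof clarify
  fix l assume l: "l \<le> N"
  let ?U = "orb scalings ` {z \<in> Cn (Suc N). z l \<noteq> 0}"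
  let ?S = "affine_chart N l ` (?U \<inter> W)"
  have SC: "?S \<subseteq> Cn N" by (auto simp: affine_chart_def Let_def Cn_def l)
  have key: "insert_one l u \<in> Cn (Suc N) - {\<lambda>_. 0} \<and> orb scalings (insert_one l u) = q \<and> q \<in> W"
    if q: "q \<in> ?U" "q \<in> W" "u = affine_chart N l q" for u q
  proof -
    obtain z where z: "z \<in> Cn (Suc N)" "z l \<noteq> 0" "q = orb scalings z" using q by auto
    have u: "insert_one l u = (\<lambda>i. 1 / z l * z i)"
      unfolding q(3) z(3) affine_chart_orb by (rule insert_one_affine[OF z(1) l z(2)])
    have "z \<noteq> (\<lambda>_. 0)" using z by auto
    then have "orb scalings z = orb scalings (insert_one l u) \<and> insert_one l u \<in> Cn (Suc N) - {\<lambda>_. 0}"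
      using orb_scalings_eq_iff[OF z(1), of "insert_one l u"] u z(2) by (metis divide_eq_0_iff one_neq_zero)
    then show ?thesis using z q by simp
  qed
  have eq: "(h \<circ> inv_into ?U (affine_chart N l)) u = H (insert_one l u)" if u: "u \<in> ?S" for u
  proof -
    obtain q0 where q0: "q0 \<in> ?U" "q0 \<in> W" "u = affine_chart N l q0" using u by blast
    let ?q = "inv_into ?U (affine_chart N l) u"
    have q: "?q \<in> ?U" "affine_chart N l ?q = u" 
      using q0 by (auto intro: inv_into_into f_inv_into_f)
    obtain z where z: "z \<in> Cn (Suc N)" "z l \<noteq> 0" "?q = orb scalings z" using q(1) by auto
    have iu: "insert_one l u = (\<lambda>i. 1 / z l * z i)"
      using insert_one_affine[OF z(1) l z(2)] q(2) z(3) affine_chart_orb[of N l z] by simp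
    have "z \<noteq> (\<lambda>_. 0)" using z by auto
    then have "orb scalings z = orb scalings (insert_one l u)"
      using orb_scalings_eq_iff[OF z(1), of "insert_one l u"] iu z(2) by (metis divide_eq_0_iff one_neq_zero)
    then have "?q = orb scalings (insert_one l u)" using z by simp
    then show ?thesis using h[of "insert_one l u"] key[OF q0] by simp
  qed
  show "holo_fun N ?S (h \<circ> inv_into ?U (affine_chart N l))"
    unfolding holo_fun_def
  proof
    fix w assume w: "w \<in> ?S"
    have "cdifferentiable N ?S (\<lambda>u. H (insert_one l u)) w"
    proof (rule H[OF l SC w])
      fix u assume "u \<in> ?S"
      then obtain q where "q \<in> ?U" "q \<in> W" "u = affine_chart N l q" by blast
      from key[OF this] show "insert_one l u \<in> Cn (Suc N) - {\<lambda>_. 0} \<and> orb scalings (insert_one l u) \<in> W"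
        by blast
    qed
    then obtain c where c: "has_cgradient N ?S (\<lambda>u. H (insert_one l u)) c w" by (auto simp: cdifferentiable_def)
    have "has_cgradient N ?S (h \<circ> inv_into ?U (affine_chart N l)) c w"
      by (rule has_cgradient_transfer[OF c SC SC, of 1]) (use w SC eq in auto)
    then show "\<exists>c. has_cgradient N ?S (h \<circ> inv_into ?U (affine_chart N l)) c w" by blast
  qed
qed

section \<open>A projectivity criterion\<close>

definition cscale :: "real^'n^'n \<Rightarrow> complex \<Rightarrow> real^'n \<Rightarrow> real^'n" where
  "cscale J c v = Re c *\<^sub>R v + Im c *\<^sub>R (J *v v)"

lemma cscale_simps:
  "cscale J 0 v = 0" "cscale J 1 v = v" "cscale J (a + b) v = cscale J a v + cscale J b v"
  "cscale J (r *\<^sub>R a) v = r *\<^sub>R cscale J a v" "cscale J (a - b) v = cscale J a v - cscale J b v"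
  by (simp_all add: cscale_def scaleR_add_left scaleR_add_right scaleR_diff_left)

lemma linear_cscale: "linear (\<lambda>c. cscale J c v)"
  by (rule linearI) (simp_all add: cscale_simps)

lemma cscale_ii: "complex_structure J \<Longrightarrow> cscale J (\<i> * c) v = J *v cscale J c v"
  by (simp add: cscale_def matrix_vector_right_distrib matrix_vector_mult_scaleR complex_structure_twice)

lemma linear_chart_cscale:
  assumes "linear_chart J \<kappa>"
  shows "\<kappa> (cscale J c v) m = c * \<kappa> v m"
proof -
  interpret l: linear "\<lambda>v. \<kappa> v m" by (rule linear_chartD(3)[OF assms])
  have "\<kappa> (cscale J c v) m = Re c *\<^sub>R \<kappa> v m + Im c *\<^sub>R (\<i> * \<kappa> v m)"
    unfolding cscale_def l.add l.scale linear_chartD(4)[OF assms] by simp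
  also have "\<dots> = c * \<kappa> v m" by (subst (3) complex_eq) (simp add: scaleR_conv_of_real algebra_simps)
  finally show ?thesis .
qed

lemma has_derivative_cscale_sum:
  assumes "\<And>i. i \<in> I \<Longrightarrow> (f i has_derivative D i) (at x)"
  shows "((\<lambda>y. \<Sum>i\<in>I. cscale J (f i y) (a i)) has_derivative (\<lambda>v. \<Sum>i\<in>I. cscale J (D i v) (a i))) (at x)"
proof (rule has_derivative_sum)
  fix i assume "i \<in> I"
  have "bounded_linear (\<lambda>c. cscale J c (a i))" using linear_cscale linear_conv_bounded_linear by blast
  from bounded_linear.has_derivative[OF this assms[OF \<open>i \<in> I\<close>]]
  show "((\<lambda>y. cscale J (f i y) (a i)) has_derivative (\<lambda>v. cscale J (D i v) (a i))) (at x)" .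
qed

lemma cderiv_divide:
  assumes "cderiv J f D x" "cderiv J g E x" "g x \<noteq> 0"
  shows "cderiv J (\<lambda>y. f y / g y) (\<lambda>v. (D v * g x - f x * E v) / (g x * g x)) x"
proof -
  have f: "(f has_derivative D) (at x)" "\<And>v. D (J *v v) = \<i> * D v"
    and g: "(g has_derivative E) (at x)" "\<And>v. E (J *v v) = \<i> * E v" using assms by (auto simp: cderiv_def)
  have "((\<lambda>y. f y / g y) has_derivative (\<lambda>v. (D v * g x - f x * E v) / (g x * g x))) (at x)"
    using has_derivative_divide'[OF f(1) g(1) assms(3)] by simp
  moreover have "(D (J *v v) * g x - f x * E (J *v v)) / (g x * g x) = \<i> * ((D v * g x - f x * E v) / (g x * g x))" for v
    by (simp add: f(2) g(2) right_diff_distrib mult.assoc mult.left_commute)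
  ultimately show ?thesis by (simp add: cderiv_def)
qed

text \<open>The \<open>\<Theta> i\<close> play the role of sections of a line bundle, pulled back to
  the vector space. \<open>base\<close>, \<open>equiv\<close> and \<open>sep\<close> say that they
  define an injective map to projective space. \<open>loc\<close> says that they separate tangent
  vectors, in the form that some combination of ratios is a local coordinate map with values in the
  vector space itself; both the immersion and the equations of the image are read off from
  it.\<close>

locale projective_sections =
  fixes J :: "real^'n^'n" and M :: "'a cmfd" and \<pi> :: "real^'n \<Rightarrow> 'a"
    and N :: nat and \<Theta> :: "nat \<Rightarrow> real^'n \<Rightarrow> complex"
  assumes J: "complex_structure J" and cov: "affine_cover J M \<pi>" and man: "complex_manifold M"
    and comp: "compact_space (ctop M)"
    and hol: "\<And>i x. i \<le> N \<Longrightarrow> \<exists>D. cderiv J (\<Theta> i) D x"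
    and base: "\<And>x. \<exists>i\<le>N. \<Theta> i x \<noteq> 0"
    and equiv: "\<And>x y. \<pi> x = \<pi> y \<Longrightarrow> \<exists>c. c \<noteq> 0 \<and> (\<forall>i\<le>N. \<Theta> i y = c * \<Theta> i x)"
    and sep: "\<And>x y c. \<forall>i\<le>N. \<Theta> i y = c * \<Theta> i x \<Longrightarrow> \<pi> x = \<pi> y"
    and loc: "\<And>x. \<exists>B j a. open B \<and> x \<in> B \<and> j \<le> N \<and> (\<forall>y\<in>B. \<Theta> j y \<noteq> 0) \<and>
        inj_on (\<lambda>y. \<Sum>i\<le>N. cscale J (\<Theta> i y / \<Theta> j y) (a i)) B \<and>
        (\<forall>y\<in>B. \<exists>D. ((\<lambda>y. \<Sum>i\<le>N. cscale J (\<Theta> i y / \<Theta> j y) (a i)) has_derivative D) (at y) \<and> inj D)"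
begin

section \<open>The map to projective space defined by the sections\<close>

definition hvec :: "real^'n \<Rightarrow> nat \<Rightarrow> complex" where
  "hvec x = (\<lambda>i. if i \<le> N then \<Theta> i x else 0)"

definition emb :: "'a \<Rightarrow> (nat \<Rightarrow> complex) set" where
  "emb p = orb scalings (hvec (SOME x. \<pi> x = p))"

abbreviation "pcone \<equiv> Cn (Suc N) - {\<lambda>_. 0}"

lemma hvec_cone: "hvec x \<in> pcone"
  using base[of x] by (auto simp: hvec_def Cn_def fun_eq_iff)

lemma orb_hvec_eq_iff: "orb scalings (hvec x) = orb scalings (hvec y) \<longleftrightarrow> \<pi> x = \<pi> y"
proof -
  have *: "orb scalings (hvec x) = orb scalings (hvec y) \<longleftrightarrow> (\<exists>c. c \<noteq> 0 \<and> hvec y = (\<lambda>i. c * hvec x i))"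
    using orb_scalings_eq_iff[of "hvec x" N "hvec y"] hvec_cone[of x] hvec_cone[of y] by auto
  show ?thesis
  proof
    assume "orb scalings (hvec x) = orb scalings (hvec y)"
    then obtain c where "hvec y = (\<lambda>i. c * hvec x i)" using * by blast
    then have "\<forall>i\<le>N. \<Theta> i y = c * \<Theta> i x" by (metis hvec_def)
    then show "\<pi> x = \<pi> y" by (rule sep)
  next
    assume "\<pi> x = \<pi> y"
    then obtain c where "c \<noteq> 0" "\<forall>i\<le>N. \<Theta> i y = c * \<Theta> i x" using equiv by blast
    then show "orb scalings (hvec x) = orb scalings (hvec y)"
      unfolding * by (intro exI[of _ c]) (auto simp: hvec_def fun_eq_iff)
  qed
qed

lemma emb_\<pi>: "emb (\<pi> x) = orb scalings (hvec x)"
proof -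
  have "\<pi> (SOME y. \<pi> y = \<pi> x) = \<pi> x" by (rule someI[of "\<lambda>y. \<pi> y = \<pi> x" x]) simp
  then show ?thesis unfolding emb_def orb_hvec_eq_iff .
qed

lemma emb_inj: "emb (\<pi> x) = emb (\<pi> y) \<longleftrightarrow> \<pi> x = \<pi> y"
  by (simp add: emb_\<pi> orb_hvec_eq_iff)

lemma range_\<pi>: "range \<pi> = points M"
  by (rule affine_coverD(4)[OF cov])

lemma continuous_\<Theta>: "i \<le> N \<Longrightarrow> continuous_on A (\<Theta> i)"
  using hol has_derivative_continuous unfolding cderiv_def
  by (metis continuous_at_imp_continuous_on)

lemma continuous_emb: "continuous_map (ctop M) (ctop (proj_space N)) emb"
proof -
  have "continuous_on UNIV hvec"
    unfolding hvec_def
  proof (rule continuous_on_coordinatewise_then_product)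
    show "continuous_on UNIV (\<lambda>x. if i \<le> N then \<Theta> i x else 0)" for i
      using continuous_\<Theta>[of i UNIV] by (cases "i \<le> N") simp_all
  qed
  then have "continuous_map euclidean (top_of_set pcone) hvec"
    using hvec_cone by (auto simp: continuous_map_in_subtopology continuous_map_iff_continuous2)
  then have "continuous_map euclidean (ctop (proj_space N)) (orb scalings \<circ> hvec)"
    unfolding proj_space_simps by (rule continuous_map_compose[OF _ continuous_map_quot])
  moreover have "orb scalings \<circ> hvec = emb \<circ> \<pi>" by (simp add: fun_eq_iff emb_\<pi>)
  moreover have "quotient_map euclidean (ctop M) \<pi>"
    using continuous_open_imp_quotient_map[OF affine_coverD(2,3)[OF cov]] range_\<pi> by simp
  ultimately show ?thesis
    using continuous_compose_quotient_map_eq[of euclidean "ctop M" \<pi> "ctop (proj_space N)" emb] by simp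
qed

lemma emb_domain: "emb (\<pi> x) \<in> orb scalings ` {z \<in> Cn (Suc N). z j \<noteq> 0} \<longleftrightarrow> j \<le> N \<and> \<Theta> j x \<noteq> 0"
  unfolding emb_\<pi> using orb_in_affine_domain[of "hvec x" N j] hvec_cone[of x] by (simp add: hvec_def)

lemma affine_chart_emb:
  assumes "j \<le> N" "a < N"
  shows "affine_chart N j (emb (\<pi> y)) a = \<Theta> (if a < j then a else Suc a) y / \<Theta> j y"
  unfolding emb_\<pi> affine_chart_orb using assms by (simp add: hvec_def)

lemma holomorphic_emb: "holomorphic_map M (proj_space N) emb"
proof (rule holomorphic_map_affine_cover[OF cov continuous_emb])
  fix V \<psi> assume "(V, \<psi>) \<in> catlas (proj_space N)"
  then obtain j where j: "j \<le> N" "V = orb scalings ` {z \<in> Cn (Suc N). z j \<noteq> 0}" "\<psi> = affine_chart N j"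
    unfolding proj_space_simps by blast
  show "\<psi> ` V \<subseteq> Cn (cdim (proj_space N))"
    using j(1) unfolding j(3) proj_space_simps by (auto simp: affine_chart_def Let_def Cn_def)
  fix x a assume x: "emb (\<pi> x) \<in> V" and a: "a < cdim (proj_space N)"
  have aN: "a < N" using a by (simp add: proj_space_simps)
  let ?i = "if a < j then a else Suc a"
  have "?i \<le> N" using aN by auto
  then obtain D where D: "cderiv J (\<Theta> ?i) D x" using hol by blast
  obtain E where E: "cderiv J (\<Theta> j) E x" using hol[of j x] j by auto
  have nz: "\<Theta> j x \<noteq> 0" using x unfolding j(2) emb_domain by blast
  show "\<exists>Y F D. open Y \<and> x \<in> Y \<and> cderiv J F D x \<and> (\<forall>y\<in>Y. emb (\<pi> y) \<in> V \<longrightarrow> \<psi> (emb (\<pi> y)) a = F y)"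
    using cderiv_divide[OF D E nz] affine_chart_emb[OF j(1) aN] j(3) by (intro exI[of _ UNIV] exI conjI) auto
qed

lemma ex_derivatives: "\<exists>D. \<forall>i\<le>N. cderiv J (\<Theta> i) (D i) x"
proof -
  have "\<forall>i. \<exists>D. i \<le> N \<longrightarrow> cderiv J (\<Theta> i) D x" using hol by blast
  then show ?thesis by (rule choice)
qed

text \<open>If the derivatives along \<open>v\<close> are proportional to the values, all ratios
  have zero derivative along \<open>v\<close>. So does the local coordinate map, whose derivative is
  injective.\<close>

lemma derivative_injective:
  assumes D: "\<And>i. i \<le> N \<Longrightarrow> cderiv J (\<Theta> i) (D i) x" and v: "\<And>i. i \<le> N \<Longrightarrow> D i v = t * \<Theta> i x"
  shows "v = 0"
proof -
  obtain B j a where B: "x \<in> B" "j \<le> N" "\<forall>y\<in>B. \<Theta> j y \<noteq> 0"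
    "\<forall>y\<in>B. \<exists>D. ((\<lambda>y. \<Sum>i\<le>N. cscale J (\<Theta> i y / \<Theta> j y) (a i)) has_derivative D) (at y) \<and> inj D"
    using loc[of x] by blast
  obtain E where E: "((\<lambda>y. \<Sum>i\<le>N. cscale J (\<Theta> i y / \<Theta> j y) (a i)) has_derivative E) (at x)" "inj E"
    using B by blast
  let ?D = "\<lambda>i v. (D i v * \<Theta> j x - \<Theta> i x * D j v) / (\<Theta> j x * \<Theta> j x)"
  have "((\<lambda>y. \<Theta> i y / \<Theta> j y) has_derivative ?D i) (at x)" if "i \<in> {..N}" for i
    using cderiv_divide[OF D[of i] D[OF B(2)]] that B(1,3) by (auto simp: cderiv_def)
  then have "((\<lambda>y. \<Sum>i\<le>N. cscale J (\<Theta> i y / \<Theta> j y) (a i)) has_derivative (\<lambda>v. \<Sum>i\<le>N. cscale J (?D i v) (a i))) (at x)"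
    by (rule has_derivative_cscale_sum)
  then have Eeq: "E = (\<lambda>v. \<Sum>i\<le>N. cscale J (?D i v) (a i))" using E(1) has_derivative_unique by blast
  have z: "?D i v = 0" if "i \<in> {..N}" for i using that v[of i] v[OF B(2)] by simp
  have "E v = (\<Sum>i\<le>N. cscale J (?D i v) (a i))" by (simp only: Eeq)
  also have "\<dots> = 0" using z by (intro sum.neutral ballI) (metis cscale_simps(1))
  finally have "E v = 0" .
  moreover have "E 0 = 0" using E(1) has_derivative_linear linear_0 by blast
  ultimately show ?thesis using E(2) by (metis injD)
qed

lemma immersion_emb: "immersion M (proj_space N) emb"
  unfolding immersion_def
proof clarify
  fix U \<phi> V \<psi> p assume U: "(U, \<phi>) \<in> catlas M" and V: "(V, \<psi>) \<in> catlas (proj_space N)" and p: "p \<in> U" "emb p \<in> V"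
  let ?k = "CARD('n) div 2"
  have "p \<in> points M" using affine_coverD(6)[OF cov U] openin_subset p by blast
  then obtain x where x: "p = \<pi> x" using range_\<pi> by blast
  obtain j where j: "j \<le> N" "V = orb scalings ` {z \<in> Cn (Suc N). z j \<noteq> 0}" "\<psi> = affine_chart N j"
    using V unfolding proj_space_simps by blast
  have nz: "\<Theta> j x \<noteq> 0" using p unfolding x j(2) emb_domain by blast
  obtain \<kappa> where lc: "linear_chart J \<kappa>" and grad: "\<forall>F D h Y S. cderiv J F D x \<longrightarrow> open Y \<longrightarrow> x \<in> Y \<longrightarrow> S \<subseteq> U \<longrightarrow> \<pi> x \<in> S \<longrightarrow>
      (\<forall>y\<in>Y. \<pi> y \<in> S \<longrightarrow> h (\<pi> y) = F y) \<longrightarrow>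
      has_cgradient ?k (\<phi> ` S) (h \<circ> inv_into U \<phi>) (\<lambda>i. D (linv \<kappa> (cunit i))) (\<phi> (\<pi> x))"
    using affine_cover_gradient[OF cov U, of x] p x by blast
  obtain D where D: "\<And>i. i \<le> N \<Longrightarrow> cderiv J (\<Theta> i) (D i) x" using ex_derivatives by blast
  let ?s = "\<lambda>a. if a < j then a else Suc a"
  let ?D = "\<lambda>i v. (D i v * \<Theta> j x - \<Theta> i x * D j v) / (\<Theta> j x * \<Theta> j x)"
  have cd: "cderiv J (\<lambda>y. \<Theta> i y / \<Theta> j y) (?D i) x" if "i \<le> N" for i
    using cderiv_divide[OF D[OF that] D[OF j(1)] nz] .
  have sN: "?s a \<le> N" if "a < N" for a using that by auto
  have g: "has_cgradient (cdim M) (\<phi> ` (U \<inter> emb -` V)) (\<lambda>z. (\<psi> \<circ> emb \<circ> inv_into U \<phi>) z a)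
          (\<lambda>i. ?D (?s a) (linv \<kappa> (cunit i))) (\<phi> p)" if a: "a < N" for a
  proof -
    have "has_cgradient ?k (\<phi> ` (U \<inter> emb -` V)) ((\<lambda>p. \<psi> (emb p) a) \<circ> inv_into U \<phi>)
        (\<lambda>i. ?D (?s a) (linv \<kappa> (cunit i))) (\<phi> (\<pi> x))"
      by (rule grad[rule_format, OF cd[OF sN[OF a]], of UNIV])
         (use p x j affine_chart_emb[OF j(1) a] in auto)
    then show ?thesis unfolding x affine_coverD(1)[OF cov] by (simp add: comp_def)
  qed
  show "\<exists>c. (\<forall>a<cdim (proj_space N). has_cgradient (cdim M) (\<phi> ` (U \<inter> emb -` V)) (\<lambda>z. (\<psi> \<circ> emb \<circ> inv_into U \<phi>) z a) (c a) (\<phi> p)) \<and>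
            (\<forall>v. (\<forall>a<cdim (proj_space N). (\<Sum>i<cdim M. c a i * v i) = 0) \<longrightarrow> (\<forall>i<cdim M. v i = 0))"
    unfolding proj_space_simps
  proof (rule exI[of _ "\<lambda>a i. ?D (?s a) (linv \<kappa> (cunit i))"], intro conjI allI impI)
    show "has_cgradient (cdim M) (\<phi> ` (U \<inter> emb -` V)) (\<lambda>z. (\<psi> \<circ> emb \<circ> inv_into U \<phi>) z a)
          (\<lambda>i. ?D (?s a) (linv \<kappa> (cunit i))) (\<phi> p)" if "a < N" for a by (rule g[OF that])
    fix v i assume v: "\<forall>a<N. (\<Sum>i<cdim M. ?D (?s a) (linv \<kappa> (cunit i)) * v i) = 0" and i: "i < cdim M"
    \<comment> \<open>\<open>v\<close> is arbitrary beyond the dimension, so it is truncated to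
      become an element of \<open>Cn\<close>.\<close>
    define w where "w = (\<lambda>i. if i < ?k then v i else 0)"
    have wC: "w \<in> Cn ?k" by (simp add: w_def Cn_def)
    let ?u = "linv \<kappa> w"
    have lin: "linear (?D i)" "\<And>v. ?D i (J *v v) = \<i> * ?D i v" if "i \<le> N" for i
      using cd[OF that] has_derivative_linear unfolding cderiv_def by blast+
    have Ds: "?D (?s a) ?u = 0" if "a < N" for a
    proof -
      have "?D (?s a) ?u = (\<Sum>i<?k. ?D (?s a) (linv \<kappa> (cunit i)) * w i)"
        by (rule linear_chart_inv_complex_linear[OF lc lin[OF sN[OF that]] wC])
      also have "\<dots> = (\<Sum>i<?k. ?D (?s a) (linv \<kappa> (cunit i)) * v i)"
        by (intro sum.cong) (auto simp: w_def)
      finally show ?thesis using v that affine_coverD(1)[OF cov] by simp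
    qed
    \<comment> \<open>The omitted index \<open>j\<close> adds no condition, because its ratio is
      constantly 1.\<close>
    have D0: "?D i ?u = 0" if "i \<le> N" for i
    proof -
      consider "i = j" | "i < j" | "j < i" by linarith
      then show ?thesis
      proof cases
        case 2
        then show ?thesis using Ds[of i] j(1) by simp
      next
        case 3
        then obtain a where "i = Suc a" by (cases i) auto
        then show ?thesis using Ds[of a] 3 that by simp
      qed simp
    qed
    have "?u = 0"
    proof (rule derivative_injective[OF D, where t = "D j ?u / \<Theta> j x"])
      fix i assume "i \<le> N"
      then have "D i ?u * \<Theta> j x - \<Theta> i x * D j ?u = 0" using D0[of i] nz by auto
      then show "D i ?u = D j ?u / \<Theta> j x * \<Theta> i x" using nz by (simp add: field_simps)
    qed
    then have "w = \<kappa> 0" using linear_chartD(5)[OF lc wC] by simp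
    then have "w i = 0" using linear_0[OF linear_chartD(3)[OF lc]] by simp
    then show "v i = 0" using i affine_coverD(1)[OF cov] by (simp add: w_def)
  qed
qed

lemma embedding_emb: "embedding_map (ctop M) (ctop (proj_space N)) emb"
proof (rule continuous_imp_embedding_map[OF continuous_emb comp Hausdorff_proj_space])
  show "inj_on emb (points M)" using emb_inj unfolding range_\<pi>[symmetric] inj_on_def by blast
qed

lemma openin_image_complement:
  "openin (ctop (proj_space N)) (points (proj_space N) - emb ` points M)"
proof -
  have "compactin (ctop (proj_space N)) (emb ` points M)"
    using comp by (intro image_compactin[OF _ continuous_emb]) (simp add: compact_space_def)
  then have "closedin (ctop (proj_space N)) (emb ` points M)"
    by (rule compactin_imp_closedin[OF Hausdorff_proj_space])
  then show ?thesis by blast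
qed

lemma emb_subset: "emb ` points M \<subseteq> points (proj_space N)"
  unfolding range_\<pi>[symmetric] proj_space_simps(3) using hvec_cone by (auto simp: emb_\<pi>)

text \<open>
  Near a point of the image a left inverse \<open>g\<close> of the local coordinate map \<open>\<Phi>\<close> shows
  that the image is the graph-like zero set of \<open>z\<^sub>i / z\<^sub>j - (\<Theta>\<^sub>i / \<Theta>\<^sub>j) (g (\<dots>))\<close>.
\<close>

lemma local_equations:
  "\<exists>W F. openin (ctop (proj_space N)) W \<and> emb (\<pi> x0) \<in> W \<and> finite F \<and>
     (\<forall>h\<in>F. holomorphic_function_on (proj_space N) W h) \<and>
     emb ` points M \<inter> W = {y \<in> W. \<forall>h\<in>F. h y = 0}"
proof -
  let ?k = "CARD('n) div 2"
  obtain B j a where B: "open B" "x0 \<in> B" "j \<le> N" "\<And>y. y \<in> B \<Longrightarrow> \<Theta> j y \<noteq> 0"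
    and inj: "inj_on (\<lambda>y. \<Sum>i\<le>N. cscale J (\<Theta> i y / \<Theta> j y) (a i)) B"
    and der: "\<And>y. y \<in> B \<Longrightarrow> \<exists>D. ((\<lambda>y. \<Sum>i\<le>N. cscale J (\<Theta> i y / \<Theta> j y) (a i)) has_derivative D) (at y) \<and> inj D"
    using loc[of x0] by blast
  define \<Phi> where "\<Phi> = (\<lambda>y. \<Sum>i\<le>N. cscale J (\<Theta> i y / \<Theta> j y) (a i))"
  define L where "L = (\<lambda>z::nat \<Rightarrow> complex. \<Sum>i\<le>N. cscale J (z i / z j) (a i))"
  have L\<Phi>: "L (hvec y) = \<Phi> y" for y using B(3) by (simp add: L_def \<Phi>_def hvec_def)
  have Lscale: "L (\<lambda>i. c * z i) = L z" if "c \<noteq> 0" for c z using that by (simp add: L_def)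
  have inj: "inj_on \<Phi> B" using inj by (simp add: \<Phi>_def)
  have cont: "continuous_on B \<Phi>"
    using der unfolding \<Phi>_def[symmetric] by (meson continuous_at_imp_continuous_on has_derivative_continuous)
  \<comment> \<open>Nothing is known about continuity of the derivatives, so openness comes from
    invariance of domain; the derivative of the inverse then exists because the forward derivative
    is bijective.\<close>
  have oV: "open (\<Phi> ` B)" by (rule invariance_of_domain[OF cont B(1) inj])
  define g where "g = inv_into B \<Phi>"
  have g: "g (\<Phi> y) = y" if "y \<in> B" for y using inj that by (simp add: g_def)
  have gder: "\<exists>D. cderiv J (\<lambda>v. \<Theta> i (g v) / \<Theta> j (g v)) D v" if v: "v \<in> \<Phi> ` B" and i: "i \<le> N" for i v
  proof -
    obtain y where y: "y \<in> B" "v = \<Phi> y" using v by blast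
    obtain D where D: "(\<Phi> has_derivative D) (at y)" "inj D" using der[OF y(1)] unfolding \<Phi>_def[symmetric] by blast
    have linD: "linear D" using D(1) has_derivative_linear by blast
    have bijD: "bij D" using linD D(2) linear_injective_imp_surjective by (auto simp: bij_def)
    let ?D' = "inv_into UNIV D"
    have DD': "D (?D' w) = w" for w using bijD by (simp add: bij_is_surj surj_f_inv_f)
    have "(g has_derivative ?D') (at (\<Phi> y))"
      by (rule has_derivative_inverse_strong[OF B(1) y(1) cont g D(1)]) (auto simp: DD' fun_eq_iff)
    \<comment> \<open>\<open>D\<close> is a sum of terms \<open>cscale J (?E i v) (a i)\<close> with
      complex linear \<open>?E i\<close>, so it commutes with \<open>J\<close>, and its inverse does
      as well.\<close>
    moreover have "?D' (J *v w) = J *v ?D' w" for w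
    proof -
      obtain E where E: "\<And>i. i \<le> N \<Longrightarrow> cderiv J (\<Theta> i) (E i) y" using ex_derivatives by blast
      let ?E = "\<lambda>i v. (E i v * \<Theta> j y - \<Theta> i y * E j v) / (\<Theta> j y * \<Theta> j y)"
      have cE: "cderiv J (\<lambda>y. \<Theta> i y / \<Theta> j y) (?E i) y" if "i \<in> {..N}" for i
        using cderiv_divide[OF E[of i] E[OF B(3)] B(4)[OF y(1)]] that by simp
      then have "(\<Phi> has_derivative (\<lambda>v. \<Sum>i\<le>N. cscale J (?E i v) (a i))) (at y)"
        unfolding \<Phi>_def by (intro has_derivative_cscale_sum) (auto simp: cderiv_def)
      then have Deq: "D = (\<lambda>v. \<Sum>i\<le>N. cscale J (?E i v) (a i))" using D(1) has_derivative_unique by blast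
      have Ei: "?E i (J *v v) = \<i> * ?E i v" if "i \<in> {..N}" for i v
        using cE[OF that] unfolding cderiv_def by blast
      have "D (J *v v) = J *v D v" for v
      proof -
        have "D (J *v v) = (\<Sum>i\<le>N. cscale J (?E i (J *v v)) (a i))" by (simp only: Deq)
        also have "\<dots> = (\<Sum>i\<le>N. J *v cscale J (?E i v) (a i))"
          by (intro sum.cong refl) (simp only: Ei cscale_ii[OF J])
        also have "\<dots> = J *v D v" by (simp only: Deq linear_sum[OF matrix_vector_mul_linear])
        finally show ?thesis .
      qed
      then have "D (J *v ?D' w) = J *v w" by (simp add: DD')
      then show ?thesis using bijD by (metis bij_is_inj inv_f_f)
    qed
    ultimately have gg: "(g has_derivative ?D') (at v)" "\<And>w. ?D' (J *v w) = J *v ?D' w" using y by auto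
    obtain E where E: "cderiv J (\<Theta> i) E y" using hol i by blast
    obtain E' where E': "cderiv J (\<Theta> j) E' y" using hol B(3) by blast
    let ?Q = "\<lambda>v. (E v * \<Theta> j y - \<Theta> i y * E' v) / (\<Theta> j y * \<Theta> j y)"
    have q: "cderiv J (\<lambda>y. \<Theta> i y / \<Theta> j y) ?Q y" by (rule cderiv_divide[OF E E' B(4)[OF y(1)]])
    have "((\<lambda>y. \<Theta> i y / \<Theta> j y) has_derivative ?Q) (at (g v))" using q g y by (simp add: cderiv_def)
    from has_derivative_compose[OF gg(1) this]
    have "((\<lambda>v. \<Theta> i (g v) / \<Theta> j (g v)) has_derivative (\<lambda>w. ?Q (?D' w))) (at v)" .
    moreover have "?Q (?D' (J *v w)) = \<i> * ?Q (?D' w)" for w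
    proof -
      have "\<forall>v. ?Q (J *v v) = \<i> * ?Q v" using q unfolding cderiv_def by blast
      then show ?thesis unfolding gg(2) by blast
    qed
    ultimately show ?thesis unfolding cderiv_def by blast
  qed
  have "openin (ctop M) (\<pi> ` B)" using affine_coverD(3)[OF cov] B(1) by (simp add: open_map_def)
  then have "openin (subtopology (ctop (proj_space N)) (emb ` points M)) (emb ` \<pi> ` B)"
    using embedding_emb homeomorphic_imp_open_map unfolding embedding_map_def open_map_def by blast
  \<comment> \<open>\<open>W0\<close> meets the image only in the sheet over \<open>B\<close>. Other
    branches of the image may enter \<open>Z\<close> without satisfying the equations.\<close>
  then obtain W0 where W0: "openin (ctop (proj_space N)) W0" "emb ` \<pi> ` B = W0 \<inter> emb ` points M"
    by (auto simp: openin_subtopology)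
  define Z where "Z = pcone \<inter> {z. z j \<noteq> 0 \<and> L z \<in> \<Phi> ` B}"
  define W where "W = W0 \<inter> orb scalings ` Z"
  have ZL: "z j \<noteq> 0 \<and> L z \<in> \<Phi> ` B" if z: "z \<in> pcone" "orb scalings z \<in> orb scalings ` Z" for z
  proof -
    obtain z' where z': "z' \<in> pcone" "z' j \<noteq> 0" "L z' \<in> \<Phi> ` B" "orb scalings z = orb scalings z'" 
      using z(2) unfolding Z_def by auto
    then obtain c where "c \<noteq> 0" "z' = (\<lambda>i. c * z i)" using orb_scalings_eq_iff[of z N z'] z(1) by auto
    then show ?thesis using z' Lscale by auto
  qed
  have "openin (top_of_set pcone) Z"
  proof -
    have o: "open {z::nat \<Rightarrow> complex. z j \<noteq> 0}"
      by (intro open_Collect_neq continuous_on_product_then_coordinatewise[OF continuous_on_id] continuous_on_const)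
    have coord: "continuous_on {z::nat \<Rightarrow> complex. z j \<noteq> 0} (\<lambda>z. z i)" for i
      by (intro continuous_on_product_then_coordinatewise[OF continuous_on_id])
    have "continuous_on {z::nat \<Rightarrow> complex. z j \<noteq> 0} (\<lambda>z. cscale J (z i / z j) (a i))" for i
    proof -
      have "continuous_on {z::nat \<Rightarrow> complex. z j \<noteq> 0} (\<lambda>z. z i / z j)"
        by (intro continuous_on_divide coord) auto
      moreover have "continuous_on UNIV (\<lambda>c. cscale J c (a i))"
        by (intro linear_continuous_on) (simp add: linear_conv_bounded_linear[symmetric] linear_cscale)
      ultimately show ?thesis using continuous_on_compose2[of UNIV "\<lambda>c. cscale J c (a i)"] by blast
    qed
    then have "continuous_on {z::nat \<Rightarrow> complex. z j \<noteq> 0} L" unfolding L_def by (intro continuous_on_sum)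
    then have "open ({z. z j \<noteq> 0} \<inter> L -` (\<Phi> ` B))"
      using o oV by (rule continuous_open_preimage)
    moreover have "Z = pcone \<inter> ({z. z j \<noteq> 0} \<inter> L -` (\<Phi> ` B))" by (auto simp: Z_def)
    ultimately show ?thesis by (metis openin_open_Int)
  qed
  then have "openin (ctop (proj_space N)) (orb scalings ` Z)"
    using open_map_orb[OF transformation_group_scalings] unfolding proj_space_simps open_map_def by blast
  then have W: "openin (ctop (proj_space N)) W" unfolding W_def using W0(1) by blast
  have hB: "hvec y \<in> Z" if "y \<in> B" for y
    using hvec_cone[of y] B(3) B(4)[OF that] that by (auto simp: Z_def L\<Phi>) (simp add: hvec_def)
  have x0W: "emb (\<pi> x0) \<in> W" unfolding W_def using W0(2) B(2) hB[OF B(2)] emb_\<pi>[of x0] by blast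
  define H where "H i z = z i / z j - \<Theta> i (g (L z)) / \<Theta> j (g (L z))" for i z
  define h where "h i q = H i (SOME z. z \<in> q)" for i q
  have h: "h i (orb scalings z) = H i z" for i z
  proof -
    obtain c where "c \<noteq> 0" "(SOME w. w \<in> orb scalings z) = (\<lambda>i. c * z i)" by (rule orb_scalings_someE)
    then show ?thesis by (simp add: h_def H_def Lscale)
  qed
  have WP: "W \<subseteq> points (proj_space N)" by (rule openin_subset[OF W])
  have holo: "holomorphic_function_on (proj_space N) W (h i)" if i: "i \<le> N" for i
  proof (rule holomorphic_function_on_proj_space[where H = "H i", OF WP])
    show "h i (orb scalings z) = H i z" for z by (rule h)
  next
    fix l S w assume l: "l \<le> N" and S: "S \<subseteq> Cn N" "w \<in> S"
      and ins: "\<And>u. u \<in> S \<Longrightarrow> insert_one l u \<in> pcone \<and> orb scalings (insert_one l u) \<in> W"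
    have w: "w \<in> Cn N" using S by blast
    have zL: "insert_one l u j \<noteq> 0 \<and> L (insert_one l u) \<in> \<Phi> ` B" if "u \<in> S" for u
      using ZL[of "insert_one l u"] ins[OF that] unfolding W_def by blast
    have quot: "cdifferentiable N S (\<lambda>u. insert_one l u m / insert_one l u j) w" for m
      using cdifferentiable_divide[OF cdifferentiable_insert_one[OF S(1) w] cdifferentiable_insert_one[OF S(1) w]] zL[OF S(2)] by blast
    obtain \<kappa> where lc: "linear_chart J \<kappa>" using ex_linear_chart[OF J] by blast
    have \<kappa>L: "\<kappa> (L z) m = (\<Sum>i<Suc N. \<kappa> (a i) m * (z i / z j))" for z m
      unfolding L_def lessThan_Suc_atMost linear_sum[OF linear_chartD(3)[OF lc]] linear_chart_cscale[OF lc]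
      by (simp add: mult.commute)
    have \<kappa>d: "cdifferentiable N S (\<lambda>u. \<kappa> (L (insert_one l u)) m) w" for m
      unfolding \<kappa>L by (rule cdifferentiable_sum[OF quot S(1) w])
    obtain D where D: "cderiv J (\<lambda>v. \<Theta> i (g v) / \<Theta> j (g v)) D (L (insert_one l w))"
      using gder[OF _ i] zL[OF S(2)] by blast
    have "has_cgradient ?k (Cn ?k) (\<lambda>u. \<Theta> i (g (linv \<kappa> (\<lambda>i. u i - 0))) / \<Theta> j (g (linv \<kappa> (\<lambda>i. u i - 0))))
       (\<lambda>i. D (linv \<kappa> (cunit i))) (\<lambda>i. \<kappa> (L (insert_one l w)) i + 0)"
      by (rule has_cgradient_linear_chart[OF lc D]) (auto simp: Cn_def)
    then have G: "has_cgradient ?k (Cn ?k) (\<lambda>u. \<Theta> i (g (linv \<kappa> u)) / \<Theta> j (g (linv \<kappa> u)))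
       (\<lambda>i. D (linv \<kappa> (cunit i))) (\<kappa> (L (insert_one l w)))" by simp
    have "\<exists>A. \<forall>m. has_cgradient N S (\<lambda>u. \<kappa> (L (insert_one l u)) m) (A m) w"
      using \<kappa>d unfolding cdifferentiable_def by metis
    then obtain A where A: "\<And>m. has_cgradient N S (\<lambda>u. \<kappa> (L (insert_one l u)) m) (A m) w" by blast
    have "has_cgradient N S (\<lambda>u. \<Theta> i (g (linv \<kappa> (\<kappa> (L (insert_one l u))))) / \<Theta> j (g (linv \<kappa> (\<kappa> (L (insert_one l u))))))
       (\<lambda>m. \<Sum>i<?k. D (linv \<kappa> (cunit i)) * A i m) w"
    proof (rule has_cgradient_compose[OF S(1) w, where F = "\<lambda>u. \<kappa> (L (insert_one l u))" and T = "Cn ?k"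
          and f = "\<lambda>u. \<Theta> i (g (linv \<kappa> u)) / \<Theta> j (g (linv \<kappa> u))"])
      show "(\<lambda>u. \<kappa> (L (insert_one l u))) ` S \<subseteq> Cn ?k" "\<kappa> (L (insert_one l w)) \<in> Cn ?k"
        using linear_chartD(2)[OF lc] by auto
    qed (use A G in auto)
    then have "cdifferentiable N S (\<lambda>u. \<Theta> i (g (L (insert_one l u))) / \<Theta> j (g (L (insert_one l u)))) w"
      unfolding cdifferentiable_def linear_chartD(1)[OF lc] using S(1) w by blast
    from cdifferentiable_add[OF quot[of i] this, of 1 "-1"]
    show "cdifferentiable N S (\<lambda>u. H i (insert_one l u)) w" unfolding H_def by simp
  qed
  have "emb ` points M \<inter> W = {y \<in> W. \<forall>h\<in>h ` {..N}. h y = 0}"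
  proof (intro equalityI subsetI)
    fix y assume y: "y \<in> emb ` points M \<inter> W"
    then obtain b where b: "b \<in> B" "y = emb (\<pi> b)" using W0(2) unfolding W_def by blast
    have "H i (hvec b) = 0" if "i \<le> N" for i
      unfolding H_def L\<Phi> g[OF b(1)] using that B(3) by (simp add: hvec_def)
    then show "y \<in> {y \<in> W. \<forall>h\<in>h ` {..N}. h y = 0}" using y b by (auto simp: emb_\<pi> h)
  next
    fix y assume y: "y \<in> {y \<in> W. \<forall>h\<in>h ` {..N}. h y = 0}"
    then obtain z where z: "z \<in> pcone" "y = orb scalings z" using WP unfolding proj_space_simps(3) by blast
    have zL: "z j \<noteq> 0" "L z \<in> \<Phi> ` B" using ZL[OF z(1)] y z unfolding W_def by blast+
    then obtain b where b: "b \<in> B" "L z = \<Phi> b" by blast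
    \<comment> \<open>The equations express all ratios of \<open>z\<close> through \<open>b\<close>,
      so \<open>z\<close> is a multiple of \<open>hvec b\<close>.\<close>
    have "hvec b = (\<lambda>i. \<Theta> j b / z j * z i)"
    proof
      fix i
      show "hvec b i = \<Theta> j b / z j * z i"
      proof (cases "i \<le> N")
        case True
        then have "H i z = 0" using y z h by auto
        then have "z i / z j = \<Theta> i b / \<Theta> j b" by (simp add: H_def b g)
        then show ?thesis using True zL(1) B(4)[OF b(1)] by (simp add: hvec_def field_simps)
      next
        case False
        then show ?thesis using z(1) by (auto simp: hvec_def Cn_def)
      qed
    qed
    then have "orb scalings z = orb scalings (hvec b)"
      using orb_scalings_eq_iff[of z N "hvec b"] z(1) zL(1) B(4)[OF b(1)] by (metis DiffD1 DiffD2 divide_eq_0_iff insertI1)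
    then have "y = emb (\<pi> b)" using z emb_\<pi>[of b] by simp
    moreover have "\<pi> b \<in> points M" unfolding range_\<pi>[symmetric] by simp
    ultimately show "y \<in> emb ` points M \<inter> W" using y by blast
  qed
  then show ?thesis using W x0W holo by (intro exI[of _ W] exI[of _ "h ` {..N}"]) auto
qed

lemma analytic_image: "analytic_subvariety (proj_space N) (emb ` points M)"
  unfolding analytic_subvariety_def
proof (intro conjI emb_subset ballI)
  fix q assume q: "q \<in> points (proj_space N)"
  show "\<exists>W F. openin (ctop (proj_space N)) W \<and> q \<in> W \<and> finite F \<and>
        (\<forall>h\<in>F. holomorphic_function_on (proj_space N) W h) \<and>
        emb ` points M \<inter> W = {y \<in> W. \<forall>h\<in>F. h y = 0}"
  proof (cases "q \<in> emb ` points M")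
    case True
    then obtain x where "q = emb (\<pi> x)" unfolding range_\<pi>[symmetric] by blast
    then show ?thesis using local_equations by blast
  next
    case False
    \<comment> \<open>Off the closed image the equation 1 = 0 defines the empty set.\<close>
    have "holomorphic_function_on (proj_space N) (points (proj_space N) - emb ` points M) (\<lambda>_. 1)"
      unfolding holomorphic_function_on_def holo_fun_def comp_def
      by (auto simp: has_cgradient_def intro!: exI[of _ "\<lambda>_. 0"])
    then show ?thesis using openin_image_complement q False
      by (intro exI[of _ "points (proj_space N) - emb ` points M"] exI[of _ "{\<lambda>_. 1}"]) auto
  qed
qed

lemma projective: "projective M"
  unfolding projective_def holomorphic_embedding_def
  using man comp holomorphic_emb immersion_emb embedding_emb analytic_image by blast

end

section \<open>Series of holomorphic functions\<close>

text \<open>Unit discs around points of the unit disc stay in the domain, so Cauchy's inequality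
  bounds the first derivative by \<open>M\<close> and the second by \<open>2 * M\<close>. Taylor's
  formula of order one gives the remainder.\<close>

lemma Cauchy_estimates_unit:
  assumes hol: "G holomorphic_on ball 0 4" and bd: "\<And>t. t \<in> ball 0 4 \<Longrightarrow> cmod (G t) \<le> M"
    and s: "0 \<le> s" "s \<le> 1"
  shows "cmod (deriv G 0) \<le> M" "cmod (G (of_real s) - G 0 - deriv G 0 * of_real s) \<le> 2 * M * s\<^sup>2"
proof -
  have sub: "cball \<xi> 1 \<subseteq> ball 0 4" if "\<xi> \<in> cball 0 1" for \<xi> :: complex
  proof
    fix x assume "x \<in> cball \<xi> 1"
    then show "x \<in> ball 0 4" using that norm_triangle_ineq[of "x - \<xi>" \<xi>] by (simp add: dist_norm norm_minus_commute)
  qed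
  have der: "cmod ((deriv ^^ k) G \<xi>) \<le> fact k * M" if "\<xi> \<in> cball 0 1" for k \<xi>
  proof -
    have "cmod ((deriv ^^ k) G \<xi>) \<le> fact k * M / 1 ^ k"
    proof (rule Cauchy_inequality)
      show "G holomorphic_on ball \<xi> 1" using sub[OF that] hol by (meson ball_subset_cball holomorphic_on_subset order_trans)
      show "continuous_on (cball \<xi> 1) G" using sub[OF that] hol holomorphic_on_imp_continuous_on continuous_on_subset by blast
      show "norm (G x) \<le> M" if "norm (\<xi> - x) = 1" for x
        using that sub[OF \<open>\<xi> \<in> cball 0 1\<close>] bd by (auto simp: dist_norm subset_iff)
    qed simp
    then show ?thesis by simp
  qed
  show "cmod (deriv G 0) \<le> M" using der[of 0 1] by simp
  have "cmod ((deriv ^^ 0) G (of_real s) - (\<Sum>i\<le>1. (deriv ^^ i) G 0 * (of_real s - 0) ^ i / fact i)) \<le> 2 * M * cmod (of_real s - 0) ^ Suc 1 / fact 1"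
  proof (rule complex_Taylor[where S = "cball 0 1"])
    show "((deriv ^^ i) G has_field_derivative (deriv ^^ Suc i) G x) (at x within cball 0 1)" if "x \<in> cball 0 1" for i x
    proof -
      have "(deriv ^^ i) G holomorphic_on ball 0 4" by (rule holomorphic_higher_deriv[OF hol open_ball])
      moreover have "x \<in> ball 0 4" using that by auto
      ultimately have "((deriv ^^ i) G has_field_derivative deriv ((deriv ^^ i) G) x) (at x)"
        using holomorphic_derivI open_ball by blast
      then show ?thesis by (simp add: has_field_derivative_at_within)
    qed
    show "cmod ((deriv ^^ Suc 1) G x) \<le> 2 * M" if "x \<in> cball 0 1" for x
      using der[OF that, of 2] by (simp add: numeral_2_eq_2)
  qed (use s in auto)
  then show "cmod (G (of_real s) - G 0 - deriv G 0 * of_real s) \<le> 2 * M * s\<^sup>2"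
    using s by (simp add: power2_eq_square algebra_simps)
qed

section \<open>Cauchy estimates for complex differentiable functions\<close>

definition orthogonal_complex_structure :: "real^'n^'n \<Rightarrow> bool" where
  "orthogonal_complex_structure J \<longleftrightarrow> complex_structure J \<and> (\<forall>v w. (J *v v) \<bullet> (J *v w) = v \<bullet> w)"

lemma orthogonal_complex_structureD:
  assumes "orthogonal_complex_structure J"
  shows "complex_structure J" "(J *v v) \<bullet> (J *v w) = v \<bullet> w" "(J *v v) \<bullet> w = - (v \<bullet> (J *v w))"
    "v \<bullet> (J *v v) = 0" "norm (J *v v) = norm v"
proof -
  show 1: "complex_structure J" and 2: "(J *v v) \<bullet> (J *v w) = v \<bullet> w" for v w
    using assms by (auto simp: orthogonal_complex_structure_def)
  show 3: "(J *v v) \<bullet> w = - (v \<bullet> (J *v w))" for v w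
    using 2[of v "J *v w"] complex_structure_twice[OF 1, of w] by simp
  show "v \<bullet> (J *v v) = 0" using 3[of v v] by (simp add: inner_commute)
  show "norm (J *v v) = norm v" using 2[of v v] by (simp add: norm_eq_sqrt_inner)
qed

lemma norm_cscale:
  assumes "orthogonal_complex_structure J"
  shows "norm (cscale J c v) = cmod c * norm v"
proof -
  note J = orthogonal_complex_structureD[OF assms]
  have "cscale J c v \<bullet> cscale J c v = (Re c)\<^sup>2 * (v \<bullet> v) + (Im c)\<^sup>2 * (v \<bullet> v)"
    by (simp add: cscale_def inner_add_left inner_add_right J(2,4) inner_commute[of "J *v v" v] power2_eq_square)
  also have "\<dots> = (cmod c * norm v)\<^sup>2"
    by (simp add: cmod_power2 power_mult_distrib power2_norm_eq_inner algebra_simps)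
  finally show ?thesis by (simp add: norm_eq_sqrt_inner real_sqrt_unique)
qed

lemma cderiv_cscale:
  assumes "cderiv J F D x"
  shows "D (cscale J c v) = c * D v"
proof -
  have lin: "linear D" "D (J *v v) = \<i> * D v" 
    using assms has_derivative_linear unfolding cderiv_def by blast+
  have "D (cscale J c v) = Re c *\<^sub>R D v + Im c *\<^sub>R (\<i> * D v)"
    unfolding cscale_def linear_add[OF lin(1)] linear_cmul[OF lin(1)] lin(2) ..
  also have "\<dots> = c * D v" by (subst (3) complex_eq) (simp add: scaleR_conv_of_real algebra_simps)
  finally show ?thesis .
qed

lemma cderiv_on_line:
  assumes "cderiv J F D (x + cscale J t u)"
  shows "((\<lambda>t. F (x + cscale J t u)) has_field_derivative D u) (at t)"
proof -
  have "bounded_linear (\<lambda>t. cscale J t u)" using linear_cscale linear_conv_bounded_linear by blast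
  then have "((\<lambda>t. x + cscale J t u) has_derivative (\<lambda>h. cscale J h u)) (at t)"
    by (auto intro!: derivative_eq_intros bounded_linear_imp_has_derivative)
  moreover have "(F has_derivative D) (at (x + cscale J t u))" using assms by (simp add: cderiv_def)
  ultimately have "((\<lambda>t. F (x + cscale J t u)) has_derivative (\<lambda>h. D (cscale J h u))) (at t)"
    by (rule has_derivative_compose)
  moreover have "(\<lambda>h. D (cscale J h u)) = (*) (D u)"
    by (auto simp: cderiv_cscale[OF assms] mult.commute)
  ultimately show ?thesis by (simp add: has_field_derivative_def)
qed

text \<open>The function is restricted to the complex line through \<open>z0\<close> in direction
  \<open>v\<close>. The direction is rescaled to length \<open>R / 4\<close>, so that the parameter
  disc of radius 4 fills the ball of radius \<open>R\<close>. Then \<open>v\<close> has parameter s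
  = 4|v|/R, and the constants 4 M / R and 32 M / R^2 are s M / |v| and 2 M s^2 / |v|^2.\<close>

lemma cderiv_estimates:
  assumes J: "orthogonal_complex_structure J" and R: "0 < R"
    and hol: "\<And>z. z \<in> ball z0 R \<Longrightarrow> \<exists>D. cderiv J F D z"
    and bd: "\<And>z. z \<in> ball z0 R \<Longrightarrow> cmod (F z) \<le> M" and D: "cderiv J F D z0"
  shows "cmod (D v) \<le> 4 * M / R * norm v"
    and "norm v \<le> R / 4 \<Longrightarrow> cmod (F (z0 + v) - F z0 - D v) \<le> 32 * M / R\<^sup>2 * (norm v)\<^sup>2"
proof -
  have lin: "linear D" using D has_derivative_linear unfolding cderiv_def by blast
  have *: "cmod (D v) \<le> 4 * M / R * norm v \<and> (norm v \<le> R / 4 \<longrightarrow> cmod (F (z0 + v) - F z0 - D v) \<le> 32 * M / R\<^sup>2 * (norm v)\<^sup>2)"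
  proof (cases "v = 0")
    case True
    then show ?thesis using linear_0[OF lin] by simp
  next
    case False
    define u where "u = (R / (4 * norm v)) *\<^sub>R v"
    define s where "s = 4 * norm v / R"
    have nu: "norm u = R / 4" using False R by (simp add: u_def)
    have s: "0 < s" using False R by (simp add: s_def)
    have v: "v = s *\<^sub>R u" using False R by (simp add: s_def u_def)
    define G where "G t = F (z0 + cscale J t u)" for t
    have in_ball: "z0 + cscale J t u \<in> ball z0 R" if "t \<in> ball 0 4" for t
    proof -
      have "cmod t * (R / 4) < 4 * (R / 4)" using that R by (intro mult_strict_right_mono) auto
      then show ?thesis by (simp add: dist_norm norm_cscale[OF J] nu)
    qed
    have "G holomorphic_on ball 0 4"
      unfolding holomorphic_on_open[OF open_ball] G_def using cderiv_on_line hol in_ball by blast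
    moreover have "cmod (G t) \<le> M" if "t \<in> ball 0 4" for t unfolding G_def using bd in_ball that by blast
    moreover have "cscale J (of_real r) u = r *\<^sub>R u" for r by (simp add: cscale_def)
    moreover have "deriv G 0 = D u"
      unfolding G_def using D cderiv_on_line[of J F D z0 0 u] by (intro DERIV_imp_deriv) (simp add: cscale_simps)
    ultimately have 1: "cmod (D u) \<le> M" 
      and 2: "s \<le> 1 \<Longrightarrow> cmod (F (z0 + s *\<^sub>R u) - F z0 - D u * of_real s) \<le> 2 * M * s\<^sup>2"
      using Cauchy_estimates_unit[of G M 0] Cauchy_estimates_unit[of G M s] s
      by (auto simp: G_def cscale_simps)
    have Dv: "D v = of_real s * D u" unfolding v linear_cmul[OF lin] by (simp add: scaleR_conv_of_real)
    have "cmod (D v) \<le> s * M" unfolding Dv norm_mult using 1 s by simp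
    also have "s * M = 4 * M / R * norm v" by (simp add: s_def)
    finally have a: "cmod (D v) \<le> 4 * M / R * norm v" .
    have b: "cmod (F (z0 + v) - F z0 - D v) \<le> 32 * M / R\<^sup>2 * (norm v)\<^sup>2" if "norm v \<le> R / 4"
    proof -
      have "s \<le> 1" using that R by (simp add: s_def)
      then have "cmod (F (z0 + v) - F z0 - D v) \<le> 2 * M * s\<^sup>2"
        using 2 unfolding Dv v[symmetric] by (simp add: mult.commute)
      also have "\<dots> = 32 * M / R\<^sup>2 * (norm v)\<^sup>2" by (simp add: s_def power_divide power_mult_distrib)
      finally show ?thesis .
    qed
    show ?thesis using a b by blast
  qed
  show "cmod (D v) \<le> 4 * M / R * norm v" using * by blast
  show "norm v \<le> R / 4 \<Longrightarrow> cmod (F (z0 + v) - F z0 - D v) \<le> 32 * M / R\<^sup>2 * (norm v)\<^sup>2" using * by blast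
qed

lemma infsum_diff_complex:
  fixes f g :: "'i \<Rightarrow> complex"
  assumes "f summable_on I" "g summable_on I"
  shows "(\<lambda>i. f i - g i) summable_on I" "(\<Sum>\<^sub>\<infinity>i\<in>I. f i - g i) = infsum f I - infsum g I"
proof -
  have g: "(\<lambda>i. (-1) * g i) summable_on I" by (rule summable_on_cmult_right[OF assms(2)])
  show "(\<lambda>i. f i - g i) summable_on I" using summable_on_add[OF assms(1) g] by simp
  show "(\<Sum>\<^sub>\<infinity>i\<in>I. f i - g i) = infsum f I - infsum g I"
    using infsum_add[OF assms(1) g] infsum_cmult_right[of "-1" g I] assms(2) by simp
qed

text \<open>The remainder of the i-th term is at most a fixed multiple of \<open>M i\<close> times
  |v|^2. These bounds can be summed, so the series is differentiated term by term.\<close>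

lemma cderiv_infsum:
  assumes J: "orthogonal_complex_structure J" and R: "0 < R"
    and hol: "\<And>i z. i \<in> I \<Longrightarrow> z \<in> ball z0 R \<Longrightarrow> \<exists>D. cderiv J (F i) D z"
    and bd: "\<And>i z. i \<in> I \<Longrightarrow> z \<in> ball z0 R \<Longrightarrow> cmod (F i z) \<le> M i" and M: "M summable_on I"
  shows "\<exists>D. cderiv J (\<lambda>z. \<Sum>\<^sub>\<infinity>i\<in>I. F i z) D z0"
proof -
  have "\<forall>i. \<exists>D. i \<in> I \<longrightarrow> cderiv J (F i) D z0" using hol R by (metis centre_in_ball)
  then obtain D where D: "\<And>i. i \<in> I \<Longrightarrow> cderiv J (F i) (D i) z0" by (metis choice)
  have est: "i \<in> I \<Longrightarrow> cmod (D i v) \<le> 4 * M i / R * norm v"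
    "i \<in> I \<Longrightarrow> norm v \<le> R / 4 \<Longrightarrow> cmod (F i (z0 + v) - F i z0 - D i v) \<le> 32 * M i / R\<^sup>2 * (norm v)\<^sup>2" for i v
    using cderiv_estimates[OF J R hol bd D] by blast+
  have M0: "0 \<le> M i" if "i \<in> I" for i using bd[OF that, of z0] R norm_ge_zero order_trans by (metis centre_in_ball)
  have sF: "(\<lambda>i. F i z) summable_on I" if "z \<in> ball z0 R" for z
  proof (rule abs_summable_summable)
    show "(\<lambda>i. cmod (F i z)) summable_on I" by (rule summable_on_comparison_test[OF M]) (use bd that in auto)
  qed
  have sM: "(\<lambda>i. c * M i) summable_on I" for c using M by (rule summable_on_cmult_right)
  have sD: "(\<lambda>i. D i v) summable_on I" for v
  proof (rule abs_summable_summable, rule summable_on_comparison_test[OF sM[of "4 / R * norm v"]])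
    show "cmod (D i v) \<le> 4 / R * norm v * M i" if "i \<in> I" for i using est(1)[OF that, of v] by (simp add: mult_ac)
  qed simp
  let ?D = "\<lambda>v. \<Sum>\<^sub>\<infinity>i\<in>I. D i v"
  let ?S = "\<Sum>\<^sub>\<infinity>i\<in>I. M i"
  have S0: "0 \<le> ?S" by (rule infsum_nonneg) (rule M0)
  have lin: "linear (D i)" if "i \<in> I" for i using D[OF that] has_derivative_linear unfolding cderiv_def by blast
  have "linear ?D"
  proof (rule linearI)
    fix u v
    have "?D (u + v) = (\<Sum>\<^sub>\<infinity>i\<in>I. D i u + D i v)" by (intro infsum_cong) (simp add: linear_add lin)
    also have "\<dots> = ?D u + ?D v" by (rule infsum_add[OF sD sD])
    finally show "?D (u + v) = ?D u + ?D v" .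
    fix r
    have "?D (r *\<^sub>R v) = (\<Sum>\<^sub>\<infinity>i\<in>I. r *\<^sub>R D i v)" by (intro infsum_cong) (simp add: linear_cmul lin)
    also have "\<dots> = r *\<^sub>R ?D v" by (rule infsum_scaleR_right)
    finally show "?D (r *\<^sub>R v) = r *\<^sub>R ?D v" .
  qed
  then have bl: "bounded_linear ?D" by (simp add: linear_conv_bounded_linear)
  have "((\<lambda>z. \<Sum>\<^sub>\<infinity>i\<in>I. F i z) has_derivative ?D) (at z0)"
    unfolding has_derivative_at_alt
  proof (intro conjI bl allI impI)
    fix e :: real assume e: "e > 0"
    define K where "K = 32 / R\<^sup>2 * ?S + 1"
    have K: "K > 0" using S0 R by (simp add: K_def add_nonneg_pos)
    have "norm ((\<Sum>\<^sub>\<infinity>i\<in>I. F i y) - (\<Sum>\<^sub>\<infinity>i\<in>I. F i z0) - ?D (y - z0)) \<le> e * norm (y - z0)"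
      if y: "norm (y - z0) < min (R / 4) (e / K)" for y
    proof -
      let ?v = "y - z0"
      have yb: "y \<in> ball z0 R" "z0 \<in> ball z0 R" using y R by (auto simp: dist_norm norm_minus_commute)
      have sd: "(\<lambda>i. F i y - F i z0) summable_on I" using sF[OF yb(1)] sF[OF yb(2)] by (rule infsum_diff_complex)
      have "(\<Sum>\<^sub>\<infinity>i\<in>I. F i y) - (\<Sum>\<^sub>\<infinity>i\<in>I. F i z0) - ?D ?v = (\<Sum>\<^sub>\<infinity>i\<in>I. F i y - F i z0 - D i ?v)"
        by (simp add: infsum_diff_complex(2) sF[OF yb(1)] sF[OF yb(2)] sd sD)
      also have "norm \<dots> \<le> (\<Sum>\<^sub>\<infinity>i\<in>I. (32 / R\<^sup>2 * (norm ?v)\<^sup>2) * M i)"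
      proof (rule norm_infsum_le)
        show "((\<lambda>i. F i y - F i z0 - D i ?v) has_sum (\<Sum>\<^sub>\<infinity>i\<in>I. F i y - F i z0 - D i ?v)) I"
          by (rule has_sum_infsum, rule infsum_diff_complex(1)[OF sd sD])
        show "((\<lambda>i. (32 / R\<^sup>2 * (norm ?v)\<^sup>2) * M i) has_sum (\<Sum>\<^sub>\<infinity>i\<in>I. (32 / R\<^sup>2 * (norm ?v)\<^sup>2) * M i)) I"
          by (rule has_sum_infsum, rule sM)
        show "norm (F i y - F i z0 - D i ?v) \<le> (32 / R\<^sup>2 * (norm ?v)\<^sup>2) * M i" if "i \<in> I" for i
          using est(2)[OF that, of ?v] y by (simp add: mult_ac)
      qed
      also have "\<dots> = (32 / R\<^sup>2 * (norm ?v)\<^sup>2) * ?S" by (rule infsum_cmult_right[OF M])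
      also have "\<dots> \<le> K * norm ?v * norm ?v"
        by (simp add: K_def power2_eq_square algebra_simps)
      also have "\<dots> \<le> e * norm ?v"
      proof (rule mult_right_mono)
        show "K * norm ?v \<le> e" using y K by (simp add: pos_less_divide_eq mult.commute less_imp_le)
      qed simp
      finally show ?thesis .
    qed
    then show "\<exists>d>0. \<forall>y. norm (y - z0) < d \<longrightarrow>
        norm ((\<Sum>\<^sub>\<infinity>i\<in>I. F i y) - (\<Sum>\<^sub>\<infinity>i\<in>I. F i z0) - ?D (y - z0)) \<le> e * norm (y - z0)"
      using R e K by (intro exI[of _ "min (R / 4) (e / K)"]) auto
  qed
  moreover have "?D (J *v v) = \<i> * ?D v" for v
  proof -
    have "?D (J *v v) = (\<Sum>\<^sub>\<infinity>i\<in>I. \<i> * D i v)" by (intro infsum_cong) (use D in \<open>auto simp: cderiv_def\<close>)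
    then show ?thesis by (simp add: infsum_cmult_right sD)
  qed
  ultimately show ?thesis unfolding cderiv_def by blast
qed


section \<open>Sums of Gaussians over separated families\<close>

text \<open>Packing: the balls of radius \<rho>/2 around the points are disjoint and lie in the ball
  of radius r + \<rho>/2, so their number is bounded by the quotient of volumes.\<close>

lemma card_separated_le:
  fixes p :: "'i \<Rightarrow> 'a::euclidean_space"
  assumes \<rho>: "\<rho> > 0" and F: "finite F" and sep: "\<And>i j. i \<in> F \<Longrightarrow> j \<in> F \<Longrightarrow> i \<noteq> j \<Longrightarrow> \<rho> \<le> dist (p i) (p j)"
    and r: "0 \<le> r" "\<And>i. i \<in> F \<Longrightarrow> dist w (p i) \<le> r"
  shows "real (card F) \<le> (1 + 2 * r / \<rho>) ^ DIM('a)"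
proof -
  let ?V = "unit_ball_vol (real DIM('a))"
  have V: "?V > 0" by simp
  have disj: "disjoint_family_on (\<lambda>i. ball (p i) (\<rho> / 2)) F"
    unfolding disjoint_family_on_def
  proof (intro ballI impI)
    fix i j assume ij: "i \<in> F" "j \<in> F" "i \<noteq> j"
    show "ball (p i) (\<rho> / 2) \<inter> ball (p j) (\<rho> / 2) = {}"
    proof (rule ccontr)
      assume "ball (p i) (\<rho> / 2) \<inter> ball (p j) (\<rho> / 2) \<noteq> {}"
      then obtain x where "dist (p i) x < \<rho> / 2" "dist (p j) x < \<rho> / 2" by auto
      then have "dist (p i) (p j) < \<rho>" using dist_triangle_half_l[of "p i" x \<rho> "p j"] by (simp add: dist_commute)
      then show False using sep[OF ij] by simp
    qed
  qed
  have "real (card F) * (?V * (\<rho> / 2) ^ DIM('a)) = (\<Sum>i\<in>F. measure lborel (ball (p i) (\<rho> / 2)))"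
    using \<rho> by (simp add: content_ball)
  also have "\<dots> = measure lborel (\<Union>i\<in>F. ball (p i) (\<rho> / 2))"
    by (rule measure_finite_Union[symmetric]) (use F disj emeasure_lborel_ball_finite in \<open>auto simp: less_top\<close>)
  also have "\<dots> \<le> measure lborel (ball w (r + \<rho> / 2))"
  proof (rule measure_mono_fmeasurable)
    show "(\<Union>i\<in>F. ball (p i) (\<rho> / 2)) \<subseteq> ball w (r + \<rho> / 2)"
    proof
      fix x assume "x \<in> (\<Union>i\<in>F. ball (p i) (\<rho> / 2))"
      then obtain i where "i \<in> F" "dist (p i) x < \<rho> / 2" by auto
      then show "x \<in> ball w (r + \<rho> / 2)" using r(2)[of i] dist_triangle[of w x "p i"] by simp
    qed
    show "ball w (r + \<rho> / 2) \<in> fmeasurable lborel" by (rule fmeasurableI) (simp, rule emeasure_lborel_ball_finite)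
  qed (use F in auto)
  also have "\<dots> = ?V * (r + \<rho> / 2) ^ DIM('a)" using r \<rho> by (simp add: content_ball)
  finally have "?V * (real (card F) * (\<rho> / 2) ^ DIM('a)) \<le> ?V * (r + \<rho> / 2) ^ DIM('a)" by (simp add: mult_ac)
  then have "real (card F) * (\<rho> / 2) ^ DIM('a) \<le> (r + \<rho> / 2) ^ DIM('a)" using V by (simp only: mult_le_cancel_left_pos)
  also have "r + \<rho> / 2 = (1 + 2 * r / \<rho>) * (\<rho> / 2)" using \<rho> by (simp add: field_simps)
  also have "((1 + 2 * r / \<rho>) * (\<rho> / 2)) ^ DIM('a) = (1 + 2 * r / \<rho>) ^ DIM('a) * (\<rho> / 2) ^ DIM('a)" by (rule power_mult_distrib)
  finally show ?thesis using \<rho> by (simp only: mult_le_cancel_right) auto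
qed

text \<open>With B = 2/\<rho>, the shell of points at distance between l and l + 1 has at most exp(n
  B (l + 1)) members. Against exp(-l^2/4) this leaves the constant exp(n B + (n B + 1)^2) and a
  geometric series. Neither the centre nor the family enters.\<close>

definition gauss_bound :: "nat \<Rightarrow> real \<Rightarrow> real" where
  "gauss_bound n \<rho> = exp (real n * (2 / \<rho>) + (real n * (2 / \<rho>) + 1)\<^sup>2) * (\<Sum>k. exp (- 1) ^ k)"

lemma gauss_bound_pos: "0 < gauss_bound n \<rho>"
proof -
  have "(\<Sum>k. exp (- 1 :: real) ^ k) = 1 / (1 - exp (- 1))" by (rule suminf_geometric) simp
  then show ?thesis by (simp add: gauss_bound_def)
qed

lemma sum_gauss_separated_le:
  fixes p :: "'i \<Rightarrow> 'a::euclidean_space"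
  assumes \<rho>: "\<rho> > 0" and F: "finite F" and sep: "\<And>i j. i \<in> F \<Longrightarrow> j \<in> F \<Longrightarrow> i \<noteq> j \<Longrightarrow> \<rho> \<le> dist (p i) (p j)"
  shows "(\<Sum>i\<in>F. exp (- (dist w (p i))\<^sup>2 / 4)) \<le> gauss_bound DIM('a) \<rho>"
proof -
  let ?n = "real DIM('a)"
  let ?B = "2 / \<rho>"
  define k where "k i = nat \<lfloor>dist w (p i)\<rfloor>" for i
  have k: "real (k i) \<le> dist w (p i)" "dist w (p i) \<le> real (k i) + 1" for i
    unfolding k_def by (simp, linarith)
  let ?E = "exp (?n * ?B + (?n * ?B + 1)\<^sup>2)"
  have layer: "(\<Sum>i\<in>{i \<in> F. k i = l}. exp (- (dist w (p i))\<^sup>2 / 4)) \<le> ?E * exp (- 1) ^ l" for l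
  proof -
    let ?F = "{i \<in> F. k i = l}"
    have "real (card ?F) \<le> (1 + 2 * (real l + 1) / \<rho>) ^ DIM('a)"
      by (rule card_separated_le[OF \<rho>]) (use F sep k in auto)
    also have "\<dots> \<le> exp (2 * (real l + 1) / \<rho>) ^ DIM('a)"
      using \<rho> by (intro power_mono) (auto simp: add.commute exp_ge_add_one_self)
    also have "\<dots> = exp (?n * ?B * (real l + 1))" by (simp add: exp_of_nat_mult[symmetric] algebra_simps)
    finally have c: "real (card ?F) \<le> exp (?n * ?B * (real l + 1))" .
    have "(\<Sum>i\<in>?F. exp (- (dist w (p i))\<^sup>2 / 4)) \<le> (\<Sum>i\<in>?F. exp (- (real l)\<^sup>2 / 4))"
      using k(1) by (intro sum_mono) (auto intro: power_mono)
    also have "\<dots> = real (card ?F) * exp (- (real l)\<^sup>2 / 4)" by simp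
    also have "\<dots> \<le> exp (?n * ?B * (real l + 1)) * exp (- (real l)\<^sup>2 / 4)"
      using c by (intro mult_right_mono) auto
    also have "\<dots> = exp (?n * ?B * (real l + 1) - (real l)\<^sup>2 / 4)" by (simp add: exp_add[symmetric])
    also have "\<dots> \<le> exp (?n * ?B + (?n * ?B + 1)\<^sup>2 - real l)"
    proof -
      \<comment> \<open>Completing the square bounds -l^2/4 by a linear term. The slope n B + 1
        leaves exp(-l) after the growth of the shells is cancelled.\<close>
      have "0 \<le> (real l / 2 - (?n * ?B + 1))\<^sup>2" by simp
      also have "\<dots> = (real l)\<^sup>2 / 4 - (?n * ?B + 1) * real l + (?n * ?B + 1)\<^sup>2"
        by (simp add: power2_diff power_divide)
      finally have "?n * ?B * (real l + 1) - (real l)\<^sup>2 / 4 \<le> ?n * ?B + (?n * ?B + 1)\<^sup>2 - real l"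
        by (simp add: distrib_left distrib_right)
      then show ?thesis by simp
    qed
    also have "\<dots> = ?E * exp (- 1) ^ l" by (simp add: exp_diff exp_of_nat_mult[symmetric] exp_minus field_simps)
    finally show ?thesis .
  qed
  have "(\<Sum>i\<in>F. exp (- (dist w (p i))\<^sup>2 / 4)) = (\<Sum>l\<in>k ` F. \<Sum>i\<in>{i \<in> F. k i = l}. exp (- (dist w (p i))\<^sup>2 / 4))"
    by (rule sum.image_gen[OF F])
  also have "\<dots> \<le> (\<Sum>l\<in>k ` F. ?E * exp (- 1) ^ l)" by (intro sum_mono layer)
  also have "\<dots> = ?E * (\<Sum>l\<in>k ` F. exp (- 1) ^ l)" by (simp add: sum_distrib_left)
  also have "\<dots> \<le> ?E * (\<Sum>k. exp (- 1) ^ k)"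
    using F by (intro mult_left_mono sum_le_suminf summable_geometric) auto
  finally show ?thesis by (simp add: gauss_bound_def)
qed

lemma gauss_summable_separated:
  fixes p :: "'i \<Rightarrow> 'a::euclidean_space"
  assumes \<rho>: "\<rho> > 0" and sep: "\<And>i j. i \<in> I \<Longrightarrow> j \<in> I \<Longrightarrow> i \<noteq> j \<Longrightarrow> \<rho> \<le> dist (p i) (p j)"
  shows "(\<lambda>i. exp (- (dist w (p i))\<^sup>2 / 4)) summable_on I"
    and "(\<Sum>\<^sub>\<infinity>i\<in>I. exp (- (dist w (p i))\<^sup>2 / 4)) \<le> gauss_bound DIM('a) \<rho>"
proof -
  have fin: "(\<Sum>i\<in>F. exp (- (dist w (p i))\<^sup>2 / 4)) \<le> gauss_bound DIM('a) \<rho>" if "finite F" "F \<subseteq> I" for F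
    using that sep by (intro sum_gauss_separated_le[OF \<rho>]) auto
  show s: "(\<lambda>i. exp (- (dist w (p i))\<^sup>2 / 4)) summable_on I"
    by (rule nonneg_bdd_above_summable_on) (use fin in \<open>auto intro!: bdd_aboveI2\<close>)
  show "(\<Sum>\<^sub>\<infinity>i\<in>I. exp (- (dist w (p i))\<^sup>2 / 4)) \<le> gauss_bound DIM('a) \<rho>"
    by (rule infsum_le_finite_sums[OF s fin])
qed

section \<open>Poincare series\<close>

lemma cmod_infsum_le:
  fixes f :: "'i \<Rightarrow> complex"
  assumes "\<And>i. i \<in> I \<Longrightarrow> cmod (f i) \<le> g i" "g summable_on I"
  shows "f summable_on I" "cmod (infsum f I) \<le> infsum g I"
proof -
  show s: "f summable_on I"
    by (rule abs_summable_summable, rule summable_on_comparison_test[OF assms(2)]) (use assms(1) in auto)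
  show "cmod (infsum f I) \<le> infsum g I"
    by (rule norm_infsum_le[OF has_sum_infsum[OF s] has_sum_infsum[OF assms(2)] assms(1)])
qed

section \<open>Rules for complex derivatives and the Hermitian form\<close>

lemma cderiv_const: "cderiv J (\<lambda>_. c) (\<lambda>_. 0) z"
  by (simp add: cderiv_def)

lemma cderiv_diff: "cderiv J f D z \<Longrightarrow> cderiv J g E z \<Longrightarrow> cderiv J (\<lambda>x. f x - g x) (\<lambda>v. D v - E v) z"
  by (auto simp: cderiv_def right_diff_distrib intro: has_derivative_diff)

lemma cderiv_mult:
  "cderiv J f D z \<Longrightarrow> cderiv J g E z \<Longrightarrow> cderiv J (\<lambda>x. f x * g x) (\<lambda>v. f z * E v + D v * g z) z"
  by (auto simp: cderiv_def algebra_simps dest: has_derivative_mult)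

lemma cderiv_exp: 
  assumes "cderiv J f D z"
  shows "cderiv J (\<lambda>x. exp (f x)) (\<lambda>v. exp (f z) * D v) z"
proof -
  have "(exp has_derivative (*) (exp (f z))) (at (f z))"
    using DERIV_exp[of "f z"] by (simp add: has_field_derivative_def)
  moreover have "(f has_derivative D) (at z)" using assms by (simp add: cderiv_def)
  ultimately have "((\<lambda>x. exp (f x)) has_derivative (\<lambda>v. exp (f z) * D v)) (at z)"
    using has_derivative_compose by blast
  then show ?thesis using assms by (simp add: cderiv_def)
qed

text \<open>Complex linear in the first argument. The real part is the inner product and the
  imaginary part the symplectic form whose values on translation parts the locale below requires to
  be in 2 pi Z.\<close>

definition herm :: "real^'n^'n \<Rightarrow> real^'n \<Rightarrow> real^'n \<Rightarrow> complex" where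
  "herm J x y = Complex (x \<bullet> y) (x \<bullet> (J *v y))"

lemma herm_simps:
  "herm J (x + y) z = herm J x z + herm J y z" "herm J (x - y) z = herm J x z - herm J y z"
  "herm J x (y + z) = herm J x y + herm J x z" "herm J 0 z = 0" "herm J z 0 = 0"
  "Re (herm J x y) = x \<bullet> y" "Im (herm J x y) = x \<bullet> (J *v y)"
  by (simp_all add: herm_def complex_eq_iff inner_add_left inner_add_right inner_diff_left matrix_vector_right_distrib)

lemma linear_herm: "linear (\<lambda>x. herm J x y)"
  by (rule linearI) (simp_all add: herm_def complex_eq_iff inner_add_left)

lemma herm_ii: "orthogonal_complex_structure J \<Longrightarrow> herm J (J *v x) y = \<i> * herm J x y"
  using orthogonal_complex_structureD(2)[of J x y] orthogonal_complex_structureD(3)[of J x y]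
  by (simp add: herm_def complex_eq_iff)

lemma cmod_herm_le: 
  assumes "orthogonal_complex_structure J"
  shows "cmod (herm J x y) \<le> 2 * norm x * norm y"
proof -
  have "cmod (herm J x y) \<le> \<bar>x \<bullet> y\<bar> + \<bar>x \<bullet> (J *v y)\<bar>"
    using cmod_le[of "herm J x y"] by (simp add: herm_simps)
  also have "\<dots> \<le> norm x * norm y + norm x * norm (J *v y)"
    by (intro add_mono Cauchy_Schwarz_ineq2)
  finally show ?thesis by (simp add: orthogonal_complex_structureD(5)[OF assms])
qed

lemma cderiv_herm:
  assumes J: "orthogonal_complex_structure J" and A: "A ** J = J ** A"
  shows "cderiv J (\<lambda>z. herm J (A *v z + b) w) (\<lambda>v. herm J (A *v v) w) z"
proof -
  have "linear (\<lambda>v. herm J (A *v v) w)"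
    using linear_compose[OF matrix_vector_mul_linear[of A] linear_herm[of J w]] by (simp add: comp_def)
  then have "((\<lambda>v. herm J (A *v v) w) has_derivative (\<lambda>v. herm J (A *v v) w)) (at z)"
    by (intro bounded_linear_imp_has_derivative) (simp add: linear_conv_bounded_linear)
  then have "((\<lambda>v. herm J (A *v v) w + herm J b w) has_derivative (\<lambda>v. herm J (A *v v) w)) (at z)"
    by (rule has_derivative_add_const)
  moreover have "herm J (A *v (J *v v)) w = \<i> * herm J (A *v v) w" for v
    using A herm_ii[OF J] by (simp add: matrix_vector_mul_assoc) (simp flip: matrix_vector_mul_assoc)
  ultimately show ?thesis by (simp add: cderiv_def herm_simps)
qed

text \<open>
  The group \<open>\<Gamma>\<close> acts by unitary affine maps; \<open>integral\<close> makes the factors \<open>jac\<close> below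
  an automorphy factor, that is, a cocycle.
\<close>

locale crystallographic =
  fixes J :: "real^'n^'n" and \<Gamma> :: "(real^'n \<Rightarrow> real^'n) set" and \<rho> R C :: real
  assumes J: "orthogonal_complex_structure J"
    and affine: "\<And>\<gamma>. \<gamma> \<in> \<Gamma> \<Longrightarrow> \<exists>A b. (\<forall>x. \<gamma> x = A *v x + b) \<and> (\<forall>x y. (A *v x) \<bullet> (A *v y) = x \<bullet> y) \<and> A ** J = J ** A"
    and one: "(\<lambda>x. x) \<in> \<Gamma>"
    and mult: "\<And>\<gamma> \<delta>. \<gamma> \<in> \<Gamma> \<Longrightarrow> \<delta> \<in> \<Gamma> \<Longrightarrow> (\<lambda>x. \<gamma> (\<delta> x)) \<in> \<Gamma>"
    and inverse: "\<And>\<gamma>. \<gamma> \<in> \<Gamma> \<Longrightarrow> \<exists>\<delta>\<in>\<Gamma>. \<forall>x. \<delta> (\<gamma> x) = x \<and> \<gamma> (\<delta> x) = x"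
    and integral: "\<And>\<gamma> \<delta>. \<gamma> \<in> \<Gamma> \<Longrightarrow> \<delta> \<in> \<Gamma> \<Longrightarrow> \<exists>k::int. (\<gamma> (\<delta> 0) - \<gamma> 0) \<bullet> (J *v \<gamma> 0) = 2 * pi * of_int k"
    and rho: "0 < \<rho>" and disp: "\<And>\<gamma> z. \<gamma> \<in> \<Gamma> \<Longrightarrow> \<gamma> \<noteq> (\<lambda>x. x) \<Longrightarrow> \<rho> \<le> norm (\<gamma> z - z)"
    and C: "C = gauss_bound CARD('n) \<rho>"
    and cobounded: "\<And>x. \<exists>\<gamma>\<in>\<Gamma>. norm (\<gamma> x) \<le> R"
begin

section \<open>Orbits and Poincare series of the affine group\<close>

lemma isometry: "\<gamma> \<in> \<Gamma> \<Longrightarrow> norm (\<gamma> x - \<gamma> y) = norm (x - y)"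
proof -
  assume "\<gamma> \<in> \<Gamma>"
  then obtain A b where A: "\<And>x. \<gamma> x = A *v x + b" "\<And>x y. (A *v x) \<bullet> (A *v y) = x \<bullet> y" using affine by blast
  have "\<gamma> x - \<gamma> y = A *v (x - y)" by (simp add: A matrix_vector_mult_diff_distrib)
  then show ?thesis by (simp add: norm_eq_sqrt_inner A(2))
qed

lemma herm_affine:
  assumes "\<gamma> \<in> \<Gamma>"
  shows "herm J (\<gamma> x - \<gamma> y) (\<gamma> z - \<gamma> w) = herm J (x - y) (z - w)"
proof -
  obtain A b where A: "\<And>x. \<gamma> x = A *v x + b" "\<And>x y. (A *v x) \<bullet> (A *v y) = x \<bullet> y" "A ** J = J ** A" 
    using affine[OF assms] by blast
  have d: "\<gamma> x - \<gamma> y = A *v (x - y)" for x y by (simp add: A matrix_vector_mult_diff_distrib)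
  have JA: "J *v (A *v v) = A *v (J *v v)" for v by (simp add: matrix_vector_mul_assoc A(3))
  show ?thesis by (simp add: d herm_def JA A(2))
qed

lemma separated:
  assumes "\<gamma> \<in> \<Gamma>" "\<delta> \<in> \<Gamma>" "\<gamma> \<noteq> \<delta>"
  shows "\<rho> \<le> dist (\<gamma> z) (\<delta> z)"
proof -
  obtain \<delta>' where d: "\<delta>' \<in> \<Gamma>" "\<forall>x. \<delta>' (\<delta> x) = x \<and> \<delta> (\<delta>' x) = x" using inverse[OF assms(2)] by blast
  have "(\<lambda>x. \<delta>' (\<gamma> x)) \<noteq> (\<lambda>x. x)"
  proof
    assume "(\<lambda>x. \<delta>' (\<gamma> x)) = (\<lambda>x. x)"
    then have "\<delta> (\<delta>' (\<gamma> x)) = \<delta> x" for x by metis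
    then have "\<gamma> = \<delta>" using d by auto
    then show False using assms by blast
  qed
  then have "\<rho> \<le> norm (\<delta>' (\<gamma> z) - z)" using disp mult[OF d(1) assms(1)] by blast
  also have "\<dots> = norm (\<delta>' (\<gamma> z) - \<delta>' (\<delta> z))" using d by simp
  also have "\<dots> = norm (\<gamma> z - \<delta> z)" by (rule isometry[OF d(1)])
  finally show ?thesis by (simp add: dist_norm)
qed

lemma C_pos: "0 < C" unfolding C by (rule gauss_bound_pos)

lemma gauss:
  "(\<lambda>\<gamma>. exp (- (norm (\<gamma> z - w))\<^sup>2 / 4)) summable_on \<Gamma>"
  "(\<Sum>\<^sub>\<infinity>\<gamma>\<in>\<Gamma>. exp (- (norm (\<gamma> z - w))\<^sup>2 / 4)) \<le> C"
proof -
  have "(\<lambda>\<gamma>. exp (- (dist w (\<gamma> z))\<^sup>2 / 4)) summable_on \<Gamma>"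
    by (rule gauss_summable_separated(1)[OF rho]) (use separated in blast)
  moreover have "(\<Sum>\<^sub>\<infinity>\<gamma>\<in>\<Gamma>. exp (- (dist w (\<gamma> z))\<^sup>2 / 4)) \<le> gauss_bound DIM(real^'n) \<rho>"
    by (rule gauss_summable_separated(2)[OF rho]) (use separated in blast)
  ultimately show "(\<lambda>\<gamma>. exp (- (norm (\<gamma> z - w))\<^sup>2 / 4)) summable_on \<Gamma>"
    "(\<Sum>\<^sub>\<infinity>\<gamma>\<in>\<Gamma>. exp (- (norm (\<gamma> z - w))\<^sup>2 / 4)) \<le> C"
    by (simp_all add: dist_norm norm_minus_commute C)
qed

text \<open>The exponent of \<open>s_w(\<gamma> z)\<close> divided by the automorphy factor of
  \<open>\<gamma>\<close>, for m = 1: the first two terms belong to the Gaussian section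
  \<open>s_w(z) = exp(H(z,w) - |w|^2/2)\<close> centred at \<open>w\<close>, the last two are the
  logarithm of the factor \<open>jac\<close>. Summing over the group thus gives a Poincare
  series.\<close>

definition phase :: "(real^'n \<Rightarrow> real^'n) \<Rightarrow> real^'n \<Rightarrow> real^'n \<Rightarrow> complex" where
  "phase \<gamma> w z = herm J (\<gamma> z) w - of_real ((norm w)\<^sup>2 / 2) - herm J (\<gamma> z - \<gamma> 0) (\<gamma> 0) - of_real ((norm (\<gamma> 0))\<^sup>2 / 2)"

text \<open>With \<open>Some e\<close> the section is multiplied by a linear function that vanishes
  at the centre. The quotient of the \<open>Some e\<close> series by the \<open>None\<close> series
  then approximates a coordinate near the centre.\<close>

definition ell :: "real^'n \<Rightarrow> (real^'n) option \<Rightarrow> real^'n \<Rightarrow> complex" where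
  "ell w p y = (case p of None \<Rightarrow> 1 | Some e \<Rightarrow> herm J (y - w) e)"

definition pterm :: "nat \<Rightarrow> real^'n \<Rightarrow> (real^'n) option \<Rightarrow> (real^'n \<Rightarrow> real^'n) \<Rightarrow> real^'n \<Rightarrow> complex" where
  "pterm m w p \<gamma> z = exp (of_nat m * phase \<gamma> w z) * ell w p (\<gamma> z)"

definition series :: "nat \<Rightarrow> real^'n \<Rightarrow> (real^'n) option \<Rightarrow> real^'n \<Rightarrow> complex" where
  "series m w p z = (\<Sum>\<^sub>\<infinity>\<gamma>\<in>\<Gamma>. pterm m w p \<gamma> z)"

definition jac :: "nat \<Rightarrow> (real^'n \<Rightarrow> real^'n) \<Rightarrow> real^'n \<Rightarrow> complex" where
  "jac m \<delta> z = exp (of_nat m * (herm J (\<delta> z - \<delta> 0) (\<delta> 0) + of_real ((norm (\<delta> 0))\<^sup>2 / 2)))"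

text \<open>After division by exp(m |z|^2/2), the weight of the metric on the line bundle, a term is
  exactly a Gaussian in the distance from \<open>\<gamma> z\<close> to the centre. This rests on
  \<open>\<gamma>\<close> being an isometry, which gives |z| = |\<gamma> z - \<gamma> 0|.\<close>

lemma Re_phase:
  assumes "\<gamma> \<in> \<Gamma>"
  shows "Re (phase \<gamma> w z) = (norm z)\<^sup>2 / 2 - (norm (\<gamma> z - w))\<^sup>2 / 2"
proof -
  have "(norm z)\<^sup>2 = (norm (\<gamma> z - \<gamma> 0))\<^sup>2" using isometry[OF assms, of z 0] by simp
  then show ?thesis
    unfolding phase_def power2_norm_eq_inner
    by (simp add: herm_simps inner_diff_left inner_diff_right inner_commute field_simps)
qed

text \<open>The defect of the cocycle relation is the purely imaginary last summand, a symplectic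
  pairing of translation parts. By \<open>integral\<close> it is a multiple of 2 pi i and disappears
  in the exponential.\<close>

lemma phase_cocycle:
  assumes \<gamma>: "\<gamma> \<in> \<Gamma>" and \<delta>: "\<delta> \<in> \<Gamma>"
  shows "phase \<gamma> w (\<delta> z) = phase (\<lambda>x. \<gamma> (\<delta> x)) w z + (herm J (\<delta> z - \<delta> 0) (\<delta> 0) + of_real ((norm (\<delta> 0))\<^sup>2 / 2))
     - \<i> * of_real ((\<gamma> (\<delta> 0) - \<gamma> 0) \<bullet> (J *v \<gamma> 0))"
proof -
  define P where "P = \<gamma> (\<delta> z)"
  define b where "b = \<gamma> 0"
  define x where "x = \<gamma> (\<delta> 0) - \<gamma> 0"
  have g: "\<gamma> (\<delta> 0) = b + x" by (simp add: b_def x_def)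
  have h: "herm J (\<delta> z - \<delta> 0) (\<delta> 0) = herm J (P - (b + x)) x"
    using herm_affine[OF \<gamma>, of "\<delta> z" "\<delta> 0" "\<delta> 0" 0] by (simp add: P_def x_def b_def)
  have n: "norm (\<delta> 0) = norm x" using isometry[OF \<gamma>, of "\<delta> 0" 0] by (simp add: x_def)
  have nb: "(norm (b + x))\<^sup>2 = (norm b)\<^sup>2 + 2 * (x \<bullet> b) + (norm x)\<^sup>2"
    by (simp add: power2_norm_eq_inner inner_add_left inner_add_right inner_commute)
  have hx: "herm J x b = of_real (x \<bullet> b) + \<i> * of_real (x \<bullet> (J *v b))"
    by (simp add: herm_def complex_eq_iff)
  show ?thesis
    unfolding phase_def P_def[symmetric] b_def[symmetric] x_def[symmetric] h n g nb
    by (simp add: herm_simps hx field_simps)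
qed

lemma term_equivariant:
  assumes \<gamma>: "\<gamma> \<in> \<Gamma>" and \<delta>: "\<delta> \<in> \<Gamma>"
  shows "pterm m w p \<gamma> (\<delta> z) = jac m \<delta> z * pterm m w p (\<lambda>x. \<gamma> (\<delta> x)) z"
proof -
  obtain k :: int where k: "(\<gamma> (\<delta> 0) - \<gamma> 0) \<bullet> (J *v \<gamma> 0) = 2 * pi * of_int k" using integral[OF \<gamma> \<delta>] by blast
  have e: "exp (- (of_nat m * (\<i> * of_real (2 * pi * of_int k)))) = (1 :: complex)"
  proof -
    have "- (of_nat m * (\<i> * of_real (2 * pi * of_int k))) = 2 * of_int (- (int m * k)) * of_real pi * \<i>"
      by simp
    then show ?thesis by (simp only: exp_eq_1) (auto intro: exI[of _ "- (int m * k)"])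
  qed
  have "of_nat m * phase \<gamma> w (\<delta> z) = of_nat m * phase (\<lambda>x. \<gamma> (\<delta> x)) w z 
      + of_nat m * (herm J (\<delta> z - \<delta> 0) (\<delta> 0) + of_real ((norm (\<delta> 0))\<^sup>2 / 2))
      + - (of_nat m * (\<i> * of_real (2 * pi * of_int k)))"
    unfolding phase_cocycle[OF assms] k by (simp only: ring_distribs diff_conv_add_uminus mult_minus_right)
  then have "exp (of_nat m * phase \<gamma> w (\<delta> z)) = exp (of_nat m * phase (\<lambda>x. \<gamma> (\<delta> x)) w z) * jac m \<delta> z"
    unfolding jac_def by (simp only: exp_add e) simp
  then show ?thesis by (simp add: pterm_def mult_ac)
qed

lemma jac_nonzero: "jac m \<delta> z \<noteq> 0"
  by (simp add: jac_def)

text \<open>Right multiplication by \<open>\<delta>\<close> permutes the group, and every term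
  contributes the same factor.\<close>

lemma series_equivariant:
  assumes \<delta>: "\<delta> \<in> \<Gamma>"
  shows "series m w p (\<delta> z) = jac m \<delta> z * series m w p z"
proof -
  obtain \<delta>' where d: "\<delta>' \<in> \<Gamma>" "\<And>x. \<delta>' (\<delta> x) = x" "\<And>x. \<delta> (\<delta>' x) = x" using inverse[OF \<delta>] by blast
  have bij: "bij_betw (\<lambda>\<gamma> x. \<gamma> (\<delta> x)) \<Gamma> \<Gamma>"
    by (rule bij_betw_byWitness[where f' = "\<lambda>\<gamma> x. \<gamma> (\<delta>' x)"]) (auto simp: d mult \<delta> fun_eq_iff)
  have "series m w p (\<delta> z) = (\<Sum>\<^sub>\<infinity>\<gamma>\<in>\<Gamma>. jac m \<delta> z * pterm m w p (\<lambda>x. \<gamma> (\<delta> x)) z)"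
    unfolding series_def by (intro infsum_cong) (simp add: term_equivariant \<delta>)
  also have "\<dots> = jac m \<delta> z * (\<Sum>\<^sub>\<infinity>\<gamma>\<in>\<Gamma>. pterm m w p (\<lambda>x. \<gamma> (\<delta> x)) z)"
    using jac_nonzero by (simp add: infsum_cmult_right')
  also have "(\<Sum>\<^sub>\<infinity>\<gamma>\<in>\<Gamma>. pterm m w p (\<lambda>x. \<gamma> (\<delta> x)) z) = series m w p z"
    unfolding series_def by (rule infsum_reindex_bij_betw[OF bij])
  finally show ?thesis .
qed

lemma norm_term_None:
  assumes "\<gamma> \<in> \<Gamma>"
  shows "cmod (pterm m w None \<gamma> z) = exp (real m * (norm z)\<^sup>2 / 2) * exp (- (real m * (norm (\<gamma> z - w))\<^sup>2 / 2))"
  unfolding pterm_def ell_def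
  by (simp add: Re_phase[OF assms] exp_add[symmetric] algebra_simps)

definition small :: "(real^'n) option \<Rightarrow> bool" where
  "small p \<longleftrightarrow> (\<forall>e. p = Some e \<longrightarrow> norm e \<le> 1)"

text \<open>The linear factor is absorbed into a Gaussian at the cost of lowering the exponent from
  m to m - 1, so that both kinds of terms share one estimate.\<close>

lemma cmod_ell_le:
  assumes "small p"
  shows "cmod (ell w p y) \<le> 2 * exp ((norm (y - w))\<^sup>2 / 2)"
proof (cases p)
  case None
  have "1 \<le> exp ((norm (y - w))\<^sup>2 / 2)" by simp
  then have "1 \<le> 2 * exp ((norm (y - w))\<^sup>2 / 2)" by linarith
  then show ?thesis by (simp only: None ell_def option.case norm_one)
next
  case (Some e)
  let ?r = "norm (y - w)"
  have "cmod (herm J (y - w) e) \<le> 2 * ?r * norm e" by (rule cmod_herm_le[OF J])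
  also have "\<dots> \<le> 2 * ?r * 1" using assms Some by (intro mult_left_mono) (auto simp: small_def)
  also have "\<dots> \<le> 2 * (1 + ?r\<^sup>2 / 2)"
  proof -
    have "0 \<le> (?r - 1)\<^sup>2" by simp
    then show ?thesis by (simp add: power2_diff)
  qed
  also have "\<dots> \<le> 2 * exp (?r\<^sup>2 / 2)" by (rule mult_left_mono[OF exp_ge_add_one_self]) simp
  finally show ?thesis by (simp add: Some ell_def)
qed

lemma norm_term_le:
  assumes "\<gamma> \<in> \<Gamma>" "small p"
  shows "cmod (pterm m w p \<gamma> z) \<le> 2 * exp (real m * (norm z)\<^sup>2 / 2) * exp (- ((real m - 1) / 2 * (norm (\<gamma> z - w))\<^sup>2))"
proof -
  let ?r = "norm (\<gamma> z - w)"
  have "cmod (pterm m w p \<gamma> z) \<le> exp (real m * ((norm z)\<^sup>2 / 2 - ?r\<^sup>2 / 2)) * (2 * exp (?r\<^sup>2 / 2))"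
    unfolding pterm_def norm_mult norm_exp_eq_Re using cmod_ell_le[OF assms(2)] Re_phase[OF assms(1)]
    by (intro mult_mono) auto
  also have "\<dots> = 2 * exp (real m * (norm z)\<^sup>2 / 2 + - ((real m - 1) / 2 * ?r\<^sup>2))"
    by (simp add: exp_add[symmetric] algebra_simps diff_divide_distrib)
  finally show ?thesis by (simp only: exp_add mult.assoc)
qed

lemma cderiv_term:
  assumes "\<gamma> \<in> \<Gamma>"
  shows "\<exists>D. cderiv J (pterm m w p \<gamma>) D z"
proof -
  obtain A b where A: "\<And>x. \<gamma> x = A *v x + b" "A ** J = J ** A" using affine[OF assms] by blast
  have 1: "cderiv J (\<lambda>z. herm J (\<gamma> z) w) (\<lambda>v. herm J (A *v v) w) z" for w
    unfolding A(1) by (rule cderiv_herm[OF J A(2)])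
  have h: "herm J (\<gamma> z - y) w = herm J (\<gamma> z) w - herm J y w" for z y w by (rule herm_simps)
  have "\<exists>D. cderiv J (phase \<gamma> w) D z"
    unfolding phase_def[abs_def] h
    using cderiv_diff[OF cderiv_diff[OF cderiv_diff[OF 1 cderiv_const] cderiv_diff[OF 1 cderiv_const]] cderiv_const] by blast
  then obtain D where "cderiv J (phase \<gamma> w) D z" by blast
  from cderiv_exp[OF cderiv_mult[OF cderiv_const this]]
  have e: "\<exists>D. cderiv J (\<lambda>z. exp (of_nat m * phase \<gamma> w z)) D z" by blast
  have "\<exists>D. cderiv J (\<lambda>z. ell w p (\<gamma> z)) D z"
  proof (cases p)
    case None
    then show ?thesis using cderiv_const by (auto simp: ell_def)
  next
    case (Some e)
    then show ?thesis unfolding ell_def option.case(2) Some h using cderiv_diff[OF 1 cderiv_const] by blast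
  qed
  with e show ?thesis unfolding pterm_def[abs_def] using cderiv_mult by blast
qed

lemma cderiv_series:
  assumes m: "2 \<le> m" and p: "small p"
  shows "\<exists>D. cderiv J (series m w p) D z0"
proof -
  let ?K = "2 * exp (real m * (norm z0 + 1)\<^sup>2 / 2) * exp (1 / 2)"
  have "\<exists>D. cderiv J (\<lambda>z. \<Sum>\<^sub>\<infinity>\<gamma>\<in>\<Gamma>. pterm m w p \<gamma> z) D z0"
  proof (rule cderiv_infsum[OF J, of 1])
    show "\<exists>D. cderiv J (pterm m w p \<gamma>) D z" if "\<gamma> \<in> \<Gamma>" for \<gamma> z by (rule cderiv_term[OF that])
    show "(\<lambda>\<gamma>. ?K * exp (- (norm (\<gamma> z0 - w))\<^sup>2 / 4)) summable_on \<Gamma>"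
      by (rule summable_on_cmult_right[OF gauss(1)])
    fix \<gamma> z assume \<gamma>: "\<gamma> \<in> \<Gamma>" and z: "z \<in> ball z0 1"
    have n: "norm z \<le> norm z0 + 1" using z norm_triangle_sub[of z z0] by (simp add: dist_norm norm_minus_commute)
    \<comment> \<open>The majorant must not depend on \<open>z\<close>. As \<gamma> is an isometry,
      the distances to the centre from \<gamma> z and \<gamma> z0 differ by less than 1, and m at
      least 2 leaves enough decay to compare with the Gaussian at \<open>z0\<close>.\<close>
    let ?r = "norm (\<gamma> z - w)" and ?rr = "norm (\<gamma> z0 - w)"
    have "?rr \<le> ?r + 1"
      using norm_triangle_ineq[of "\<gamma> z - w" "\<gamma> z0 - \<gamma> z"] isometry[OF \<gamma>, of z0 z] z
      by (simp add: dist_norm)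
    then have "?rr\<^sup>2 \<le> (?r + 1)\<^sup>2" by (intro power_mono) auto
    also have "\<dots> \<le> 2 * ?r\<^sup>2 + 2" using zero_le_power2[of "?r - 1"] by (simp add: power2_sum power2_diff)
    finally have r: "?rr\<^sup>2 / 4 \<le> ?r\<^sup>2 / 2 + 1 / 2" by simp
    have "?r\<^sup>2 / 2 \<le> (real m - 1) / 2 * ?r\<^sup>2"
      using m mult_right_mono[of 1 "real m - 1" "?r\<^sup>2 / 2"] by simp
    then have e: "exp (- ((real m - 1) / 2 * ?r\<^sup>2)) \<le> exp (1 / 2 + - ?rr\<^sup>2 / 4)" using r by simp
    have "cmod (pterm m w p \<gamma> z) \<le> 2 * exp (real m * (norm z)\<^sup>2 / 2) * exp (- ((real m - 1) / 2 * ?r\<^sup>2))"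
      by (rule norm_term_le[OF \<gamma> p])
    also have "\<dots> \<le> 2 * exp (real m * (norm z0 + 1)\<^sup>2 / 2) * exp (1 / 2 + - ?rr\<^sup>2 / 4)"
    proof (intro mult_mono e)
      have "(norm z)\<^sup>2 \<le> (norm z0 + 1)\<^sup>2" using n by (intro power_mono) auto
      then show "exp (real m * (norm z)\<^sup>2 / 2) \<le> exp (real m * (norm z0 + 1)\<^sup>2 / 2)"
        by (simp add: mult_left_mono divide_right_mono)
    qed auto
    finally show "cmod (pterm m w p \<gamma> z) \<le> ?K * exp (- (norm (\<gamma> z0 - w))\<^sup>2 / 4)" by (simp only: exp_add mult.assoc)
  qed simp
  then show ?thesis by (simp add: series_def[abs_def])
qed

text \<open>Of the exponent m d^2/2 the part d^2/4 is kept for summation and contributes at most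
  \<open>C\<close>; the rest is estimated by the minimal distance \<open>r\<close>.\<close>

lemma norm_series_None_le:
  assumes "2 \<le> m" "0 \<le> r" "\<And>\<gamma>. \<gamma> \<in> \<Gamma> \<Longrightarrow> r \<le> norm (\<gamma> z - w)"
  shows "cmod (series m w None z) \<le> exp (real m * (norm z)\<^sup>2 / 2) * (exp (- ((real m / 2 - 1 / 4) * r\<^sup>2)) * C)"
proof -
  let ?K = "exp (real m * (norm z)\<^sup>2 / 2) * exp (- ((real m / 2 - 1 / 4) * r\<^sup>2))"
  have b: "cmod (pterm m w None \<gamma> z) \<le> ?K * exp (- (norm (\<gamma> z - w))\<^sup>2 / 4)" if \<gamma>: "\<gamma> \<in> \<Gamma>" for \<gamma>
  proof -
    let ?d = "norm (\<gamma> z - w)"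
    have "(real m / 2 - 1 / 4) * r\<^sup>2 \<le> (real m / 2 - 1 / 4) * ?d\<^sup>2"
      using assms \<gamma> by (intro mult_left_mono power_mono) auto
    then have "- (real m * ?d\<^sup>2 / 2) \<le> - ((real m / 2 - 1 / 4) * r\<^sup>2) + - ?d\<^sup>2 / 4"
      by (simp add: left_diff_distrib)
    then have "exp (- (real m * ?d\<^sup>2 / 2)) \<le> exp (- ((real m / 2 - 1 / 4) * r\<^sup>2)) * exp (- ?d\<^sup>2 / 4)"
      by (simp only: exp_add[symmetric] exp_le_cancel_iff)
    then show ?thesis unfolding norm_term_None[OF \<gamma>] by (simp add: mult.assoc)
  qed
  have "cmod (series m w None z) \<le> (\<Sum>\<^sub>\<infinity>\<gamma>\<in>\<Gamma>. ?K * exp (- (norm (\<gamma> z - w))\<^sup>2 / 4))"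
    unfolding series_def by (rule cmod_infsum_le(2)[OF b summable_on_cmult_right[OF gauss(1)]])
  also have "\<dots> = ?K * (\<Sum>\<^sub>\<infinity>\<gamma>\<in>\<Gamma>. exp (- (norm (\<gamma> z - w))\<^sup>2 / 4))" by (rule infsum_cmult_right[OF gauss(1)])
  also have "\<dots> \<le> ?K * C" by (intro mult_left_mono gauss(2)) simp
  finally show ?thesis by (simp add: mult.assoc)
qed

definition peak :: "nat \<Rightarrow> real^'n \<Rightarrow> real^'n \<Rightarrow> complex" where
  "peak m w z = exp (of_nat m * phase (\<lambda>x. x) w z)"

text \<open>A bound for all noncentral terms together, relative to the central one.\<close>

definition err :: "nat \<Rightarrow> real" where
  "err m = 2 * C * exp (- ((real m - 2) * \<rho>\<^sup>2 / 4))"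

lemma norm_peak: "cmod (peak m w z) = exp (real m * ((norm z)\<^sup>2 / 2 - (norm (z - w))\<^sup>2 / 2))"
  unfolding peak_def norm_exp_eq_Re using Re_phase[OF one] by simp

lemma peak_nonzero: "peak m w z \<noteq> 0"
  by (simp add: peak_def)

text \<open>Within \<rho>/4 of the centre, every nontrivial translate of \<open>z\<close> is at
  least 3\<rho>/4 away from it, because displacements are at least \<rho>. Relative to the central
  term the others decay exponentially in m.\<close>

lemma series_near_centre:
  assumes m: "2 \<le> m" and p: "small p" and z: "norm (z - w) < \<rho> / 4"
  shows "cmod (series m w p z / peak m w z - ell w p z) \<le> err m"
proof -
  let ?\<Gamma> = "\<Gamma> - {\<lambda>x. x}"
  let ?dd = "norm (z - w)"
  let ?K = "2 * exp (- ((real m - 2) * \<rho>\<^sup>2 / 4))"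
  have b: "cmod (pterm m w p \<gamma> z / peak m w z) \<le> ?K * exp (- (norm (\<gamma> z - w))\<^sup>2 / 4)" if \<gamma>: "\<gamma> \<in> ?\<Gamma>" for \<gamma>
  proof -
    let ?d = "norm (\<gamma> z - w)"
    have "\<rho> \<le> norm (\<gamma> z - z)" using disp \<gamma> by blast
    also have "\<dots> \<le> ?d + ?dd" using norm_triangle_ineq4[of "\<gamma> z - w" "z - w"] by simp
    finally have d: "3 * \<rho> / 4 \<le> ?d" using z by simp
    have "(3 * \<rho> / 4)\<^sup>2 \<le> ?d\<^sup>2" using d rho by (intro power_mono) auto
    then have d2: "9 / 16 * \<rho>\<^sup>2 \<le> ?d\<^sup>2" by (simp add: power_divide power_mult_distrib)
    have "?dd\<^sup>2 \<le> (\<rho> / 4)\<^sup>2" using z by (intro power_mono) auto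
    then have d0: "?dd\<^sup>2 \<le> \<rho>\<^sup>2 / 16" by (simp add: power_divide)
    have m2: "2 \<le> real m" using m by simp
    have "(real m / 2 - 3 / 4) * (9 / 16 * \<rho>\<^sup>2) \<le> (real m / 2 - 3 / 4) * ?d\<^sup>2"
      using m2 d2 by (intro mult_left_mono) auto
    moreover have "real m / 2 * ?dd\<^sup>2 \<le> real m / 2 * (\<rho>\<^sup>2 / 16)" using m2 d0 by (intro mult_left_mono) auto
    \<comment> \<open>The exponent (m - 1)/2 is split into m/2 - 3/4 and the 1/4 needed for
      summation. The coefficients of m \<rho>^2 agree on both sides: 1/4 + 1/32 = 9/32, which is
      where the rate in \<open>err\<close> comes from.\<close>
    moreover have "(real m - 2) * \<rho>\<^sup>2 / 4 + real m / 2 * (\<rho>\<^sup>2 / 16) \<le> (real m / 2 - 3 / 4) * (9 / 16 * \<rho>\<^sup>2)"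
      using rho by (simp add: field_simps)
    ultimately have le: "- ((real m - 1) / 2 * ?d\<^sup>2) + real m / 2 * ?dd\<^sup>2 \<le> - ((real m - 2) * \<rho>\<^sup>2 / 4) + - ?d\<^sup>2 / 4"
      by (simp add: left_diff_distrib diff_divide_distrib)
    have "cmod (pterm m w p \<gamma> z / peak m w z) \<le>
       (2 * exp (real m * (norm z)\<^sup>2 / 2) * exp (- ((real m - 1) / 2 * ?d\<^sup>2))) / exp (real m * ((norm z)\<^sup>2 / 2 - ?dd\<^sup>2 / 2))"
      unfolding norm_divide norm_peak by (intro divide_right_mono norm_term_le[OF _ p]) (use \<gamma> in auto)
    also have "\<dots> = 2 * exp (real m * (norm z)\<^sup>2 / 2 + - ((real m - 1) / 2 * ?d\<^sup>2) - real m * ((norm z)\<^sup>2 / 2 - ?dd\<^sup>2 / 2))"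
      by (simp only: exp_add exp_diff times_divide_eq_right mult.assoc)
    also have "\<dots> = 2 * exp (- ((real m - 1) / 2 * ?d\<^sup>2) + real m / 2 * ?dd\<^sup>2)"
      by (simp add: right_diff_distrib)
    also have "\<dots> \<le> 2 * exp (- ((real m - 2) * \<rho>\<^sup>2 / 4) + - ?d\<^sup>2 / 4)" using le by simp
    finally show ?thesis by (simp only: exp_add mult.assoc)
  qed
  have sub: "(\<lambda>\<gamma>. exp (- (norm (\<gamma> z - w))\<^sup>2 / 4)) summable_on ?\<Gamma>"
    by (rule summable_on_subset_banach[OF gauss(1)]) auto
  note bnd = cmod_infsum_le[where f = "\<lambda>\<gamma>. pterm m w p \<gamma> z / peak m w z"
      and g = "\<lambda>\<gamma>. ?K * exp (- (norm (\<gamma> z - w))\<^sup>2 / 4)", OF b summable_on_cmult_right[OF sub]]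
  have "series m w p z / peak m w z = (\<Sum>\<^sub>\<infinity>\<gamma>\<in>\<Gamma>. pterm m w p \<gamma> z / peak m w z)"
    unfolding series_def divide_inverse by (rule infsum_cmult_left'[symmetric])
  also have "\<dots> = (\<Sum>\<^sub>\<infinity>\<gamma>\<in>{\<lambda>x. x} \<union> ?\<Gamma>. pterm m w p \<gamma> z / peak m w z)"
    using one by (intro arg_cong[of _ _ "infsum (\<lambda>\<gamma>. pterm m w p \<gamma> z / peak m w z)"]) blast
  also have "(\<Sum>\<^sub>\<infinity>\<gamma>\<in>{\<lambda>x. x} \<union> ?\<Gamma>. pterm m w p \<gamma> z / peak m w z) =
     (\<Sum>\<^sub>\<infinity>\<gamma>\<in>{\<lambda>x. x}. pterm m w p \<gamma> z / peak m w z) + (\<Sum>\<^sub>\<infinity>\<gamma>\<in>?\<Gamma>. pterm m w p \<gamma> z / peak m w z)"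
    by (intro infsum_Un_disjoint bnd(1)) auto
  also have "(\<Sum>\<^sub>\<infinity>\<gamma>\<in>{\<lambda>x. x}. pterm m w p \<gamma> z / peak m w z) = ell w p z"
    using peak_nonzero[of m w z] by (simp add: pterm_def peak_def)
  finally have "cmod (series m w p z / peak m w z - ell w p z) \<le> (\<Sum>\<^sub>\<infinity>\<gamma>\<in>?\<Gamma>. ?K * exp (- (norm (\<gamma> z - w))\<^sup>2 / 4))"
    using bnd(2) by simp
  also have "\<dots> = ?K * (\<Sum>\<^sub>\<infinity>\<gamma>\<in>?\<Gamma>. exp (- (norm (\<gamma> z - w))\<^sup>2 / 4))" by (rule infsum_cmult_right[OF sub])
  also have "\<dots> \<le> ?K * (\<Sum>\<^sub>\<infinity>\<gamma>\<in>\<Gamma>. exp (- (norm (\<gamma> z - w))\<^sup>2 / 4))"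
    by (intro mult_left_mono infsum_mono2 sub gauss(1)) auto
  also have "\<dots> \<le> ?K * C" by (intro mult_left_mono gauss(2)) simp
  finally show ?thesis by (simp add: err_def mult_ac)
qed

end

section \<open>The projective embedding\<close>

text \<open>The real basis is twice too large over the complex numbers: the real parts and the
  imaginary parts of the coefficients each reproduce \<open>v\<close>, hence the factor 1/2.\<close>

lemma cscale_herm_basis:
  fixes J :: "real^'n^'n"
  assumes "orthogonal_complex_structure J"
  shows "(\<Sum>b\<in>Basis. cscale J (herm J v b) ((1 / 2) *\<^sub>R b)) = v"
proof -
  note J = orthogonal_complex_structureD[OF assms]
  have "(\<Sum>b\<in>Basis. (v \<bullet> (J *v b)) *\<^sub>R (J *v b)) = J *v (\<Sum>b\<in>Basis. (v \<bullet> (J *v b)) *\<^sub>R b)"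
    by (simp add: linear_sum[OF matrix_vector_mul_linear] matrix_vector_mult_scaleR)
  also have "(\<Sum>b\<in>Basis. (v \<bullet> (J *v b)) *\<^sub>R b) = - (\<Sum>b\<in>Basis. ((J *v v) \<bullet> b) *\<^sub>R b)"
    by (simp add: J(3) sum_negf)
  also have "\<dots> = - (J *v v)" by (simp add: euclidean_representation)
  also have "J *v (- (J *v v)) = v"
    by (simp add: linear_neg[OF matrix_vector_mul_linear] complex_structure_twice[OF J(1)])
  finally have 1: "(\<Sum>b\<in>Basis. (v \<bullet> (J *v b)) *\<^sub>R (J *v b)) = v" .
  have "(\<Sum>b\<in>Basis. cscale J (herm J v b) ((1 / 2) *\<^sub>R b))
     = (1 / 2) *\<^sub>R (\<Sum>b\<in>Basis. (v \<bullet> b) *\<^sub>R b) + (1 / 2) *\<^sub>R (\<Sum>b\<in>Basis. (v \<bullet> (J *v b)) *\<^sub>R (J *v b))"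
    by (simp add: cscale_def herm_simps sum.distrib scaleR_sum_right matrix_vector_mult_scaleR mult.commute)
  also have "\<dots> = v" unfolding 1 euclidean_representation by (simp add: scaleR_left_distrib[symmetric])
  finally show ?thesis .
qed

context crystallographic
begin

text \<open>The second condition keeps the sections nonzero near their centres, the third keeps the
  derivative of \<open>locmap\<close> within 1/2 of the identity, and the fourth yields the
  contradiction that separates points far apart.\<close>

definition good :: "nat \<Rightarrow> bool" where
  "good m \<longleftrightarrow> 2 \<le> m \<and> err m \<le> 1 / 2 \<and> real CARD('n) * (err m * (2 + \<rho>)) \<le> \<rho> / 32 \<and>
     4 * C\<^sup>2 * exp (- ((real m / 2 - 1 / 4) * (\<rho> / 8)\<^sup>2)) < exp (- (real m * (\<rho> / 32)\<^sup>2))"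

text \<open>All conditions hold eventually by exponential decay in m. In the last one the rate
  \<rho>^2/128 competes with \<rho>^2/1024; the difference is 7\<rho>^2/1024.\<close>

lemma ex_good: "\<exists>m. good m"
proof -
  have small: "eventually (\<lambda>m. K * exp (- a) ^ m < \<epsilon>) sequentially" if "0 < a" "0 < \<epsilon>" for K a \<epsilon> :: real
  proof -
    have "(\<lambda>m. K * exp (- a) ^ m) \<longlonglongrightarrow> K * 0"
      by (intro tendsto_intros LIMSEQ_power_zero) (use that in simp)
    then show ?thesis using that(2) order_tendstoD(2) by fastforce
  qed
  have err: "err m = (2 * C * exp (\<rho>\<^sup>2 / 2)) * exp (- (\<rho>\<^sup>2 / 4)) ^ m" for m
  proof -
    have "exp (- ((real m - 2) * \<rho>\<^sup>2 / 4)) = exp (\<rho>\<^sup>2 / 2 + real m * (- (\<rho>\<^sup>2 / 4)))" by (simp add: field_simps)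
    also have "\<dots> = exp (\<rho>\<^sup>2 / 2) * exp (- (\<rho>\<^sup>2 / 4)) ^ m" by (simp only: exp_add exp_of_nat_mult)
    finally show ?thesis by (simp add: err_def)
  qed
  have r2: "0 < \<rho>\<^sup>2 / 4" "0 < 7 * \<rho>\<^sup>2 / 1024" using rho by auto
  have n: "0 < \<rho> / 32 / (real CARD('n) * (2 + \<rho>))" using rho by (simp add: add_pos_pos)
  have "eventually (\<lambda>m. 2 \<le> m \<and> err m < 1 / 2 \<and> err m < \<rho> / 32 / (real CARD('n) * (2 + \<rho>)) \<and>
      4 * C\<^sup>2 * exp (\<rho>\<^sup>2 / 256) * exp (- (7 * \<rho>\<^sup>2 / 1024)) ^ m < 1) sequentially"
    unfolding err by (intro eventually_conj eventually_ge_at_top small r2 n) auto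
  then obtain m where m: "2 \<le> m" "err m < 1 / 2" "err m < \<rho> / 32 / (real CARD('n) * (2 + \<rho>))"
      "4 * C\<^sup>2 * exp (\<rho>\<^sup>2 / 256) * exp (- (7 * \<rho>\<^sup>2 / 1024)) ^ m < 1"
    using eventually_happens'[OF sequentially_bot] by blast
  have "real CARD('n) * (err m * (2 + \<rho>)) \<le> \<rho> / 32"
    using m(3) rho by (simp add: pos_less_divide_eq mult_ac less_imp_le add_pos_pos)
  moreover have "4 * C\<^sup>2 * exp (- ((real m / 2 - 1 / 4) * (\<rho> / 8)\<^sup>2)) < exp (- (real m * (\<rho> / 32)\<^sup>2))"
  proof -
    have "- ((real m / 2 - 1 / 4) * (\<rho> / 8)\<^sup>2) = \<rho>\<^sup>2 / 256 + real m * (- (7 * \<rho>\<^sup>2 / 1024)) + - (real m * (\<rho> / 32)\<^sup>2)"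
      by (simp add: power_divide field_simps)
    then have "4 * C\<^sup>2 * exp (- ((real m / 2 - 1 / 4) * (\<rho> / 8)\<^sup>2)) =
        (4 * C\<^sup>2 * exp (\<rho>\<^sup>2 / 256) * exp (- (7 * \<rho>\<^sup>2 / 1024)) ^ m) * exp (- (real m * (\<rho> / 32)\<^sup>2))"
      by (simp only: exp_add exp_of_nat_mult mult.assoc)
    also have "\<dots> < 1 * exp (- (real m * (\<rho> / 32)\<^sup>2))" using m(4) by (intro mult_strict_right_mono) auto
    finally show ?thesis by simp
  qed
  ultimately show ?thesis using m by (auto simp: good_def)
qed

section \<open>Sections near their centres\<close>

lemma small_simps: "small None" "b \<in> Basis \<Longrightarrow> small (Some b)"
  by (auto simp: small_def)

lemma series_None_lower:
  assumes m: "good m" and z: "norm (z - w) < \<rho> / 4"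
  shows "cmod (peak m w z) \<le> 2 * cmod (series m w None z)"
proof -
  have "cmod (series m w None z / peak m w z - 1) \<le> 1 / 2"
    using series_near_centre[OF _ small_simps(1) z, of m] m by (simp add: good_def ell_def)
  then have "1 / 2 \<le> cmod (series m w None z / peak m w z)"
    using norm_triangle_ineq2[of 1 "series m w None z / peak m w z"] by (simp add: norm_minus_commute)
  then show ?thesis using peak_nonzero[of m w z] by (simp add: norm_divide field_simps)
qed

lemma series_None_nonzero:
  assumes "good m" "norm (z - w) < \<rho> / 4"
  shows "series m w None z \<noteq> 0"
  using series_None_lower[OF assms] peak_nonzero[of m w z] by auto

text \<open>After division by the central term the quotient is (h + O(err)) / (1 + O(err)) with |h|
  at most \<rho>/2 and denominator at least 1/2. Hence the factor 2(1 + \<rho>/2) = 2 +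
  \<rho>.\<close>

lemma ratio_near_centre:
  assumes m: "good m" and z: "norm (z - w) < \<rho> / 4" and b: "b \<in> Basis"
  shows "cmod (series m w (Some b) z / series m w None z - herm J (z - w) b) \<le> err m * (2 + \<rho>)"
proof -
  let ?p = "peak m w z"
  define s where "s = series m w None z / ?p"
  define t where "t = series m w (Some b) z / ?p"
  let ?h = "herm J (z - w) b"
  have m2: "2 \<le> m" and e: "err m \<le> 1 / 2" using m by (auto simp: good_def)
  have 1: "cmod (s - 1) \<le> err m"
    using series_near_centre[OF m2 small_simps(1) z] by (simp add: ell_def s_def)
  have 2: "cmod (t - ?h) \<le> err m"
    using series_near_centre[OF m2 small_simps(2)[OF b] z] by (simp add: ell_def t_def)
  have s: "1 / 2 \<le> cmod s" using 1 e norm_triangle_ineq2[of 1 s] by (simp add: norm_minus_commute)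
  have "cmod ?h \<le> 2 * norm (z - w) * norm b" by (rule cmod_herm_le[OF J])
  also have "\<dots> \<le> \<rho> / 2" using z b by simp
  finally have h: "cmod ?h \<le> \<rho> / 2" .
  have e0: "0 \<le> err m" using 1 norm_ge_zero order_trans by blast
  have "s \<noteq> 0" using s by auto
  then have "series m w (Some b) z / series m w None z - ?h = ((t - ?h) - ?h * (s - 1)) / s"
    using peak_nonzero[of m w z] by (simp add: s_def t_def field_simps)
  also have "cmod \<dots> \<le> (err m + \<rho> / 2 * err m) / (1 / 2)"
    unfolding norm_divide
  proof (intro frac_le s)
    have "cmod ((t - ?h) - ?h * (s - 1)) \<le> cmod (t - ?h) + cmod ?h * cmod (s - 1)"
      by (metis norm_mult norm_triangle_ineq4)
    also have "\<dots> \<le> err m + \<rho> / 2 * err m" using 1 2 h rho by (intro add_mono mult_mono) auto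
    finally show "cmod ((t - ?h) - ?h * (s - 1)) \<le> err m + \<rho> / 2 * err m" .
    show "0 \<le> err m + \<rho> / 2 * err m" using e0 rho by simp
  qed simp
  also have "\<dots> = err m * (2 + \<rho>)" by (simp add: algebra_simps)
  finally show ?thesis .
qed

text \<open>If the ratios were exactly \<open>herm J (z - w) b\<close>, this would be
  \<open>z - w\<close> by \<open>cscale_herm_basis\<close>. It is a perturbation of a translation
  and, being built from ratios, invariant under the group.\<close>

definition locmap :: "nat \<Rightarrow> real^'n \<Rightarrow> real^'n \<Rightarrow> real^'n" where
  "locmap m w z = (\<Sum>b\<in>Basis. cscale J (series m w (Some b) z / series m w None z) ((1 / 2) *\<^sub>R b))"

text \<open>The ratios are uniformly close to linear functions on the ball of radius \<rho>/4 about
  the centre. The Cauchy estimate on balls of radius \<rho>/8 turns this into closeness of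
  derivatives, and the third condition of \<open>good\<close> was chosen so that the sum over the
  basis gives 1/2.\<close>

lemma locmap_derivative:
  assumes m: "good m" and y: "norm (y - w) < \<rho> / 8"
  shows "\<exists>E. (locmap m w has_derivative (\<lambda>v. v + E v)) (at y) \<and> linear E \<and> (\<forall>v. norm (E v) \<le> 1 / 2 * norm v)"
proof -
  have m2: "2 \<le> m" using m by (simp add: good_def)
  let ?f = "\<lambda>b z. series m w (Some b) z / series m w None z - herm J (z - w) b"
  have cd: "\<exists>D. cderiv J (?f b) D z" if b: "b \<in> Basis" and z: "norm (z - w) < \<rho> / 4" for b z
  proof -
    obtain D where D: "cderiv J (series m w (Some b)) D z" using cderiv_series[OF m2 small_simps(2)[OF b]] by blast
    obtain E where E: "cderiv J (series m w None) E z" using cderiv_series[OF m2 small_simps(1)] by blast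
    have "cderiv J (\<lambda>z. herm J (mat 1 *v z + - w) b) (\<lambda>v. herm J (mat 1 *v v) b) z" by (rule cderiv_herm[OF J]) simp
    then have "cderiv J (\<lambda>z. herm J (z - w) b) (\<lambda>v. herm J v b) z" by simp
    from cderiv_diff[OF cderiv_divide[OF D E series_None_nonzero[OF m z]] this] show ?thesis by blast
  qed
  have sub: "norm (z - w) < \<rho> / 4" if "z \<in> ball y (\<rho> / 8)" for z
    using that y norm_triangle_ineq[of "z - y" "y - w"] by (simp add: dist_norm norm_minus_commute)
  have y4: "norm (y - w) < \<rho> / 4" using y rho by simp
  have "\<forall>b. \<exists>D. b \<in> Basis \<longrightarrow> cderiv J (?f b) D y" using cd[OF _ y4] by blast
  then have "\<exists>D. \<forall>b. b \<in> Basis \<longrightarrow> cderiv J (?f b) (D b) y" by (rule choice)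
  then obtain D where D: "\<And>b. b \<in> Basis \<Longrightarrow> cderiv J (?f b) (D b) y" by blast
  have Dle: "cmod (D b v) \<le> 4 * (err m * (2 + \<rho>)) / (\<rho> / 8) * norm v" if b: "b \<in> Basis" for b v
  proof (rule cderiv_estimates(1)[OF J _ _ _ D[OF b]])
    show "0 < \<rho> / 8" using rho by simp
    show "\<exists>D. cderiv J (?f b) D z" if "z \<in> ball y (\<rho> / 8)" for z using cd[OF b sub[OF that]] .
    show "cmod (?f b z) \<le> err m * (2 + \<rho>)" if "z \<in> ball y (\<rho> / 8)" for z
      using ratio_near_centre[OF m sub[OF that] b] .
  qed
  let ?E = "\<lambda>v. \<Sum>b\<in>Basis. cscale J (D b v) ((1 / 2) *\<^sub>R b)"
  have "((\<lambda>z. z - w) has_derivative (\<lambda>v. v)) (at y)" by (auto intro!: derivative_eq_intros)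
  moreover have "((\<lambda>z. \<Sum>b\<in>Basis. cscale J (?f b z) ((1 / 2) *\<^sub>R b)) has_derivative ?E) (at y)"
    by (rule has_derivative_cscale_sum) (use D in \<open>auto simp: cderiv_def\<close>)
  ultimately have E: "((\<lambda>z. (z - w) + (\<Sum>b\<in>Basis. cscale J (?f b z) ((1 / 2) *\<^sub>R b))) has_derivative (\<lambda>v. v + ?E v)) (at y)"
    by (rule has_derivative_add)
  have "locmap m w z = (z - w) + (\<Sum>b\<in>Basis. cscale J (?f b z) ((1 / 2) *\<^sub>R b))" for z
  proof -
    have "(\<Sum>b\<in>Basis. cscale J (?f b z) ((1 / 2) *\<^sub>R b)) = locmap m w z - (\<Sum>b\<in>Basis. cscale J (herm J (z - w) b) ((1 / 2) *\<^sub>R b))"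
      unfolding locmap_def by (simp only: cscale_simps(5) sum_subtractf)
    then show ?thesis unfolding cscale_herm_basis[OF J] by simp
  qed
  then have 1: "(locmap m w has_derivative (\<lambda>v. v + ?E v)) (at y)" using E by presburger
  have 2: "norm (?E v) \<le> 1 / 2 * norm v" for v
  proof -
    have "norm (?E v) \<le> (\<Sum>b\<in>(Basis :: (real^'n) set). 4 * (err m * (2 + \<rho>)) / (\<rho> / 8) * norm v * (1 / 2))"
    proof (intro sum_norm_le)
      fix b :: "real^'n" assume b: "b \<in> Basis"
      have "norm (cscale J (D b v) ((1 / 2) *\<^sub>R b)) = cmod (D b v) * (1 / 2)"
        using b by (simp add: norm_cscale[OF J])
      also have "\<dots> \<le> 4 * (err m * (2 + \<rho>)) / (\<rho> / 8) * norm v * (1 / 2)"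
        by (rule mult_right_mono[OF Dle[OF b]]) simp
      finally show "norm (cscale J (D b v) ((1 / 2) *\<^sub>R b)) \<le> 4 * (err m * (2 + \<rho>)) / (\<rho> / 8) * norm v * (1 / 2)" .
    qed
    also have "\<dots> = 16 / \<rho> * (real CARD('n) * (err m * (2 + \<rho>))) * norm v" using rho by (simp add: field_simps)
    also have "\<dots> \<le> 16 / \<rho> * (\<rho> / 32) * norm v"
      using m rho by (intro mult_right_mono mult_left_mono) (auto simp: good_def)
    finally show ?thesis using rho by simp
  qed
  have "linear ?E"
  proof -
    have "linear (\<lambda>v. v + ?E v)" using 1 has_derivative_linear by blast
    from linear_compose_sub[OF this linear_id] show ?thesis by simp
  qed
  with 1 2 show ?thesis by (intro exI[of _ ?E] conjI allI)
qed

text \<open>On the convex ball, the difference from the identity has Lipschitz constant 1/2.\<close>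

lemma locmap_inj: 
  assumes m: "good m"
  shows "inj_on (locmap m w) (ball w (\<rho> / 8))"
proof (rule inj_onI)
  fix x y assume xy: "x \<in> ball w (\<rho> / 8)" "y \<in> ball w (\<rho> / 8)" "locmap m w x = locmap m w y"
  have "\<forall>z. \<exists>E. norm (z - w) < \<rho> / 8 \<longrightarrow> (locmap m w has_derivative (\<lambda>v. v + E v)) (at z) \<and> linear E \<and> (\<forall>v. norm (E v) \<le> 1 / 2 * norm v)"
    using locmap_derivative[OF m] by blast
  then obtain E where E: "\<And>z. norm (z - w) < \<rho> / 8 \<Longrightarrow> (locmap m w has_derivative (\<lambda>v. v + E z v)) (at z) \<and> linear (E z) \<and> (\<forall>v. norm (E z v) \<le> 1 / 2 * norm v)"
    by (metis choice)
  have "norm ((locmap m w x - x) - (locmap m w y - y)) \<le> 1 / 2 * norm (x - y)"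
  proof (rule differentiable_bound[where S = "ball w (\<rho> / 8)" and f' = E])
    fix z assume "z \<in> ball w (\<rho> / 8)"
    then have z: "norm (z - w) < \<rho> / 8" by (simp add: dist_norm norm_minus_commute)
    have "((\<lambda>z. locmap m w z - z) has_derivative (\<lambda>v. (v + E z v) - v)) (at z)"
      using E[OF z] by (intro has_derivative_diff has_derivative_ident) blast
    then show "((\<lambda>z. locmap m w z - z) has_derivative E z) (at z within ball w (\<rho> / 8))"
      by (simp add: has_derivative_at_withinI)
    show "onorm (E z) \<le> 1 / 2" by (rule onorm_le) (use E[OF z] in blast)
  qed (use xy in auto)
  then have "norm (x - y) \<le> 1 / 2 * norm (x - y)" using xy(3) by (simp add: norm_minus_commute)
  then show "x = y" by simp
qed

lemma locmap_equivariant: "\<delta> \<in> \<Gamma> \<Longrightarrow> locmap m w (\<delta> z) = locmap m w z"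
  using jac_nonzero by (simp add: locmap_def series_equivariant)

text \<open>
  If \<open>y\<close> stays away from the orbit of the centre \<open>w\<close> near \<open>x\<close>, the sections at \<open>w\<close> and at a
  centre \<open>w'\<close> near \<open>y\<close> have different ratios at \<open>x\<close> and \<open>y\<close>.
\<close>

lemma separation:
  assumes m: "good m"
    and net: "\<And>x. \<exists>\<gamma>\<in>\<Gamma>. \<exists>w\<in>W. norm (\<gamma> x - w) < \<rho> / 32"
    and eq: "\<And>w p. w \<in> W \<Longrightarrow> p \<in> insert None (Some ` Basis) \<Longrightarrow> series m w p y = c * series m w p x"
  shows "\<exists>\<gamma>\<in>\<Gamma>. y = \<gamma> x"
proof -
  have m2: "2 \<le> m" using m by (simp add: good_def)
  obtain \<gamma>1 w where g1: "\<gamma>1 \<in> \<Gamma>" "w \<in> W" "norm (\<gamma>1 x - w) < \<rho> / 32" using net by blast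
  obtain \<gamma>3 w' where g3: "\<gamma>3 \<in> \<Gamma>" "w' \<in> W" "norm (\<gamma>3 y - w') < \<rho> / 32" using net by blast
  have c0: "c \<noteq> 0"
  proof
    assume "c = 0"
    then have "series m w' None (\<gamma>3 y) = 0" using eq[OF g3(2), of None] by (simp add: series_equivariant[OF g3(1)])
    moreover have "series m w' None (\<gamma>3 y) \<noteq> 0" using series_None_nonzero[OF m] g3(3) rho by simp
    ultimately show False by blast
  qed
  show ?thesis
  \<comment> \<open>If the orbit of \<open>y\<close> comes near the centre \<open>w\<close> of
    \<open>x\<close>, then translates of both points lie in the domain of one local coordinate map
    and have equal ratios, so injectivity decides. Otherwise the sizes of the sections at two
    centres are compared.\<close>
  proof (cases "\<exists>\<gamma>2\<in>\<Gamma>. norm (\<gamma>2 y - w) < \<rho> / 8")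
    case True
    then obtain \<gamma>2 where g2: "\<gamma>2 \<in> \<Gamma>" "norm (\<gamma>2 y - w) < \<rho> / 8" by blast
    have "locmap m w y = locmap m w x"
      unfolding locmap_def using eq[OF g1(2)] c0 by (intro sum.cong refl) simp
    then have "locmap m w (\<gamma>1 x) = locmap m w (\<gamma>2 y)" by (simp add: locmap_equivariant g1(1) g2(1))
    then have e: "\<gamma>1 x = \<gamma>2 y"
      using inj_onD[OF locmap_inj[OF m]] g1(3) g2(2) rho by (simp add: dist_norm norm_minus_commute)
    obtain \<delta> where d: "\<delta> \<in> \<Gamma>" "\<forall>x. \<delta> (\<gamma>2 x) = x \<and> \<gamma>2 (\<delta> x) = x" using inverse[OF g2(1)] by blast
    have "y = \<delta> (\<gamma>1 x)" using d(2) e by metis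
    then show ?thesis using mult[OF d(1) g1(1)] by (intro bexI[of _ "\<lambda>x. \<delta> (\<gamma>1 x)"]) auto
  next
    case False
    let ?x = "\<gamma>1 x" and ?y = "\<gamma>3 y"
    let ?A = "exp (real m * (norm ?x)\<^sup>2 / 2)" and ?B = "exp (real m * (norm ?y)\<^sup>2 / 2)"
    let ?q = "exp (- ((real m / 2 - 1 / 4) * (\<rho> / 8)\<^sup>2))"
    let ?s = "exp (- (real m * (\<rho> / 32)\<^sup>2) / 2)"
    have u1: "cmod (series m w None ?y) \<le> ?B * (?q * C)"
    proof (rule norm_series_None_le[OF m2])
      show "\<rho> / 8 \<le> norm (\<gamma> ?y - w)" if "\<gamma> \<in> \<Gamma>" for \<gamma>
        using False mult[OF that g3(1)] by (meson not_le)
    qed (use rho in simp)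
    have u2: "cmod (series m w' None ?x) \<le> ?A * C"
      using norm_series_None_le[OF m2, of 0 ?x w'] by simp
    have low: "exp (real m * (norm z)\<^sup>2 / 2) * ?s \<le> 2 * cmod (series m v None z)" if z: "norm (z - v) < \<rho> / 32" for z v
    proof -
      have "(norm (z - v))\<^sup>2 \<le> (\<rho> / 32)\<^sup>2" using z by (intro power_mono) auto
      then have "real m * (norm (z - v))\<^sup>2 \<le> real m * (\<rho> / 32)\<^sup>2" by (intro mult_left_mono) auto
      then have "real m * (norm z)\<^sup>2 / 2 + - (real m * (\<rho> / 32)\<^sup>2) / 2 \<le> real m * ((norm z)\<^sup>2 / 2 - (norm (z - v))\<^sup>2 / 2)"
        by (simp add: right_diff_distrib)
      then have "exp (real m * (norm z)\<^sup>2 / 2) * ?s \<le> cmod (peak m v z)"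
        unfolding norm_peak exp_add[symmetric] by simp
      also have "\<dots> \<le> 2 * cmod (series m v None z)" using series_None_lower[OF m] z rho by simp
      finally show ?thesis .
    qed
    note l1 = low[OF g1(3)] and l2 = low[OF g3(3)]
    have e1: "series m w None ?y = jac m \<gamma>3 y * c * series m w None x" 
      "series m w' None ?y = jac m \<gamma>3 y * c * series m w' None x"
      using eq[OF g1(2), of None] eq[OF g3(2), of None] by (simp_all add: series_equivariant[OF g3(1)])
    have e2: "series m v None ?x = jac m \<gamma>1 x * series m v None x" for v by (rule series_equivariant[OF g1(1)])
    \<comment> \<open>Proportionality makes the cross products equal. The left side is large, since
      each point is near the centre of its section; the right side is small, since the whole orbit
      of \<open>y\<close> avoids \<open>w\<close>.\<close>
    have swap: "cmod (series m w None ?x) * cmod (series m w' None ?y) = cmod (series m w None ?y) * cmod (series m w' None ?x)"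
      unfolding e1 e2 by (simp add: norm_mult mult_ac)
    have "(?A * ?s) * (?B * ?s) \<le> (2 * cmod (series m w None ?x)) * (2 * cmod (series m w' None ?y))"
      by (rule mult_mono[OF l1 l2]) simp_all
    also have "\<dots> = 4 * (cmod (series m w None ?y) * cmod (series m w' None ?x))" unfolding swap[symmetric] by simp
    also have "\<dots> \<le> 4 * ((?B * (?q * C)) * (?A * C))"
      using u1 u2 C_pos by (intro mult_left_mono mult_mono) auto
    finally have "(?A * ?s) * (?B * ?s) \<le> 4 * ((?B * (?q * C)) * (?A * C))" .
    then have "(?A * ?B) * (?s * ?s) \<le> (?A * ?B) * (4 * C\<^sup>2 * ?q)" by (simp add: power2_eq_square mult_ac)
    then have "?s * ?s \<le> 4 * C\<^sup>2 * ?q" by (rule mult_left_le_imp_le) simp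
    moreover have "?s * ?s = exp (- (real m * (\<rho> / 32)\<^sup>2))" by (simp add: exp_add[symmetric])
    ultimately show ?thesis using m by (simp add: good_def)
  qed
qed

theorem projective_quotient:
  fixes M :: "'a cmfd"
  assumes cov: "affine_cover J M \<pi>" and man: "complex_manifold M" and comp: "compact_space (ctop M)"
    and fibre: "\<And>x y. \<pi> x = \<pi> y \<longleftrightarrow> (\<exists>\<gamma>\<in>\<Gamma>. y = \<gamma> x)"
  shows "projective M"
proof -
  obtain m where m: "good m" using ex_good by blast
  have m2: "2 \<le> m" using m by (simp add: good_def)
  \<comment> \<open>A finite net of one ball suffices, because every orbit meets that ball.\<close>
  have "cball (0 :: real^'n) R \<subseteq> (\<Union>w\<in>cball 0 R. ball w (\<rho> / 32))" using rho by auto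
  then obtain W :: "(real^'n) set" where W: "finite W" "cball 0 R \<subseteq> (\<Union>w\<in>W. ball w (\<rho> / 32))"
    using compactE_image[OF compact_cball, of "cball 0 R" "\<lambda>w. ball w (\<rho> / 32)"] by (metis open_ball)
  have net: "\<exists>\<gamma>\<in>\<Gamma>. \<exists>w\<in>W. norm (\<gamma> x - w) < \<rho> / 32" for x
  proof -
    obtain \<gamma> where g: "\<gamma> \<in> \<Gamma>" "norm (\<gamma> x) \<le> R" using cobounded by blast
    then have "\<gamma> x \<in> (\<Union>w\<in>W. ball w (\<rho> / 32))" by (intro subsetD[OF W(2)]) simp
    then show ?thesis using g by (auto simp: dist_norm norm_minus_commute)
  qed
  \<comment> \<open>At each centre there is one plain section and one section with linear factor for
    every real basis vector. Homogeneous coordinates are numbered from 0 to \<open>N\<close>, hence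
    \<open>Suc N\<close> sections.\<close>
  define I where "I = W \<times> insert None (Some ` (Basis :: (real^'n) set))"
  have finI: "finite I" using W by (simp add: I_def)
  have "I \<noteq> {}" using net[of 0] by (auto simp: I_def)
  then obtain N where N: "card I = Suc N" using finI by (metis card_0_eq not0_implies_Suc)
  obtain e where "bij_betw e {0..<card I} I" using ex_bij_betw_nat_finite[OF finI] by blast
  then have e: "bij_betw e {..N} I" unfolding N by (simp add: atLeast0LessThan lessThan_Suc_atMost)
  have eI: "e i \<in> I" if "i \<le> N" for i using e that by (auto simp: bij_betw_def)
  have Ie: "\<exists>i\<le>N. e i = t" if "t \<in> I" for t using e that by (auto simp: bij_betw_def)
  define \<Theta> where "\<Theta> i = series m (fst (e i)) (snd (e i))" for i
  interpret projective_sections J M \<pi> N \<Theta>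
  proof
    show "complex_structure J" by (rule orthogonal_complex_structureD(1)[OF J])
    show "affine_cover J M \<pi>" "complex_manifold M" "compact_space (ctop M)" by fact+
    show "\<exists>D. cderiv J (\<Theta> i) D x" if "i \<le> N" for i x
    proof -
      have "small (snd (e i))" using eI[OF that] by (auto simp: I_def small_simps)
      then show ?thesis unfolding \<Theta>_def by (rule cderiv_series[OF m2])
    qed
    show "\<exists>i\<le>N. \<Theta> i x \<noteq> 0" for x
    proof -
      obtain \<gamma> w where g: "\<gamma> \<in> \<Gamma>" "w \<in> W" "norm (\<gamma> x - w) < \<rho> / 32" using net by blast
      then have "series m w None (\<gamma> x) \<noteq> 0" using series_None_nonzero[OF m] rho by simp
      then have "series m w None x \<noteq> 0" by (simp add: series_equivariant[OF g(1)])
      moreover obtain i where "i \<le> N" "e i = (w, None)" using Ie[of "(w, None)"] g by (auto simp: I_def)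
      ultimately show ?thesis by (auto simp: \<Theta>_def)
    qed
    show "\<exists>c. c \<noteq> 0 \<and> (\<forall>i\<le>N. \<Theta> i y = c * \<Theta> i x)" if "\<pi> x = \<pi> y" for x y
      using that jac_nonzero unfolding fibre \<Theta>_def by (metis series_equivariant)
    show "\<pi> x = \<pi> y" if eq: "\<forall>i\<le>N. \<Theta> i y = c * \<Theta> i x" for x y c
      unfolding fibre
    proof (rule separation[OF m net])
      fix w p assume "w \<in> W" "p \<in> insert None (Some ` (Basis :: (real^'n) set))"
      then have "(w, p) \<in> I" by (simp add: I_def)
      then obtain i where "i \<le> N" "e i = (w, p)" using Ie by blast
      then show "series m w p y = c * series m w p x" using eq by (metis \<Theta>_def fst_conv snd_conv)
    qed
    show "\<exists>B j a. open B \<and> x \<in> B \<and> j \<le> N \<and> (\<forall>y\<in>B. \<Theta> j y \<noteq> 0) \<and>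
        inj_on (\<lambda>y. \<Sum>i\<le>N. cscale J (\<Theta> i y / \<Theta> j y) (a i)) B \<and>
        (\<forall>y\<in>B. \<exists>D. ((\<lambda>y. \<Sum>i\<le>N. cscale J (\<Theta> i y / \<Theta> j y) (a i)) has_derivative D) (at y) \<and> inj D)" for x
    proof -
      obtain \<gamma> w where g: "\<gamma> \<in> \<Gamma>" "w \<in> W" "norm (\<gamma> x - w) < \<rho> / 32" using net by blast
      obtain j where j: "j \<le> N" "e j = (w, None)" using Ie[of "(w, None)"] g by (auto simp: I_def)
      \<comment> \<open>These coefficients select the sections at \<open>w\<close> that carry a
        linear factor, so that the combination of ratios is \<open>locmap\<close>.\<close>
      define a where "a t = (case snd t of None \<Rightarrow> 0 | Some b \<Rightarrow> if fst t = w then (1 / 2) *\<^sub>R b else 0)" 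
        for t :: "(real^'n) \<times> (real^'n) option"
      obtain A b where A: "\<And>x. \<gamma> x = A *v x + b" "\<And>x y. (A *v x) \<bullet> (A *v y) = x \<bullet> y" using affine[OF g(1)] by blast
      have sum: "(\<Sum>i\<le>N. cscale J (\<Theta> i y / \<Theta> j y) (a (e i))) = locmap m w (\<gamma> y)" for y
      proof -
        let ?F = "\<lambda>t. cscale J (series m (fst t) (snd t) y / series m w None y) (a t)"
        have "(\<Sum>i\<le>N. cscale J (\<Theta> i y / \<Theta> j y) (a (e i))) = (\<Sum>t\<in>I. ?F t)"
          using sum.reindex_bij_betw[OF e, of ?F] by (simp add: \<Theta>_def j(2))
        also have "\<dots> = (\<Sum>t\<in>(\<lambda>b. (w, Some b)) ` Basis. ?F t)"
          by (intro sum.mono_neutral_right finI) (use g(2) in \<open>auto simp: I_def a_def cscale_def\<close>)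
        also have "\<dots> = locmap m w y"
          by (subst sum.reindex) (auto simp: inj_on_def a_def locmap_def)
        finally show ?thesis by (simp add: locmap_equivariant[OF g(1)])
      qed
      have cont: "continuous_on UNIV \<gamma>"
        unfolding A(1) by (intro continuous_intros linear_continuous_on) (simp add: linear_conv_bounded_linear[symmetric])
      let ?B = "\<gamma> -` ball w (\<rho> / 8)"
      have "open ?B" by (rule open_vimage[OF open_ball cont])
      moreover have "x \<in> ?B" using g(3) rho by (simp add: dist_norm norm_minus_commute)
      moreover have "\<Theta> j y \<noteq> 0" if "y \<in> ?B" for y
      proof -
        have "norm (\<gamma> y - w) < \<rho> / 4" using that rho by (simp add: dist_norm norm_minus_commute)
        then have "series m w None (\<gamma> y) \<noteq> 0" by (rule series_None_nonzero[OF m])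
        then show ?thesis by (simp add: \<Theta>_def j(2) series_equivariant[OF g(1)])
      qed
      moreover have inj\<gamma>: "y = y'" if "\<gamma> y = \<gamma> y'" for y y' using isometry[OF g(1), of y y'] that by simp
      moreover have "inj_on (\<lambda>y. \<Sum>i\<le>N. cscale J (\<Theta> i y / \<Theta> j y) (a (e i))) ?B"
        unfolding sum
      proof (rule inj_onI)
        fix y y' assume y: "y \<in> ?B" "y' \<in> ?B" "locmap m w (\<gamma> y) = locmap m w (\<gamma> y')"
        have "\<gamma> y = \<gamma> y'"
          by (rule inj_onD[OF locmap_inj[OF m, of w] y(3) y(1)[unfolded vimage_eq] y(2)[unfolded vimage_eq]])
        then show "y = y'" by (rule inj\<gamma>)
      qed
      moreover have "\<exists>D. ((\<lambda>y. \<Sum>i\<le>N. cscale J (\<Theta> i y / \<Theta> j y) (a (e i))) has_derivative D) (at y) \<and> inj D" if "y \<in> ?B" for y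
      proof -
        have "norm (\<gamma> y - w) < \<rho> / 8" using that by (simp add: dist_norm norm_minus_commute)
        then obtain E where E: "(locmap m w has_derivative (\<lambda>v. v + E v)) (at (\<gamma> y))" "linear E" "\<And>v. norm (E v) \<le> 1 / 2 * norm v"
          using locmap_derivative[OF m] by blast
        have "((*v) A has_derivative (*v) A) (at y)"
          by (intro bounded_linear_imp_has_derivative) (simp add: linear_conv_bounded_linear[symmetric])
        then have "((\<lambda>y. A *v y + b) has_derivative (*v) A) (at y)" by (rule has_derivative_add_const)
        then have "(\<gamma> has_derivative (*v) A) (at y)" using A(1) by presburger
        from has_derivative_compose[OF this E(1)]
        have "((\<lambda>y. locmap m w (\<gamma> y)) has_derivative (\<lambda>v. A *v v + E (A *v v))) (at y)" .
        moreover have "inj (\<lambda>v. A *v v + E (A *v v))"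
        proof -
          have "linear (\<lambda>v. A *v v + E (A *v v))"
            using linear_compose_add[OF matrix_vector_mul_linear linear_compose[OF matrix_vector_mul_linear E(2)], of A A]
            by (simp add: comp_def)
          moreover have "v = 0" if "A *v v + E (A *v v) = 0" for v
          proof -
            have "norm (A *v v) = norm (E (A *v v))" using that by (metis add_eq_0_iff norm_minus_cancel)
            then have "norm (A *v v) \<le> 1 / 2 * norm (A *v v)" using E(3)[of "A *v v"] by simp
            then have "A *v v = 0" by simp
            then show ?thesis using A(2)[of v v] by simp
          qed
          ultimately show ?thesis using linear_injective_0[of "\<lambda>v. A *v v + E (A *v v)"] by blast
        qed
        ultimately show ?thesis unfolding sum by blast
      qed
      ultimately show ?thesis using j(1) by (intro exI[of _ ?B] exI[of _ j] exI[of _ "\<lambda>i. a (e i)"]) blast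
    qed
  qed
  show ?thesis by (rule projective)
qed

end

section \<open>Automorphisms of complex tori\<close>

lemma transformation_group_inverse:
  "transformation_group X G \<Longrightarrow> g \<in> G \<Longrightarrow> \<exists>h\<in>G. \<forall>x\<in>topspace X. h (g x) = x"
  by (simp add: transformation_group_def)

text \<open>The difference of the linear parts maps the whole vector space into the lattice; scaling
  a vector would produce nonzero lattice vectors of arbitrarily small norm.\<close>

lemma lattice_affine_unique:
  fixes A A' :: "real^'n^'n"
  assumes L: "full_lattice \<Lambda>" and eq: "\<And>x. coset \<Lambda> (A *v x + b) = coset \<Lambda> (A' *v x + b')"
  shows "A = A'"
proof -
  obtain r where r: "r > 0" "\<And>l. l \<in> \<Lambda> \<Longrightarrow> l \<noteq> 0 \<Longrightarrow> r \<le> norm l" using full_lattice_min_norm[OF L] by blast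
  define B where "B = A' - A"
  have mem: "B *v x + (b' - b) \<in> \<Lambda>" for x
    using eq[of x] unfolding coset_eq_iff[OF L] by (simp add: B_def matrix_vector_mult_diff_rdistrib algebra_simps)
  have B: "B *v x \<in> \<Lambda>" for x
    using full_lattice_closed_under(4)[OF L mem[of x] mem[of 0]] by simp
  have "B *v x = 0" for x
  proof (rule ccontr)
    assume nz: "B *v x \<noteq> 0"
    let ?t = "r / (2 * norm (B *v x))"
    have "B *v (?t *\<^sub>R x) = ?t *\<^sub>R (B *v x)" by (simp add: matrix_vector_mult_scaleR)
    moreover have "norm (?t *\<^sub>R (B *v x)) = r / 2" using nz r(1) by simp
    ultimately have "norm (B *v (?t *\<^sub>R x)) = r / 2" by simp
    then show False using r B[of "?t *\<^sub>R x"] by fastforce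
  qed
  then have "B = 0" by (simp add: matrix_eq)
  then show ?thesis by (simp add: B_def)
qed

lemma torus_chart:
  fixes J :: "real^'n^'n"
  assumes L: "full_lattice \<Lambda>" and \<kappa>: "linear_chart J \<kappa>"
  shows "\<exists>U \<phi> W. (U, \<phi>) \<in> catlas (torus \<Lambda> J) \<and> open W \<and> x \<in> W \<and> (\<forall>y\<in>W. coset \<Lambda> y \<in> U \<and> \<phi> (coset \<Lambda> y) = \<kappa> y)"
proof -
  obtain r where r: "r > 0" "\<And>l. l \<in> \<Lambda> \<Longrightarrow> l \<noteq> 0 \<Longrightarrow> r \<le> norm l" using full_lattice_min_norm[OF L] by blast
  let ?W = "ball x (r / 2)"
  have inj: "inj_on (coset \<Lambda>) ?W"
  proof (rule inj_onI)
    fix a b assume ab: "a \<in> ?W" "b \<in> ?W" "coset \<Lambda> a = coset \<Lambda> b"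
    have "norm (b - a) < r"
      using ab dist_triangle_half_r[of x b r a] by (simp add: dist_norm norm_minus_commute)
    then show "a = b" using r(2)[of "b - a"] ab coset_eq_iff[OF L] by force
  qed
  have "(UNIV, \<kappa>) \<in> catlas (linear_manifold J)" using \<kappa> by (simp add: linear_manifold_def linear_chart_def)
  moreover have "openin (ctop (linear_manifold J)) ?W" by (simp add: linear_manifold_def)
  ultimately have "(coset \<Lambda> ` ?W, \<kappa> \<circ> inv_into ?W (coset \<Lambda>)) \<in> catlas (torus \<Lambda> J)"
    using inj unfolding torus_def quot_manifold_def by auto
  moreover have "\<forall>y\<in>?W. coset \<Lambda> y \<in> coset \<Lambda> ` ?W \<and> (\<kappa> \<circ> inv_into ?W (coset \<Lambda>)) (coset \<Lambda> y) = \<kappa> y"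
    using inj by (auto simp: inv_into_f_f)
  moreover have "x \<in> ?W" using r by simp
  ultimately show ?thesis by (meson open_ball)
qed

text \<open>A continuous lift of a self-map of the torus is obtained from logarithms of the coordinate characters.\<close>

lemma torus_map_lift:
  fixes \<Lambda> :: "(real^'n) set"
  assumes L: "full_lattice \<Lambda>" and g: "continuous_map (quot_topology euclidean (coset \<Lambda>)) (quot_topology euclidean (coset \<Lambda>)) g"
  obtains F where "continuous_on UNIV F" "\<And>x. coset \<Lambda> (F x) = g (coset \<Lambda> x)"
proof -
  let ?T = "quot_topology euclidean (coset \<Lambda>)"
  obtain M N :: "real^'n^'n" where MN: "M ** N = mat 1" "N ** M = mat 1" and Leq: "\<Lambda> = {x. \<forall>i. (N *v x) $ i \<in> \<int>}"
    by (rule full_lattice_coordinates[OF L])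
  \<comment> \<open>In lattice coordinates these are the standard characters of the torus; together
    they determine a coset.\<close>
  define \<chi>' where "\<chi>' i x = exp (of_real (2 * pi * (N *v x) $ i) * \<i>)" for i x
  define ch where "ch i p = \<chi>' i (SOME x. coset \<Lambda> x = p)" for i p
  have \<chi>'_eq: "\<chi>' i x = \<chi>' i y" if "coset \<Lambda> x = coset \<Lambda> y" for i x y
  proof -
    have "(N *v (y - x)) $ i \<in> \<int>" using that Leq unfolding coset_eq_iff[OF L] by simp
    then obtain k :: int where "(N *v y) $ i - (N *v x) $ i = of_int k"
      by (auto simp: matrix_vector_mult_diff_distrib elim: Ints_cases)
    then have "(N *v y) $ i = (N *v x) $ i + of_int k" by simp
    then show ?thesis unfolding \<chi>'_def exp_eq by (intro exI[of _ "- k"]) (simp add: algebra_simps)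
  qed
  have ch: "ch i (coset \<Lambda> x) = \<chi>' i x" for i x
    unfolding ch_def by (rule \<chi>'_eq) (rule someI[of "\<lambda>y. coset \<Lambda> y = coset \<Lambda> x"], rule refl)
  have cont\<chi>: "continuous_on UNIV (\<chi>' i)" for i
    unfolding \<chi>'_def by (intro continuous_intros linear_continuous_on) (simp add: linear_conv_bounded_linear[symmetric])
  have "continuous_map ?T euclidean (ch i)" for i
  proof -
    have "ch i \<circ> coset \<Lambda> = \<chi>' i" by (simp add: fun_eq_iff ch)
    then have "continuous_map euclidean euclidean (ch i \<circ> coset \<Lambda>)" using cont\<chi> by (simp add: continuous_map_iff_continuous2)
    then show ?thesis using continuous_compose_quotient_map_eq[OF quotient_map_quot_topology] by blast
  qed
  then have "continuous_map euclidean euclidean (ch i \<circ> (g \<circ> coset \<Lambda>))" for i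
    using continuous_map_compose continuous_map_quot g by metis
  then have "continuous_on UNIV (\<lambda>x. ch i (g (coset \<Lambda> x)))" for i by (simp add: continuous_map_iff_continuous2 comp_def)
  moreover have gx: "\<exists>y. g (coset \<Lambda> x) = coset \<Lambda> y" for x
  proof -
    have "g (coset \<Lambda> x) \<in> topspace ?T"
      using g by (auto simp: continuous_map_def topspace_quot_topology)
    then show ?thesis by (auto simp: topspace_quot_topology)
  qed
  moreover have "ch i (g (coset \<Lambda> x)) \<noteq> 0" for i x using gx[of x] ch by (auto simp: \<chi>'_def)
  \<comment> \<open>The covering space is contractible, so every nowhere zero continuous function on
    it has a continuous logarithm. The imaginary parts divided by 2 pi are the lattice coordinates
    of the lift.\<close>
  ultimately have "\<exists>h. continuous_on UNIV h \<and> (\<forall>x. ch i (g (coset \<Lambda> x)) = exp (h x))" for i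
    using continuous_logarithm_on_contractible[of UNIV "\<lambda>x. ch i (g (coset \<Lambda> x))"] by (metis UNIV_I contractible_UNIV)
  then obtain h where h: "\<And>i. continuous_on UNIV (h i)" "\<And>i x. ch i (g (coset \<Lambda> x)) = exp (h i x)" by metis
  define F where "F x = M *v (\<chi> i. Im (h i x) / (2 * pi))" for x
  have "coset \<Lambda> (F x) = g (coset \<Lambda> x)" for x
  proof -
    obtain y where y: "g (coset \<Lambda> x) = coset \<Lambda> y" using gx by blast
    have "(N *v (y - F x)) $ i \<in> \<int>" for i
    proof -
      have "exp (h i x) = \<chi>' i y" using h(2)[of i x] ch y by simp
      then obtain k :: int where "h i x = of_real (2 * pi * (N *v y) $ i) * \<i> + of_int (2 * k) * of_real pi * \<i>"
        unfolding \<chi>'_def exp_eq by auto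
      then have "Im (h i x) = 2 * pi * (N *v y) $ i + 2 * of_int k * pi" by simp
      then have "Im (h i x) / (2 * pi) = (N *v y) $ i + of_int k" by (simp add: field_simps)
      then have "(N *v (y - F x)) $ i = - of_int k"
        by (simp add: F_def matrix_vector_mult_diff_distrib matrix_vector_mul_assoc MN)
      then show ?thesis by simp
    qed
    then have "y - F x \<in> \<Lambda>" unfolding Leq by simp
    then show ?thesis unfolding y coset_eq_iff[OF L] .
  qed
  moreover have "continuous_on UNIV F"
  proof -
    have "continuous_on UNIV (\<lambda>x. \<chi> i. Im (h i x) / (2 * pi))"
      by (intro continuous_on_vec_lambda continuous_intros h(1)) simp
    then show ?thesis
      unfolding F_def by (rule bounded_linear.continuous_on[rotated]) (simp add: linear_conv_bounded_linear[symmetric])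
  qed
  ultimately show ?thesis using that by blast
qed

text \<open>A continuous lift changes by a constant under each lattice translation, hence grows at
  most linearly. Liouville makes it affine on every complex line through the origin. Additivity
  across lines is a separate argument from boundedness of increments.\<close>

lemma holomorphic_torus_map_affine:
  fixes J :: "real^'n^'n"
  assumes T: "complex_torus \<Lambda> J" and g: "holomorphic_map (torus \<Lambda> J) (torus \<Lambda> J) g"
  shows "\<exists>A b. A ** J = J ** A \<and> (\<forall>x. g (coset \<Lambda> x) = coset \<Lambda> (A *v x + b))"
proof -
  let ?k = "CARD('n) div 2"
  have L: "full_lattice \<Lambda>" and J: "complex_structure J" using T by (auto simp: complex_torus_def)
  have gc: "continuous_map (quot_topology euclidean (coset \<Lambda>)) (quot_topology euclidean (coset \<Lambda>)) g"
    using g by (simp add: holomorphic_map_def ctop_torus)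
  obtain F where cF: "continuous_on UNIV F" and F: "\<And>x. coset \<Lambda> (F x) = g (coset \<Lambda> x)"
    using torus_map_lift[OF L gc] by blast
  obtain r where r: "r > 0" "\<And>l. l \<in> \<Lambda> \<Longrightarrow> l \<noteq> 0 \<Longrightarrow> r \<le> norm l" using full_lattice_min_norm[OF L] by blast
  obtain M N :: "real^'n^'n" where MN: "M ** N = mat 1" and Leq: "\<Lambda> = {x. \<forall>i. (N *v x) $ i \<in> \<int>}"
    using full_lattice_coordinates[OF L] by blast
  have period: "F (x + l) - F x = F l - F 0" if l: "l \<in> \<Lambda>" for x l
  proof -
    let ?d = "\<lambda>x. F (x + l) - F x"
    have mem: "?d x \<in> \<Lambda>" for x
    proof -
      have "coset \<Lambda> x = coset \<Lambda> (x + l)" using l coset_eq_iff[OF L] by simp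
      then have "coset \<Lambda> (F x) = coset \<Lambda> (F (x + l))" unfolding F by simp
      then show ?thesis by (simp add: coset_eq_iff[OF L])
    qed
    have cd: "continuous_on UNIV ?d"
      by (intro continuous_intros continuous_on_compose2[OF cF] cF) auto
    \<comment> \<open>A continuous function with integral values on a connected space is
      constant.\<close>
    have "(N *v ?d x) $ i = (N *v ?d 0) $ i" for i
    proof -
      have "continuous_on UNIV (\<lambda>x. (N *v ?d x) $ i)"
        by (intro continuous_intros bounded_linear.continuous_on[OF _ cd])
           (simp add: linear_conv_bounded_linear[symmetric])
      moreover have "\<exists>e>0. \<forall>y. y \<in> UNIV \<and> (N *v ?d y) $ i \<noteq> (N *v ?d x) $ i \<longrightarrow> e \<le> norm ((N *v ?d y) $ i - (N *v ?d x) $ i)" for x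
      proof (intro exI[of _ 1] conjI allI impI)
        fix y assume "y \<in> UNIV \<and> (N *v ?d y) $ i \<noteq> (N *v ?d x) $ i"
        then have "(N *v ?d y) $ i - (N *v ?d x) $ i \<noteq> 0" by simp
        moreover have "(N *v ?d y) $ i - (N *v ?d x) $ i \<in> \<int>"
          using mem[of x] mem[of y] unfolding Leq by (intro Ints_diff) blast+
        ultimately show "1 \<le> norm ((N *v ?d y) $ i - (N *v ?d x) $ i)" unfolding real_norm_def by (intro Ints_nonzero_abs_ge1)
      qed simp
      ultimately have "(\<lambda>x. (N *v ?d x) $ i) constant_on UNIV"
        using continuous_discrete_range_constant[of UNIV "\<lambda>x. (N *v ?d x) $ i"] by auto
      then show ?thesis unfolding constant_on_def by (metis UNIV_I)
    qed
    then have "N *v ?d x = N *v ?d 0" by (simp only: vec_eq_iff) blast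
    then have "(M ** N) *v ?d x = (M ** N) *v ?d 0" by (simp only: matrix_vector_mul_assoc[symmetric])
    then have "?d x = ?d 0" by (simp add: MN)
    then show ?thesis by simp
  qed
  obtain R0 where R0: "\<And>x. \<exists>l\<in>\<Lambda>. norm (x + l) \<le> R0" using full_lattice_cobounded[OF L] by blast
  \<comment> \<open>\<open>R\<close> is at least 1, so that the increments of length at most 1 used
    for the growth estimate are covered.\<close>
  define R where "R = max R0 1"
  have R: "\<exists>l\<in>\<Lambda>. norm (x + l) \<le> R" for x using R0[of x] unfolding R_def by (metis le_max_iff_disj)
  have R1: "1 \<le> R" by (simp add: R_def)
  have "bounded (F ` cball 0 (2 * R))"
    by (intro compact_imp_bounded compact_continuous_image continuous_on_subset[OF cF]) auto
  then obtain B where "\<forall>y\<in>F ` cball 0 (2 * R). norm y \<le> B" unfolding bounded_iff by blast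
  then have B: "norm (F x) \<le> B" if "norm x \<le> 2 * R" for x using that by simp
  \<comment> \<open>A lattice translation brings the base point into a fixed ball without changing
    increments.\<close>
  have inc: "norm (F (x + u) - F x) \<le> 2 * B" if u: "norm u \<le> R" for x u
  proof -
    obtain l where l: "l \<in> \<Lambda>" "norm (x + l) \<le> R" using R by blast
    have "F (x + l + u) - F (x + l) = F (x + u) - F x"
    proof -
      have e: "x + l + u = x + u + l" by simp
      have "F (x + l) = F x + (F l - F 0)" "F (x + u + l) = F (x + u) + (F l - F 0)"
        using period[OF l(1), of x] period[OF l(1), of "x + u"] by (simp_all only: diff_eq_eq add.commute)
      then show ?thesis unfolding e by simp
    qed
    moreover have "norm (F (x + l + u)) \<le> B" using l u norm_triangle_ineq[of "x + l" u] by (intro B) simp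
    moreover have "norm (F (x + l)) \<le> B" using l R1 by (intro B) simp
    ultimately show ?thesis using norm_triangle_ineq4[of "F (x + l + u)" "F (x + l)"] by simp
  qed
  have B0: "0 \<le> B" using B[of 0] R1 norm_ge_zero order_trans by (metis mult_nonneg_nonneg norm_zero zero_le_numeral zero_le_one)
  \<comment> \<open>The segment from 0 to \<open>x\<close> is cut into at most |x| + 2 steps of
    length at most 1.\<close>
  have growth: "norm (F x) \<le> norm (F 0) + (norm x + 2) * (2 * B)" for x
  proof -
    define n where "n = nat \<lceil>norm x\<rceil> + 1"
    have n: "norm x \<le> real n" "real n \<le> norm x + 2" "0 < n" unfolding n_def by (auto, linarith+)
    let ?u = "(1 / real n) *\<^sub>R x"
    have "norm ?u \<le> 1" using n by (simp add: divide_le_eq)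
    then have u: "norm ?u \<le> R" using R1 by (rule order_trans)
    have "norm (F (real j *\<^sub>R ?u) - F 0) \<le> real j * (2 * B)" for j
    proof (induction j)
      case (Suc j)
      have "real (Suc j) *\<^sub>R ?u = real j *\<^sub>R ?u + ?u" by (simp only: of_nat_Suc scaleR_add_left scaleR_one add.commute)
      then have "norm (F (real (Suc j) *\<^sub>R ?u) - F (real j *\<^sub>R ?u)) \<le> 2 * B" using inc[OF u] by simp
      then show ?case using norm_diff_triangle_le[OF _ Suc.IH] by (simp add: algebra_simps)
    qed simp
    from this[of n] have "norm (F x - F 0) \<le> real n * (2 * B)" using n by simp
    also have "\<dots> \<le> (norm x + 2) * (2 * B)" using n B0 by (intro mult_right_mono) auto
    finally show ?thesis using norm_triangle_sub[of "F x" "F 0"] by simp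
  qed
  obtain \<kappa> where \<kappa>: "linear_chart J \<kappa>" using ex_linear_chart[OF J] by blast
  have cd: "\<exists>D. cderiv J (\<lambda>y. \<kappa> (F y) i) D x" for x i
  proof (cases "i < ?k")
    case False
    then have "\<kappa> (F y) i = 0" for y using linear_chartD(2)[OF \<kappa>, of "F y"] by (simp add: Cn_def)
    then show ?thesis using cderiv_const[of J 0 x] by auto
  next
    case True
    obtain U \<phi> W where U: "(U, \<phi>) \<in> catlas (torus \<Lambda> J)" "open W" "x \<in> W" "\<And>y. y \<in> W \<Longrightarrow> coset \<Lambda> y \<in> U \<and> \<phi> (coset \<Lambda> y) = \<kappa> y"
      using torus_chart[OF L \<kappa>, of x] by blast
    obtain V \<psi> W' where V: "(V, \<psi>) \<in> catlas (torus \<Lambda> J)" "open W'" "F x \<in> W'" "\<And>y. y \<in> W' \<Longrightarrow> coset \<Lambda> y \<in> V \<and> \<psi> (coset \<Lambda> y) = \<kappa> y"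
      using torus_chart[OF L \<kappa>, of "F x"] by blast
    note cov = affine_cover_torus[OF T]
    let ?S = "\<phi> ` (U \<inter> g -` V)"
    have "coset \<Lambda> x \<in> U" "g (coset \<Lambda> x) \<in> V" using U(3,4) V(3,4) F by metis+
    then obtain A where A: "\<forall>i<cdim (torus \<Lambda> J). has_cgradient (cdim (torus \<Lambda> J)) ?S (\<lambda>w. (\<psi> \<circ> g \<circ> inv_into U \<phi>) w i) (A i) (\<phi> (coset \<Lambda> x))"
      using holomorphic_map_gradients[OF g U(1) V(1)] by blast
    have kx: "\<phi> (coset \<Lambda> x) = (\<lambda>i. \<kappa> x i + 0)" using U(3,4) by simp
    have G: "has_cgradient ?k ?S (\<lambda>w. (\<psi> \<circ> g \<circ> inv_into U \<phi>) w i) (A i) (\<lambda>i. \<kappa> x i + 0)"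
      using A True unfolding affine_coverD(1)[OF cov] kx by blast
    have "cderiv J (\<lambda>y. \<kappa> (F y) i) (\<lambda>v. \<Sum>j<?k. A i j * \<kappa> v j) x"
    proof (rule cderiv_of_cgradient[OF \<kappa> _ _ G, where Y = "W \<inter> F -` W'"])
      show "(\<lambda>_. 0) \<in> Cn ?k" by (simp add: Cn_def)
      show "?S \<subseteq> Cn ?k" using affine_cover_chart_Cn[OF cov U(1)] by blast
      show "open (W \<inter> F -` W')" using open_vimage[OF V(2) cF] U(2) by blast
      show "x \<in> W \<inter> F -` W'" using U V by simp
      fix y assume y: "y \<in> W \<inter> F -` W'"
      have 1: "coset \<Lambda> y \<in> U" "\<phi> (coset \<Lambda> y) = \<kappa> y" using U(4) y by blast+
      have 2: "g (coset \<Lambda> y) \<in> V" "\<psi> (g (coset \<Lambda> y)) = \<kappa> (F y)" using V(4)[of "F y"] y F[of y] by auto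
      have "inv_into U \<phi> (\<kappa> y) = coset \<Lambda> y"
        using 1 affine_coverD(7)[OF cov U(1)] by (metis inv_into_f_f)
      then show "(\<lambda>i. \<kappa> y i + 0) \<in> ?S \<and> \<kappa> (F y) i = (\<psi> \<circ> g \<circ> inv_into U \<phi>) (\<lambda>i. \<kappa> y i + 0) i"
        using 1 2 by (auto intro!: image_eqI[of _ _ "coset \<Lambda> y"])
    qed
    then show ?thesis by blast
  qed
  define D where "D v = F v - F 0" for v
  have hom: "D (cscale J t v) = cscale J t (D v)" for t v
  proof -
    have "\<kappa> (D (cscale J t v)) i = \<kappa> (cscale J t (D v)) i" for i
    proof -
      define G where "G t = \<kappa> (F (cscale J t v)) i" for t
      have hol: "G holomorphic_on UNIV"
        unfolding holomorphic_on_open[OF open_UNIV]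
      proof
        fix t
        obtain E where "cderiv J (\<lambda>y. \<kappa> (F y) i) E (0 + cscale J t v)" using cd by blast
        from cderiv_on_line[OF this] show "\<exists>f'. (G has_field_derivative f') (at t)"
          unfolding G_def add_0_left by blast
      qed
      have lk: "linear (\<lambda>v. \<kappa> v i)" by (rule linear_chartD(3)[OF \<kappa>])
      then obtain K where K: "K > 0" "\<And>v. norm (\<kappa> v i) \<le> norm v * K"
        using bounded_linear.pos_bounded linear_conv_bounded_linear by blast
      let ?c = "norm v + norm (J *v v)"
      let ?B = "(norm (F 0) + (?c + 2) * (2 * B)) * K"
      have "cmod (G t) \<le> ?B * cmod t ^ 1" if t: "1 \<le> cmod t" for t
      proof -
        have "norm (cscale J t v) \<le> \<bar>Re t\<bar> * norm v + \<bar>Im t\<bar> * norm (J *v v)"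
          unfolding cscale_def by (metis norm_scaleR norm_triangle_ineq)
        also have "\<dots> \<le> cmod t * norm v + cmod t * norm (J *v v)"
          using abs_Re_le_cmod abs_Im_le_cmod by (intro add_mono mult_right_mono) auto
        finally have n: "norm (cscale J t v) \<le> cmod t * ?c" by (simp add: distrib_left)
        have "norm (F (cscale J t v)) \<le> norm (F 0) + (cmod t * ?c + 2) * (2 * B)"
          using growth[of "cscale J t v"] n B0 by (smt (verit) mult_right_mono)
        also have "\<dots> \<le> cmod t * norm (F 0) + (cmod t * ?c + cmod t * 2) * (2 * B)"
          using t B0 by (intro add_mono mult_right_mono) (auto simp: mult_le_cancel_right1)
        also have "\<dots> = (norm (F 0) + (?c + 2) * (2 * B)) * cmod t" by (simp add: algebra_simps)
        finally have "norm (F (cscale J t v)) * K \<le> (norm (F 0) + (?c + 2) * (2 * B)) * cmod t * K"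
          using K(1) by (intro mult_right_mono) auto
        then show ?thesis using K(2)[of "F (cscale J t v)"] by (simp add: G_def mult_ac)
      qed
      \<comment> \<open>Entire functions of at most linear growth are polynomials of degree at most
        1.\<close>
      then have "G t = (\<Sum>j\<le>1. (deriv ^^ j) G 0 / fact j * t ^ j)" for t
        by (rule Liouville_polynomial[OF hol, of 1 ?B 1]) auto
      then have Gsum: "G t = (\<Sum>j\<le>1. (deriv ^^ j) G 0 / fact j * t ^ j)" for t .
      have G: "G t = G 0 + deriv G 0 * t" for t by (subst Gsum) simp
      have k: "\<kappa> (D (cscale J t v)) i = G t - G 0" for t
        by (simp add: D_def G_def cscale_simps linear_diff[OF lk])
      have "\<kappa> (D v) i = G 1 - G 0" using k[of 1] by (simp add: cscale_simps)
      then show ?thesis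
        unfolding k linear_chart_cscale[OF \<kappa>] using G[of t] G[of 1] by (simp add: mult.commute)
    qed
    then have "\<kappa> (D (cscale J t v)) = \<kappa> (cscale J t (D v))" by blast
    then show ?thesis using linear_chartD(1)[OF \<kappa>] by metis
  qed
  have real: "D (c *\<^sub>R v) = c *\<^sub>R D v" for c v using hom[of "of_real c" v] by (simp add: cscale_def)
  have add: "D (u + v) = D u + D v" for u v
  proof (rule ccontr)
    assume ne: "D (u + v) \<noteq> D u + D v"
    \<comment> \<open>The additivity defect is homogeneous: for n u, n v it is n times as large.
      Replacing n u by its remainder modulo the lattice shows that it stays below 4 B for all n, so
      it vanishes.\<close>
    let ?e = "norm (D (u + v) - D u - D v)"
    have e: "?e > 0" using ne by (simp add: diff_diff_eq)
    have "real n * ?e \<le> 4 * B" for n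
    proof -
      let ?n = "real n"
      obtain l where l: "l \<in> \<Lambda>" "norm (?n *\<^sub>R u + l) \<le> R" using R by blast
      let ?r = "?n *\<^sub>R u + l"
      have 1: "D (?n *\<^sub>R u) = D ?r - D l" using period[OF l(1), of "?n *\<^sub>R u"] by (simp add: D_def algebra_simps)
      have 2: "D (?n *\<^sub>R u + ?n *\<^sub>R v) = D (?n *\<^sub>R v + ?r) - D l"
        using period[OF l(1), of "?n *\<^sub>R u + ?n *\<^sub>R v"] by (simp add: D_def algebra_simps)
      have "?n *\<^sub>R (D (u + v) - D u - D v) = D (?n *\<^sub>R u + ?n *\<^sub>R v) - D (?n *\<^sub>R u) - D (?n *\<^sub>R v)"
        by (simp add: real[symmetric] scaleR_diff_right scaleR_add_right)
      also have "\<dots> = (D (?n *\<^sub>R v + ?r) - D (?n *\<^sub>R v)) - (D (0 + ?r) - D 0)"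
        unfolding 1 2 by (simp add: D_def)
      also have "norm \<dots> \<le> 2 * B + 2 * B"
      proof -
        have "norm (D (?n *\<^sub>R v + ?r) - D (?n *\<^sub>R v)) \<le> 2 * B" "norm (D (0 + ?r) - D 0) \<le> 2 * B"
          using inc[OF l(2), of "?n *\<^sub>R v"] inc[OF l(2), of 0] by (simp_all add: D_def)
        then show ?thesis using norm_triangle_ineq4 add_mono order_trans by meson
      qed
      finally show ?thesis by simp
    qed
    moreover obtain n :: nat where "4 * B < real n * ?e" using e reals_Archimedean3 by blast
    ultimately show False by (meson not_le)
  qed
  have lin: "linear D" by (rule linearI[OF add real])
  have "D (J *v v) = J *v D v" for v using hom[of \<i> v] by (simp add: cscale_def)
  then have "matrix D ** J = J ** matrix D"
    by (simp add: matrix_eq matrix_vector_mul_assoc[symmetric] matrix_works lin)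
  moreover have "g (coset \<Lambda> x) = coset \<Lambda> (matrix D *v x + F 0)" for x
    by (simp add: matrix_works lin D_def F)
  ultimately show ?thesis by blast
qed

section \<open>Linear parts of automorphisms\<close>

lemma linear_part_eq:
  assumes "full_lattice \<Lambda>" "\<And>x. g (coset \<Lambda> x) = coset \<Lambda> (A *v x + b)"
  shows "linear_part \<Lambda> g = A"
  unfolding linear_part_def
proof (rule the_equality)
  show "\<exists>b. \<forall>x. g (coset \<Lambda> x) = coset \<Lambda> (A *v x + b)" using assms(2) by blast
  fix A' assume "\<exists>b'. \<forall>x. g (coset \<Lambda> x) = coset \<Lambda> (A' *v x + b')"
  then show "A' = A" using assms(2) lattice_affine_unique[OF assms(1)] by metis
qed

lemma aut_group_lifts:
  fixes J :: "real^'n^'n"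
  assumes T: "complex_torus \<Lambda> J" and G: "finite_free_aut_group (torus \<Lambda> J) G" and g: "g \<in> G"
  shows "linear_part \<Lambda> g ** J = J ** linear_part \<Lambda> g" "invertible (linear_part \<Lambda> g)"
    "\<exists>b. \<forall>x. g (coset \<Lambda> x) = coset \<Lambda> (linear_part \<Lambda> g *v x + b)"
proof -
  have L: "full_lattice \<Lambda>" using T by (simp add: complex_torus_def)
  have lift: "\<exists>A b. A ** J = J ** A \<and> (\<forall>x. g (coset \<Lambda> x) = coset \<Lambda> (A *v x + b))" if "g \<in> G" for g
    using G that holomorphic_torus_map_affine[OF T] unfolding finite_free_aut_group_def biholomorphism_def by blast
  obtain A b where A: "A ** J = J ** A" "\<forall>x. g (coset \<Lambda> x) = coset \<Lambda> (A *v x + b)" using lift[OF g] by blast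
  have lpA: "linear_part \<Lambda> g = A" using linear_part_eq[OF L] A(2) by blast
  show "linear_part \<Lambda> g ** J = J ** linear_part \<Lambda> g" "\<exists>b. \<forall>x. g (coset \<Lambda> x) = coset \<Lambda> (linear_part \<Lambda> g *v x + b)"
    unfolding lpA using A by blast+
  obtain h where h: "h \<in> G" "\<forall>p\<in>points (torus \<Lambda> J). h (g p) = p"
    using transformation_group_inverse[OF finite_free_aut_groupD(2)[OF G] g] by blast
  obtain A' b' where A': "\<forall>x. h (coset \<Lambda> x) = coset \<Lambda> (A' *v x + b')" using lift[OF h(1)] by blast
  have "coset \<Lambda> ((A' ** A) *v x + (A' *v b + b')) = coset \<Lambda> (mat 1 *v x + 0)" for x
  proof -
    have "h (g (coset \<Lambda> x)) = coset \<Lambda> x" using h(2) by (simp add: points_torus)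
    then show ?thesis using A(2) A' by (simp add: matrix_vector_right_distrib matrix_vector_mul_assoc add.assoc)
  qed
  then have "A' ** A = mat 1" by (rule lattice_affine_unique[OF L])
  then show "invertible (linear_part \<Lambda> g)" unfolding lpA invertible_def by (meson matrix_left_right_inverse)
qed

text \<open>The maps and the topological torus stay the same. Affine maps whose linear parts commute
  with the new structure are holomorphic for it.\<close>

lemma finite_free_aut_group_change_structure:
  fixes J J' :: "real^'n^'n"
  assumes T: "complex_torus \<Lambda> J" "complex_torus \<Lambda> J'" and G: "finite_free_aut_group (torus \<Lambda> J) G"
    and com: "\<And>g. g \<in> G \<Longrightarrow> linear_part \<Lambda> g ** J' = J' ** linear_part \<Lambda> g"
  shows "finite_free_aut_group (torus \<Lambda> J') G"
proof -
  have ct: "ctop (torus \<Lambda> J') = ctop (torus \<Lambda> J)" by (simp add: ctop_torus)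
  have hol: "holomorphic_map (torus \<Lambda> J') (torus \<Lambda> J') f"
    if g: "g \<in> G" and f: "continuous_map (ctop (torus \<Lambda> J)) (ctop (torus \<Lambda> J)) f" "\<And>p. p \<in> points (torus \<Lambda> J) \<Longrightarrow> f p = g p" for f g
  proof -
    obtain b where b: "\<forall>x. g (coset \<Lambda> x) = coset \<Lambda> (linear_part \<Lambda> g *v x + b)" using aut_group_lifts(3)[OF T(1) G g] by blast
    show ?thesis
      by (rule holomorphic_map_affine[OF affine_cover_torus[OF T(2)] affine_cover_torus[OF T(2)] _ com[OF g], where b = b])
         (use f b ct in \<open>auto simp: points_torus\<close>)
  qed
  have "biholomorphism (torus \<Lambda> J') (torus \<Lambda> J') g" if g: "g \<in> G" for g
  proof -
    obtain g' where g': "homeomorphic_maps (ctop (torus \<Lambda> J)) (ctop (torus \<Lambda> J)) g g'"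
      using G g unfolding finite_free_aut_group_def biholomorphism_def by blast
    obtain h where h: "h \<in> G" "\<forall>p\<in>points (torus \<Lambda> J). h (g p) = p"
      using transformation_group_inverse[OF finite_free_aut_groupD(2)[OF G] g] by blast
    \<comment> \<open>The continuous inverse \<open>g'\<close> need not belong to \<open>G\<close>
      as a function, but on points of the torus it agrees with a member \<open>h\<close>, whose
      linear part is controlled.\<close>
    have "g' p = h p" if p: "p \<in> points (torus \<Lambda> J)" for p
    proof -
      have "g' p \<in> points (torus \<Lambda> J)" "g (g' p) = p" 
        using g' p unfolding homeomorphic_maps_def continuous_map_def by auto
      then show ?thesis using h(2) by metis
    qed
    then show ?thesis
      unfolding biholomorphism_def ct using g' hol[OF g, of g] hol[OF h(1), of g']
      by (intro exI[of _ g']) (auto simp: homeomorphic_maps_def)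
  qed
  then show ?thesis using G unfolding finite_free_aut_group_def ct by blast
qed

section \<open>Polarizable complex structures are dense\<close>

lemma norm_matrix_power2: "(norm (A :: real^'n^'m))\<^sup>2 = (\<Sum>i\<in>UNIV. \<Sum>j\<in>UNIV. (A $ i $ j)\<^sup>2)"
  by (simp add: norm_vec_def L2_set_def sum_nonneg)

text \<open>The norm of this type is the Frobenius norm, so Cauchy-Schwarz applies to every entry of
  the product.\<close>

lemma norm_matrix_mult_le: "norm (A ** B) \<le> norm A * norm (B :: real^'n^'n)" for A :: "real^'n^'n"
proof -
  have "(norm (A ** B))\<^sup>2 = (\<Sum>i\<in>UNIV. \<Sum>j\<in>UNIV. (\<Sum>k\<in>UNIV. A $ i $ k * B $ k $ j)\<^sup>2)"
    by (simp add: norm_matrix_power2 matrix_matrix_mult_def)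
  also have "\<dots> \<le> (\<Sum>i\<in>UNIV. \<Sum>j\<in>UNIV. (\<Sum>k\<in>UNIV. (A $ i $ k)\<^sup>2) * (\<Sum>k\<in>UNIV. (B $ k $ j)\<^sup>2))"
    by (intro sum_mono Cauchy_Schwarz_ineq_sum)
  also have "\<dots> = (\<Sum>i\<in>UNIV. \<Sum>k\<in>UNIV. (A $ i $ k)\<^sup>2) * (\<Sum>j\<in>UNIV. \<Sum>k\<in>UNIV. (B $ k $ j)\<^sup>2)"
    by (simp add: sum_product)
  also have "(\<Sum>j\<in>UNIV. \<Sum>k\<in>UNIV. (B $ k $ j)\<^sup>2) = (norm B)\<^sup>2"
    unfolding norm_matrix_power2 by (rule sum.swap)
  also have "(\<Sum>i\<in>UNIV. \<Sum>k\<in>UNIV. (A $ i $ k)\<^sup>2) = (norm A)\<^sup>2" by (rule norm_matrix_power2[symmetric])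
  finally have "(norm (A ** B))\<^sup>2 \<le> (norm A * norm B)\<^sup>2" by (simp add: power_mult_distrib)
  then show ?thesis by (rule power2_le_imp_le) simp
qed

interpretation mm: bounded_bilinear "(**) :: real^'n^'n \<Rightarrow> real^'n^'n \<Rightarrow> real^'n^'n"
proof
  fix a a' b b' :: "real^'n^'n" and r :: real
  show "(a + a') ** b = a ** b + a' ** b" by (simp add: matrix_eq matrix_vector_mul_assoc[symmetric] matrix_vector_mult_add_rdistrib)
  show "a ** (b + b') = a ** b + a ** b'" by (rule matrix_add_ldistrib)
  show "(r *\<^sub>R a) ** b = r *\<^sub>R (a ** b)" by (simp add: matrix_eq matrix_vector_mul_assoc[symmetric] scaleR_matrix_vector_assoc[symmetric])
  show "a ** (r *\<^sub>R b) = r *\<^sub>R (a ** b)" by (simp add: matrix_eq matrix_vector_mul_assoc[symmetric] scaleR_matrix_vector_assoc[symmetric] matrix_vector_mult_scaleR)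
  show "\<exists>K. \<forall>(a :: real^'n^'n) (b :: real^'n^'n). norm (a ** b) \<le> norm a * norm b * K"
    by (rule exI[of _ 1]) (simp add: norm_matrix_mult_le)
qed

lemmas matrix_algebra = mm.add_left mm.add_right mm.diff_left mm.diff_right mm.scaleR_left mm.scaleR_right
  mm.minus_left mm.minus_right

lemma transpose_linear:
  "transpose (A + B) = transpose A + transpose B" "transpose (A - B) = transpose A - transpose B"
  "transpose (- A) = - transpose A" for A B :: "real^'n^'n"
  by (simp_all add: transpose_def vec_eq_iff)

lemma norm_matrix_vector_le: "norm (A *v x) \<le> norm A * norm x" for A :: "real^'n^'n"
proof -
  have "(norm (A *v x))\<^sup>2 = (\<Sum>i\<in>UNIV. (\<Sum>j\<in>UNIV. A $ i $ j * x $ j)\<^sup>2)"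
    by (simp add: norm_vec_def L2_set_def sum_nonneg matrix_vector_mult_def)
  also have "\<dots> \<le> (\<Sum>i\<in>UNIV. (\<Sum>j\<in>UNIV. (A $ i $ j)\<^sup>2) * (\<Sum>j\<in>UNIV. (x $ j)\<^sup>2))"
    by (intro sum_mono Cauchy_Schwarz_ineq_sum)
  also have "\<dots> = (norm A)\<^sup>2 * (norm x)\<^sup>2"
    by (simp add: norm_matrix_power2 sum_distrib_right norm_vec_def L2_set_def sum_nonneg)
  finally have "(norm (A *v x))\<^sup>2 \<le> (norm A * norm x)\<^sup>2" by (simp add: power_mult_distrib)
  then show ?thesis by (rule power2_le_imp_le) simp
qed

lemma matrix_left_inverse_of_inj:
  fixes A :: "real^'n^'n"
  assumes "\<And>x. A *v x = 0 \<Longrightarrow> x = 0"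
  obtains B where "B ** A = mat 1" "A ** B = mat 1"
proof -
  have "inj ((*v) A)" using assms linear_injective_0[OF matrix_vector_mul_linear[of A]] by blast
  then obtain B where "B ** A = mat 1" using matrix_left_invertible_injective by blast
  then show ?thesis using that matrix_left_right_inverse by blast
qed

lemma inverse_one_minus:
  fixes Y :: "real^'n^'n"
  assumes "norm Y < 1"
  obtains B where "B ** (mat 1 - Y) = mat 1" "(mat 1 - Y) ** B = mat 1"
proof (rule matrix_left_inverse_of_inj)
  fix x assume "(mat 1 - Y) *v x = 0"
  then have "x = Y *v x" by (simp add: matrix_vector_mult_diff_rdistrib)
  then have "norm x \<le> norm Y * norm x" using norm_matrix_vector_le[of Y x] by simp
  then show "x = 0" using assms by (metis mult_le_cancel_right1 norm_le_zero_iff not_le)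
qed (use that in blast)

text \<open>
  The square root \<open>1 - Y\<close> of \<open>1 - E\<close> is the fixed point \<open>Y = (E + Y\<^sup>2) / 2\<close>; the iteration preserves
  commutation with a matrix and self-adjointness, so its limit inherits them.
\<close>

lemma matrix_sqrt:
  fixes E :: "real^'n^'n"
  assumes q: "norm E \<le> q" "q < 1"
  obtains Y where "norm Y \<le> q" "(mat 1 - Y) ** (mat 1 - Y) = mat 1 - E"
    "\<And>B. B ** E = E ** B \<Longrightarrow> B ** Y = Y ** B"
    "\<And>P. transpose E ** P = P ** E \<Longrightarrow> transpose Y ** P = P ** Y"
proof -
  have q0: "0 \<le> q" using q norm_ge_zero order_trans by blast
  \<comment> \<open>All wanted properties of the limit are closed conditions. They are imposed for
    every commuting matrix and every compatible form at once, so that one fixed point has them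
    all.\<close>
  define S where "S = cball 0 q \<inter> (\<Inter>B\<in>{B. B ** E = E ** B}. {Y. B ** Y = Y ** B})
     \<inter> (\<Inter>P\<in>{P. transpose E ** P = P ** E}. {Y. transpose Y ** P = P ** Y})"
  define f where "f Y = (1 / 2) *\<^sub>R (E + Y ** Y)" for Y
  have ct: "continuous_on UNIV (transpose :: real^'n^'n \<Rightarrow> real^'n^'n)"
    unfolding transpose_def by (intro continuous_intros)
  have "closed {Y. B ** Y = Y ** B}" for B :: "real^'n^'n"
    by (rule closed_Collect_eq[OF mm.continuous_on[OF continuous_on_const continuous_on_id] mm.continuous_on[OF continuous_on_id continuous_on_const]])
  moreover have "closed {Y. transpose Y ** P = P ** Y}" for P :: "real^'n^'n"
    by (rule closed_Collect_eq[OF mm.continuous_on[OF ct continuous_on_const] mm.continuous_on[OF continuous_on_const continuous_on_id]])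
  ultimately have "closed S" unfolding S_def by (intro closed_Int closed_INT closed_cball) auto
  then have S: "complete S" by (simp add: complete_eq_closed)
  have t0: "transpose (0::real^'n^'n) = 0" by (simp add: transpose_def vec_eq_iff)
  have "0 \<in> S" using q0 by (simp add: S_def t0)
  then have ne: "S \<noteq> {}" by blast
  have nS: "norm Y \<le> q" if "Y \<in> S" for Y using that by (simp add: S_def)
  have fS: "f ` S \<subseteq> S"
  proof
    fix X assume "X \<in> f ` S"
    then obtain Y where Y: "Y \<in> S" "X = f Y" by blast
    have "norm (Y ** Y) \<le> q * q"
      using norm_matrix_mult_le[of Y Y] mult_mono[OF nS[OF Y(1)] nS[OF Y(1)] q0] by simp
    also have "\<dots> \<le> q" using q q0 by (simp add: mult_left_le)
    finally have "norm (E + Y ** Y) \<le> 2 * q" using norm_triangle_ineq[of E "Y ** Y"] q by simp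
    then have "norm X \<le> q" by (simp add: Y(2) f_def)
    moreover have "B ** X = X ** B" if B: "B ** E = E ** B" for B
    proof -
      have BY: "B ** Y = Y ** B" using Y(1) B by (simp add: S_def)
      have "B ** (Y ** Y) = (Y ** Y) ** B" by (metis BY matrix_mul_assoc)
      then show ?thesis using B by (simp add: Y(2) f_def matrix_algebra)
    qed
    moreover have "transpose X ** P = P ** X" if P: "transpose E ** P = P ** E" for P
    proof -
      have PY: "transpose Y ** P = P ** Y" using Y(1) P by (simp add: S_def)
      have "transpose (Y ** Y) ** P = P ** (Y ** Y)" by (metis PY matrix_mul_assoc matrix_transpose_mul)
      then show ?thesis using P by (simp add: Y(2) f_def matrix_algebra transpose_scalar transpose_linear)
    qed
    ultimately show "X \<in> S" by (simp add: S_def)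
  qed
  have lip: "dist (f Y) (f Z) \<le> q * dist Y Z" if YZ: "Y \<in> S" "Z \<in> S" for Y Z
  proof -
    \<comment> \<open>The noncommutative difference of squares gives contraction constant
      \<open>q\<close>.\<close>
    have "f Y - f Z = (1 / 2) *\<^sub>R (Y ** (Y - Z) + (Y - Z) ** Z)"
      by (simp add: f_def matrix_algebra scaleR_diff_right[symmetric])
    moreover have "norm (Y ** (Y - Z) + (Y - Z) ** Z) \<le> q * norm (Y - Z) + norm (Y - Z) * q"
      by (intro norm_triangle_le add_mono order_trans[OF norm_matrix_mult_le] mult_mono nS YZ) (use q0 in auto)
    ultimately show ?thesis by (simp add: dist_norm)
  qed
  obtain Y where Y: "Y \<in> S" "f Y = Y" using Banach_fix[OF S ne q0 q(2) fS] lip by blast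
  have "2 *\<^sub>R f Y = E + Y ** Y" by (simp add: f_def)
  then have "E + Y ** Y = 2 *\<^sub>R Y" unfolding Y(2) by (rule sym)
  then have "(mat 1 - Y) ** (mat 1 - Y) = mat 1 - E" by (simp add: matrix_algebra scaleR_2 algebra_simps)
  then show ?thesis using that[of Y] Y(1) by (simp add: S_def)
qed

section \<open>Rational approximation of invariant forms\<close>

lemma Rats_sum: "(\<And>i. i \<in> I \<Longrightarrow> f i \<in> \<rat>) \<Longrightarrow> sum f I \<in> \<rat>"
  by (induction I rule: infinite_finite_induct) auto

definition rational_matrix :: "real^'n^'n \<Rightarrow> bool" where
  "rational_matrix A \<longleftrightarrow> (\<forall>i j. A $ i $ j \<in> \<rat>)"

lemma rational_matrix_mult: "rational_matrix A \<Longrightarrow> rational_matrix B \<Longrightarrow> rational_matrix (A ** B)"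
  by (simp add: rational_matrix_def matrix_matrix_mult_def Rats_sum)

lemma rational_matrix_transpose: "rational_matrix A \<Longrightarrow> rational_matrix (transpose A)"
  by (simp add: rational_matrix_def transpose_def)

lemma rational_matrix_sum: "(\<And>i. i \<in> I \<Longrightarrow> rational_matrix (f i)) \<Longrightarrow> rational_matrix (sum f I)"
  by (simp add: rational_matrix_def Rats_sum)

lemma rational_matrix_scale: "r \<in> \<rat> \<Longrightarrow> rational_matrix A \<Longrightarrow> rational_matrix (r *\<^sub>R A)"
  by (simp add: rational_matrix_def)

text \<open>Averaging preserves rationality, so invariant real forms are limits of invariant rational forms.\<close>

lemma invariant_rational_skew_approx:
  fixes W M N :: "real^'n^'n" and \<A> :: "(real^'n^'n) set"
  assumes MN: "M ** N = mat 1" "N ** M = mat 1"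
    and fin: "finite \<A>" and ne: "\<A> \<noteq> {}" and mult: "\<And>A B. A \<in> \<A> \<Longrightarrow> B \<in> \<A> \<Longrightarrow> A ** B \<in> \<A>"
    and inv: "\<And>A. A \<in> \<A> \<Longrightarrow> invertible A" and rat: "\<And>A. A \<in> \<A> \<Longrightarrow> rational_matrix (N ** A ** M)"
    and W: "transpose W = - W" "\<And>A. A \<in> \<A> \<Longrightarrow> transpose A ** W ** A = W"
  obtains V where "V \<longlonglongrightarrow> W" "\<And>n. transpose (V n) = - V n"
    "\<And>n A. A \<in> \<A> \<Longrightarrow> transpose A ** V n ** A = V n" "\<And>n. rational_matrix (transpose M ** V n ** M)"
proof -
  let ?c = "1 / real (card \<A>)"
  have c: "card \<A> > 0" using fin ne by (simp add: card_gt_0_iff)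
  define avg where "avg X = ?c *\<^sub>R (\<Sum>A\<in>\<A>. transpose A ** X ** A)" for X
  define R where "R = transpose M ** W ** M"
  \<comment> \<open>In lattice coordinates, entries are rounded down to multiples of 1/n. Taking the
    skew part and averaging do not disturb the limit, since \<open>R\<close> is skew and
    \<open>W\<close> invariant.\<close>
  define Q where "Q n = (\<chi> i j. of_int \<lfloor>real n * R $ i $ j\<rfloor> / real n)" for n :: nat
  define Q' where "Q' n = (1 / 2) *\<^sub>R (Q n - transpose (Q n))" for n
  define V where "V n = avg (transpose N ** Q' n ** N)" for n
  have Qlim: "Q \<longlonglongrightarrow> R"
  proof (rule vec_tendstoI, rule vec_tendstoI)
    fix i j
    have "(\<lambda>n. of_int \<lfloor>real n * R $ i $ j\<rfloor> / real n) \<longlonglongrightarrow> R $ i $ j"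
    proof (rule tendsto_sandwich)
      show "\<forall>\<^sub>F n in sequentially. R $ i $ j - 1 / real n \<le> of_int \<lfloor>real n * R $ i $ j\<rfloor> / real n"
      proof (rule eventually_mono[OF eventually_gt_at_top[of 0]])
        fix n :: nat assume n: "0 < n"
        have "(real n * R $ i $ j - 1) / real n \<le> of_int \<lfloor>real n * R $ i $ j\<rfloor> / real n"
          by (intro divide_right_mono) linarith+
        then show "R $ i $ j - 1 / real n \<le> of_int \<lfloor>real n * R $ i $ j\<rfloor> / real n"
          using n by (simp add: diff_divide_distrib)
      qed
      show "\<forall>\<^sub>F n in sequentially. of_int \<lfloor>real n * R $ i $ j\<rfloor> / real n \<le> R $ i $ j"
        using eventually_gt_at_top[of 0] by eventually_elim (simp add: field_simps)
      show "(\<lambda>n. R $ i $ j - 1 / real n) \<longlonglongrightarrow> R $ i $ j"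
        using tendsto_diff[OF tendsto_const lim_1_over_n, of "R $ i $ j"] by simp
    qed simp
    then show "(\<lambda>n. Q n $ i $ j) \<longlonglongrightarrow> R $ i $ j" by (simp add: Q_def)
  qed
  have tlim: "(\<lambda>n. transpose (X n)) \<longlonglongrightarrow> transpose L" if "X \<longlonglongrightarrow> L" for X and L :: "real^'n^'n"
    using that unfolding transpose_def by (intro vec_tendstoI) (simp add: tendsto_vec_nth)
  have Rskew: "transpose R = - R" by (simp add: R_def matrix_transpose_mul W(1) matrix_algebra matrix_mul_assoc)
  have "Q' \<longlonglongrightarrow> (1 / 2) *\<^sub>R (R - transpose R)"
    unfolding Q'_def[abs_def] by (rule tendsto_scaleR[OF tendsto_const tendsto_diff[OF Qlim tlim[OF Qlim]]])
  also have "(1 / 2) *\<^sub>R (R - transpose R) = R" by (simp add: Rskew scaleR_2[symmetric])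
  finally have Q'lim: "Q' \<longlonglongrightarrow> R" .
  have "V \<longlonglongrightarrow> avg (transpose N ** R ** N)"
    unfolding V_def[abs_def] avg_def by (intro tendsto_scaleR tendsto_sum mm.tendsto tendsto_const Q'lim)
  also have "transpose N ** R ** N = W"
  proof -
    have "transpose N ** R ** N = transpose (M ** N) ** W ** (M ** N)"
      by (simp only: R_def matrix_transpose_mul matrix_mul_assoc)
    then show ?thesis by (simp add: MN)
  qed
  also have "avg W = W" using c by (simp add: avg_def W(2) sum_constant_scaleR del: sum_constant)
  finally have "V \<longlonglongrightarrow> W" .
  moreover have "transpose (V n) = - V n" for n
  proof -
    have q: "transpose (Q' n) = - Q' n" by (simp add: Q'_def transpose_scalar transpose_linear scaleR_diff_right)
    have ts: "transpose (sum f I) = (\<Sum>i\<in>I. transpose (f i))" for f :: "real^'n^'n \<Rightarrow> real^'n^'n" and I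
      by (simp add: transpose_def vec_eq_iff)
    show ?thesis
      by (simp add: V_def avg_def transpose_scalar ts matrix_transpose_mul q matrix_algebra matrix_mul_assoc sum_negf)
  qed
  moreover have "transpose B ** V n ** B = V n" if B: "B \<in> \<A>" for n B
  proof -
    let ?X = "transpose N ** Q' n ** N"
    have "inj_on (\<lambda>A. A ** B) \<A>"
    proof (rule inj_onI)
      fix A A' assume "A ** B = A' ** B"
      moreover obtain B' where "B ** B' = mat 1" using inv[OF B] by (auto simp: invertible_def)
      ultimately show "A = A'" by (metis matrix_mul_assoc matrix_mul_rid)
    qed
    then have bij: "bij_betw (\<lambda>A. A ** B) \<A> \<A>"
      using fin mult B by (simp add: bij_betw_def endo_inj_surj image_subset_iff)
    have "transpose B ** V n ** B = ?c *\<^sub>R (\<Sum>A\<in>\<A>. transpose B ** (transpose A ** ?X ** A) ** B)"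
      by (simp only: V_def avg_def mm.scaleR_right mm.scaleR_left mm.sum_right mm.sum_left)
    also have "\<dots> = ?c *\<^sub>R (\<Sum>A\<in>\<A>. transpose (A ** B) ** ?X ** (A ** B))"
      by (simp only: matrix_transpose_mul matrix_mul_assoc)
    also have "\<dots> = V n"
      unfolding V_def avg_def using sum.reindex_bij_betw[OF bij, of "\<lambda>A. transpose A ** ?X ** A"] by simp
    finally show ?thesis .
  qed
  moreover have "rational_matrix (transpose M ** V n ** M)" for n
  proof -
    have "rational_matrix (Q n)" by (simp add: rational_matrix_def Q_def)
    then have Q': "rational_matrix (Q' n)"
      unfolding Q'_def by (intro rational_matrix_scale) (auto simp: rational_matrix_def transpose_def)
    have "transpose M ** V n ** M = ?c *\<^sub>R (\<Sum>A\<in>\<A>. transpose M ** (transpose A ** (transpose N ** Q' n ** N) ** A) ** M)"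
      by (simp only: V_def avg_def mm.scaleR_right mm.scaleR_left mm.sum_right mm.sum_left)
    also have "\<dots> = ?c *\<^sub>R (\<Sum>A\<in>\<A>. transpose (N ** A ** M) ** Q' n ** (N ** A ** M))"
      by (simp only: matrix_transpose_mul matrix_mul_assoc)
    also have "rational_matrix \<dots>"
      by (intro rational_matrix_scale rational_matrix_sum rational_matrix_mult[OF rational_matrix_mult[OF rational_matrix_transpose[OF rat] Q'] rat]) auto
    finally show ?thesis .
  qed
  ultimately show ?thesis using that by blast
qed

text \<open>With K = (1 + J' J)/2, the matrix 1 - K = (1 - J' J)/2 intertwines \<open>J\<close> with
  \<open>J'\<close>. Since |K| < 1, all 1 - t K with t in [0,1] are invertible, and conjugating
  \<open>J\<close> by them is the path. Whatever commutes with both ends commutes with every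
  member.\<close>

lemma conjugation_path:
  fixes J J' :: "real^'n^'n"
  assumes J: "complex_structure J" "complex_structure J'" and K: "norm ((1 / 2) *\<^sub>R (mat 1 + J' ** J)) < 1"
    and com: "\<And>A. A \<in> \<A> \<Longrightarrow> A ** J = J ** A" "\<And>A. A \<in> \<A> \<Longrightarrow> A ** J' = J' ** A"
  obtains p :: "real \<Rightarrow> real^'n^'n" where "continuous_on {0..1} p" "p 0 = J" "p 1 = J'"
    "\<And>t. t \<in> {0..1} \<Longrightarrow> complex_structure (p t)" "\<And>t A. t \<in> {0..1} \<Longrightarrow> A \<in> \<A> \<Longrightarrow> A ** p t = p t ** A"
proof -
  define K where "K = (1 / 2) *\<^sub>R (mat 1 + J' ** J)"
  have nK: "norm K < 1" using K by (simp add: K_def)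
  let ?g = "\<lambda>t. mat 1 - t *\<^sub>R K"
  have "\<exists>B. B ** ?g t = mat 1 \<and> ?g t ** B = mat 1" if t: "t \<in> {0..1}" for t
  proof -
    have "norm (t *\<^sub>R K) \<le> 1 * norm K" using t by (simp add: mult_left_le_one_le)
    then have "norm (t *\<^sub>R K) < 1" using nK by simp
    then show ?thesis using inverse_one_minus by metis
  qed
  then obtain X where X: "\<And>t. t \<in> {0..1} \<Longrightarrow> X t ** ?g t = mat 1 \<and> ?g t ** X t = mat 1" by metis
  define p where "p t = ?g t ** J ** X t" for t
  \<comment> \<open>The inverse satisfies X = 1 + t K X, which bounds its norm uniformly in
    t.\<close>
  let ?b = "norm (mat 1 :: real^'n^'n) / (1 - norm K)"
  have Xb: "norm (X t) \<le> ?b" if t: "t \<in> {0..1}" for t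
  proof -
    have "X t = mat 1 + (t *\<^sub>R K) ** X t" using X[OF t] by (simp add: matrix_algebra algebra_simps)
    then have "norm (X t) \<le> norm (mat 1 :: real^'n^'n) + norm ((t *\<^sub>R K) ** X t)" by (metis norm_triangle_ineq)
    also have "norm ((t *\<^sub>R K) ** X t) \<le> norm (t *\<^sub>R K) * norm (X t)" by (rule norm_matrix_mult_le)
    also have "\<dots> \<le> norm K * norm (X t)" using t by (intro mult_right_mono) (auto simp: mult_left_le_one_le)
    finally have "norm (X t) * (1 - norm K) \<le> norm (mat 1 :: real^'n^'n)" by (simp add: algebra_simps)
    then show ?thesis using nK by (simp add: pos_le_divide_eq)
  qed
  have b0: "0 \<le> ?b" using nK by simp
  have lip: "norm (X t - X s) \<le> (?b * norm K * ?b) * \<bar>t - s\<bar>" if ts: "t \<in> {0..1}" "s \<in> {0..1}" for t s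
  proof -
    \<comment> \<open>The resolvent identity makes the inverse Lipschitz in t.\<close>
    have "X t ** (?g s - ?g t) ** X s = X t ** (?g s ** X s) - (X t ** ?g t) ** X s"
      by (simp only: mm.diff_left mm.diff_right matrix_mul_assoc)
    also have "\<dots> = X t - X s" using X[OF ts(1)] X[OF ts(2)] by simp
    finally have "norm (X t - X s) = norm (X t ** ((t - s) *\<^sub>R K) ** X s)"
      by (simp add: scaleR_diff_left)
    also have "\<dots> \<le> norm (X t) * norm ((t - s) *\<^sub>R K) * norm (X s)"
      by (intro order_trans[OF norm_matrix_mult_le] mult_right_mono norm_matrix_mult_le) simp
    also have "\<dots> \<le> ?b * norm ((t - s) *\<^sub>R K) * ?b"
      by (intro mult_mono[OF mult_mono[OF Xb[OF ts(1)] order_refl b0 norm_ge_zero] Xb[OF ts(2)]] mult_nonneg_nonneg b0 norm_ge_zero)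
    finally show ?thesis by (simp add: mult_ac)
  qed
  have cX: "continuous_on {0..1} X"
  proof (rule lipschitz_on_continuous_on)
    show "(?b * norm K * ?b)-lipschitz_on {0..1} X"
      using lip b0 by (intro lipschitz_onI) (auto simp: dist_norm dist_real_def)
  qed
  have "continuous_on {0..1} p"
    unfolding p_def[abs_def] by (intro mm.continuous_on continuous_intros cX)
  moreover have "p 0 = J" using X[of 0] by (simp add: p_def)
  moreover have "p 1 = J'"
  proof -
    have JJ: "J ** J = - mat 1" "J' ** J' = - mat 1" using J by (auto simp: complex_structure_def)
    have g1: "?g 1 = (1 / 2) *\<^sub>R (mat 1 - J' ** J)"
    proof -
      have "mat 1 = (1 / 2) *\<^sub>R mat 1 + (1 / 2) *\<^sub>R (mat 1 :: real^'n^'n)" by (simp add: scaleR_add_left[symmetric])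
      then show ?thesis by (simp add: K_def scaleR_add_right scaleR_diff_right)
    qed
    have "(mat 1 - J' ** J) ** J = J' ** (mat 1 - J' ** J)"
    proof -
      have "J' ** J ** J = J' ** (J ** J)" "J' ** (J' ** J) = (J' ** J') ** J" by (simp_all only: matrix_mul_assoc)
      then show ?thesis by (simp add: mm.diff_left mm.diff_right JJ matrix_algebra)
    qed
    then have "?g 1 ** J = J' ** ?g 1" unfolding g1 by (simp add: matrix_algebra)
    then have "p 1 = J' ** (?g 1 ** X 1)" by (simp only: p_def matrix_mul_assoc)
    then show ?thesis using X[of 1] by simp
  qed
  moreover have "complex_structure (p t)" if t: "t \<in> {0..1}" for t
  proof -
    have "p t ** p t = ?g t ** J ** (X t ** ?g t) ** J ** X t" by (simp only: p_def matrix_mul_assoc)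
    also have "\<dots> = ?g t ** (J ** J) ** X t" using X[OF t] by (simp add: matrix_mul_assoc)
    also have "\<dots> = - mat 1" using X[OF t] J(1)[unfolded complex_structure_def] by (simp only: mm.minus_right mm.minus_left matrix_mul_rid)
    finally show ?thesis by (simp add: complex_structure_def)
  qed
  moreover have "A ** p t = p t ** A" if t: "t \<in> {0..1}" and A: "A \<in> \<A>" for t A
  proof -
    have "A ** (J' ** J) = (J' ** J) ** A" using com[OF A] by (metis matrix_mul_assoc)
    then have AK: "A ** K = K ** A" by (simp add: K_def matrix_algebra)
    then have Ag: "A ** ?g t = ?g t ** A" by (simp add: matrix_algebra)
    have AX: "A ** X t = X t ** A"
    proof -
      have "A ** X t = X t ** ?g t ** A ** X t" using X[OF t] by simp
      also have "\<dots> = X t ** (A ** ?g t) ** X t" unfolding Ag by (simp only: matrix_mul_assoc)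
      also have "\<dots> = X t ** A ** (?g t ** X t)" by (simp only: matrix_mul_assoc)
      finally show ?thesis using X[OF t] by simp
    qed
    have "A ** p t = (A ** ?g t) ** J ** X t" by (simp only: p_def matrix_mul_assoc)
    also have "\<dots> = ?g t ** (A ** J) ** X t" unfolding Ag by (simp only: matrix_mul_assoc)
    also have "\<dots> = ?g t ** J ** (A ** X t)" unfolding com(1)[OF A] by (simp only: matrix_mul_assoc)
    also have "\<dots> = p t ** A" unfolding AX p_def by (simp only: matrix_mul_assoc)
    finally show ?thesis .
  qed
  ultimately show ?thesis using that by blast
qed

text \<open>
  For an invariant form \<open>V\<close> near \<open>W = P\<^sub>0 J\<close>, the polar part of \<open>P\<^sub>0\<^sup>-\<^sup>1 V\<close> is a complex structure
  compatible with \<open>V\<close>.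
\<close>

lemma polarizable_deformation:
  fixes J M N :: "real^'n^'n" and \<A> :: "(real^'n^'n) set"
  assumes MN: "M ** N = mat 1" "N ** M = mat 1"
    and fin: "finite \<A>" and one: "mat 1 \<in> \<A>" and mult: "\<And>A B. A \<in> \<A> \<Longrightarrow> B \<in> \<A> \<Longrightarrow> A ** B \<in> \<A>"
    and inv: "\<And>A. A \<in> \<A> \<Longrightarrow> invertible A" and rat: "\<And>A. A \<in> \<A> \<Longrightarrow> rational_matrix (N ** A ** M)"
    and J: "complex_structure J" and com: "\<And>A. A \<in> \<A> \<Longrightarrow> A ** J = J ** A"
  obtains J' P and p :: "real \<Rightarrow> real^'n^'n" where
    "complex_structure J'" "\<forall>A\<in>\<A>. A ** J' = J' ** A"
    "transpose P = P" "\<forall>x. x \<noteq> 0 \<longrightarrow> 0 < x \<bullet> (P *v x)" "\<forall>A\<in>\<A>. transpose A ** P ** A = P"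
    "transpose J' ** P ** J' = P" "rational_matrix (transpose M ** (P ** J') ** M)"
    "continuous_on {0..1} p" "p 0 = J" "p 1 = J'"
    "\<forall>t\<in>{0..1}. complex_structure (p t)" "\<forall>t\<in>{0..1}. \<forall>A\<in>\<A>. A ** p t = p t ** A"
proof -
  have JJ: "J ** J = - mat 1" using J by (simp add: complex_structure_def)
  \<comment> \<open>Adding the pullback by \<open>J\<close> makes the Euclidean form
    \<open>J\<close>-invariant, because J^2 = -1. Averaging then makes it invariant under the group
    and keeps the \<open>J\<close>-invariance. As \<open>mat 1\<close> is among the summands, the
    result dominates the Euclidean form.\<close>
  define X0 where "X0 = mat 1 + transpose J ** J"
  define P0 where "P0 = (\<Sum>A\<in>\<A>. transpose A ** X0 ** A)"
  have ts: "transpose (sum f I) = (\<Sum>i\<in>I. transpose (f i))" for f :: "real^'n^'n \<Rightarrow> real^'n^'n" and I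
    by (simp add: transpose_def vec_eq_iff)
  have X0: "transpose X0 = X0" "transpose J ** X0 ** J = X0"
  proof -
    show "transpose X0 = X0" by (simp add: X0_def transpose_linear matrix_transpose_mul)
    have "transpose J ** (transpose J ** J) ** J = transpose (J ** J) ** (J ** J)"
      by (simp only: matrix_transpose_mul matrix_mul_assoc)
    also have "\<dots> = mat 1" by (simp add: JJ transpose_linear matrix_algebra)
    finally show "transpose J ** X0 ** J = X0" by (simp add: X0_def matrix_algebra)
  qed
  have P0sym: "transpose P0 = P0"
    by (simp add: P0_def ts matrix_transpose_mul X0(1) matrix_mul_assoc)
  have P0pos: "x \<bullet> x \<le> x \<bullet> (P0 *v x)" for x
  proof -
    have q: "x \<bullet> ((transpose A ** X0 ** A) *v x) = (A *v x) \<bullet> (A *v x) + (J *v (A *v x)) \<bullet> (J *v (A *v x))" for A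
    proof -
      have tr: "u \<bullet> (transpose B *v v) = (B *v u) \<bullet> v" for u v and B :: "real^'n^'n"
        by (metis dot_lmul_matrix inner_commute transpose_matrix_vector)
      show ?thesis
        by (simp only: matrix_vector_mul_assoc[symmetric] tr X0_def matrix_vector_mult_add_rdistrib inner_add_right matrix_vector_mul_lid)
    qed
    have "x \<bullet> (P0 *v x) = (\<Sum>A\<in>\<A>. x \<bullet> ((transpose A ** X0 ** A) *v x))"
    proof -
      have "linear (\<lambda>B :: real^'n^'n. B *v x)" by (rule linearI) (simp_all add: matrix_vector_mult_add_rdistrib scaleR_matrix_vector_assoc)
      then show ?thesis unfolding P0_def by (simp only: linear_sum[of "\<lambda>B. B *v x"] inner_sum_right)
    qed
    moreover have "x \<bullet> ((transpose (mat 1) ** X0 ** mat 1) *v x) \<le> (\<Sum>A\<in>\<A>. x \<bullet> ((transpose A ** X0 ** A) *v x))"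
      by (rule member_le_sum[OF one _ fin]) (simp add: q)
    moreover have "0 \<le> (J *v x) \<bullet> (J *v x)" by (rule inner_ge_zero)
    ultimately show ?thesis unfolding q by (simp del: inner_ge_zero)
  qed
  have P0inv: "transpose B ** P0 ** B = P0" if B: "B \<in> \<A>" for B
  proof -
    have "inj_on (\<lambda>A. A ** B) \<A>"
    proof (rule inj_onI)
      fix A A' assume "A ** B = A' ** B"
      moreover obtain B' where "B ** B' = mat 1" using inv[OF B] by (auto simp: invertible_def)
      ultimately show "A = A'" by (metis matrix_mul_assoc matrix_mul_rid)
    qed
    then have bij: "bij_betw (\<lambda>A. A ** B) \<A> \<A>"
      using fin mult B by (simp add: bij_betw_def endo_inj_surj image_subset_iff)
    have "transpose B ** P0 ** B = (\<Sum>A\<in>\<A>. transpose B ** (transpose A ** X0 ** A) ** B)"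
      by (simp only: P0_def mm.sum_right mm.sum_left)
    also have "\<dots> = (\<Sum>A\<in>\<A>. transpose (A ** B) ** X0 ** (A ** B))"
      by (simp only: matrix_transpose_mul matrix_mul_assoc)
    also have "\<dots> = P0"
      unfolding P0_def using sum.reindex_bij_betw[OF bij, of "\<lambda>A. transpose A ** X0 ** A"] by simp
    finally show ?thesis .
  qed
  have JP0: "transpose J ** P0 ** J = P0"
  proof -
    have "transpose J ** (transpose A ** X0 ** A) ** J = transpose A ** X0 ** A" if A: "A \<in> \<A>" for A
    proof -
      have "transpose J ** (transpose A ** X0 ** A) ** J = transpose (A ** J) ** X0 ** (A ** J)"
        by (simp only: matrix_transpose_mul matrix_mul_assoc)
      also have "\<dots> = transpose A ** (transpose J ** X0 ** J) ** A"
        unfolding com[OF A] by (simp only: matrix_transpose_mul matrix_mul_assoc)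
      finally show ?thesis unfolding X0(2) .
    qed
    then show ?thesis unfolding P0_def mm.sum_right mm.sum_left by simp
  qed
  define W where "W = P0 ** J"
  have Wskew: "transpose W = - W"
  proof -
    have "transpose J ** P0 = - (transpose J ** P0 ** (J ** J))" by (simp add: JJ matrix_algebra)
    also have "\<dots> = - (P0 ** J)" using JP0 by (simp only: matrix_mul_assoc)
    finally show ?thesis by (simp add: W_def matrix_transpose_mul P0sym)
  qed
  have Winv: "transpose A ** W ** A = W" if A: "A \<in> \<A>" for A
  proof -
    have "transpose A ** W ** A = transpose A ** P0 ** (J ** A)" by (simp only: W_def matrix_mul_assoc)
    also have "\<dots> = (transpose A ** P0 ** A) ** J" unfolding com[OF A, symmetric] by (simp only: matrix_mul_assoc)
    finally show ?thesis unfolding P0inv[OF A] W_def .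
  qed
  have "\<A> \<noteq> {}" using one by blast
  then obtain V where V: "V \<longlonglongrightarrow> W" "\<And>n. transpose (V n) = - V n"
    "\<And>n A. A \<in> \<A> \<Longrightarrow> transpose A ** V n ** A = V n" "\<And>n. rational_matrix (transpose M ** V n ** M)"
    using invariant_rational_skew_approx[OF MN fin _ mult inv rat Wskew Winv] by metis
  obtain P0' where P0': "P0' ** P0 = mat 1" "P0 ** P0' = mat 1"
  proof (rule matrix_left_inverse_of_inj[of P0])
    fix x assume x: "P0 *v x = 0"
    have "x \<bullet> x \<le> 0" using P0pos[of x] unfolding x inner_zero_right .
    then show "x = 0" using inner_gt_zero_iff[of x] by linarith
  qed
  define H where "H n = P0' ** V n" for n
  have Hlim: "H \<longlonglongrightarrow> J"
  proof -
    have "H \<longlonglongrightarrow> P0' ** W" unfolding H_def[abs_def] by (intro mm.tendsto tendsto_const V(1))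
    then show ?thesis by (simp add: W_def matrix_mul_assoc P0')
  qed
  \<comment> \<open>\<open>E\<close> measures the failure of \<open>H\<close> to be a complex
    structure: -H^2 = 1 - E. It tends to 0, which makes the square root available.\<close>
  define E where "E n = mat 1 + H n ** H n" for n
  have "E \<longlonglongrightarrow> mat 1 + J ** J" unfolding E_def[abs_def] by (intro tendsto_intros mm.tendsto Hlim)
  then have "(\<lambda>n. norm (E n)) \<longlonglongrightarrow> norm (0 :: real^'n^'n)" by (intro tendsto_norm) (simp add: JJ)
  then have Elim: "(\<lambda>n. norm (E n)) \<longlonglongrightarrow> 0" by simp
  have "(\<lambda>n. norm P0 * norm (E n)) \<longlonglongrightarrow> norm P0 * 0" by (intro tendsto_intros Elim)
  then have ev1: "\<forall>\<^sub>F n in sequentially. norm P0 * norm (E n) < 1" by (rule order_tendstoD) simp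
  have "(\<lambda>n. norm J * (norm (H n - J) + 2 * norm (E n) * norm (H n))) \<longlonglongrightarrow> norm J * (norm (J - J) + 2 * 0 * norm J)"
    by (intro tendsto_intros Elim Hlim)
  then have ev2: "\<forall>\<^sub>F n in sequentially. norm J * (norm (H n - J) + 2 * norm (E n) * norm (H n)) < 1" by (rule order_tendstoD) simp
  have ev3: "\<forall>\<^sub>F n in sequentially. norm (E n) < 1 / 2" using Elim by (rule order_tendstoD) simp
  \<comment> \<open>The first condition makes the new metric positive definite, the second brings
    the new structure close enough to \<open>J\<close> for the conjugation path, and the third
    provides the square root.\<close>
  obtain n where n: "norm P0 * norm (E n) < 1" "norm J * (norm (H n - J) + 2 * norm (E n) * norm (H n)) < 1" "norm (E n) < 1 / 2"
    using eventually_happens'[OF sequentially_bot eventually_conj[OF ev1 eventually_conj[OF ev2 ev3]]] by blast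
  define h where "h = H n"
  have P0h: "P0 ** h = V n" by (simp add: h_def H_def matrix_mul_assoc P0')
  have hP0: "transpose h ** P0 = - (P0 ** h)"
  proof -
    have "transpose (P0 ** h) = - (P0 ** h)" unfolding P0h by (rule V(2))
    then show ?thesis by (simp add: matrix_transpose_mul P0sym)
  qed
  \<comment> \<open>\<open>A ** h\<close> and \<open>h ** A\<close> both become \<open>V n\<close>
    after multiplication by the invertible matrix \<open>transpose A ** P0\<close>.\<close>
  have Ah: "A ** h = h ** A" if A: "A \<in> \<A>" for A
  proof -
    obtain A' where A': "A ** A' = mat 1" using inv[OF A] by (auto simp: invertible_def)
    have "transpose A ** P0 ** (A ** h) = V n" by (simp only: matrix_mul_assoc P0inv[OF A] P0h)
    moreover have "transpose A ** P0 ** (h ** A) = V n"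
    proof -
      have "transpose A ** P0 ** (h ** A) = transpose A ** (P0 ** h) ** A" by (simp only: matrix_mul_assoc)
      then show ?thesis unfolding P0h V(3)[OF A] .
    qed
    ultimately have "P0' ** transpose A' ** (transpose A ** P0 ** (A ** h)) = P0' ** transpose A' ** (transpose A ** P0 ** (h ** A))"
      by simp
    moreover have "P0' ** transpose A' ** (transpose A ** P0 ** Z) = Z" for Z :: "real^'n^'n"
    proof -
      have "P0' ** transpose A' ** (transpose A ** P0 ** Z) = P0' ** transpose (A ** A') ** P0 ** Z"
        by (simp only: matrix_transpose_mul matrix_mul_assoc)
      then show ?thesis by (simp add: A' P0')
    qed
    ultimately show ?thesis by simp
  qed
  have Eh: "E n = mat 1 + h ** h" by (simp add: E_def h_def)
  obtain Y where Y: "norm Y \<le> norm (E n)" "(mat 1 - Y) ** (mat 1 - Y) = mat 1 - E n"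
    "\<And>B. B ** E n = E n ** B \<Longrightarrow> B ** Y = Y ** B"
    "\<And>P. transpose (E n) ** P = P ** E n \<Longrightarrow> transpose Y ** P = P ** Y"
    using matrix_sqrt[of "E n" "norm (E n)"] n(3) by auto
  define R where "R = mat 1 - Y"
  \<comment> \<open>\<open>R\<close> is the square root of -h^2 near the identity, the symmetric
    factor in the polar decomposition of \<open>h\<close>. It commutes with everything that commutes
    with \<open>h\<close> and is self-adjoint for \<open>P0\<close>.\<close>
  have RR: "R ** R = - (h ** h)" using Y(2) by (simp add: R_def Eh)
  have Y1: "norm Y < 1" using Y(1) n(3) by simp
  obtain R' where R': "R' ** R = mat 1" "R ** R' = mat 1" unfolding R_def by (rule inverse_one_minus[OF Y1])
  have comR: "B ** R = R ** B" if "B ** h = h ** B" for B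
  proof -
    have "B ** (h ** h) = (h ** h) ** B" using that by (metis matrix_mul_assoc)
    then have "B ** E n = E n ** B" by (simp add: Eh matrix_algebra)
    then have "B ** Y = Y ** B" by (rule Y(3))
    then show ?thesis by (simp add: R_def matrix_algebra)
  qed
  have comR': "B ** R' = R' ** B" if "B ** h = h ** B" for B
    using comR[OF that] R' by (metis matrix_mul_assoc matrix_mul_lid matrix_mul_rid)
  define J' where "J' = h ** R'"
  define P where "P = P0 ** R"
  have J'J': "complex_structure J'"
  proof -
    have "J' ** J' = h ** (R' ** h) ** R'" by (simp only: J'_def matrix_mul_assoc)
    also have "\<dots> = (h ** h) ** R' ** R'" unfolding comR'[OF refl, symmetric] by (simp only: matrix_mul_assoc)
    also have "h ** h = - (R ** R)" using RR by simp
    also have "- (R ** R) ** R' ** R' = - (R ** (R ** R') ** R')" by (simp only: mm.minus_left matrix_mul_assoc)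
    also have "\<dots> = - mat 1" by (simp add: R')
    finally show ?thesis by (simp add: complex_structure_def)
  qed
  have AJ': "A ** J' = J' ** A" if A: "A \<in> \<A>" for A
    using Ah[OF A] comR'[OF Ah[OF A]] unfolding J'_def by (metis matrix_mul_assoc)
  have RP0: "transpose R ** P0 = P0 ** R"
  proof -
    have "transpose (h ** h) ** P0 = P0 ** (h ** h)"
    proof -
      have "transpose (h ** h) ** P0 = transpose h ** (transpose h ** P0)" by (simp only: matrix_transpose_mul matrix_mul_assoc)
      also have "\<dots> = - ((transpose h ** P0) ** h)" unfolding hP0 by (simp add: matrix_algebra matrix_mul_assoc hP0)
      also have "\<dots> = P0 ** (h ** h)" unfolding hP0 by (simp add: matrix_algebra matrix_mul_assoc)
      finally show ?thesis .
    qed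
    then have "transpose (E n) ** P0 = P0 ** E n" by (simp add: Eh transpose_linear matrix_algebra)
    then have "transpose Y ** P0 = P0 ** Y" by (rule Y(4))
    then show ?thesis by (simp add: R_def transpose_linear matrix_algebra)
  qed
  have Psym: "transpose P = P" by (simp add: P_def matrix_transpose_mul P0sym RP0)
  \<comment> \<open>\<open>P\<close> differs from \<open>P0\<close> by \<open>P0 ** Y\<close>, whose
    norm is below 1, while \<open>P0\<close> dominates the Euclidean form.\<close>
  have Ppos: "0 < x \<bullet> (P *v x)" if x: "x \<noteq> 0" for x
  proof -
    have "P *v x = P0 *v x - (P0 ** Y) *v x"
      by (simp add: P_def R_def matrix_algebra matrix_vector_mult_diff_rdistrib)
    then have "x \<bullet> (P *v x) \<ge> x \<bullet> x - norm x * norm ((P0 ** Y) *v x)"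
      using P0pos[of x] norm_cauchy_schwarz[of x "(P0 ** Y) *v x"] by (simp add: inner_diff_right)
    moreover have "norm ((P0 ** Y) *v x) \<le> norm (P0 ** Y) * norm x" by (rule norm_matrix_vector_le)
    moreover have "norm (P0 ** Y) \<le> norm P0 * norm (E n)"
      using norm_matrix_mult_le[of P0 Y] mult_left_mono[OF Y(1), of "norm P0"] by simp
    then have "norm (P0 ** Y) < 1" using n(1) by simp
    then have "norm x * (norm (P0 ** Y) * norm x) < norm x * (1 * norm x)"
      using x by (intro mult_strict_left_mono mult_strict_right_mono) auto
    moreover have "norm x * norm ((P0 ** Y) *v x) \<le> norm x * (norm (P0 ** Y) * norm x)"
      by (intro mult_left_mono norm_matrix_vector_le) simp
    ultimately show ?thesis by (simp add: power2_norm_eq_inner[symmetric] power2_eq_square)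
  qed
  have AP: "transpose A ** P ** A = P" if A: "A \<in> \<A>" for A
  proof -
    have "transpose A ** P ** A = transpose A ** P0 ** (R ** A)" by (simp only: P_def matrix_mul_assoc)
    also have "\<dots> = (transpose A ** P0 ** A) ** R" unfolding comR[OF Ah[OF A], symmetric] by (simp only: matrix_mul_assoc)
    finally show ?thesis unfolding P0inv[OF A] P_def .
  qed
  \<comment> \<open>The polarization belonging to the new structure and metric is exactly the
    rational form, since \<open>R\<close> commutes with \<open>h\<close>.\<close>
  have PJ': "P ** J' = V n"
  proof -
    have "P ** J' = P0 ** (R ** h) ** R'" by (simp only: P_def J'_def matrix_mul_assoc)
    also have "\<dots> = (P0 ** h) ** (R ** R')" unfolding comR[OF refl, symmetric] by (simp only: matrix_mul_assoc)
    finally show ?thesis by (simp add: R' P0h)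
  qed
  have J'P: "transpose J' ** P ** J' = P"
  proof -
    have "transpose J' ** P = transpose (P ** J')" by (simp add: matrix_transpose_mul Psym)
    also have "\<dots> = - (P ** J')" unfolding PJ' by (rule V(2))
    finally have "transpose J' ** P ** J' = - (P ** (J' ** J'))" by (simp add: matrix_algebra matrix_mul_assoc)
    then show ?thesis using J'J' by (simp add: complex_structure_def matrix_algebra)
  qed
  \<comment> \<open>Since J^2 = -1, the matrix 1 + J' J equals (J' - J) J, so closeness of the
    structures gives the bound.\<close>
  have K: "norm ((1 / 2) *\<^sub>R (mat 1 + J' ** J)) < 1"
  proof -
    have J'R: "J' ** R = h" by (simp add: J'_def matrix_mul_assoc[symmetric] R')
    then have d: "J' - J = (h - J) + J' ** Y" by (simp add: R_def matrix_algebra algebra_simps)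
    have "J' = h + J' ** Y" using J'R by (simp add: R_def matrix_algebra algebra_simps)
    then have "norm J' \<le> norm h + norm (J' ** Y)" by (metis norm_triangle_ineq)
    also have "norm (J' ** Y) \<le> norm J' * (1 / 2)"
      using Y(1) n(3) by (intro order_trans[OF norm_matrix_mult_le] mult_left_mono) auto
    finally have nJ': "norm J' \<le> 2 * norm h" by simp
    have "norm (J' - J) \<le> norm (h - J) + norm (J' ** Y)" unfolding d by (rule norm_triangle_ineq)
    also have "norm (J' ** Y) \<le> 2 * norm h * norm (E n)"
      using Y(1) nJ' by (intro order_trans[OF norm_matrix_mult_le] mult_mono) auto
    finally have "norm (J' - J) * norm J \<le> (norm (h - J) + 2 * norm h * norm (E n)) * norm J"
      by (intro mult_right_mono) auto
    also have "\<dots> < 1" using n(2) by (simp add: h_def mult_ac)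
    finally have "norm ((J' - J) ** J) < 1" using norm_matrix_mult_le[of "J' - J" J] by simp
    moreover have "(J' - J) ** J = mat 1 + J' ** J" by (simp add: matrix_algebra JJ)
    ultimately show ?thesis by simp
  qed
  obtain p :: "real \<Rightarrow> real^'n^'n" where p: "continuous_on {0..1} p" "p 0 = J" "p 1 = J'"
    "\<And>t. t \<in> {0..1} \<Longrightarrow> complex_structure (p t)" "\<And>t A. t \<in> {0..1} \<Longrightarrow> A \<in> \<A> \<Longrightarrow> A ** p t = p t ** A"
    using conjugation_path[OF J J'J' K, of \<A>] com AJ' by metis
  have "rational_matrix (transpose M ** (P ** J') ** M)" unfolding PJ' by (rule V(4))
  then show ?thesis using that[of J' P p] J'J' AJ' Psym Ppos AP J'P p by blast
qed

section \<open>Projectivity of polarized quotients\<close>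

text \<open>The linear part \<open>S\<close> serves to make the polarization metric standard, and
  the translation by \<open>c\<close> moves the chosen base point to the origin.\<close>

lemma affine_cover_affine_change:
  fixes J J' S S' :: "real^'n^'n"
  assumes cov: "affine_cover J M \<pi>" and S: "S' ** S = mat 1" "S ** S' = mat 1" and J': "J ** S = S ** J'"
  shows "affine_cover J' M (\<lambda>x. \<pi> (S *v x + c))"
proof -
  let ?T = "\<lambda>x. S *v x + c" and ?k = "CARD('n) div 2"
  have T: "?T (S' *v (y - c)) = y" "S' *v (?T y - c) = y" for y
    by (simp_all add: matrix_vector_mul_assoc S)
  have cT: "continuous_on UNIV ?T" "continuous_on UNIV (\<lambda>y. S' *v (y - c))"
    by (intro continuous_intros linear_continuous_on matrix_vector_mul_bounded_linear
        continuous_on_compose2[OF linear_continuous_on[OF matrix_vector_mul_bounded_linear]])+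
       (auto intro!: continuous_intros)
  have oT: "open (?T ` W)" if "open W" for W
  proof -
    have "?T ` W = (\<lambda>y. S' *v (y - c)) -` W"
    proof (intro equalityI subsetI)
      fix y assume "y \<in> (\<lambda>y. S' *v (y - c)) -` W"
      then show "y \<in> ?T ` W" using T(1)[of y] by (metis imageI vimageD)
    qed (auto simp: matrix_vector_mul_assoc S)
    then show ?thesis using cT(2) that by (simp add: continuous_on_open_vimage)
  qed
  have lc: "linear_chart J' (\<lambda>x. \<kappa> (S *v x))" if "linear_chart J \<kappa>" for \<kappa>
    unfolding linear_chart_def
  proof (intro conjI allI)
    have "bij ((*v) S)" by (rule o_bij[of "(*v) S'"]) (auto simp: matrix_vector_mul_assoc S)
    then show "bij_betw (\<lambda>x. \<kappa> (S *v x)) UNIV (Cn ?k)"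
      using bij_betw_trans[of "(*v) S" UNIV UNIV \<kappa>] that by (simp add: linear_chart_def comp_def)
    show "linear (\<lambda>v. \<kappa> (S *v v) i)" for i
      using linear_compose[OF matrix_vector_mul_linear[of S] linear_chartD(3)[OF that, of i]] by (simp add: comp_def)
    show "\<kappa> (S *v (J' *v v)) i = \<i> * \<kappa> (S *v v) i" for v i
      using linear_chartD(4)[OF that, of "S *v v" i] by (simp add: matrix_vector_mul_assoc J')
  qed
  note D = affine_coverD[OF cov]
  have surj: "range ?T = UNIV"  by (rule surjI[of ?T "\<lambda>y. S' *v (y - c)"]) (rule T(1))
  show ?thesis unfolding affine_cover_def
  proof (intro conjI ballI)
    show "cdim M = ?k" by (rule D(1))
    show "continuous_map euclidean (ctop M) (\<lambda>x. \<pi> (?T x))"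
      using continuous_map_compose[of euclidean euclidean ?T "ctop M" \<pi>] D(2) cT(1) by (simp add: comp_def)
    show "open_map euclidean (ctop M) (\<lambda>x. \<pi> (?T x))"
      using D(3) oT by (simp add: open_map_def image_image[of \<pi> ?T, symmetric])
    show "range (\<lambda>x. \<pi> (?T x)) = points M" using D(4) surj by (simp add: image_image[of \<pi> ?T, symmetric])
    show "(\<Union>(U, \<phi>)\<in>catlas M. U) = points M" by (rule D(5))
    fix u assume u: "u \<in> catlas M"
    obtain U \<phi> where U: "u = (U, \<phi>)" by (cases u)
    have "\<exists>\<kappa> d W. linear_chart J' \<kappa> \<and> d \<in> Cn ?k \<and> open W \<and> x \<in> W \<and>
            (\<forall>y\<in>W. \<pi> (?T y) \<in> U \<and> \<phi> (\<pi> (?T y)) = (\<lambda>i. \<kappa> y i + d i))" if \<pi>x: "\<pi> (?T x) \<in> U" for x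
    proof -
      obtain \<kappa> d W where k: "linear_chart J \<kappa>" "d \<in> Cn ?k" "open W" "?T x \<in> W"
          "\<forall>y\<in>W. \<pi> y \<in> U \<and> \<phi> (\<pi> y) = (\<lambda>i. \<kappa> y i + d i)"
        using D(8)[OF u[unfolded U] \<pi>x] by blast
      have o: "open (?T -` W)" using cT(1) k(3) by (simp add: continuous_on_open_vimage)
      have "\<kappa> c \<in> Cn ?k" by (rule linear_chartD(2)[OF k(1)])
      then have d: "(\<lambda>i. \<kappa> c i + d i) \<in> Cn ?k" using k(2) by (simp add: Cn_def)
      have "\<kappa> (?T y) i = \<kappa> (S *v y) i + \<kappa> c i" for y i by (rule linear_add[OF linear_chartD(3)[OF k(1)]])
      then have "\<forall>y\<in>?T -` W. \<pi> (?T y) \<in> U \<and> \<phi> (\<pi> (?T y)) = (\<lambda>i. \<kappa> (S *v y) i + (\<kappa> c i + d i))"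
        using k(5) by (simp add: add.assoc)
      then show ?thesis using lc[OF k(1)] d o k(4) by blast
    qed
    then show "case u of (U, \<phi>) \<Rightarrow> openin (ctop M) U \<and> inj_on \<phi> U \<and>
        (\<forall>x. \<pi> (?T x) \<in> U \<longrightarrow> (\<exists>\<kappa> d W. linear_chart J' \<kappa> \<and> d \<in> Cn ?k \<and> open W \<and> x \<in> W \<and>
            (\<forall>y\<in>W. \<pi> (?T y) \<in> U \<and> \<phi> (\<pi> (?T y)) = (\<lambda>i. \<kappa> y i + d i))))"
      using D(6,7) u U by simp
  qed
qed

lemma matrix_inner_transpose: "x \<bullet> (transpose A *v y) = (A *v x) \<bullet> (y :: real^'n)" for A :: "real^'n^'n"
  by (metis dot_lmul_matrix inner_commute transpose_matrix_vector)

text \<open>Gram--Schmidt: a maximal \<open>P\<close>-orthonormal set spans.\<close>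

lemma ex_orthonormalizing_matrix:
  fixes P :: "real^'n^'n"
  assumes sym: "transpose P = P" and pos: "\<And>x. x \<noteq> 0 \<Longrightarrow> 0 < x \<bullet> (P *v x)"
  obtains S S' :: "real^'n^'n" where "S' ** S = mat 1" "S ** S' = mat 1" "\<And>x y. (S *v x) \<bullet> (P *v (S *v y)) = x \<bullet> y"
proof -
  define \<beta> where "\<beta> x y = x \<bullet> (P *v y)" for x y
  have lin: "linear (\<lambda>x. \<beta> x y)" "linear (\<beta> y)" for y
    unfolding \<beta>_def by (auto intro!: linearI simp: inner_add_left matrix_vector_right_distrib inner_add_right matrix_vector_mult_scaleR)
  have sm: "\<beta> x y = \<beta> y x" for x y
    unfolding \<beta>_def using matrix_inner_transpose[of x P y] by (simp add: sym inner_commute)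
  define on where "on B \<longleftrightarrow> (\<forall>b\<in>B. \<forall>b'\<in>B. \<beta> b b' = (if b = b' then 1 else 0))" for B
  have coeff: "\<beta> (\<Sum>b\<in>B. u b *\<^sub>R b) b' = u b'" if "on B" "finite B" "b' \<in> B" for B b' and u :: "real^'n \<Rightarrow> real"
  proof -
    have "\<beta> (\<Sum>b\<in>B. u b *\<^sub>R b) b' = (\<Sum>b\<in>B. u b * \<beta> b b')"
      by (simp add: linear_sum[OF lin(1)] linear_scale[OF lin(1)])
    also have "\<dots> = (\<Sum>b\<in>B. if b = b' then u b else 0)"
      using that(1,3) by (intro sum.cong) (auto simp: on_def)
    finally show ?thesis using that by simp
  qed
  have ind: "independent B" if "on B" "finite B" for B
    unfolding independent_explicit_finite_subsets
  proof (intro allI ballI impI)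
    fix A u v assume A: "A \<subseteq> B" "finite A" "(\<Sum>v\<in>A. u v *\<^sub>R v) = 0" "v \<in> A"
    have "on A" using that(1) A(1) unfolding on_def by blast
    from coeff[OF this A(2,4), of u] show "u v = 0" using linear_0[OF lin(1)] by (simp add: A(3))
  qed
  have card: "card B \<le> CARD('n)" if "on B" "finite B" for B
    using independent_card_le[OF ind[OF that]] by simp
  have "\<exists>B. (on B \<and> finite B) \<and> (\<forall>B'. on B' \<and> finite B' \<longrightarrow> card B' \<le> card B)"
    using ex_has_greatest_nat[of "\<lambda>B. on B \<and> finite B" "{}" card "Suc CARD('n)"] card by (simp add: on_def less_Suc_eq_le)
  then obtain B where B: "on B" "finite B" and max: "\<And>B'. on B' \<Longrightarrow> finite B' \<Longrightarrow> card B' \<le> card B" by blast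
  have span: "span B = UNIV"
  proof (rule ccontr)
    assume "span B \<noteq> UNIV"
    then obtain x where x: "x \<notin> span B" by blast
    define s where "s = (\<Sum>b\<in>B. \<beta> x b *\<^sub>R b)"
    define y where "y = x - s"
    have "s \<in> span B" unfolding s_def by (intro span_sum span_scale span_base)
    then have y0: "y \<noteq> 0" "y \<notin> span B" using x span_add[of s B y] by (auto simp: y_def)
    have yb: "\<beta> y b = 0" if "b \<in> B" for b
      using coeff[OF B that, of "\<beta> x"] by (simp add: y_def s_def linear_diff[OF lin(1)])
    have yy: "0 < \<beta> y y" using pos[OF y0(1)] by (simp add: \<beta>_def)
    define z where "z = (1 / sqrt (\<beta> y y)) *\<^sub>R y"
    have zz: "\<beta> z z = 1"
      using yy by (simp add: z_def linear_scale[OF lin(1)] linear_scale[OF lin(2)])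
    have zb: "\<beta> z b = 0" "\<beta> b z = 0" if "b \<in> B" for b
      using yb[OF that] sm by (simp_all add: z_def linear_scale[OF lin(1)] linear_scale[OF lin(2)])
    have zB: "z \<notin> B" using zb zz by force
    have "on (insert z B)" using B(1) zz zb zB unfolding on_def by auto
    then show False using max[of "insert z B"] B(2) zB by simp
  qed
  have "card B = CARD('n)" using dim_span_eq_card_independent[OF ind[OF B]] span by (simp add: dim_UNIV)
  then obtain e :: "'n \<Rightarrow> real^'n" where e: "bij_betw e UNIV B"
    using finite_same_card_bij[of "UNIV :: 'n set" B] B(2) by auto
  define S :: "real^'n^'n" where "S = (\<chi> i j. e j $ i)"
  have S: "S *v x = (\<Sum>j\<in>UNIV. x $ j *\<^sub>R e j)" for x
    by (simp add: S_def vec_eq_iff matrix_vector_mult_def mult.commute)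
  have ee: "\<beta> (e i) (e j) = (if i = j then 1 else 0)" for i j
    using B(1) e unfolding on_def bij_betw_def inj_on_def by auto
  have SS: "(S *v x) \<bullet> (P *v (S *v y)) = x \<bullet> y" for x y
  proof -
    have l: "\<beta> (S *v x) z = (\<Sum>i\<in>UNIV. x $ i * \<beta> (e i) z)" for z
      by (simp add: S linear_sum[OF lin(1)] linear_scale[OF lin(1)])
    have r: "\<beta> (e i) (S *v y) = (\<Sum>j\<in>UNIV. y $ j * \<beta> (e i) (e j))" for i
      by (simp add: S linear_sum[OF lin(2)] linear_scale[OF lin(2)])
    have "\<beta> (S *v x) (S *v y) = (\<Sum>i\<in>UNIV. \<Sum>j\<in>UNIV. x $ i * (y $ j * \<beta> (e i) (e j)))"
      unfolding l r sum_distrib_left ..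
    also have "\<dots> = (\<Sum>i\<in>UNIV. x $ i * y $ i)" by (simp add: ee if_distrib[of "(*) _"] cong: if_cong)
    finally show ?thesis by (simp add: \<beta>_def inner_vec_def)
  qed
  obtain S' where "S' ** S = mat 1" "S ** S' = mat 1"
  proof (rule matrix_left_inverse_of_inj[of S])
    fix x assume "S *v x = 0"
    then have "x \<bullet> x = 0" using SS[of x x] by simp
    then show "x = 0" by simp
  qed blast
  then show ?thesis using that SS by blast
qed

text \<open>In coordinates orthonormal for a multiple of \<open>P\<close> and centred at
  \<open>c\<close>, the group consists of unitary affine maps whose translation parts pair
  integrally, so that the Poincare series apply.\<close>

lemma affine_quotient_projective:
  fixes J P :: "real^'n^'n" and \<Delta> :: "(real^'n \<Rightarrow> real^'n) set" and M :: "'a cmfd"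
  assumes L: "full_lattice \<Lambda>" and J: "complex_structure J"
    and P: "transpose P = P" "\<And>x. x \<noteq> 0 \<Longrightarrow> 0 < x \<bullet> (P *v x)" "transpose J ** P ** J = P"
    and affine: "\<And>\<gamma>. \<gamma> \<in> \<Delta> \<Longrightarrow> \<exists>A b. \<gamma> = (\<lambda>x. A *v x + b) \<and> A ** J = J ** A \<and> transpose A ** P ** A = P"
    and translation: "\<And>l. l \<in> \<Lambda> \<Longrightarrow> (\<lambda>x. x + l) \<in> \<Delta>"
    and mult: "\<And>\<gamma> \<delta>. \<gamma> \<in> \<Delta> \<Longrightarrow> \<delta> \<in> \<Delta> \<Longrightarrow> (\<lambda>x. \<gamma> (\<delta> x)) \<in> \<Delta>"
    and inverse: "\<And>\<gamma>. \<gamma> \<in> \<Delta> \<Longrightarrow> \<exists>\<delta>\<in>\<Delta>. \<forall>x. \<delta> (\<gamma> x) = x \<and> \<gamma> (\<delta> x) = x"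
    and n: "0 < n" "\<And>\<gamma>. \<gamma> \<in> \<Delta> \<Longrightarrow> real n *\<^sub>R (\<gamma> c - c) \<in> \<Lambda>"
    and q: "0 < q" "\<And>l l'. l \<in> \<Lambda> \<Longrightarrow> l' \<in> \<Lambda> \<Longrightarrow> real q * (l \<bullet> ((P ** J) *v l')) \<in> \<int>"
    and \<rho>: "0 < \<rho>" "\<And>\<gamma> x. \<gamma> \<in> \<Delta> \<Longrightarrow> \<gamma> \<noteq> (\<lambda>x. x) \<Longrightarrow> \<rho> \<le> norm (\<gamma> x - x)"
    and cov: "affine_cover J M \<pi>" and M: "complex_manifold M" "compact_space (ctop M)"
    and fibre: "\<And>x y. \<pi> x = \<pi> y \<longleftrightarrow> (\<exists>\<gamma>\<in>\<Delta>. y = \<gamma> x)"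
  shows "projective M"
proof -
  \<comment> \<open>\<open>q\<close> clears the denominators of the form on the lattice and n^2
    those of two translation parts, each of which lies in (1/n) \<Lambda>; 2 pi is the period
    demanded by \<open>integral\<close>.\<close>
  define \<tau> where "\<tau> = 2 * pi * real q * (real n)\<^sup>2"
  have \<tau>: "0 < \<tau>" using n q pi_gt_zero by (simp add: \<tau>_def)
  obtain S S' :: "real^'n^'n" where S: "S' ** S = mat 1" "S ** S' = mat 1" and
    Sorth: "\<And>x y. (S *v x) \<bullet> ((\<tau> *\<^sub>R P) *v (S *v y)) = x \<bullet> y"
  proof (rule ex_orthonormalizing_matrix[of "\<tau> *\<^sub>R P"])
    show "transpose (\<tau> *\<^sub>R P) = \<tau> *\<^sub>R P" by (simp add: transpose_scalar P(1))
    show "0 < x \<bullet> ((\<tau> *\<^sub>R P) *v x)" if "x \<noteq> 0" for x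
      using P(2)[OF that] \<tau> by (simp add: scaleR_matrix_vector_assoc[symmetric])
  qed blast
  have Sin: "x \<bullet> y = \<tau> * ((S *v x) \<bullet> (P *v (S *v y)))" for x y
    using Sorth[of x y] by (simp add: scaleR_matrix_vector_assoc[symmetric])
  have SS: "S' *v (S *v x) = x" "S *v (S' *v x) = x" for x by (simp_all add: matrix_vector_mul_assoc S)
  have iso: "(A *v x) \<bullet> (P *v (A *v y)) = x \<bullet> (P *v y)" if "transpose A ** P ** A = P" for A x y
  proof -
    have "x \<bullet> ((transpose A ** P ** A) *v y) = (A *v x) \<bullet> (P *v (A *v y))"
      by (simp only: matrix_vector_mul_assoc[symmetric] matrix_inner_transpose)
    then show ?thesis using that by simp
  qed
  define J' where "J' = S' ** J ** S"
  have J'v: "J' *v x = S' *v (J *v (S *v x))" for x by (simp add: J'_def matrix_vector_mul_assoc matrix_mul_assoc)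
  define conj where "conj \<gamma> x = S' *v (\<gamma> (S *v x + c) - c)" for \<gamma> :: "real^'n \<Rightarrow> real^'n" and x
  define \<Gamma> where "\<Gamma> = conj ` \<Delta>"
  obtain R where R: "\<And>x. \<exists>l\<in>\<Lambda>. norm (x + l) \<le> R" using full_lattice_cobounded[OF L] by blast
  have S0: "0 < norm S"
  proof -
    have "S \<noteq> 0"
    proof
      assume "S = 0"
      then have "S' ** S = 0" by (simp add: mm.zero_right)
      then have "mat 1 *v axis undefined 1 = (0 :: real^'n^'n) *v axis undefined 1" using S(1) by simp
      then show False by (simp add: axis_eq_0_iff)
    qed
    then show ?thesis by simp
  qed
  \<comment> \<open>A displacement \<open>v\<close> in the new coordinates is \<open>S *v v\<close>
    in the old ones, which is at most |S| times as long.\<close>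
  let ?\<rho> = "\<rho> / norm S"
  interpret crystallographic J' \<Gamma> ?\<rho> "norm S' * R" "gauss_bound CARD('n) ?\<rho>"
  proof
    have "J' ** J' = S' ** J ** (S ** S') ** J ** S" by (simp only: J'_def matrix_mul_assoc)
    also have "\<dots> = S' ** (J ** J) ** S" by (simp add: S matrix_mul_assoc)
    also have "\<dots> = - mat 1" using J S(1) by (simp add: complex_structure_def matrix_algebra)
    finally have "complex_structure J'" by (simp add: complex_structure_def)
    moreover have "(J' *v v) \<bullet> (J' *v w) = v \<bullet> w" for v w
    proof -
      have "(J' *v v) \<bullet> (J' *v w) = \<tau> * ((S *v (J' *v v)) \<bullet> (P *v (S *v (J' *v w))))" by (rule Sin)
      also have "\<dots> = \<tau> * ((S *v v) \<bullet> (P *v (S *v w)))" by (simp only: J'v SS iso[OF P(3)])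
      finally show ?thesis unfolding Sin[symmetric] .
    qed
    ultimately show "orthogonal_complex_structure J'" by (simp add: orthogonal_complex_structure_def)
    show "\<exists>A b. (\<forall>x. \<gamma> x = A *v x + b) \<and> (\<forall>x y. (A *v x) \<bullet> (A *v y) = x \<bullet> y) \<and> A ** J' = J' ** A"
      if \<gamma>: "\<gamma> \<in> \<Gamma>" for \<gamma>
    proof -
      obtain \<gamma>0 where g0: "\<gamma>0 \<in> \<Delta>" "\<gamma> = conj \<gamma>0" using \<gamma> unfolding \<Gamma>_def by blast
      obtain A b where A: "\<gamma>0 = (\<lambda>x. A *v x + b)" "A ** J = J ** A" "transpose A ** P ** A = P"
        using affine[OF g0(1)] by blast
      let ?A = "S' ** A ** S"
      have Av: "?A *v x = S' *v (A *v (S *v x))" for x by (simp add: matrix_vector_mul_assoc matrix_mul_assoc)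
      have "\<gamma> x = ?A *v x + S' *v (A *v c + b - c)" for x
        by (simp add: g0(2) conj_def A(1) Av matrix_vector_right_distrib matrix_vector_mult_diff_distrib algebra_simps)
      moreover have "(?A *v x) \<bullet> (?A *v y) = x \<bullet> y" for x y
      proof -
        have "(?A *v x) \<bullet> (?A *v y) = \<tau> * ((S *v (?A *v x)) \<bullet> (P *v (S *v (?A *v y))))" by (rule Sin)
        also have "\<dots> = \<tau> * ((S *v x) \<bullet> (P *v (S *v y)))" by (simp only: Av SS iso[OF A(3)])
        finally show ?thesis unfolding Sin[symmetric] .
      qed
      moreover have "?A ** J' = J' ** ?A"
      proof -
        have "?A ** J' = S' ** A ** (S ** S') ** J ** S" by (simp only: J'_def matrix_mul_assoc)
        also have "\<dots> = S' ** (A ** J) ** S" by (simp add: S matrix_mul_assoc)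
        also have "\<dots> = S' ** J ** (S ** S') ** A ** S" by (simp add: S A(2) matrix_mul_assoc)
        also have "\<dots> = J' ** ?A" by (simp only: J'_def matrix_mul_assoc)
        finally show ?thesis .
      qed
      ultimately show ?thesis by blast
    qed
    have id: "(\<lambda>x. x) \<in> \<Delta>" using translation[OF full_lattice_closed_under(1)[OF L]] by simp
    have "conj (\<lambda>x. x) = (\<lambda>x. x)" by (simp add: conj_def fun_eq_iff SS)
    then show "(\<lambda>x. x) \<in> \<Gamma>" using id unfolding \<Gamma>_def by (metis imageI)
    have cc: "conj \<gamma> (conj \<delta> x) = conj (\<lambda>x. \<gamma> (\<delta> x)) x" for \<gamma> \<delta> x by (simp add: conj_def SS)
    show "(\<lambda>x. \<gamma> (\<delta> x)) \<in> \<Gamma>" if \<gamma>\<delta>: "\<gamma> \<in> \<Gamma>" "\<delta> \<in> \<Gamma>" for \<gamma> \<delta>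
    proof -
      obtain \<gamma>0 \<delta>0 where g: "\<gamma>0 \<in> \<Delta>" "\<gamma> = conj \<gamma>0" "\<delta>0 \<in> \<Delta>" "\<delta> = conj \<delta>0" using \<gamma>\<delta> unfolding \<Gamma>_def by blast
      have "(\<lambda>x. \<gamma> (\<delta> x)) = conj (\<lambda>x. \<gamma>0 (\<delta>0 x))" by (simp add: fun_eq_iff g cc)
      then show ?thesis unfolding \<Gamma>_def using mult[OF g(1,3)] by blast
    qed
    show "\<exists>\<delta>\<in>\<Gamma>. \<forall>x. \<delta> (\<gamma> x) = x \<and> \<gamma> (\<delta> x) = x" if \<gamma>: "\<gamma> \<in> \<Gamma>" for \<gamma>
    proof -
      obtain \<gamma>0 where g: "\<gamma>0 \<in> \<Delta>" "\<gamma> = conj \<gamma>0" using \<gamma> unfolding \<Gamma>_def by blast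
      obtain \<delta>0 where d: "\<delta>0 \<in> \<Delta>" "\<forall>x. \<delta>0 (\<gamma>0 x) = x \<and> \<gamma>0 (\<delta>0 x) = x" using inverse[OF g(1)] by blast
      have "\<forall>x. conj \<delta>0 (\<gamma> x) = x \<and> \<gamma> (conj \<delta>0 x) = x" using d(2) by (simp add: g(2) conj_def SS)
      then show ?thesis unfolding \<Gamma>_def using d(1) by blast
    qed
    show "\<exists>k::int. (\<gamma> (\<delta> 0) - \<gamma> 0) \<bullet> (J' *v \<gamma> 0) = 2 * pi * of_int k" if \<gamma>\<delta>: "\<gamma> \<in> \<Gamma>" "\<delta> \<in> \<Gamma>" for \<gamma> \<delta>
    proof -
      obtain \<gamma>0 \<delta>0 where g: "\<gamma>0 \<in> \<Delta>" "\<gamma> = conj \<gamma>0" "\<delta>0 \<in> \<Delta>" "\<delta> = conj \<delta>0" using \<gamma>\<delta> unfolding \<Gamma>_def by blast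
      \<comment> \<open>n times either difference is a lattice vector: by hypothesis for
        \<open>?v\<close>, and as a difference of two such vectors for \<open>?u\<close>.\<close>
      let ?u = "\<gamma>0 (\<delta>0 c) - \<gamma>0 c" and ?v = "\<gamma>0 c - c"
      have "real n *\<^sub>R ?u = real n *\<^sub>R (\<gamma>0 (\<delta>0 c) - c) - real n *\<^sub>R ?v" by (simp add: algebra_simps)
      then have u: "real n *\<^sub>R ?u \<in> \<Lambda>"
        using full_lattice_closed_under(4)[OF L n(2)[OF mult[OF g(1,3)]] n(2)[OF g(1)]] by simp
      obtain k where k: "real q * ((real n *\<^sub>R ?u) \<bullet> ((P ** J) *v (real n *\<^sub>R ?v))) = of_int k"
        using q(2)[OF u n(2)[OF g(1)]] by (auto elim: Ints_cases)
      have "\<gamma> (\<delta> 0) - \<gamma> 0 = S' *v ?u" "\<gamma> 0 = S' *v ?v"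
        by (simp_all add: g conj_def SS matrix_vector_mult_diff_distrib[symmetric])
      then have "(\<gamma> (\<delta> 0) - \<gamma> 0) \<bullet> (J' *v \<gamma> 0) = \<tau> * (?u \<bullet> (P *v (J *v ?v)))"
        by (subst Sin) (simp add: J'v SS)
      also have "\<dots> = 2 * pi * (real q * ((real n *\<^sub>R ?u) \<bullet> ((P ** J) *v (real n *\<^sub>R ?v))))"
        by (simp add: \<tau>_def matrix_vector_mul_assoc[symmetric] matrix_vector_mult_scaleR power2_eq_square mult_ac)
      finally show ?thesis unfolding k by blast
    qed
    show "0 < ?\<rho>" using \<rho>(1) S0 by simp
    show "?\<rho> \<le> norm (\<gamma> z - z)" if \<gamma>: "\<gamma> \<in> \<Gamma>" "\<gamma> \<noteq> (\<lambda>x. x)" for \<gamma> z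
    proof -
      obtain \<gamma>0 where g: "\<gamma>0 \<in> \<Delta>" "\<gamma> = conj \<gamma>0" using \<gamma> unfolding \<Gamma>_def by blast
      have g1: "\<gamma>0 \<noteq> (\<lambda>x. x)" using \<gamma>(2) by (auto simp: g(2) conj_def SS)
      let ?w = "S *v z + c"
      have "\<rho> \<le> norm (\<gamma>0 ?w - ?w)" by (rule \<rho>(2)[OF g(1) g1])
      also have "\<gamma>0 ?w - ?w = S *v (\<gamma> z - z)" by (simp add: g(2) conj_def SS matrix_vector_mult_diff_distrib algebra_simps)
      also have "norm \<dots> \<le> norm S * norm (\<gamma> z - z)" by (rule norm_matrix_vector_le)
      finally show ?thesis using S0 by (simp add: pos_divide_le_eq mult.commute)
    qed
    show "\<exists>\<gamma>\<in>\<Gamma>. norm (\<gamma> x) \<le> norm S' * R" for x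
    proof -
      obtain l where l: "l \<in> \<Lambda>" "norm (S *v x + l) \<le> R" using R by blast
      have "conj (\<lambda>x. x + l) x = S' *v (S *v x + l)" by (simp add: conj_def algebra_simps)
      also have "norm \<dots> \<le> norm S' * norm (S *v x + l)" by (rule norm_matrix_vector_le)
      also have "\<dots> \<le> norm S' * R" by (intro mult_left_mono l(2)) simp
      finally show ?thesis unfolding \<Gamma>_def using translation[OF l(1)] by blast
    qed
  qed rule
  have JS: "J ** S = S ** J'"
  proof -
    have "S ** J' = (S ** S') ** J ** S" by (simp only: J'_def matrix_mul_assoc)
    then show ?thesis by (simp add: S)
  qed
  show ?thesis
  proof (rule projective_quotient[OF affine_cover_affine_change[OF cov S JS, of c] M])
    fix x y
    have "S *v y + c = \<gamma> (S *v x + c) \<longleftrightarrow> y = conj \<gamma> x" for \<gamma>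
    proof
      assume "S *v y + c = \<gamma> (S *v x + c)"
      then show "y = conj \<gamma> x" unfolding conj_def by (metis SS(1) add_diff_cancel_right')
    qed (simp add: conj_def SS)
    then show "\<pi> (S *v x + c) = \<pi> (S *v y + c) \<longleftrightarrow> (\<exists>\<gamma>\<in>\<Gamma>. y = \<gamma> x)"
      unfolding fibre \<Gamma>_def by simp
  qed
qed

section \<open>The affine group of a torus quotient\<close>

text \<open>The extension of \<open>G\<close> by the lattice translations: all affine lifts of
  members of \<open>G\<close> to the vector space, with every admissible translation part.\<close>

definition lift_group :: "(real^'n) set \<Rightarrow> ((real^'n) set \<Rightarrow> (real^'n) set) set \<Rightarrow> (real^'n \<Rightarrow> real^'n) set" where
  "lift_group \<Lambda> G = {\<gamma>. \<exists>g\<in>G. \<exists>b. \<gamma> = (\<lambda>x. linear_part \<Lambda> g *v x + b) \<and> (\<forall>x. g (coset \<Lambda> x) = coset \<Lambda> (\<gamma> x))}"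

lemma common_denominator:
  assumes "finite F" "F \<subseteq> \<rat>"
  obtains q :: nat where "0 < q" "\<And>x. x \<in> F \<Longrightarrow> real q * x \<in> \<int>"
proof -
  have "\<exists>q::nat. 0 < q \<and> (\<forall>x\<in>F. real q * x \<in> \<int>)" using assms
  proof (induction F rule: finite_induct)
    case empty
    then show ?case by (intro exI[of _ 1]) simp
  next
    case (insert y F)
    then obtain q :: nat where q: "0 < q" "\<forall>x\<in>F. real q * x \<in> \<int>" by auto
    obtain m n :: int where mn: "0 < n" "y = of_int m / of_int n" using insert.prems by (auto elim!: Rats_cases')
    have "real (q * nat n) * x \<in> \<int>" if "x \<in> insert y F" for x
    proof (cases "x = y")
      case True
      have "real (q * nat n) * y = of_int (int q * m)" using mn by simp
      then show ?thesis using True by (metis Ints_of_int)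
    next
      case False
      then have "of_int n * (real q * x) \<in> \<int>" using q(2) that by (intro Ints_mult[OF Ints_of_int]) auto
      then show ?thesis using mn(1) by (simp add: mult_ac)
    qed
    then show ?case using q(1) mn(1) by (intro exI[of _ "q * nat n"]) simp
  qed
  then show ?thesis using that by blast
qed

locale torus_quotient =
  fixes \<Lambda> :: "(real^'n) set" and J :: "real^'n^'n" and G :: "((real^'n) set \<Rightarrow> (real^'n) set) set"
  assumes T: "complex_torus \<Lambda> J" and G: "finite_free_aut_group (torus \<Lambda> J) G"
begin

section \<open>Structure of the group of affine lifts\<close>

lemma L: "full_lattice \<Lambda>" using T by (simp add: complex_torus_def)

lemmas lattice = full_lattice_closed_under[OF L]
lemmas coset_eq = coset_eq_iff[OF L]

lemma transformation: "transformation_group (ctop (torus \<Lambda> J)) G" and fin: "finite G"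
  using finite_free_aut_groupD[OF G] by blast+

lemma coset_point: "coset \<Lambda> x \<in> points (torus \<Lambda> J)" by (simp add: points_torus)

lemma identity: obtains e where "e \<in> G" "\<And>x. e (coset \<Lambda> x) = coset \<Lambda> x" "linear_part \<Lambda> e = mat 1"
proof -
  obtain e where e: "e \<in> G" "\<And>x. e (coset \<Lambda> x) = coset \<Lambda> x"
  proof -
    have "\<exists>e\<in>G. \<forall>x\<in>points (torus \<Lambda> J). e x = x"
      using transformation unfolding transformation_group_def by (elim conjE)
    then show ?thesis using that coset_point by blast
  qed
  moreover have "linear_part \<Lambda> e = mat 1" by (rule linear_part_eq[OF L, of e _ 0]) (simp add: e(2))
  ultimately show ?thesis using that by blast
qed

lemma lift_groupI:
  assumes "g \<in> G" "\<And>x. g (coset \<Lambda> x) = coset \<Lambda> (A *v x + b)"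
  shows "(\<lambda>x. A *v x + b) \<in> lift_group \<Lambda> G"
  using assms(1,2) linear_part_eq[OF L assms(2)] unfolding lift_group_def by blast

lemma lift_groupE:
  assumes "\<gamma> \<in> lift_group \<Lambda> G"
  obtains g b where "g \<in> G" "\<gamma> = (\<lambda>x. linear_part \<Lambda> g *v x + b)" "\<And>x. g (coset \<Lambda> x) = coset \<Lambda> (\<gamma> x)"
  using assms unfolding lift_group_def by blast

lemma lift_group_translation: "l \<in> \<Lambda> \<Longrightarrow> (\<lambda>x. x + l) \<in> lift_group \<Lambda> G"
proof -
  assume l: "l \<in> \<Lambda>"
  obtain e where e: "e \<in> G" "\<And>x. e (coset \<Lambda> x) = coset \<Lambda> x" by (rule identity) blast
  have "(\<lambda>x. mat 1 *v x + l) \<in> lift_group \<Lambda> G"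
    by (rule lift_groupI[OF e(1)]) (simp add: e(2) coset_eq l)
  then show ?thesis by simp
qed

lemma product:
  assumes "g \<in> G" "h \<in> G"
  obtains k where "k \<in> G" "\<And>x. k (coset \<Lambda> x) = g (h (coset \<Lambda> x))"
  using transformation assms coset_point unfolding transformation_group_def by (metis (no_types, lifting))

lemma lift_group_mult:
  assumes "\<gamma> \<in> lift_group \<Lambda> G" "\<delta> \<in> lift_group \<Lambda> G"
  shows "(\<lambda>x. \<gamma> (\<delta> x)) \<in> lift_group \<Lambda> G"
proof -
  obtain g b where g: "g \<in> G" "\<gamma> = (\<lambda>x. linear_part \<Lambda> g *v x + b)" "\<And>x. g (coset \<Lambda> x) = coset \<Lambda> (\<gamma> x)"
    using assms(1) unfolding lift_group_def by blast
  obtain h d where h: "h \<in> G" "\<delta> = (\<lambda>x. linear_part \<Lambda> h *v x + d)" "\<And>x. h (coset \<Lambda> x) = coset \<Lambda> (\<delta> x)"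
    using assms(2) unfolding lift_group_def by blast
  obtain k where k: "k \<in> G" "\<And>x. k (coset \<Lambda> x) = g (h (coset \<Lambda> x))" using product[OF g(1) h(1)] by blast
  have e: "\<gamma> (\<delta> x) = (linear_part \<Lambda> g ** linear_part \<Lambda> h) *v x + (linear_part \<Lambda> g *v d + b)" for x
    by (simp add: g(2) h(2) matrix_vector_right_distrib matrix_vector_mul_assoc add.assoc)
  show ?thesis unfolding e by (rule lift_groupI[OF k(1)]) (simp add: k(2) h(3) g(3) e[symmetric])
qed

lemma lift_group_inverse:
  assumes "\<gamma> \<in> lift_group \<Lambda> G"
  shows "\<exists>\<delta>\<in>lift_group \<Lambda> G. \<forall>x. \<delta> (\<gamma> x) = x \<and> \<gamma> (\<delta> x) = x"
proof -
  obtain g b where g: "g \<in> G" "\<gamma> = (\<lambda>x. linear_part \<Lambda> g *v x + b)" "\<And>x. g (coset \<Lambda> x) = coset \<Lambda> (\<gamma> x)"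
    using assms unfolding lift_group_def by blast
  obtain h where h: "h \<in> G" "\<And>x. h (g (coset \<Lambda> x)) = coset \<Lambda> x"
    using transformation_group_inverse[OF transformation g(1)] coset_point by blast
  obtain d where d: "\<And>x. h (coset \<Lambda> x) = coset \<Lambda> (linear_part \<Lambda> h *v x + d)"
    using aut_group_lifts(3)[OF T G h(1)] by blast
  let ?A = "linear_part \<Lambda> g" and ?B = "linear_part \<Lambda> h"
  have hg: "coset \<Lambda> ((?B ** ?A) *v x + (?B *v b + d)) = coset \<Lambda> (mat 1 *v x + 0)" for x
  proof -
    have "coset \<Lambda> (?B *v \<gamma> x + d) = coset \<Lambda> x" using h(2)[of x] by (simp add: g(3) d)
    then show ?thesis by (simp add: g(2) matrix_vector_right_distrib matrix_vector_mul_assoc add.assoc)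
  qed
  then have BA: "?B ** ?A = mat 1" by (rule lattice_affine_unique[OF L])
  then have AB: "?A ** ?B = mat 1" by (simp add: matrix_left_right_inverse)
  \<comment> \<open>The composite of the two lifts is the identity only up to the lattice vector
    \<open>?l\<close>. Changing the translation part of the lift of \<open>h\<close> by it gives an
    exact inverse.\<close>
  let ?l = "?B *v b + d" and ?\<delta> = "\<lambda>x. ?B *v x + (- (?B *v b))"
  have "- ?l \<in> \<Lambda>" using hg[of 0] by (simp add: coset_eq)
  then have dl: "coset \<Lambda> (?B *v x + d) = coset \<Lambda> (?\<delta> x)" for x by (simp add: coset_eq algebra_simps)
  have "?\<delta> \<in> lift_group \<Lambda> G" by (rule lift_groupI[OF h(1)]) (simp only: d dl)
  moreover have "?\<delta> (\<gamma> x) = x \<and> \<gamma> (?\<delta> x) = x" for x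
    by (simp add: g(2) matrix_vector_right_distrib matrix_vector_mult_diff_distrib matrix_vector_mul_assoc BA AB)
  ultimately show ?thesis by (intro bexI[of _ ?\<delta>]) simp_all
qed

lemma lift_group_fibre: "(orb G \<circ> coset \<Lambda>) x = (orb G \<circ> coset \<Lambda>) y \<longleftrightarrow> (\<exists>\<gamma>\<in>lift_group \<Lambda> G. y = \<gamma> x)"
proof -
  have "(orb G \<circ> coset \<Lambda>) x = (orb G \<circ> coset \<Lambda>) y \<longleftrightarrow> (\<exists>g\<in>G. coset \<Lambda> y = g (coset \<Lambda> x))"
    using orb_eq_iff[OF transformation coset_point, of x "coset \<Lambda> y"] coset_point[of y] by simp
  also have "\<dots> \<longleftrightarrow> (\<exists>\<gamma>\<in>lift_group \<Lambda> G. y = \<gamma> x)"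
  proof
    assume "\<exists>g\<in>G. coset \<Lambda> y = g (coset \<Lambda> x)"
    then obtain g where g: "g \<in> G" "coset \<Lambda> y = g (coset \<Lambda> x)" by blast
    obtain b where b: "\<And>x. g (coset \<Lambda> x) = coset \<Lambda> (linear_part \<Lambda> g *v x + b)"
      using aut_group_lifts(3)[OF T G g(1)] by blast
    let ?\<delta> = "\<lambda>x. linear_part \<Lambda> g *v x + b"
    \<comment> \<open>The chosen lift reaches \<open>y\<close> up to a lattice vector, which is then
      added.\<close>
    have l: "y - ?\<delta> x \<in> \<Lambda>" using g(2) by (simp add: b coset_eq[of "?\<delta> x" y, symmetric])
    have "?\<delta> \<in> lift_group \<Lambda> G" by (rule lift_groupI[OF g(1) b])
    from lift_group_mult[OF lift_group_translation[OF l] this]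
    have "(\<lambda>z. ?\<delta> z + (y - ?\<delta> x)) \<in> lift_group \<Lambda> G" .
    then show "\<exists>\<gamma>\<in>lift_group \<Lambda> G. y = \<gamma> x" by (rule bexI[rotated]) simp
  next
    assume "\<exists>\<gamma>\<in>lift_group \<Lambda> G. y = \<gamma> x"
    then show "\<exists>g\<in>G. coset \<Lambda> y = g (coset \<Lambda> x)" by (metis lift_groupE)
  qed
  finally show ?thesis .
qed

lemma linear_part_lattice:
  assumes "g \<in> G" "l \<in> \<Lambda>"
  shows "linear_part \<Lambda> g *v l \<in> \<Lambda>"
proof -
  obtain b where b: "\<And>x. g (coset \<Lambda> x) = coset \<Lambda> (linear_part \<Lambda> g *v x + b)"
    using aut_group_lifts(3)[OF T G assms(1)] by blast
  have "coset \<Lambda> (0 :: real^'n) = coset \<Lambda> l" using assms(2) by (simp add: coset_eq)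
  then have "coset \<Lambda> (linear_part \<Lambda> g *v 0 + b) = coset \<Lambda> (linear_part \<Lambda> g *v l + b)" unfolding b[symmetric] by simp
  then show ?thesis by (simp add: coset_eq)
qed

lemma linear_part_mult:
  assumes "g \<in> G" "h \<in> G"
  shows "\<exists>k\<in>G. linear_part \<Lambda> k = linear_part \<Lambda> g ** linear_part \<Lambda> h"
proof -
  obtain k where k: "k \<in> G" "\<And>x. k (coset \<Lambda> x) = g (h (coset \<Lambda> x))" using product[OF assms] by blast
  obtain b d where b: "\<And>x. g (coset \<Lambda> x) = coset \<Lambda> (linear_part \<Lambda> g *v x + b)"
      and d: "\<And>x. h (coset \<Lambda> x) = coset \<Lambda> (linear_part \<Lambda> h *v x + d)"
    using aut_group_lifts(3)[OF T G assms(1)] aut_group_lifts(3)[OF T G assms(2)] by blast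
  have "linear_part \<Lambda> k = linear_part \<Lambda> g ** linear_part \<Lambda> h"
    by (rule linear_part_eq[OF L, of k _ "linear_part \<Lambda> g *v d + b"])
       (simp add: k(2) d b matrix_vector_right_distrib matrix_vector_mul_assoc add.assoc)
  then show ?thesis using k(1) by blast
qed

text \<open>A linear part preserves the lattice, so its matrix in lattice coordinates even has
  integral entries.\<close>

lemma linear_part_rational:
  fixes M N :: "real^'n^'n"
  assumes NM: "N ** M = mat 1" and Leq: "\<Lambda> = {x. \<forall>i. (N *v x) $ i \<in> \<int>}" and g: "g \<in> G"
  shows "rational_matrix (N ** linear_part \<Lambda> g ** M)"
  unfolding rational_matrix_def
proof (intro allI)
  fix i j
  let ?a = "axis j 1 :: real^'n"
  have "N *v (M *v ?a) = ?a" by (simp add: matrix_vector_mul_assoc NM)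
  then have "M *v ?a \<in> \<Lambda>" unfolding Leq by (simp add: axis_def)
  then have "linear_part \<Lambda> g *v (M *v ?a) \<in> \<Lambda>" by (rule linear_part_lattice[OF g])
  then have "(N *v (linear_part \<Lambda> g *v (M *v ?a))) $ i \<in> \<int>" unfolding Leq by simp
  moreover have "(N ** linear_part \<Lambda> g ** M) $ i $ j = (N *v (linear_part \<Lambda> g *v (M *v ?a))) $ i"
    by (simp add: matrix_vector_mul_assoc matrix_mul_assoc matrix_vector_mul_component inner_axis)
  ultimately show "(N ** linear_part \<Lambda> g ** M) $ i $ j \<in> \<rat>" using Ints_subset_Rats by auto
qed

lemma sum_in_lattice: "(\<And>i. i \<in> I \<Longrightarrow> f i \<in> \<Lambda>) \<Longrightarrow> sum f I \<in> \<Lambda>"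
  by (induction I rule: infinite_finite_induct) (auto intro: lattice(1,2))

text \<open>
  \<open>G\<close> permutes the orbit of the origin of the torus; \<open>c\<close> is the barycentre of representatives of this orbit
  and \<open>n\<close> is its size.
\<close>

lemma lift_group_barycentre:
  obtains c :: "real^'n" and n :: nat where "0 < n" "\<forall>\<gamma>\<in>lift_group \<Lambda> G. real n *\<^sub>R (\<gamma> c - c) \<in> \<Lambda>"
proof -
  let ?O = "(\<lambda>g. g (coset \<Lambda> 0)) ` G"
  have fO: "finite ?O" using fin by simp
  have nO: "card ?O > 0" using fO identity by (metis card_gt_0_iff empty_iff image_is_empty)
  have ex: "\<exists>x. coset \<Lambda> x = o'" if o': "o' \<in> ?O" for o'
  proof -
    obtain g where "g \<in> G" "o' = g (coset \<Lambda> 0)" using o' by blast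
    then show ?thesis using aut_group_lifts(3)[OF T G] by metis
  qed
  then obtain r where r: "\<And>o'. o' \<in> ?O \<Longrightarrow> coset \<Lambda> (r o') = o'" by metis
  define n where "n = card ?O"
  define c where "c = (1 / real n) *\<^sub>R (\<Sum>o'\<in>?O. r o')"
  have nc: "real n *\<^sub>R c = (\<Sum>o'\<in>?O. r o')" using nO by (simp add: c_def n_def)
  have "real n *\<^sub>R (\<gamma> c - c) \<in> \<Lambda>" if \<gamma>: "\<gamma> \<in> lift_group \<Lambda> G" for \<gamma>
  proof -
    obtain g b where g: "g \<in> G" "\<gamma> = (\<lambda>x. linear_part \<Lambda> g *v x + b)" "\<And>x. g (coset \<Lambda> x) = coset \<Lambda> (\<gamma> x)"
      using \<gamma> unfolding lift_group_def by blast
    have sub: "g ` ?O \<subseteq> ?O"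
    proof
      fix o' assume "o' \<in> g ` ?O"
      then obtain h where h: "h \<in> G" "o' = g (h (coset \<Lambda> 0))" by blast
      obtain k where "k \<in> G" "\<And>x. k (coset \<Lambda> x) = g (h (coset \<Lambda> x))" using product[OF g(1) h(1)] by blast
      then show "o' \<in> ?O" using h(2) by (metis imageI)
    qed
    obtain h where h: "h \<in> G" "\<forall>p\<in>points (torus \<Lambda> J). h (g p) = p"
      using transformation_group_inverse[OF transformation g(1)] by blast
    have "inj_on g ?O"
    proof (rule inj_on_inverseI)
      fix o' assume "o' \<in> ?O"
      then show "h (g o') = o'" using h(2) r coset_point by metis
    qed
    then have bij: "bij_betw g ?O ?O" using endo_inj_surj[OF fO sub] by (simp add: bij_betw_def)
    have "linear_part \<Lambda> g *v (\<Sum>o'\<in>?O. r o') = (\<Sum>o'\<in>?O. linear_part \<Lambda> g *v r o')"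
      by (rule linear_sum[OF matrix_vector_mul_linear])
    moreover have "real n *\<^sub>R \<gamma> c = linear_part \<Lambda> g *v (real n *\<^sub>R c) + real n *\<^sub>R b"
      by (simp add: g(2) scaleR_add_right matrix_vector_mult_scaleR)
    ultimately have "real n *\<^sub>R \<gamma> c = (\<Sum>o'\<in>?O. \<gamma> (r o'))"
      unfolding nc by (simp add: g(2) sum.distrib n_def sum_constant_scaleR del: sum_constant)
    moreover have "(\<Sum>o'\<in>?O. r o') = (\<Sum>o'\<in>?O. r (g o'))"
      by (rule sum.reindex_bij_betw[OF bij, symmetric])
    \<comment> \<open>Since \<open>g\<close> permutes the orbit, the sum of representatives may be
      reindexed by \<open>g\<close>. The vectors \<open>\<gamma> (r o')\<close> and
      \<open>r (g o')\<close> represent the same point, so each difference is in the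
      lattice.\<close>
    ultimately have "real n *\<^sub>R (\<gamma> c - c) = (\<Sum>o'\<in>?O. \<gamma> (r o') - r (g o'))"
      by (simp add: scaleR_diff_right nc sum_subtractf)
    also have "\<dots> \<in> \<Lambda>"
    proof (rule sum_in_lattice)
      fix o' assume o: "o' \<in> ?O"
      have go: "g o' \<in> ?O" using sub o by blast
      have "coset \<Lambda> (r (g o')) = g (coset \<Lambda> (r o'))" by (simp only: r[OF o] r[OF go])
      then show "\<gamma> (r o') - r (g o') \<in> \<Lambda>" unfolding g(3) coset_eq .
    qed
    finally show ?thesis .
  qed
  then show ?thesis using that nO n_def by blast
qed

text \<open>Lifts of an element that fixes a torus point are translations by freeness, and
  discreteness of the lattice bounds them. For the finitely many other elements the displacement
  avoids the lattice everywhere; compactness of the torus gives a bound uniform in the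
  point.\<close>

lemma lift_group_displacement:
  obtains \<rho> where "0 < \<rho>" "\<And>\<gamma> x. \<gamma> \<in> lift_group \<Lambda> G \<Longrightarrow> \<gamma> \<noteq> (\<lambda>x. x) \<Longrightarrow> \<rho> \<le> norm (\<gamma> x - x)"
proof -
  obtain r where r: "r > 0" "\<And>l. l \<in> \<Lambda> \<Longrightarrow> l \<noteq> 0 \<Longrightarrow> r \<le> norm l" using full_lattice_min_norm[OF L] by blast
  obtain R where R: "\<And>x. \<exists>l\<in>\<Lambda>. norm (x + l) \<le> R" using full_lattice_cobounded[OF L] by blast
  have ex: "\<exists>\<rho>>0. \<forall>\<gamma> x. \<gamma> \<noteq> (\<lambda>x. x) \<longrightarrow> (\<exists>b. \<gamma> = (\<lambda>x. linear_part \<Lambda> g *v x + b)) \<longrightarrow>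
      (\<forall>x. g (coset \<Lambda> x) = coset \<Lambda> (\<gamma> x)) \<longrightarrow> \<rho> \<le> norm (\<gamma> x - x)" if g: "g \<in> G" for g
  proof (cases "\<exists>x. g (coset \<Lambda> x) = coset \<Lambda> x")
    case True
    then have id: "g (coset \<Lambda> y) = coset \<Lambda> y" for y
      using finite_free_aut_groupD(3)[OF G g coset_point coset_point] by blast
    have lp: "linear_part \<Lambda> g = mat 1" by (rule linear_part_eq[OF L, of g _ 0]) (simp add: id)
    have "r \<le> norm (\<gamma> x - x)" if "\<gamma> \<noteq> (\<lambda>x. x)" "\<gamma> = (\<lambda>x. linear_part \<Lambda> g *v x + b)" "\<forall>x. g (coset \<Lambda> x) = coset \<Lambda> (\<gamma> x)" for \<gamma> x b
    proof -
      have \<gamma>: "\<gamma> = (\<lambda>x. x + b)" using that(2) by (simp add: lp)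
      then have "b \<noteq> 0" using that(1) by auto
      moreover have "coset \<Lambda> 0 = coset \<Lambda> b" using that(3) id[of 0] by (simp add: \<gamma>)
      then have "b \<in> \<Lambda>" by (simp add: coset_eq)
      ultimately show ?thesis using r(2) by (simp add: \<gamma>)
    qed
    then show ?thesis using r(1) by blast
  next
    case False
    obtain b where b: "\<And>x. g (coset \<Lambda> x) = coset \<Lambda> (linear_part \<Lambda> g *v x + b)"
      using aut_group_lifts(3)[OF T G g] by blast
    \<comment> \<open>The displacement is measured modulo the lattice, which removes the choice of
      the lift. A minimum over the ball is enough, because every point has a lattice translate in
      it.\<close>
    define f where "f x = infdist (linear_part \<Lambda> g *v x + b - x) \<Lambda>" for x
    have f0: "f x \<noteq> 0" for x
    proof
      assume "f x = 0"
      then have "linear_part \<Lambda> g *v x + b - x \<in> \<Lambda>"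
        using in_closed_iff_infdist_zero[OF closed_full_lattice[OF L]] lattice(1) unfolding f_def by blast
      then have "coset \<Lambda> x = g (coset \<Lambda> x)" unfolding b coset_eq .
      then show False using False by metis
    qed
    have f1: "0 < f x" for x using f0[of x] infdist_nonneg by (simp add: f_def less_le)
    have "continuous_on (cball 0 R) f" unfolding f_def
      by (intro continuous_on_infdist continuous_intros linear_continuous_on matrix_vector_mul_bounded_linear)
    moreover have "0 \<in> cball (0 :: real^'n) R" using R[of 0] order_trans[OF norm_ge_zero] by auto
    ultimately obtain x0 where x0: "\<And>x. x \<in> cball 0 R \<Longrightarrow> f x0 \<le> f x"
      using continuous_attains_inf[OF compact_cball, of 0 R f] by blast
    have "f x0 \<le> norm (\<gamma> x - x)" if \<gamma>: "\<gamma> = (\<lambda>x. linear_part \<Lambda> g *v x + d)" "\<forall>x. g (coset \<Lambda> x) = coset \<Lambda> (\<gamma> x)" for \<gamma> x d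
    proof -
      obtain l where l: "l \<in> \<Lambda>" "norm (x + l) \<le> R" using R by blast
      have "coset \<Lambda> d = coset \<Lambda> b" using \<gamma>(2) b[of 0] by (simp add: \<gamma>(1))
      then have bd: "b - d \<in> \<Lambda>" by (simp add: coset_eq)
      let ?v = "linear_part \<Lambda> g *v (x + l) + b - (x + l)"
      have e: "?v = (\<gamma> x - x) + (b - d + (linear_part \<Lambda> g *v l - l))"
        by (simp add: \<gamma>(1) matrix_vector_right_distrib algebra_simps)
      have "f x0 \<le> f (x + l)" using l(2) by (intro x0) simp
      also have "\<dots> \<le> dist ?v (b - d + (linear_part \<Lambda> g *v l - l))"
        unfolding f_def by (intro infdist_le lattice bd l(1) linear_part_lattice[OF g])
      also have "\<dots> = norm (\<gamma> x - x)" unfolding e by (simp add: dist_norm)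
      finally show ?thesis .
    qed
    then show ?thesis using f1[of x0] by blast
  qed
  then have "\<exists>\<rho>. \<forall>g\<in>G. 0 < \<rho> g \<and> (\<forall>\<gamma> x. \<gamma> \<noteq> (\<lambda>x. x) \<longrightarrow> (\<exists>b. \<gamma> = (\<lambda>x. linear_part \<Lambda> g *v x + b)) \<longrightarrow>
      (\<forall>x. g (coset \<Lambda> x) = coset \<Lambda> (\<gamma> x)) \<longrightarrow> \<rho> g \<le> norm (\<gamma> x - x))" by (intro bchoice) blast
  then obtain \<rho> where \<rho>: "\<forall>g\<in>G. 0 < \<rho> g \<and> (\<forall>\<gamma> x. \<gamma> \<noteq> (\<lambda>x. x) \<longrightarrow> (\<exists>b. \<gamma> = (\<lambda>x. linear_part \<Lambda> g *v x + b)) \<longrightarrow>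
      (\<forall>x. g (coset \<Lambda> x) = coset \<Lambda> (\<gamma> x)) \<longrightarrow> \<rho> g \<le> norm (\<gamma> x - x))" by (rule exE)
  have ne: "\<rho> ` G \<noteq> {}" using identity by blast
  show ?thesis
  proof (rule that[of "Min (\<rho> ` G)"])
    show "0 < Min (\<rho> ` G)" using fin ne \<rho> by (subst Min_gr_iff) auto
    fix \<gamma> x assume \<gamma>: "\<gamma> \<in> lift_group \<Lambda> G" "\<gamma> \<noteq> (\<lambda>x. x)"
    obtain g b where g: "g \<in> G" "\<gamma> = (\<lambda>x. linear_part \<Lambda> g *v x + b)" "\<And>x. g (coset \<Lambda> x) = coset \<Lambda> (\<gamma> x)"
      using \<gamma>(1) unfolding lift_group_def by blast
    have "Min (\<rho> ` G) \<le> \<rho> g" using fin g(1) by simp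
    also have "\<rho> g \<le> norm (\<gamma> x - x)" using bspec[OF \<rho> g(1)] \<gamma>(2) g(2,3) by blast
    finally show "Min (\<rho> ` G) \<le> norm (\<gamma> x - x)" .
  qed
qed

text \<open>The torus and its quotient are instances of one criterion, for the group of translations
  and for the full group of lifts. This spares descending projectivity from the torus to the
  quotient.\<close>

lemma polarized_projective:
  fixes M N P :: "real^'n^'n"
  assumes P: "transpose P = P" "\<And>x. x \<noteq> 0 \<Longrightarrow> 0 < x \<bullet> (P *v x)" "transpose J ** P ** J = P"
    and inv: "\<And>g. g \<in> G \<Longrightarrow> transpose (linear_part \<Lambda> g) ** P ** linear_part \<Lambda> g = P"
    and MN: "M ** N = mat 1" and Leq: "\<Lambda> = {x. \<forall>i. (N *v x) $ i \<in> \<int>}"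
    and rat: "rational_matrix (transpose M ** (P ** J) ** M)"
  shows "abelian_variety \<Lambda> J" "projective (quot_manifold (torus \<Lambda> J) G)"
proof -
  have J: "complex_structure J" using T by (simp add: complex_torus_def)
  let ?Q = "transpose M ** (P ** J) ** M"
  have "range (\<lambda>(i, j). ?Q $ i $ j) \<subseteq> \<rat>" using rat by (auto simp: rational_matrix_def)
  then obtain q :: nat where q: "0 < q" "\<And>x. x \<in> range (\<lambda>(i, j). ?Q $ i $ j) \<Longrightarrow> real q * x \<in> \<int>"
    using common_denominator[of "range (\<lambda>(i, j). ?Q $ i $ j)"] by auto
  have q2: "real q * (l \<bullet> ((P ** J) *v l')) \<in> \<int>" if l: "l \<in> \<Lambda>" "l' \<in> \<Lambda>" for l l'
  proof -
    let ?u = "N *v l" and ?v = "N *v l'"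
    have M: "l = M *v ?u" "l' = M *v ?v" by (simp_all add: matrix_vector_mul_assoc MN)
    have "?u \<bullet> (?Q *v ?v) = ?u \<bullet> (transpose M *v ((P ** J) *v (M *v ?v)))"
      by (simp only: matrix_vector_mul_assoc matrix_mul_assoc)
    also have "\<dots> = l \<bullet> ((P ** J) *v l')" unfolding matrix_inner_transpose M[symmetric] ..
    finally have "l \<bullet> ((P ** J) *v l') = (\<Sum>i\<in>UNIV. \<Sum>j\<in>UNIV. ?u $ i * (?Q $ i $ j * ?v $ j))"
      by (simp add: inner_vec_def matrix_vector_mult_def sum_distrib_left)
    then have "real q * (l \<bullet> ((P ** J) *v l')) = (\<Sum>i\<in>UNIV. \<Sum>j\<in>UNIV. ?u $ i * ((real q * ?Q $ i $ j) * ?v $ j))"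
      by (simp only: sum_distrib_left mult_ac)
    also have "\<dots> \<in> \<int>"
    proof (intro Ints_sum)
      fix i j
      have "?u $ i \<in> \<int>" "?v $ j \<in> \<int>" using l unfolding Leq by auto
      moreover have "real q * ?Q $ i $ j \<in> \<int>" by (rule q(2)) force
      ultimately show "?u $ i * ((real q * ?Q $ i $ j) * ?v $ j) \<in> \<int>" by (intro Ints_mult[OF _ Ints_mult])
    qed
    finally show ?thesis .
  qed
  obtain c n where n: "0 < n" "\<And>\<gamma>. \<gamma> \<in> lift_group \<Lambda> G \<Longrightarrow> real n *\<^sub>R (\<gamma> c - c) \<in> \<Lambda>"
    using lift_group_barycentre by metis
  obtain \<rho> where \<rho>: "0 < \<rho>" "\<And>\<gamma> x. \<gamma> \<in> lift_group \<Lambda> G \<Longrightarrow> \<gamma> \<noteq> (\<lambda>x. x) \<Longrightarrow> \<rho> \<le> norm (\<gamma> x - x)"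
    using lift_group_displacement by blast
  note cov = affine_cover_torus[OF T] and H = Hausdorff_torus[OF L, of J]
  have lifts: "\<exists>A b. A ** J = J ** A \<and> invertible A \<and> (\<forall>x. g (coset \<Lambda> x) = coset \<Lambda> (A *v x + b))" if "g \<in> G" for g
    using aut_group_lifts[OF T G that] by blast
  note quot = quotient_affine_cover[OF cov H G lifts]
  show "projective (quot_manifold (torus \<Lambda> J) G)"
  proof (rule affine_quotient_projective[OF L J P, where \<Delta> = "lift_group \<Lambda> G" and n = n and c = c and q = q and
        \<rho> = \<rho> and \<pi> = "orb G \<circ> coset \<Lambda>"])
    show "(orb G \<circ> coset \<Lambda>) x = (orb G \<circ> coset \<Lambda>) y \<longleftrightarrow> (\<exists>\<gamma>\<in>lift_group \<Lambda> G. y = \<gamma> x)" for x y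
      by (rule lift_group_fibre)
    fix \<gamma> assume "\<gamma> \<in> lift_group \<Lambda> G"
    then show "\<exists>A b. \<gamma> = (\<lambda>x. A *v x + b) \<and> A ** J = J ** A \<and> transpose A ** P ** A = P"
      using aut_group_lifts(1)[OF T G] inv by (metis lift_groupE)
  qed (use lift_group_translation lift_group_mult lift_group_inverse n q(1) q2 \<rho> quot compact_quot_manifold[OF compact_torus[OF L]] in auto)
  have "projective (torus \<Lambda> J)"
  \<comment> \<open>For pure translations the translation parts are lattice vectors already, so the
    base point 0 and \<open>n = 1\<close> suffice; \<open>q\<close> and \<open>\<rho>\<close> are
    those of the larger group.\<close>
  proof (rule affine_quotient_projective[OF L J P, where \<Delta> = "(\<lambda>l x. x + l) ` \<Lambda>" and n = 1 and c = 0 and q = q and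
        \<rho> = \<rho> and \<pi> = "coset \<Lambda>"])
    show "\<exists>A b. \<gamma> = (\<lambda>x. A *v x + b) \<and> A ** J = J ** A \<and> transpose A ** P ** A = P"
      if \<gamma>: "\<gamma> \<in> (\<lambda>l x. x + l) ` \<Lambda>" for \<gamma>
    proof -
      obtain l where "\<gamma> = (\<lambda>x. mat 1 *v x + l)" using \<gamma> by auto
      moreover have "mat 1 ** J = J ** mat 1" "transpose (mat 1) ** P ** mat 1 = P" by simp_all
      ultimately show ?thesis by blast
    qed
    show "(\<lambda>x. \<gamma> (\<delta> x)) \<in> (\<lambda>l x. x + l) ` \<Lambda>" if gd: "\<gamma> \<in> (\<lambda>l x. x + l) ` \<Lambda>" "\<delta> \<in> (\<lambda>l x. x + l) ` \<Lambda>" for \<gamma> \<delta>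
    proof -
      obtain l l' where "l \<in> \<Lambda>" "\<gamma> = (\<lambda>x. x + l)" "l' \<in> \<Lambda>" "\<delta> = (\<lambda>x. x + l')" using gd by blast
      then have "(\<lambda>x. \<gamma> (\<delta> x)) = (\<lambda>x. x + (l' + l))" "l' + l \<in> \<Lambda>" using lattice by (auto simp: add.assoc)
      then show ?thesis by blast
    qed
    show "\<exists>\<delta>\<in>(\<lambda>l x. x + l) ` \<Lambda>. \<forall>x. \<delta> (\<gamma> x) = x \<and> \<gamma> (\<delta> x) = x" if gd: "\<gamma> \<in> (\<lambda>l x. x + l) ` \<Lambda>" for \<gamma>
    proof -
      obtain l where l: "l \<in> \<Lambda>" "\<gamma> = (\<lambda>x. x + l)" using gd by blast
      have "(\<lambda>x. x + - l) \<in> (\<lambda>l x. x + l) ` \<Lambda>" using lattice(3)[OF l(1)] by blast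
      then show ?thesis by (rule bexI[rotated]) (simp add: l(2))
    qed
    show "real 1 *\<^sub>R (\<gamma> 0 - 0) \<in> \<Lambda>" if "\<gamma> \<in> (\<lambda>l x. x + l) ` \<Lambda>" for \<gamma> using that by auto
    show "\<rho> \<le> norm (\<gamma> x - x)" if "\<gamma> \<in> (\<lambda>l x. x + l) ` \<Lambda>" "\<gamma> \<noteq> (\<lambda>x. x)" for \<gamma> x
      using \<rho>(2) that lift_group_translation by blast
    show "coset \<Lambda> x = coset \<Lambda> y \<longleftrightarrow> (\<exists>\<gamma>\<in>(\<lambda>l x. x + l) ` \<Lambda>. y = \<gamma> x)" for x y
    proof
      assume "coset \<Lambda> x = coset \<Lambda> y"
      then have "y - x \<in> \<Lambda>" by (simp add: coset_eq)
      then show "\<exists>\<gamma>\<in>(\<lambda>l x. x + l) ` \<Lambda>. y = \<gamma> x" by (intro bexI[of _ "\<lambda>z. z + (y - x)"]) auto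
    qed (auto simp: coset_eq)
  qed (use q q2 \<rho>(1) cov complex_manifold_torus[OF T] compact_torus[OF L] in auto)
  then show "abelian_variety \<Lambda> J" using T by (simp add: abelian_variety_def)
qed

end

theorem corollary1p12:
  fixes \<Lambda> :: "(real^'n) set" and J\<^sub>0 :: "real^'n^'n"
    and G :: "((real^'n) set \<Rightarrow> (real^'n) set) set"
  assumes "complex_torus \<Lambda> J\<^sub>0"
    and "finite_free_aut_group (torus \<Lambda> J\<^sub>0) G"
    and "deformation_rigid \<Lambda> J\<^sub>0 G"
  shows "quotient_of_abelian_variety (quot_manifold (torus \<Lambda> J\<^sub>0) G) \<and>
         projective (quot_manifold (torus \<Lambda> J\<^sub>0) G)"
proof -
  interpret T0: torus_quotient \<Lambda> J\<^sub>0 G by unfold_locales (rule assms)+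
  let ?\<A> = "linear_part \<Lambda> ` G" and ?X = "\<lambda>J. quot_manifold (torus \<Lambda> J) G"
  have J0: "complex_structure J\<^sub>0" using assms(1) by (simp add: complex_torus_def)
  obtain M N :: "real^'n^'n" where MN: "M ** N = mat 1" "N ** M = mat 1" "\<Lambda> = {x. \<forall>i. (N *v x) $ i \<in> \<int>}"
    using full_lattice_coordinates[OF T0.L] by blast
  note lifts = aut_group_lifts[OF assms(1,2)]
  have fin: "finite ?\<A>" using T0.fin by simp
  have one: "mat 1 \<in> ?\<A>" using T0.identity by (metis imageI)
  have mult: "A ** B \<in> ?\<A>" if AB: "A \<in> ?\<A>" "B \<in> ?\<A>" for A B
  proof -
    obtain g h where "g \<in> G" "A = linear_part \<Lambda> g" "h \<in> G" "B = linear_part \<Lambda> h" using AB by blast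
    then obtain k where "k \<in> G" "A ** B = linear_part \<Lambda> k" using T0.linear_part_mult by metis
    then show ?thesis by blast
  qed
  have inv: "invertible A" and com: "A ** J\<^sub>0 = J\<^sub>0 ** A" and rat: "rational_matrix (N ** A ** M)" if "A \<in> ?\<A>" for A
    using that lifts(1,2) T0.linear_part_rational[OF MN(2,3)] by auto
  obtain J P and p :: "real \<Rightarrow> real^'n^'n" where J: "complex_structure J" "\<forall>A\<in>?\<A>. A ** J = J ** A"
    and P: "transpose P = P" "\<forall>x. x \<noteq> 0 \<longrightarrow> 0 < x \<bullet> (P *v x)" "\<forall>A\<in>?\<A>. transpose A ** P ** A = P"
      "transpose J ** P ** J = P" "rational_matrix (transpose M ** (P ** J) ** M)"
    and p: "continuous_on {0..1} p" "p 0 = J\<^sub>0" "p 1 = J" "\<forall>t\<in>{0..1}. complex_structure (p t)"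
      "\<forall>t\<in>{0..1}. \<forall>A\<in>?\<A>. A ** p t = p t ** A"
    by (rule polarizable_deformation[OF MN(1,2) fin one mult inv rat J0 com]) (assumption | rule that)+
  \<comment> \<open>The path is a continuous deformation inside the invariant structures, so
    rigidity may be applied at its endpoint \<open>t = 1\<close>.\<close>
  have "p ` {0..1} \<subseteq> invariant_complex_structures \<Lambda> G"
    using p(4,5) by (auto simp: invariant_complex_structures_def)
  then have "biholomorphic (?X (p 1)) (?X J\<^sub>0)"
    using assms(3)[unfolded deformation_rigid_def, rule_format, of p 1] p(1,2) by auto
  then have bi: "biholomorphic (?X J\<^sub>0) (?X J)" using biholomorphic_sym unfolding p(3) by blast
  have T: "complex_torus \<Lambda> J" using assms(1) J(1) by (simp add: complex_torus_def)
  have G: "finite_free_aut_group (torus \<Lambda> J) G"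
    by (rule finite_free_aut_group_change_structure[OF assms(1) T assms(2)]) (simp add: J(2))
  \<comment> \<open>The same maps form a free group of automorphisms of the polarized torus, so the
    projectivity results are available for it.\<close>
  interpret T1: torus_quotient \<Lambda> J G by unfold_locales (rule T G)+
  have X: "abelian_variety \<Lambda> J" "projective (?X J)"
    using T1.polarized_projective[OF P(1) P(2)[rule_format] P(4) P(3)[rule_format] MN(1,3) P(5)] by blast+
  have "complex_manifold (?X J\<^sub>0)"
    by (rule quotient_affine_cover(2)[OF affine_cover_torus[OF assms(1)] Hausdorff_torus[OF T0.L] assms(2)])
       (use lifts in blast)
  then have "projective (?X J\<^sub>0)" using projective_biholomorphic[OF bi] X(2) by blast
  moreover have "quotient_of_abelian_variety (?X J\<^sub>0)"
    unfolding quotient_of_abelian_variety_def using X(1) G bi by blast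
  ultimately show ?thesis by blast
qed

end
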